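(* Let $\theta>1$ and let $V$ be twice continuously differentiable on $[0,+\infty)$ with $\lim_{x\to+\infty}V(x)/\log x=+\infty$. Suppose a probability measure $\mu$ is supported on one interval $[a,b]$ with $a>0$, has a continuous density $\psi$ on $(a,b)$, and satisfies, for some $\ell\in\mathbb R$, $$\int\log|x-y|d\mu(y)+\int\log|x^\theta-y^\theta|d\mu(y)-V(x)=\ell\quad\text{for }x\in\operatorname{supp}\mu,$$ $$\int\log|x-y|d\mu(y)+\int\log|x^\theta-y^\theta|d\mu(y)-V(x)\le\ell\quad\text{for }x\in[0,+\infty).$$ Then there are constants $c_0>c_1>0$ solving the system $$\frac{1}{2\pi i}\oint_{\widetilde\gamma}\frac{V'(\widetilde J_{c_0,c_1}(t))\widetilde J_{c_0,c_1}(t)}{t}dt=1+\theta,\qquad \frac{1}{2\pi i}\oint_{\widetilde\gamma}\frac{V'(\widetilde J_{c_0,c_1}(t))\widetilde J_{c_0,c_1}(t)}{t+1}dt=1,$$ such that $a=\widetilde J_{c_0,c_1}(s_a)$, $b=\widetilde J_{c_0,c_1}(s_b)$, and for $x\in(a,b)$, $$\psi(x)=\frac{1}{2\pi^2x}\int_a^b\big(V''(y)y+V'(y)\big)\log\left|\frac{\widetilde I_+(y)-\widetilde I_-(x)}{\widetilde I_+(y)-\widetilde I_+(x)}\right|dy.$$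
   Context: For $c_0>c_1>0$, $\widetilde J_{c_0,c_1}(s)=(c_1s+c_0)\left(\frac{s+1}{s}\right)^{1/\theta}$ with branch cut on $[-1,0]$ and $\widetilde J_{c_0,c_1}(s)\sim c_1s$ as $s\to\infty$. Its two real critical points are $$s_a=-\frac{\theta-1}{2\theta}-\frac{1}{2\theta c_1}\sqrt{4c_0c_1\theta+c_1^2(\theta-1)^2},\qquad s_b=-\frac{\theta-1}{2\theta}+\frac{1}{2\theta c_1}\sqrt{4c_0c_1\theta+c_1^2(\theta-1)^2},$$ with $s_a<-1$, $s_b>0$, $0<\widetilde J(s_a)<\widetilde J(s_b)$. There are two complex conjugate curves $\widetilde\gamma_1$ (upper half-plane) and $\widetilde\gamma_2$ (lower half-plane) from $s_a$ to $s_b$, each mapped bijectively by $\widetilde J_{c_0,c_1}$ onto $[\widetilde J(s_a),\widetilde J(s_b)]$; $\widetilde\gamma=\widetilde\gamma_1\cup\widetilde\gamma_2$ is oriented counterclockwise. $\widetilde I_+(x)\in\widetilde\gamma_1$ and $\widetilde I_-(x)\in\widetilde\gamma_2$ denote the preimages of $x$ under $\widetilde J_{c_0,c_1}$. *)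

theory Defs
  imports "HOL-Probability.Probability" "HOL-Complex_Analysis.Complex_Analysis"
begin

text \<open>The map J-tilde with principal branch: branch cut of ((s+1)/s) powr (1/theta)
  is exactly [-1,0], and J(s) ~ c1 s at infinity.\<close>
definition Jt :: "real \<Rightarrow> real \<Rightarrow> real \<Rightarrow> complex \<Rightarrow> complex" where
  "Jt \<theta> c0 c1 s = (of_real c1 * s + of_real c0) * ((s + 1) / s) powr (of_real (1 / \<theta>))"

definition s_a :: "real \<Rightarrow> real \<Rightarrow> real \<Rightarrow> real" where
  "s_a \<theta> c0 c1 = - (\<theta> - 1) / (2 * \<theta>)
     - 1 / (2 * \<theta> * c1) * sqrt (4 * c0 * c1 * \<theta> + c1^2 * (\<theta> - 1)^2)"

definition s_b :: "real \<Rightarrow> real \<Rightarrow> real \<Rightarrow> real" where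
  "s_b \<theta> c0 c1 = - (\<theta> - 1) / (2 * \<theta>)
     + 1 / (2 * \<theta> * c1) * sqrt (4 * c0 * c1 * \<theta> + c1^2 * (\<theta> - 1)^2)"

text \<open>Real values J(s_a), J(s_b) (J is real on the real axis outside [-1,0]).\<close>
definition J_a :: "real \<Rightarrow> real \<Rightarrow> real \<Rightarrow> real" where
  "J_a \<theta> c0 c1 = Re (Jt \<theta> c0 c1 (of_real (s_a \<theta> c0 c1)))"

definition J_b :: "real \<Rightarrow> real \<Rightarrow> real \<Rightarrow> real" where
  "J_b \<theta> c0 c1 = Re (Jt \<theta> c0 c1 (of_real (s_b \<theta> c0 c1)))"

text \<open>f parametrizes the upper curve gamma_1 by the value x = J(s):
  f x is the preimage of x on gamma_1 (i.e. f = I_+).\<close>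
definition is_Iplus :: "real \<Rightarrow> real \<Rightarrow> real \<Rightarrow> (real \<Rightarrow> complex) \<Rightarrow> bool" where
  "is_Iplus \<theta> c0 c1 f \<longleftrightarrow>
     continuous_on {J_a \<theta> c0 c1 .. J_b \<theta> c0 c1} f
     \<and> f (J_a \<theta> c0 c1) = of_real (s_a \<theta> c0 c1)
     \<and> f (J_b \<theta> c0 c1) = of_real (s_b \<theta> c0 c1)
     \<and> (\<forall>x \<in> {J_a \<theta> c0 c1 <..< J_b \<theta> c0 c1}.
           Im (f x) > 0 \<and> Jt \<theta> c0 c1 (f x) = of_real x)"

definition Iplus :: "real \<Rightarrow> real \<Rightarrow> real \<Rightarrow> real \<Rightarrow> complex" where
  "Iplus \<theta> c0 c1 = (SOME f. is_Iplus \<theta> c0 c1 f)"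

text \<open>gamma_2 is the complex conjugate of gamma_1, and J(conj s) = conj (J s) off the cut.\<close>
definition Iminus :: "real \<Rightarrow> real \<Rightarrow> real \<Rightarrow> real \<Rightarrow> complex" where
  "Iminus \<theta> c0 c1 x = cnj (Iplus \<theta> c0 c1 x)"

definition gamma1 :: "real \<Rightarrow> real \<Rightarrow> real \<Rightarrow> real \<Rightarrow> complex" where
  "gamma1 \<theta> c0 c1 t =
     Iplus \<theta> c0 c1 (J_a \<theta> c0 c1 + t * (J_b \<theta> c0 c1 - J_a \<theta> c0 c1))"

text \<open>gamma = gamma_1 \<union> gamma_2, counterclockwise: from s_b to s_a through the
  upper half plane, then from s_a back to s_b through the lower half plane.\<close>
definition gamma :: "real \<Rightarrow> real \<Rightarrow> real \<Rightarrow> real \<Rightarrow> complex" where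
  "gamma \<theta> c0 c1 = reversepath (gamma1 \<theta> c0 c1) +++ (cnj \<circ> gamma1 \<theta> c0 c1)"

definition measure_support :: "real measure \<Rightarrow> real set" where
  "measure_support \<mu> = {x. \<forall>e>0. emeasure \<mu> (ball x e) > 0}"

end

theory Submission
  imports Defs
begin

text \<open>The parameters are determined by $J(s_a) = a$ and $J(s_b) = b$, and both arcs of $\gamma$ are
  parametrised by $x = J(s)$. Let $q = J/J'$, a rational function with simple poles at the two
  critical points, and let $G(z) = \int (z-y)^{-1} d\mu(y)$. Integrate the Euler-Lagrange equation over
  $[a,b]$ against the $x$-derivative of the jump $k_s(x) = (I_+(x)-s)^{-1} - (I_-(x)-s)^{-1}$. For fixed
  $y$ this evaluates the kernel by Cauchy's formula: $J$ continues $\log(x-y)$ to the exterior of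
  $\gamma$, and $J^\theta$, which has no cut on $[-1,0]$, continues $\log(x^\theta-y^\theta)$ to the interior.
  The outcome, for $s$ outside $\gamma$, is
  $G(J(s)) J(s) / q(s) = 1/s + (2\pi i)^{-1} \int_a^b V'(x) k_s(x) dx$.

  The variational inequality off the support forces $G$ to stay bounded near $a$ and $b$. Since $1/q$
  vanishes at $s_a$ and $s_b$, the right-hand side vanishes there; by partial fractions these two
  conditions are the system for $c_0, c_1$, and they also turn the identity into a formula for $J(s) G(J(s))$
  itself. Its imaginary part, after an integration by parts, yields the density in the limit
  $s \to I_+(x)$.\<close>

section \<open>The map on the upper half-plane\<close>

text \<open>The point - c is the zero of J, and z = ln (s + c) is the natural coordinate: an upper
  half circle around - c becomes a vertical segment, and along it Im J changes sign at most once. So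
  the inside of the curve is swept out from the line Im z = 0 and the outside from the line Im z =
  pi, and on each side a holomorphic function has a primitive; this is the form of Cauchy's theorem
  used. The contour work stays in the upper half-plane, where the arc closes up along the real axis,
  and the lower arc enters by conjugation. The obstacle is the singularity at x = y, which lies on
  the curve. Hence y becomes y - i eta in the first logarithm and y^theta becomes y^theta + i eta in
  the second. The opposite signs keep the argument of each continuation off the branch cut on its
  own side, and they make the phases of the two logarithms cancel as eta tends to 0. Conjugating one
  of the two Cauchy integrals leaves on the real axis only the imaginary parts of the continuations,
  which tend to 0 with eta.\<close>

lemma has_vector_derivative_iff_LIM:
  "(f has_vector_derivative d) (at x) \<longleftrightarrow> ((\<lambda>y. (f y - f x) /\<^sub>R (y - x)) \<longlongrightarrow> d) (at x)"
proof -
  have "norm (f y - f x - (y - x) *\<^sub>R d) / norm (y - x) = norm ((f y - f x) /\<^sub>R (y - x) - d)" if "y \<noteq> x" for y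
  proof -
    have "(f y - f x) /\<^sub>R (y - x) - d = (f y - f x - (y - x) *\<^sub>R d) /\<^sub>R (y - x)"
      using that by (simp add: scaleR_diff_right)
    then show ?thesis by (simp add: divide_inverse mult.commute)
  qed
  then have "((\<lambda>y. norm (f y - f x - (y - x) *\<^sub>R d) / norm (y - x)) \<longlongrightarrow> 0) (at x) \<longleftrightarrow>
      ((\<lambda>y. norm ((f y - f x) /\<^sub>R (y - x) - d)) \<longlongrightarrow> 0) (at x)"
    by (intro filterlim_cong) (auto simp: eventually_at_filter)
  then show ?thesis
    unfolding has_vector_derivative_def has_derivative_iff_norm
    by (simp add: bounded_linear_scaleR_left tendsto_norm_zero_iff LIM_zero_iff)
qed

text \<open>Continuity of f is enough to invert g: Caratheodory's factor k with g z - g (f x) = k z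
  (z - f x) tends to D along f, so the difference quotient of f is that of h divided by k (f y). It
  differentiates the angle \<open>B\<close> and the parametrisation \<open>I\<close>, which are
  known at first only to be continuous.\<close>

lemma has_vector_derivative_implicit:
  fixes f h :: "real \<Rightarrow> 'a::real_normed_field"
  assumes f: "isCont f x" and g: "(g has_field_derivative D) (at (f x))" and D: "D \<noteq> 0"
    and h: "(h has_vector_derivative h') (at x)"
    and eq: "\<forall>\<^sub>F y in at x. g (f y) = h y" and eqx: "g (f x) = h x"
  shows "(f has_vector_derivative (h' / D)) (at x)"
proof -
  obtain k where k: "\<And>z. g z - g (f x) = k z * (z - f x)" "isCont k (f x)" "k (f x) = D"
    using g unfolding CARAT_DERIV by blast
  have "isCont (\<lambda>y. k (f y)) x" using isCont_o2[OF f k(2)] .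
  then have lim: "((\<lambda>y. k (f y)) \<longlongrightarrow> D) (at x)" using k(3) by (simp add: isCont_def)
  have nz: "\<forall>\<^sub>F y in at x. k (f y) \<noteq> 0" using tendsto_imp_eventually_ne[OF lim D] .
  have h2: "((\<lambda>y. (h y - h x) /\<^sub>R (y - x)) \<longlongrightarrow> h') (at x)"
    using h by (simp add: has_vector_derivative_iff_LIM)
  have "((\<lambda>y. ((h y - h x) /\<^sub>R (y - x)) / k (f y)) \<longlongrightarrow> h' / D) (at x)"
    by (rule tendsto_divide[OF h2 lim D])
  moreover have "\<forall>\<^sub>F y in at x. ((h y - h x) /\<^sub>R (y - x)) / k (f y) = (f y - f x) /\<^sub>R (y - x)"
    using nz eq
  proof eventually_elim
    case (elim y)
    have "h y - h x = k (f y) * (f y - f x)"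
      using k(1)[of "f y"] elim eqx by simp
    then show ?case using elim by (simp add: scaleR_conv_of_real)
  qed
  ultimately have "((\<lambda>y. (f y - f x) /\<^sub>R (y - x)) \<longlongrightarrow> h' / D) (at x)"
    by (rule Lim_transform_eventually)
  then show ?thesis by (simp add: has_vector_derivative_iff_LIM)
qed

text \<open>The hypotheses describe star-shapedness along an L: go vertically to the line Im = h,
  then along that line to the base point. The set \<open>U\<close> of all points with this property
  is open and deforms to the base point by two straight homotopies; hence it is simply connected and
  f has a primitive on it.\<close>

lemma primitive_on_vertical_star:
  fixes f :: "complex \<Rightarrow> complex"
  assumes S: "open S" and f: "f holomorphic_on S"
    and seg1: "\<And>z. z \<in> T \<Longrightarrow> closed_segment z (Complex (Re z) h) \<subseteq> S"
    and seg2: "\<And>z. z \<in> T \<Longrightarrow> closed_segment (Complex (Re z) h) (Complex u h) \<subseteq> S"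
  obtains F where "\<And>z. z \<in> T \<Longrightarrow> (F has_field_derivative f z) (at z)"
proof -
  define P where "P = (\<lambda>z. Complex (Re z) h)"
  define p where "p = Complex u h"
  have contP: "continuous_on A P" for A
    unfolding P_def by (auto intro!: continuous_intros simp: Complex_eq)
  define U where "U = {z. closed_segment z (P z) \<subseteq> S \<and> closed_segment (P z) p \<subseteq> S}"
  have "open U"
  proof -
    \<comment> \<open>A point violates the condition if some parameter t in [0,1] leads out of S.
      Such points form the projection of a closed set along a compact factor, hence a closed
      set.\<close>
    have cl: "closed {z. \<exists>t. t \<in> {0..1::real} \<and> (t, z) \<in> (\<lambda>(t,z). (1 - t) *\<^sub>R g z + t *\<^sub>R k z) -` (-S)}"
      if "continuous_on UNIV g" "continuous_on UNIV k" for g k :: "complex \<Rightarrow> complex"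
    proof (rule closed_compact_projection)
      have "continuous_on UNIV (\<lambda>x::real\<times>complex. g (snd x))"
        by (rule continuous_on_compose2[OF that(1)]) (auto intro!: continuous_intros)
      moreover have "continuous_on UNIV (\<lambda>x::real\<times>complex. k (snd x))"
        by (rule continuous_on_compose2[OF that(2)]) (auto intro!: continuous_intros)
      ultimately show "closed ((\<lambda>(t,z). (1 - t) *\<^sub>R g z + t *\<^sub>R k z) -` (-S))"
        using S by (intro closed_vimage) (auto simp: case_prod_unfold intro!: continuous_intros)
    qed auto
    have "- U = {z. \<exists>t. t \<in> {0..1::real} \<and> (t, z) \<in> (\<lambda>(t,z). (1 - t) *\<^sub>R z + t *\<^sub>R P z) -` (-S)}
       \<union> {z. \<exists>t. t \<in> {0..1::real} \<and> (t, z) \<in> (\<lambda>(t,z). (1 - t) *\<^sub>R P z + t *\<^sub>R p) -` (-S)}"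
      unfolding U_def closed_segment_def by auto
    then have "closed (-U)"
      using cl[of "\<lambda>z. z" P] cl[of P "\<lambda>z. p"] contP by (auto intro!: closed_Un continuous_intros)
    then show ?thesis by (simp add: closed_def)
  qed
  \<comment> \<open>\<open>P\<close> does not change along the vertical segment and is the identity
    on the horizontal one, so every point on the way from z to the base point belongs to
    \<open>U\<close> again and both homotopies stay inside.\<close>
  have PP: "P w = P z" if "w \<in> closed_segment z (P z)" for w z
    using that unfolding closed_segment_def P_def by (auto simp: complex_eq_iff algebra_simps)
  have PQ: "P w = w" if "w \<in> closed_segment (P z) p" for w z
    using that unfolding closed_segment_def P_def p_def by (auto simp: complex_eq_iff algebra_simps)
  have s1: "closed_segment z (P z) \<subseteq> U" if "z \<in> U" for z
  proof
    fix w assume w: "w \<in> closed_segment z (P z)"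
    then have "closed_segment w (P w) \<subseteq> closed_segment z (P z)"
      using PP[OF w] by (simp add: subset_closed_segment)
    then show "w \<in> U" using that PP[OF w] unfolding U_def by auto
  qed
  have s2: "closed_segment (P z) p \<subseteq> U" if "z \<in> U" for z
  proof
    fix w assume w: "w \<in> closed_segment (P z) p"
    then have "closed_segment w p \<subseteq> closed_segment (P z) p"
      by (simp add: subset_closed_segment)
    then show "w \<in> U" using that PQ[OF w] w unfolding U_def by auto
  qed
  have "homotopic_with_canon (\<lambda>x. True) U U id P"
    by (rule homotopic_with_linear) (use s1 contP in auto)
  moreover have "homotopic_with_canon (\<lambda>x. True) U U P (\<lambda>x. p)"
    by (rule homotopic_with_linear) (use s2 contP in auto)
  ultimately have "contractible U"
    unfolding contractible_def by (meson homotopic_with_trans)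
  then have "simply_connected U" by (rule contractible_imp_simply_connected)
  moreover have "f holomorphic_on U"
    by (rule holomorphic_on_subset[OF f]) (auto simp: U_def)
  ultimately obtain F where F: "\<And>z. z \<in> U \<Longrightarrow> (F has_field_derivative f z) (at z)"
    using simply_connected_eq_global_primitive[OF \<open>open U\<close>] by blast
  show ?thesis
    by (rule that[of F], rule F) (use seg1 seg2 in \<open>auto simp: U_def P_def p_def\<close>)
qed

lemma sgn_sin: 
  assumes "\<bar>x\<bar> < pi" shows "sgn (sin x) = sgn (x::real)"
proof -
  consider "x = 0" | "0 < x" | "x < 0" by linarith
  then show ?thesis
  proof cases
    case 2 then show ?thesis using sin_gt_zero[of x] assms by (simp add: sgn_if)
  next
    case 3 then show ?thesis using sin_gt_zero[of "-x"] assms by (simp add: sgn_if)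
  qed auto
qed

lemma x_cos_less_sin:
  assumes "0 < x" "x < pi / 2" shows "x * cos x < sin (x::real)"
proof -
  have "(\<lambda>x. sin x - x * cos x) 0 < (\<lambda>x. sin x - x * cos x) x"
  proof (rule DERIV_pos_imp_increasing_open[OF assms(1)])
    fix y :: real assume y: "0 < y" "y < x"
    then have "y * sin y > 0" using assms by (intro mult_pos_pos sin_gt_zero) auto
    moreover have "((\<lambda>x. sin x - x * cos x) has_real_derivative y * sin y) (at y)"
      by (auto intro!: derivative_eq_intros)
    ultimately show "\<exists>d. ((\<lambda>x. sin x - x * cos x) has_real_derivative d) (at y) \<and> d > 0" by blast
  qed (auto intro!: continuous_intros)
  then show ?thesis by simp
qed

text \<open>In the polar coordinates $s = -c + r e^{iv}$ the curve on which the map is positive is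
  the graph $\varphi(v) = (r^2 + c(c-1))/r$ of this strictly decreasing function.\<close>
definition angle_fun :: "real \<Rightarrow> real \<Rightarrow> real \<Rightarrow> real" where
  "angle_fun \<theta> c v = (2 * c - 1) * cos v + sin v * cos (\<theta> * v) / sin (\<theta> * v)"

section \<open>Critical points and argument of J\<close>

locale jmap =
  fixes \<theta> c0 c1 :: real
  assumes th: "\<theta> > 1" and c1: "0 < c1" and c01: "c1 < c0"
begin

abbreviation "J \<equiv> Jt \<theta> c0 c1"
abbreviation "sa \<equiv> s_a \<theta> c0 c1"
abbreviation "sb \<equiv> s_b \<theta> c0 c1"
text \<open>- c is the zero of the linear factor c1 s + c0, hence of J, and the centre of the polar
  coordinates.\<close>

definition c where "c = c0 / c1"
abbreviation "phi \<equiv> angle_fun \<theta> c"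

lemma c_gt_1: "1 < c" using c1 c01 by (simp add: c_def)

lemma c0_eq: "c1 * c = c0" using c1 by (simp add: c_def)

lemma s_sum: "sa + sb = - (\<theta> - 1) / \<theta>"
  using th by (simp add: s_a_def s_b_def field_simps)

lemma s_prod: "sa * sb = - c / \<theta>"
proof -
  define X where "X = 4 * c0 * c1 * \<theta> + c1^2 * (\<theta> - 1)^2"
  have "X \<ge> 0" unfolding X_def using th c1 c01 by (intro add_nonneg_nonneg mult_nonneg_nonneg) auto
  then have sq: "sqrt X * sqrt X = X" by simp
  have "sa * sb = ((\<theta> - 1) / (2 * \<theta>))^2 - (1 / (2 * \<theta> * c1))^2 * (sqrt X * sqrt X)"
    unfolding s_a_def s_b_def X_def[symmetric] by (simp add: power2_eq_square algebra_simps)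
  also have "\<dots> = - c / \<theta>"
    unfolding sq unfolding X_def c_def using th c1 by (simp add: field_simps power2_eq_square)
  finally show ?thesis .
qed

lemma sab: "sa < sb"
proof -
  have "0 < 4 * c0 * c1 * \<theta> + c1^2 * (\<theta> - 1)^2"
    using th c1 c01 by (intro add_pos_nonneg mult_pos_pos mult_nonneg_nonneg) auto
  then have "0 < 1 / (2 * \<theta> * c1) * sqrt (4 * c0 * c1 * \<theta> + c1^2 * (\<theta> - 1)^2)"
    using th c1 by simp
  then show ?thesis unfolding s_a_def s_b_def by linarith
qed

text \<open>J' / J = 1/(s + c) - 1/(theta s (s + 1)), so the critical points solve s (s + 1) = (s +
  c)/theta. The sign of this quadratic at -1, 0 and - c places \<open>sa\<close> and
  \<open>sb\<close> relative to these points.\<close>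

lemma quad_real: "(x - sa) * (x - sb) = x * (x + 1) - (x + c) / \<theta>" for x :: real
proof -
  have "(x - sa) * (x - sb) = x^2 - (sa + sb) * x + sa * sb"
    by (simp add: algebra_simps power2_eq_square)
  also have "\<dots> = x * (x + 1) - (x + c) / \<theta>"
    unfolding s_sum s_prod using th by (simp add: field_simps power2_eq_square)
  finally show ?thesis .
qed

lemma quad: "(s - of_real sa) * (s - of_real sb) = s * (s + 1) - (s + of_real c) / of_real \<theta>" for s :: complex
proof -
  have "(s - of_real sa) * (s - of_real sb) = s^2 - of_real (sa + sb) * s + of_real (sa * sb)"
    by (simp add: algebra_simps power2_eq_square)
  also have "\<dots> = s * (s + 1) - (s + of_real c) / of_real \<theta>"
    unfolding s_sum s_prod using th by (simp add: field_simps power2_eq_square)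
  finally show ?thesis .
qed

lemma sa_less: "sa < -1" and sb_pos: "0 < sb"
proof -
  have "(-1 - sa) * (-1 - sb) < 0" 
    unfolding quad_real using c_gt_1 th by (simp add: divide_pos_pos)
  then show "sa < -1" using sab by (auto simp: mult_less_0_iff)
  have "(0 - sa) * (0 - sb) < 0" unfolding quad_real using c_gt_1 th by (simp add: divide_pos_pos)
  then show "0 < sb" using sab by (auto simp: mult_less_0_iff)
qed

lemma sa_gt: "- c < sa"
proof -
  have "(-c - sa) * (-c - sb) > 0" unfolding quad_real using c_gt_1 by (simp add: mult_less_0_iff)
  then show ?thesis using c_gt_1 sb_pos by (auto simp: zero_less_mult_iff)
qed

lemma J_has_derivative:
  assumes "(s + 1) / s \<notin> \<real>\<^sub>\<le>\<^sub>0"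
  shows "(J has_field_derivative of_real c1 * ((s + 1) / s) powr (of_real (1 / \<theta>)) *
     ((s - of_real sa) * (s - of_real sb)) / (s * (s + 1))) (at s)"
proof -
  have s: "s \<noteq> 0" "s + 1 \<noteq> 0" using assms by auto
  define R where "R = ((s + 1) / s) powr (of_real (1 / \<theta>))"
  have d1: "((\<lambda>s. (s + 1) / s) has_field_derivative - 1 / s^2) (at s)"
    using s by (auto intro!: derivative_eq_intros simp: field_simps power2_eq_square)
  have "((\<lambda>s. ((s + 1) / s) powr (of_real (1 / \<theta>))) has_field_derivative
     (of_real (1/\<theta>) * ((s + 1) / s) powr (of_real (1/\<theta>) - 1)) * (- 1 / s^2)) (at s)"
    by (rule DERIV_chain2[OF has_field_derivative_powr d1]) (use assms in auto)
  also have "((s + 1) / s) powr (of_real (1/\<theta>) - 1) = R * s / (s + 1)"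
    using s by (simp add: R_def powr_diff)
  finally have d2: "((\<lambda>s. ((s + 1) / s) powr (of_real (1 / \<theta>))) has_field_derivative
     - R / (of_real \<theta> * s * (s + 1))) (at s)"
    using s th by (simp add: field_simps power2_eq_square)
  have d3: "((\<lambda>s. of_real c1 * s + of_real c0) has_field_derivative of_real c1) (at s)"
    by (auto intro!: derivative_eq_intros)
  have "(J has_field_derivative (of_real c1 * s + of_real c0) * (- R / (of_real \<theta> * s * (s + 1))) + of_real c1 * R) (at s)"
    unfolding Jt_def using DERIV_mult[OF d3 d2] by (simp add: R_def algebra_simps)
  also have "(of_real c1 * s + of_real c0) * (- R / (of_real \<theta> * s * (s + 1))) + of_real c1 * R
     = of_real c1 * R * ((s - of_real sa) * (s - of_real sb)) / (s * (s + 1))"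
    proof -
    have "complex_of_real c0 = of_real c1 * of_real c" by (metis c0_eq of_real_mult)
    then have c0c: "of_real c1 * s + complex_of_real c0 = of_real c1 * (s + of_real c)"
      by (simp add: algebra_simps)
    have "x * (y - z / t) / y = x - x * z / (t * y)" if "y \<noteq> 0" "t \<noteq> 0" for x y z t :: complex
      using that by (simp add: field_simps)
    from this[of "s * (s + 1)" "of_real \<theta>" "of_real c1 * R" "s + of_real c"]
    show ?thesis unfolding quad c0c using s th by (simp add: mult_ac)
  qed
  finally show ?thesis by (simp add: R_def)
qed

lemma off_cut_upper: "Im s \<noteq> 0 \<Longrightarrow> (s + 1) / s \<notin> \<real>\<^sub>\<le>\<^sub>0"
proof
  assume s: "Im s \<noteq> 0" and n: "(s + 1) / s \<in> \<real>\<^sub>\<le>\<^sub>0"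
  then have s0: "s \<noteq> 0" by auto
  have "(s + 1) / s = 1 + 1 / s" using s0 by (simp add: field_simps)
  moreover have "Im (1 / s) \<noteq> 0" using s s0 by (simp add: Im_divide sum_power2_eq_zero_iff)
  ultimately show False using n by (auto simp: complex_nonpos_Reals_iff)
qed

lemma off_cut_real: "x < -1 \<or> x > 0 \<Longrightarrow> (complex_of_real x + 1) / of_real x \<notin> \<real>\<^sub>\<le>\<^sub>0"
proof -
  assume x: "x < -1 \<or> x > 0"
  have "(complex_of_real x + 1) / of_real x = of_real ((x + 1) / x)" by simp
  moreover have "(x + 1) / x > 0" using x by (auto simp: zero_less_divide_iff)
  ultimately show ?thesis by (simp add: complex_nonpos_Reals_iff)
qed

text \<open>The branch of log (J / c1) on the upper half-plane, so \<open>Im (Lam s)\<close> is the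
  argument of J s followed continuously.\<close>

definition Lam :: "complex \<Rightarrow> complex" where
  "Lam s = Ln (s + of_real c) + (Ln (s + 1) - Ln s) / of_real \<theta>"

text \<open>The difference of the two arguments is the angle under which the segment [-1,0] is seen
  from s. Its sine is positive because s / (s + 1) lies in the upper half-plane.\<close>

lemma al_bounds:
  assumes "Im s > 0"
  shows "0 < Im (Ln s) - Im (Ln (s + 1))" "Im (Ln s) - Im (Ln (s + 1)) < pi"
    and "exp (Ln s - Ln (s + 1)) = s / (s + 1)"
proof -
  have s: "s \<noteq> 0" "s + 1 \<noteq> 0" using assms by (auto simp: complex_eq_iff)
  show e: "exp (Ln s - Ln (s + 1)) = s / (s + 1)" using s by (simp add: exp_diff)
  have b: "0 < Im (Ln s)" "Im (Ln s) < pi" "0 < Im (Ln (s+1))" "Im (Ln (s+1)) < pi"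
    using Im_Ln_pos_lt_imp[of s] Im_Ln_pos_lt_imp[of "s+1"] assms by auto
  then show "Im (Ln s) - Im (Ln (s + 1)) < pi" by linarith
  have "Im (s / (s + 1)) > 0"
    using assms s by (simp add: Im_divide sum_power2_gt_zero_iff complex_eq_iff)
  then have "sin (Im (Ln s) - Im (Ln (s + 1))) > 0"
    unfolding e[symmetric] by (simp add: Im_exp zero_less_mult_iff)
  then have "sgn (Im (Ln s) - Im (Ln (s + 1))) = 1"
    using sgn_sin[of "Im (Ln s) - Im (Ln (s + 1))"] b by (simp add: abs_less_iff)
  then show "0 < Im (Ln s) - Im (Ln (s + 1))" by (simp add: sgn_1_pos)
qed

lemma Im_Lam: "Im (Lam s) = Im (Ln (s + of_real c)) - (Im (Ln s) - Im (Ln (s + 1))) / \<theta>"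
  by (simp add: Lam_def diff_divide_distrib)

text \<open>Since |Im Lam| < pi, the signs of Im J and of Im Lam agree. The sharper lower bound - pi
  / theta is what later controls the theta-th power of J inside the curve.\<close>

lemma Im_Lam_bounds:
  assumes "Im s > 0" shows "- pi / \<theta> < Im (Lam s)" "Im (Lam s) < pi" "\<bar>Im (Lam s)\<bar> < pi"
proof -
  have b: "0 < Im (Ln (s + of_real c))" "Im (Ln (s + of_real c)) < pi"
    using Im_Ln_pos_lt_imp[of "s + of_real c"] assms by auto
  have d: "0 < (Im (Ln s) - Im (Ln (s + 1))) / \<theta>" "(Im (Ln s) - Im (Ln (s + 1))) / \<theta> < pi / \<theta>"
    using al_bounds[OF assms] th by (auto intro: divide_strict_right_mono)
  have e: "pi / \<theta> < pi" using th by (simp add: field_simps)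
  show "- pi / \<theta> < Im (Lam s)" "Im (Lam s) < pi" using b d unfolding Im_Lam by auto
  then show "\<bar>Im (Lam s)\<bar> < pi" using e by (simp add: abs_less_iff)
qed

lemma J_upper:
  assumes "Im s > 0" shows "J s = of_real c1 * exp (Lam s)"
proof -
  have s: "s \<noteq> 0" "s + 1 \<noteq> 0" "s + of_real c \<noteq> 0" using assms by (auto simp: complex_eq_iff)
  have "Ln ((s + 1) / s) = Ln (s + 1) - Ln s"
  proof (rule Ln_unique)
    show "exp (Ln (s + 1) - Ln s) = (s + 1) / s" using s by (simp add: exp_diff)
  qed (use al_bounds[OF assms] in auto)
  then have "((s + 1) / s) powr (of_real (1 / \<theta>)) = exp ((Ln (s + 1) - Ln s) / of_real \<theta>)"
    using s by (simp add: powr_def)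
  moreover have "of_real c1 * s + of_real c0 = of_real c1 * exp (Ln (s + of_real c))"
    using s c1 by (simp add: distrib_left flip: of_real_mult) (simp add: c0_eq)
  ultimately show ?thesis unfolding Jt_def Lam_def by (simp add: exp_add)
qed

lemma sgn_Im_J: "Im s > 0 \<Longrightarrow> sgn (Im (J s)) = sgn (Im (Lam s))"
  using sgn_sin[OF Im_Lam_bounds(3)] c1 by (simp add: J_upper Im_exp sgn_mult)

lemma rcis_upper:
  assumes "r > 0" "0 < v" "v < pi"
  shows "Im (rcis r v - of_real c) > 0" "Ln (rcis r v) = Complex (ln r) v"
proof -
  show "Im (rcis r v - of_real c) > 0" using assms sin_gt_zero[of v] by (simp add: rcis_def)
  show "Ln (rcis r v) = Complex (ln r) v"
    using assms by (intro Ln_unique) (auto simp: rcis_def cis_conv_exp Complex_eq exp_add exp_of_real)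
qed

text \<open>theta Im Lam = theta v - al, where al is the angle subtended by [-1,0]. Multiplying the
  sine of this difference by |s / (s + 1)| |s + 1|^2 makes it explicit: by the addition theorem it
  becomes r sin (theta v) times the stated difference. For v < pi / theta this factor is positive
  and theta v - al lies in (-pi, pi), so all signs agree.\<close>

lemma sgn_Im_J_polar:
  assumes r: "r > 0" and v: "0 < v" "v < pi / \<theta>"
  shows "sgn (Im (J (rcis r v - of_real c))) = sgn ((r^2 + c * (c - 1)) / r - phi v)"
proof -
  define s where "s = rcis r v - of_real c"
  have "pi / \<theta> < pi" using th by (simp add: field_simps)
  then have vpi: "v < pi" using v by linarith
  have s: "Im s > 0" and L: "Ln (rcis r v) = Complex (ln r) v"
    using rcis_upper[OF r v(1) vpi] by (auto simp: s_def)
  define al where "al = Im (Ln s) - Im (Ln (s + 1))"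
  have al: "0 < al" "al < pi" using al_bounds[OF s] by (auto simp: al_def)
  have ImL: "\<theta> * Im (Lam s) = \<theta> * v - al"
    unfolding Im_Lam al_def using L th by (simp add: s_def field_simps)
  have tv: "0 < \<theta> * v" "\<theta> * v < pi" using v th by (auto simp: field_simps)
  define M where "M = exp (Re (Ln s) - Re (Ln (s + 1)))"
  define N where "N = (Re s + 1)^2 + (Im s)^2"
  have N: "N > 0" using s by (simp add: N_def add_nonneg_pos)
  have M: "M > 0" by (simp add: M_def)
  have e: "exp (Ln s - Ln (s + 1)) = s / (s + 1)" using al_bounds[OF s] by simp
  have "M * cos al = Re (s / (s + 1))" unfolding e[symmetric] by (simp add: Re_exp M_def al_def)
  then have Mc: "M * cos al = (Re s ^2 + Im s ^2 + Re s) / N"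
    by (simp add: Re_divide N_def power2_eq_square algebra_simps)
  have "M * sin al = Im (s / (s + 1))" unfolding e[symmetric] by (simp add: Im_exp M_def al_def)
  then have Ms: "M * sin al = Im s / N"
    by (simp add: Im_divide N_def power2_eq_square algebra_simps)
  have sn: "sin (\<theta> * v) > 0" using tv by (rule sin_gt_zero)
  have Res: "Re s = r * cos v - c" "Im s = r * sin v" by (auto simp: s_def rcis_def)
  have sc: "(sin v)^2 = 1 - (cos v)^2" by (simp add: sin_squared_eq)
  have "N * (M * sin (\<theta> * v - al)) = sin (\<theta> * v) * (N * (M * cos al)) - cos (\<theta> * v) * (N * (M * sin al))"
    by (simp add: sin_diff algebra_simps)
  also have "\<dots> = sin (\<theta> * v) * (Re s ^2 + Im s ^2 + Re s) - cos (\<theta> * v) * Im s"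
    unfolding Mc Ms using N by simp
  also have "Re s ^2 + Im s ^2 + Re s = r^2 - (2 * c - 1) * r * cos v + c * (c - 1)"
    unfolding Res power_mult_distrib sc by (simp add: power2_eq_square algebra_simps)
  also have "sin (\<theta> * v) * (r^2 - (2 * c - 1) * r * cos v + c * (c - 1)) - cos (\<theta> * v) * Im s
     = r * sin (\<theta> * v) * ((r^2 + c * (c - 1)) / r - phi v)"
    unfolding Res angle_fun_def using r sn by (simp add: field_simps power2_eq_square)
  finally have eq: "N * (M * sin (\<theta> * v - al)) = r * sin (\<theta> * v) * ((r^2 + c * (c - 1)) / r - phi v)" .
  have "sgn (N * (M * sin (\<theta> * v - al))) = sgn (sin (\<theta> * v - al))"
    using N M by (simp add: sgn_mult)
  also have "\<dots> = sgn (\<theta> * v - al)" by (rule sgn_sin) (use tv al in auto)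
  also have "\<dots> = sgn (Im (Lam s))" unfolding ImL[symmetric] using th by (simp add: sgn_mult)
  finally have 1: "sgn (N * (M * sin (\<theta> * v - al))) = sgn (Im (Lam s))" .
  have "sgn (r * sin (\<theta> * v) * ((r^2 + c * (c - 1)) / r - phi v)) = sgn ((r^2 + c * (c - 1)) / r - phi v)"
    using r sn by (simp add: sgn_mult)
  then show ?thesis using 1 eq sgn_Im_J[OF s] by (simp add: s_def)
qed

text \<open>Beyond the angle pi / theta the term v exceeds al / theta whatever the radius, because
  the subtended angle al is below pi.\<close>

lemma Im_J_polar_pos:
  assumes r: "r > 0" and v: "pi / \<theta> \<le> v" "v < pi"
  shows "Im (J (rcis r v - of_real c)) > 0"
proof -
  define s where "s = rcis r v - of_real c"
  have v0: "v > 0" using v th by (smt (verit) divide_pos_pos pi_gt_zero)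
  have s: "Im s > 0" and L: "Ln (rcis r v) = Complex (ln r) v"
    using rcis_upper[OF r v0 v(2)] by (auto simp: s_def)
  have "(Im (Ln s) - Im (Ln (s + 1))) / \<theta> < pi / \<theta>"
    using al_bounds[OF s] th by (auto intro: divide_strict_right_mono)
  then have "Im (Lam s) > 0" unfolding Im_Lam using L v by (simp add: s_def)
  then show ?thesis using sgn_Im_J[OF s] by (simp add: s_def sgn_1_pos)
qed

text \<open>With x = theta v the derivative of the second summand is (cos v sin x cos x - theta sin
  v) / sin^2 x, and \<open>key\<close> says that it is negative; the first summand decreases because
  2c - 1 > 0.\<close>

lemma phi_deriv:
  assumes v: "0 < v" "v < pi / \<theta>"
  shows "\<exists>d<0. (phi has_real_derivative d) (at v)"
proof -
  define x where "x = \<theta> * v"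
  have x: "0 < x" "x < pi" using v th by (auto simp: x_def field_simps)
  have vx: "v < x" using v th by (simp add: x_def)
  have sx: "sin x > 0" using x by (rule sin_gt_zero)
  have sv: "sin v > 0" using v vx x by (intro sin_gt_zero) auto
  have ss: "sin x * sin x = 1 - cos x * cos x" using sin_squared_eq[of x] by (simp add: power2_eq_square)
  have key: "cos v * (sin x * cos x) < \<theta> * sin v"
  proof -
    \<comment> \<open>Only cosines of equal sign need an estimate. If both are positive, v < pi/2
      gives v cos v < sin v, and sin x cos x is at most x = theta v. If both are negative, v and x
      lie in (pi/2, pi), where the sine decreases.\<close>
    consider "cos v * cos x \<le> 0" | "cos v > 0" "cos x > 0" | "cos v < 0" "cos x < 0"
      by (smt (verit) mult_neg_neg mult_pos_pos zero_less_mult_iff)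
    then show ?thesis
    proof cases
      case 1
      have "cos v * (sin x * cos x) = sin x * (cos v * cos x)" by simp
      also have "\<dots> \<le> 0" using 1 sx by (simp add: mult_nonneg_nonpos)
      also have "0 < \<theta> * sin v" using sv th by simp
      finally show ?thesis .
    next
      case 2
      have "v < pi / 2" 
      proof (rule ccontr)
        assume "\<not> v < pi / 2"
        then have "cos v \<le> cos (pi / 2)" using x vx by (intro cos_monotone_0_pi_le) auto
        then show False using 2 by simp
      qed
      then have vc: "v * cos v < sin v" using x_cos_less_sin v by auto
      have "sin x * cos x \<le> x" using sin_x_le_x[of x] x cos_le_one[of x] 2
        by (smt (verit) mult_left_le sx)
      then have "cos v * (sin x * cos x) \<le> cos v * x" using 2 by simp
      also have "\<dots> = \<theta> * (v * cos v)" by (simp add: x_def)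
      also have "\<dots> < \<theta> * sin v" using vc th by simp
      finally show ?thesis .
    next
      case 3
      have "v > pi / 2" using 3(1) v by (smt (verit) cos_ge_zero)
      then have "sin x < sin v" 
        using sin_monotone_2pi[of "pi - x" "pi - v"] vx x by (simp add: sin_diff)
      moreover have "cos v * cos x \<le> 1" using 3 
        by (smt (verit) cos_ge_minus_one mult_minus_left mult_minus_right mult_le_one)
      then have "cos v * (sin x * cos x) \<le> sin x" using sx 
        by (smt (verit) mult.assoc mult.commute mult_left_le)
      moreover have "sin v \<le> \<theta> * sin v" using sv th by simp
      ultimately show ?thesis by linarith
    qed
  qed
  have "(phi has_real_derivative - (2 * c - 1) * sin v + (cos v * (sin x * cos x) - \<theta> * sin v * ((sin x)^2 + (cos x)^2)) / (sin x)^2) (at v)"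
    unfolding angle_fun_def[abs_def] x_def using sx[unfolded x_def]
    by (auto intro!: derivative_eq_intros simp: field_simps power2_eq_square)
       (simp add: ss[unfolded x_def] algebra_simps)
  moreover have "- (2 * c - 1) * sin v + (cos v * (sin x * cos x) - \<theta> * sin v * ((sin x)^2 + (cos x)^2)) / (sin x)^2 < 0"
  proof -
    have "(cos v * (sin x * cos x) - \<theta> * sin v) / (sin x)^2 < 0"
      using key sx by (simp add: divide_neg_pos)
    moreover have "(1 - 2 * c) * sin v < 0" using c_gt_1 sv by (simp add: mult_less_0_iff)
    ultimately show ?thesis by simp
  qed
  ultimately show ?thesis by blast
qed

lemma phi_strict_antimono:
  assumes "0 < v1" "v1 < v2" "v2 < pi / \<theta>" shows "phi v2 < phi v1"
proof (rule DERIV_neg_imp_decreasing[OF assms(2)])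
  fix x assume "v1 \<le> x" "x \<le> v2"
  then show "\<exists>y. (phi has_real_derivative y) (at x) \<and> y < 0"
    using phi_deriv[of x] assms by auto
qed

text \<open>The bound is the limit of \<open>phi\<close> at 0. It comes from theta sin v being at
  most theta v = x, and from x cos x < sin x.\<close>

lemma phi_less: assumes v: "0 < v" "v < pi / \<theta>" shows "phi v < 2 * c - 1 + 1 / \<theta>"
proof -
  define x where "x = \<theta> * v"
  have x: "0 < x" "x < pi" using v th by (auto simp: x_def field_simps)
  have sx: "sin x > 0" using x by (rule sin_gt_zero)
  have vx: "v < x" using v th by (simp add: x_def)
  have sv: "sin v > 0" using v vx x by (intro sin_gt_zero) auto
  have "\<theta> * (sin v * cos x) < sin x"
  proof (cases "cos x > 0")
    case True
    then have "x < pi / 2" using x by (smt (verit) cos_monotone_0_pi_le cos_pi_half pi_half_gt_zero)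
    have "\<theta> * sin v \<le> x" using sin_x_le_x[of v] v th by (simp add: x_def)
    then have "\<theta> * sin v * cos x \<le> x * cos x" using True by simp
    also have "\<dots> < sin x" using x_cos_less_sin[OF x(1) \<open>x < pi / 2\<close>] .
    finally show ?thesis by simp
  next
    case False
    then show ?thesis using sv sx th by (smt (verit) mult_nonneg_nonpos)
  qed
  then have "sin v * cos x / sin x < 1 / \<theta>" using sx th by (simp add: field_simps)
  moreover have "(2 * c - 1) * cos v \<le> 2 * c - 1" using c_gt_1 by (simp add: mult_left_le)
  ultimately show ?thesis unfolding angle_fun_def x_def by linarith
qed

text \<open>r times the difference of the two sides is, at r - c, the quadratic with roots
  \<open>sa\<close> and \<open>sb\<close>. So the radial function stays below the supremum of
  \<open>phi\<close> exactly in the open annulus between the radii \<open>sa + c\<close> and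
  \<open>sb + c\<close>, and only circles in this annulus meet the curve.\<close>

lemma outer_bound: assumes "r > 0" "r \<le> sa + c \<or> sb + c \<le> r"
  shows "2 * c - 1 + 1 / \<theta> \<le> (r^2 + c * (c - 1)) / r"
proof -
  have "0 \<le> ((r - c) - sa) * ((r - c) - sb)"
    using assms(2) sab by (auto simp: zero_le_mult_iff)
  also have "\<dots> = (r^2 + c * (c - 1)) - (2 * c - 1 + 1 / \<theta>) * r"
    unfolding quad_real using th by (simp add: field_simps power2_eq_square)
  finally show ?thesis using assms(1) by (simp add: field_simps)
qed

lemma inner_bound: assumes "sa + c < r" "r < sb + c"
  shows "(r^2 + c * (c - 1)) / r < 2 * c - 1 + 1 / \<theta>"
proof -
  have "0 < r" using assms sa_gt by linarith
  have "((r - c) - sa) * ((r - c) - sb) < 0"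
    using assms by (auto simp: mult_less_0_iff)
  also have "((r - c) - sa) * ((r - c) - sb) = (r^2 + c * (c - 1)) - (2 * c - 1 + 1 / \<theta>) * r"
    unfolding quad_real using th by (simp add: field_simps power2_eq_square)
  finally show ?thesis using \<open>0 < r\<close> by (simp add: field_simps)
qed

lemma Im_J_pos_outer:
  assumes "r > 0" "r \<le> sa + c \<or> sb + c \<le> r" "0 < v" "v < pi"
  shows "Im (J (rcis r v - of_real c)) > 0"
proof (cases "v < pi / \<theta>")
  case True
  then show ?thesis using sgn_Im_J_polar[OF assms(1) assms(3) True] phi_less[OF assms(3) True] outer_bound[OF assms(1,2)]
    by (simp add: sgn_1_pos)
qed (use Im_J_polar_pos assms in auto)

text \<open>Monotonicity of \<open>phi\<close> in geometric form: on an upper half circle around - c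
  the imaginary part of J, once nonnegative, is positive at all larger angles. This makes both sides
  of the curve vertically star-shaped in the coordinate ln (s + c).\<close>

lemma Im_J_rotate_up:
  assumes "r > 0" "0 < v1" "v1 < v2" "v2 < pi" "Im (J (rcis r v1 - of_real c)) \<ge> 0"
  shows "Im (J (rcis r v2 - of_real c)) > 0"
proof (cases "v2 < pi / \<theta>")
  case True
  have "phi v1 \<le> (r^2 + c * (c - 1)) / r"
    using sgn_Im_J_polar[OF assms(1), of v1] assms True by (auto simp: sgn_if split: if_splits)
  then have "phi v2 < (r^2 + c * (c - 1)) / r" using phi_strict_antimono[of v1 v2] assms True by auto
  then show ?thesis using sgn_Im_J_polar[OF assms(1), of v2] assms True by (auto simp: sgn_if split: if_splits)
qed (use Im_J_polar_pos assms in auto)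

lemma Im_J_rotate_down:
  assumes "r > 0" "0 < v1" "v1 < v2" "v2 < pi" "Im (J (rcis r v2 - of_real c)) \<le> 0"
  shows "Im (J (rcis r v1 - of_real c)) < 0"
  using Im_J_rotate_up[OF assms(1-4)] assms(5) by linarith

lemma polar_upper: 
  assumes "Im s > 0" 
  obtains r v where "r > 0" "0 < v" "v < pi" "s = rcis r v - of_real c" "r = cmod (s + of_real c)"
    "Ln (s + of_real c) = Complex (ln r) v"
proof -
  define w where "w = s + of_real c"
  have w: "Im w > 0" "w \<noteq> 0" using assms by (auto simp: w_def complex_eq_iff)
  show ?thesis
  proof (rule that[of "cmod w" "Im (Ln w)"])
    show "s = rcis (cmod w) (Im (Ln w)) - of_real c"
      using rcis_cmod_Arg[of w] w by (simp add: Arg_eq_Im_Ln w_def)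
    show "Ln (s + of_real c) = Complex (ln (cmod w)) (Im (Ln w))"
      using w by (simp add: w_def complex_eq_iff Re_Ln)
  qed (use w Im_Ln_pos_lt_imp[OF w(1)] in \<open>auto simp: w_def\<close>)
qed

lemma curve_radius:
  assumes "Im s > 0" "Im (J s) \<le> 0"
  shows "sa + c < cmod (s + of_real c)" "cmod (s + of_real c) < sb + c"
  using polar_upper[OF assms(1)] Im_J_pos_outer assms(2) by (metis linorder_not_le)+

lemma Im_J_pos_of_radius:
  assumes "Im s > 0" "cmod (s + of_real c) \<le> sa + c \<or> sb + c \<le> cmod (s + of_real c)"
  shows "Im (J s) > 0"
  using curve_radius[OF assms(1)] assms(2) by linarith

text \<open>The range of the argument leaves only the value 0 when J is real, so \<open>Lam\<close>
  itself is real and J = c1 exp (Lam) is positive.\<close>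

lemma J_pos_of_Im_zero:
  assumes "Im s > 0" "Im (J s) = 0" 
  shows "Re (J s) > 0" "Im (Lam s) = 0"
proof -
  show z: "Im (Lam s) = 0" using sgn_Im_J[OF assms(1)] assms(2) by (simp add: sgn_zero_iff)
  show "Re (J s) > 0" unfolding J_upper[OF assms(1)] using z c1 by (simp add: Re_exp)
qed

end

section \<open>The critical curve and the parameters\<close>

context jmap
begin

definition jr :: "real \<Rightarrow> real" where
  "jr x = c1 * (x + c) * ((x + 1) / x) powr (1 / \<theta>)"

lemma J_of_real:
  assumes "x < -1 \<or> x > 0" shows "J (of_real x) = of_real (jr x)"
proof -
  have "0 \<le> (x + 1) / x" using assms by (auto simp: zero_le_divide_iff)
  then have "(complex_of_real ((x + 1) / x)) powr of_real (1 / \<theta>) = of_real (((x + 1) / x) powr (1 / \<theta>))"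
    by (rule powr_of_real)
  moreover have "of_real c1 * complex_of_real x + of_real c0 = of_real (c1 * (x + c))"
    by (simp add: distrib_left c0_eq flip: of_real_mult of_real_add)
  ultimately show ?thesis unfolding Jt_def jr_def by simp
qed

lemma J_a_eq: "J_a \<theta> c0 c1 = jr sa" and J_b_eq: "J_b \<theta> c0 c1 = jr sb"
  and J_sa: "J (of_real sa) = of_real (J_a \<theta> c0 c1)" and J_sb: "J (of_real sb) = of_real (J_b \<theta> c0 c1)"
  using sa_less sb_pos by (auto simp: J_a_def J_b_def J_of_real)

lemma J_a_pos: "0 < J_a \<theta> c0 c1"
  unfolding J_a_eq jr_def using sa_gt sa_less c1 by (auto intro!: mult_pos_pos simp: divide_neg_neg)

abbreviation "wa \<equiv> sa + c"
abbreviation "wb \<equiv> sb + c"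

lemma wa_pos: "0 < wa" and wab: "wa < wb" using sa_gt sab by auto

definition Cf :: "real \<Rightarrow> real" where "Cf r = (r^2 + c * (c - 1)) / r"

lemma Cf_continuous: "r > 0 \<Longrightarrow> isCont Cf r"
  unfolding Cf_def by (auto intro!: continuous_intros)

lemma angle_exists:
  assumes r: "wa < r" "r < wb"
  shows "\<exists>v. 0 < v \<and> v < pi / \<theta> \<and> phi v = Cf r"
proof -
  have C: "Cf r < 2 * c - 1 + 1 / \<theta>" using inner_bound[OF r] by (simp add: Cf_def)
  \<comment> \<open>\<open>P v\<close> is sin (theta v) (Cf r - phi v) with the denominator cleared,
    hence smooth at both ends. It vanishes at 0 with negative slope, because Cf r is below the limit
    of \<open>phi\<close> there, and it is positive at pi / theta.\<close>
  define P where "P v = sin (\<theta> * v) * (Cf r - (2 * c - 1) * cos v) - cos (\<theta> * v) * sin v" for v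
  have pt: "0 < pi / \<theta>" "pi / \<theta> < pi" using th by (auto simp: field_simps)
  have "(P has_real_derivative \<theta> * (Cf r - (2 * c - 1)) - 1) (at 0)"
    unfolding P_def[abs_def] by (auto intro!: derivative_eq_intros simp: algebra_simps)
  moreover have "\<theta> * (Cf r - (2 * c - 1)) - 1 < 0" using C th by (simp add: field_simps)
  ultimately obtain d where d: "d > 0" "\<And>h. 0 < h \<Longrightarrow> h < d \<Longrightarrow> P (0 + h) < P 0"
    using DERIV_neg_dec_right[of P _ 0] by metis
  define h where "h = min (d / 2) (pi / \<theta> / 2)"
  have h: "0 < h" "h < d" "h < pi / \<theta>" using d(1) pt by (auto simp: h_def)
  have "P h < 0" using d(2)[OF h(1,2)] by (simp add: P_def)
  moreover have "P (pi / \<theta>) > 0" using th sin_gt_zero[OF pt] by (simp add: P_def)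
  moreover have "continuous_on {h..pi / \<theta>} P" unfolding P_def[abs_def] by (intro continuous_intros)
  ultimately obtain v where v: "h \<le> v" "v \<le> pi / \<theta>" "P v = 0"
    using IVT'[of P h 0 "pi / \<theta>"] h by auto
  have "v \<noteq> pi / \<theta>" using v(3) \<open>P (pi / \<theta>) > 0\<close> by auto
  then have vr: "0 < v" "v < pi / \<theta>" using v h by auto
  have "sin (\<theta> * v) > 0" using vr th by (intro sin_gt_zero) (auto simp: field_simps)
  then have "phi v = Cf r" using v(3) by (simp add: P_def angle_fun_def field_simps)
  then show ?thesis using vr by blast
qed

text \<open>The angle at which the circle of radius r meets the curve, unique since
  \<open>phi\<close> is strictly decreasing. The value 0 elsewhere is the limit at the two critical
  points, so \<open>B\<close> is continuous up to the boundary radii.\<close>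

definition B :: "real \<Rightarrow> real" where
  "B r = (if wa < r \<and> r < wb then SOME v. 0 < v \<and> v < pi / \<theta> \<and> phi v = Cf r else 0)"

lemma B_interior:
  assumes "wa < r" "r < wb" shows "0 < B r" "B r < pi / \<theta>" "phi (B r) = Cf r"
  using someI_ex[OF angle_exists[OF assms]] assms by (auto simp: B_def)

lemma B_outside: "\<not> (wa < r \<and> r < wb) \<Longrightarrow> B r = 0" by (auto simp: B_def)

text \<open>Inside the annulus an inequality between B r and a fixed angle v amounts, by
  monotonicity of \<open>phi\<close>, to one between Cf r and phi v, which is an open condition on
  r. At a boundary radius Cf is above every value of \<open>phi\<close>, which leaves only the angle
  0 in the limit.\<close>

lemma B_continuous: "continuous_on {wa..wb} B"
  unfolding continuous_on
proof
  fix r0 assume r0: "r0 \<in> {wa..wb}"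
  have r0p: "r0 > 0" using r0 wa_pos by auto
  have pt: "0 < pi / \<theta>" using th by simp
  have limC: "(Cf \<longlongrightarrow> Cf r0) (at r0 within {wa..wb})"
    using continuous_at_imp_continuous_at_within[OF Cf_continuous[OF r0p]] by (simp add: continuous_within)
  have nn: "0 \<le> B r" for r using B_interior(1)[of r] B_outside[of r] by fastforce
  have lt: "B r < pi / \<theta>" for r using B_interior(2)[of r] B_outside[of r] pt by fastforce
  have edge: "2 * c - 1 + 1 / \<theta> \<le> Cf r" if "r \<in> {wa..wb}" "\<not> (wa < r \<and> r < wb)" for r
    unfolding Cf_def by (rule outer_bound) (use that wa_pos in auto)
  show "(B \<longlongrightarrow> B r0) (at r0 within {wa..wb})"
  proof (rule order_tendstoI)
    fix e assume e: "e < B r0"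
    show "\<forall>\<^sub>F r in at r0 within {wa..wb}. e < B r"
    proof (cases "e < 0")
      case True
      then show ?thesis using nn by (intro always_eventually) (auto intro: less_le_trans)
    next
      case False
      then have ri: "wa < r0" "r0 < wb" using e B_outside[of r0] by fastforce+
      obtain v1 where v1: "e < v1" "v1 < B r0" using dense[OF e] by blast
      have "Cf r0 < phi v1"
        using phi_strict_antimono[of v1 "B r0"] v1 False B_interior[OF ri] by auto
      with limC have "\<forall>\<^sub>F r in at r0 within {wa..wb}. Cf r < phi v1" by (rule order_tendstoD)
      moreover have "\<forall>\<^sub>F r in at r0 within {wa..wb}. r \<in> {wa..wb}" 
        by (auto simp: eventually_at_filter)
      ultimately show ?thesis
      proof eventually_elim
        case (elim r)
        have v1r: "0 < v1" "v1 < pi / \<theta>" using v1 False lt[of r0] by auto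
        have int: "wa < r \<and> r < wb" using edge[of r] elim phi_less[OF v1r] by fastforce
        show ?case
        proof (rule ccontr)
          assume "\<not> e < B r"
          then have "phi v1 < phi (B r)" 
            using phi_strict_antimono[of "B r" v1] B_interior[of r] int v1 v1r by auto
          then show False using elim B_interior[of r] int by auto
        qed
      qed
    qed
  next
    fix e assume e: "B r0 < e"
    then have "B r0 < min e (pi / \<theta>)" using lt by auto
    then obtain v2 where v2: "B r0 < v2" "v2 < min e (pi / \<theta>)" using dense by blast
    have v2r: "0 < v2" "v2 < pi / \<theta>" using v2 nn[of r0] by auto
    have "phi v2 < Cf r0"
    proof (cases "wa < r0 \<and> r0 < wb")
      case True
      then show ?thesis using phi_strict_antimono[of "B r0" v2] v2 v2r B_interior[of r0] by auto
    next
      case False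
      then show ?thesis using edge[OF r0 False] phi_less[OF v2r] by linarith
    qed
    with limC have "\<forall>\<^sub>F r in at r0 within {wa..wb}. phi v2 < Cf r" by (rule order_tendstoD)
    then show "\<forall>\<^sub>F r in at r0 within {wa..wb}. B r < e"
    proof eventually_elim
      case (elim r)
      show ?case
      proof (cases "wa < r \<and> r < wb")
        case True
        have "B r < v2"
        proof (rule ccontr)
          assume "\<not> B r < v2"
          then have "phi (B r) \<le> phi v2"
            using phi_strict_antimono[of v2 "B r"] v2r B_interior[of r] True by (cases "v2 = B r") auto
          then show False using elim B_interior[of r] True by auto
        qed
        then show ?thesis using v2 by simp
      next
        case False
        then show ?thesis using B_outside v2r v2 by auto
      qed
    qed
  qed
qed

text \<open>The arc parametrised by the distance r to - c. Once J is known to be monotone along it,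
  the parameter is changed to the value of J.\<close>

definition tc :: "real \<Rightarrow> complex" where "tc r = rcis r (B r) - of_real c"

lemma tc_interior:
  assumes "wa < r" "r < wb" shows "Im (tc r) > 0" "Im (J (tc r)) = 0" "Re (J (tc r)) > 0"
proof -
  have r: "r > 0" using assms wa_pos by linarith
  have "pi / \<theta> < pi" using th by (simp add: field_simps)
  then show i: "Im (tc r) > 0" unfolding tc_def
    using B_interior[OF assms] by (intro rcis_upper r) auto
  show z: "Im (J (tc r)) = 0"
    using sgn_Im_J_polar[OF r, of "B r"] B_interior[OF assms] by (simp add: tc_def Cf_def sgn_zero_iff)
  show "Re (J (tc r)) > 0" using J_pos_of_Im_zero[OF i z] by simp
qed

lemma tc_ends: "tc wa = of_real sa" "tc wb = of_real sb"
  by (simp_all add: tc_def B_outside)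

lemma tc_continuous: "continuous_on {wa..wb} tc"
  unfolding tc_def rcis_def by (intro continuous_intros B_continuous)

lemma off_cut_curve: 
  assumes "r \<in> {wa..wb}" shows "(tc r + 1) / tc r \<notin> \<real>\<^sub>\<le>\<^sub>0"
proof -
  consider "wa < r \<and> r < wb" | "r = wa" | "r = wb" using assms by fastforce
  then show ?thesis
    using off_cut_upper[of "tc r"] tc_interior[of r] off_cut_real[of sa] off_cut_real[of sb] sa_less sb_pos
    by cases (auto simp: tc_ends simp del: of_real_add)
qed

lemma J_isCont: "(s + 1) / s \<notin> \<real>\<^sub>\<le>\<^sub>0 \<Longrightarrow> isCont J s"
  using J_has_derivative DERIV_isCont by blast

lemma J_tc_continuous: "continuous_on {wa..wb} (\<lambda>r. J (tc r))"
proof (rule continuous_on_compose2[OF _ tc_continuous])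
  show "continuous_on (tc ` {wa..wb}) J"
    by (rule continuous_at_imp_continuous_on) (use J_isCont off_cut_curve in auto)
qed auto

lemma B_deriv:
  assumes "wa < r" "r < wb" shows "\<exists>d. (B has_real_derivative d) (at r)"
proof -
  have r: "r > 0" using assms wa_pos by linarith
  obtain D where D: "D < 0" "(phi has_real_derivative D) (at (B r))"
    using phi_deriv B_interior[OF assms] by blast
  have rnhd: "r \<in> interior {wa..wb}" using assms by simp
  have "(B has_vector_derivative ((1 - c * (c - 1) / r^2) / D)) (at r)"
  proof (rule has_vector_derivative_implicit[where g = phi and h = Cf])
    show "isCont B r" using B_continuous rnhd by (rule continuous_on_interior)
    show "(Cf has_vector_derivative 1 - c * (c - 1) / r\<^sup>2) (at r)"
      unfolding has_real_derivative_iff_has_vector_derivative[symmetric] Cf_def[abs_def]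
      using r by (auto intro!: derivative_eq_intros simp: field_simps power2_eq_square)
    have "\<forall>\<^sub>F y in at r. y \<in> {wa<..<wb}"
      by (rule eventually_at_in_open') (use assms in auto)
    then show "\<forall>\<^sub>F y in at r. phi (B y) = Cf y"
      by eventually_elim (use B_interior in auto)
  qed (use D B_interior[OF assms] in auto)
  then show ?thesis unfolding has_real_derivative_iff_has_vector_derivative by blast
qed

lemma J_deriv_upper:
  assumes "Im s > 0" shows "\<exists>D. D \<noteq> 0 \<and> (J has_field_derivative D) (at s)"
proof -
  have s: "s \<noteq> 0" "s + 1 \<noteq> 0" "s \<noteq> of_real sa" "s \<noteq> of_real sb" using assms by (auto simp: complex_eq_iff)
  have "Im s \<noteq> 0" using assms by simp
  from J_has_derivative[OF off_cut_upper[OF this]] s c1 show ?thesis by (intro exI conjI) auto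
qed

text \<open>The velocity of the curve is cis (B r) (1 + i r B'(r)) and never vanishes, nor does J'
  in the upper half-plane. As J is real along the curve, the nonzero derivative of the composition
  is real.\<close>

lemma J_tc_deriv:
  assumes "wa < r" "r < wb"
  shows "\<exists>d. d \<noteq> 0 \<and> ((\<lambda>r. Re (J (tc r))) has_real_derivative d) (at r)"
proof -
  obtain b where b: "(B has_real_derivative b) (at r)" using B_deriv[OF assms] by blast
  obtain D where D: "D \<noteq> 0" "(J has_field_derivative D) (at (tc r))"
    using J_deriv_upper tc_interior[OF assms] by blast
  define t' where "t' = cis (B r) * (1 + \<i> * of_real (r * b))"
  have t'0: "t' \<noteq> 0" by (auto simp: t'_def complex_eq_iff[of "1 + _"] )
  have "((\<lambda>r. of_real (B r)) has_vector_derivative complex_of_real b) (at r)"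
    using b has_vector_derivative_of_real by blast
  then have "((\<lambda>z. exp (\<i> * z)) \<circ> (\<lambda>r. of_real (B r)) has_vector_derivative of_real b * (\<i> * exp (\<i> * of_real (B r)))) (at r)"
    by (rule field_vector_diff_chain_at) (auto intro!: derivative_eq_intros)
  then have "((\<lambda>r. cis (B r)) has_vector_derivative of_real b * (\<i> * cis (B r))) (at r)"
    by (simp add: o_def cis_conv_exp)
  from has_vector_derivative_mult[OF has_vector_derivative_of_real[OF DERIV_ident] this]
  have "((\<lambda>r. of_real r * cis (B r)) has_vector_derivative t') (at r)"
    by (simp add: t'_def algebra_simps)
  then have "(tc has_vector_derivative t') (at r)"
    unfolding tc_def[abs_def] rcis_def by (simp add: has_vector_derivative_diff_const)
  then have "(J \<circ> tc has_vector_derivative t' * D) (at r)"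
    using field_vector_diff_chain_at[of tc t' r J D] D(2) by simp
  then have dd: "((\<lambda>r. Re (J (tc r))) has_real_derivative Re (t' * D)) (at r)"
     "((\<lambda>r. Im (J (tc r))) has_real_derivative Im (t' * D)) (at r)"
    unfolding has_vector_derivative_complex_iff has_real_derivative_iff_has_vector_derivative by (simp_all add: o_def)
  have "\<forall>\<^sub>F y in nhds r. y \<in> {wa<..<wb}"
    by (rule eventually_nhds_in_open) (use assms in auto)
  then have "\<forall>\<^sub>F y in nhds r. Im (J (tc y)) = 0"
    by eventually_elim (use tc_interior in auto)
  then have "((\<lambda>r. Im (J (tc r))) has_real_derivative 0) (at r)"
    using DERIV_cong_ev[OF refl, of "\<lambda>r. Im (J (tc r))" "\<lambda>r. 0" r 0 0] by simp
  then have "Im (t' * D) = 0" using dd(2) DERIV_unique by blast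
  then have "Re (t' * D) \<noteq> 0" using t'0 D(1) by (metis complex_eqI mult_eq_0_iff zero_complex.simps)
  then show ?thesis using dd(1) by blast
qed

text \<open>By Rolle's theorem and the nonvanishing derivative, J is injective along the curve,
  hence strictly monotone from J(sa) to J(sb); the curve composed with the inverse is the required
  parametrisation. This gives the choice in \<open>Iplus\<close> its meaning.\<close>

lemma is_Iplus_exists:
  assumes ab: "J_a \<theta> c0 c1 < J_b \<theta> c0 c1"
  shows "\<exists>f. is_Iplus \<theta> c0 c1 f"
proof -
  define X where "X r = Re (J (tc r))" for r
  have contX: "continuous_on {wa..wb} X" unfolding X_def by (intro continuous_intros J_tc_continuous)
  have ends: "X wa = J_a \<theta> c0 c1" "X wb = J_b \<theta> c0 c1" by (simp_all add: X_def tc_ends J_sa J_sb)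
  have inj: "inj_on X {wa..wb}"
  proof (rule linorder_inj_onI')
    fix r1 r2 assume r: "r1 \<in> {wa..wb}" "r2 \<in> {wa..wb}" "r1 < r2"
    show "X r1 \<noteq> X r2"
    proof
      assume eq: "X r1 = X r2"
      have "\<exists>z>r1. z < r2 \<and> (X has_real_derivative 0) (at z)"
      proof (rule Rolle[OF r(3) eq])
        show "continuous_on {r1..r2} X" by (rule continuous_on_subset[OF contX]) (use r in auto)
        show "X differentiable at x" if "r1 < x" "x < r2" for x
          using J_tc_deriv[of x] that r unfolding X_def[symmetric] by (auto simp: real_differentiable_def)
      qed
      then obtain z where z: "r1 < z" "z < r2" "(X has_real_derivative 0) (at z)" by blast
      then have "wa < z" "z < wb" using r by auto
      from J_tc_deriv[OF this] obtain d where "d \<noteq> 0" "(X has_real_derivative d) (at z)"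
        unfolding X_def by blast
      then show False using DERIV_unique z(3) by blast
    qed
  qed
  have X_in: "J_a \<theta> c0 c1 < X r \<and> X r < J_b \<theta> c0 c1" if "wa < r" "r < wb" for r
    using continuous_inj_imp_mono[OF that contX inj] ab by (auto simp: ends)
  have X_img: "X ` {wa..wb} = {J_a \<theta> c0 c1..J_b \<theta> c0 c1}"
  proof
    show "X ` {wa..wb} \<subseteq> {J_a \<theta> c0 c1..J_b \<theta> c0 c1}"
    proof (rule image_subsetI)
      fix r assume "r \<in> {wa..wb}"
      then consider "wa < r \<and> r < wb" | "r = wa" | "r = wb" by fastforce
      then show "X r \<in> {J_a \<theta> c0 c1..J_b \<theta> c0 c1}" using X_in[of r] ab by cases (auto simp: ends)
    qed
    show "{J_a \<theta> c0 c1..J_b \<theta> c0 c1} \<subseteq> X ` {wa..wb}"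
    proof
      fix y assume "y \<in> {J_a \<theta> c0 c1..J_b \<theta> c0 c1}"
      then obtain r where "wa \<le> r" "r \<le> wb" "X r = y"
        using IVT'[of X wa y wb] contX wab by (auto simp: ends)
      then show "y \<in> X ` {wa..wb}" by auto
    qed
  qed
  define Y where "Y = inv_into {wa..wb} X"
  have YX: "Y (X r) = r" if "r \<in> {wa..wb}" for r unfolding Y_def by (rule inv_into_f_f[OF inj that])
  have XY: "X (Y x) = x" "Y x \<in> {wa..wb}" if "x \<in> {J_a \<theta> c0 c1..J_b \<theta> c0 c1}" for x
    using that f_inv_into_f[of x X "{wa..wb}"] inv_into_into[of x X "{wa..wb}"] unfolding X_img Y_def by auto
  have contY: "continuous_on {J_a \<theta> c0 c1..J_b \<theta> c0 c1} Y"
    unfolding X_img[symmetric] by (rule continuous_on_inv[OF contX]) (use YX in auto)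
  have "is_Iplus \<theta> c0 c1 (tc \<circ> Y)"
    unfolding is_Iplus_def
  proof (intro conjI ballI)
    show "continuous_on {J_a \<theta> c0 c1..J_b \<theta> c0 c1} (tc \<circ> Y)"
      by (rule continuous_on_compose[OF contY]) (rule continuous_on_subset[OF tc_continuous], use XY in auto)
    show "(tc \<circ> Y) (J_a \<theta> c0 c1) = of_real sa" "(tc \<circ> Y) (J_b \<theta> c0 c1) = of_real sb"
      using YX[of wa] YX[of wb] wab by (simp_all add: tc_ends ends)
    fix x assume x: "x \<in> {J_a \<theta> c0 c1<..<J_b \<theta> c0 c1}"
    then have xx: "X (Y x) = x" "Y x \<in> {wa..wb}" using XY[of x] by auto
    then have "wa < Y x" "Y x < wb" using x ends by (metis atLeastAtMost_iff greaterThanLessThan_iff order.strict_iff_order)+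
    then show "Im ((tc \<circ> Y) x) > 0" "J ((tc \<circ> Y) x) = of_real x"
      using tc_interior[of "Y x"] xx(1) by (auto simp: X_def complex_eq_iff)
  qed
  then show ?thesis by blast
qed

end

text \<open>Put q = - s_a - 1 and p = s_b; the sum of the critical points gives p = q + 1/theta. The
  ratio J(s_b) / J(s_a) is then the function \<open>R\<close> of q alone, which is large near 0 and
  close to 1 for large q, so it takes the value b/a. The factor c1 then adjusts J(s_a) to a.\<close>

lemma exists_parameters:
  fixes \<theta> a b :: real
  assumes th: "\<theta> > 1" and a: "0 < a" and ab: "a < b"
  shows "\<exists>c0 c1. 0 < c1 \<and> c1 < c0 \<and> J_a \<theta> c0 c1 = a \<and> J_b \<theta> c0 c1 = b"
proof -
  define k where "k = 1 / \<theta>"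
  have k: "0 < k" "k < 1" using th by (auto simp: k_def)
  define R where "R q = (q + k) * (q + k + 1) / (q * (q + 1)) * (((q + k + 1) / (q + k)) powr k * ((q + 1) / q) powr k)" for q
  \<comment> \<open>For the lower bound both powers are at least 1. For the upper bound they are at
    most their bases, and each of the four factors is at most (q + 1)/q.\<close>
  have low: "R q \<ge> 1 + k / q" if "q > 0" for q
  proof -
    have "1 \<le> ((q + k + 1) / (q + k)) powr k" "1 \<le> ((q + 1) / q) powr k"
      using that k by (auto intro!: ge_one_powr_ge_zero)
    then have 1: "1 * 1 \<le> ((q + k + 1) / (q + k)) powr k * ((q + 1) / q) powr k" by (intro mult_mono) auto
    have "1 + k / q \<le> (1 + k / q) * ((q + k + 1) / (q + 1))"
      using mult_left_mono[of 1 "(q + k + 1) / (q + 1)" "1 + k / q"] that k by simp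
    also have "\<dots> = (q + k) * (q + k + 1) / (q * (q + 1))" using that by (simp add: field_simps)
    also have "\<dots> \<le> R q" unfolding R_def using mult_left_mono[OF 1, of "(q + k) * (q + k + 1) / (q * (q + 1))"] that k by simp
    finally show ?thesis .
  qed
  have up: "R q \<le> ((q + 1) / q) ^ 4" if "q > 0" for q
  proof -
    have p1: "x powr k \<le> x" if "x \<ge> 1" for x :: real using powr_mono[of k 1 x] that k by simp
    have "((q + k + 1) / (q + k)) powr k \<le> (q + k + 1) / (q + k)" using that k by (intro p1) auto
    also have "\<dots> \<le> (q + 1) / q" using that k by (simp add: field_simps)
    finally have 1: "((q + k + 1) / (q + k)) powr k \<le> (q + 1) / q" .
    have 2: "((q + 1) / q) powr k \<le> (q + 1) / q" using that by (intro p1) auto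
    have 3: "(q + k) / q \<le> (q + 1) / q" using that k by (simp add: field_simps)
    have 4: "(q + k + 1) / (q + 1) \<le> (q + 1) / q"
    proof -
      have "(q + k + 1) * q \<le> (q + 2) * q" using that k by (intro mult_right_mono) auto
      also have "\<dots> \<le> (q + 1) * (q + 1)" by (simp add: algebra_simps)
      finally show ?thesis using that by (simp add: field_simps)
    qed
    have "R q = ((q + k) / q) * ((q + k + 1) / (q + 1)) * (((q + k + 1) / (q + k)) powr k * ((q + 1) / q) powr k)"
      by (simp add: R_def)
    also have "\<dots> \<le> ((q + 1) / q) * ((q + 1) / q) * (((q + 1) / q) * ((q + 1) / q))"
      using that k by (intro mult_mono 1 2 3 4 mult_nonneg_nonneg) auto
    finally show ?thesis by (simp add: power4_eq_xxxx mult.assoc)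
  qed
  have cont: "continuous_on {x..y} R" if "x > 0" for x y
    unfolding R_def using that k by (intro continuous_intros) auto
  \<comment> \<open>Chosen to make the lower bound 1 + k/q0 equal to b/a.\<close>
  define q0 where "q0 = k / (b / a - 1)"
  have ba: "b / a > 1" using a ab by simp
  have q0: "q0 > 0" using ba k by (simp add: q0_def)
  have "1 + k / q0 = b / a" using ba k by (simp add: q0_def)
  then have Rq0: "R q0 \<ge> b / a" using low[OF q0] by simp
  \<comment> \<open>The upper bound ((q + 1)/q)^4 equals b/a when (q + 1)/q is the fourth root z of
    b/a, that is, at q = 1/(z - 1).\<close>
  define z where "z = (b / a) powr (1/4)"
  have z1: "z > 1" using ba by (simp add: z_def gr_one_powr)
  have z4: "z ^ 4 = b / a" unfolding z_def using ba a ab by (subst powr_power) auto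
  define q1 where "q1 = 1 / (z - 1)"
  have q1: "q1 > 0" using z1 by (simp add: q1_def)
  have "(q1 + 1) / q1 = z" using z1 by (simp add: q1_def field_simps)
  then have Rq1: "R q1 \<le> b / a" using up[OF q1] z4 by simp
  obtain q where q: "q > 0" "R q = b / a"
  proof (cases "q0 \<le> q1")
    case True
    then obtain q where "q0 \<le> q" "q \<le> q1" "R q = b / a"
      using IVT2'[of R q1 "b / a" q0] cont[OF q0] Rq0 Rq1 by auto
    then show ?thesis using q0 by (intro that[of q]) auto
  next
    case False
    then obtain q where "q1 \<le> q" "q \<le> q0" "R q = b / a"
      using IVT'[of R q1 "b / a" q0] cont[OF q1] Rq0 Rq1 by auto
    then show ?thesis using q1 by (intro that[of q]) auto
  qed
  define p where "p = q + k"
  \<comment> \<open>p must satisfy the critical equation theta p (p + 1) = p + c, which fixes c; c1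
    is read off from J(s_a) = a.\<close>
  define c where "c = \<theta> * p^2 + (\<theta> - 1) * p"
  define c1 where "c1 = a / (\<theta> * q * (q + 1) * (q / (q + 1)) powr k)"
  define c0 where "c0 = c * c1"
  have p: "p > 0" using q k by (simp add: p_def)
  have tk: "\<theta> * k = 1" using th by (simp add: k_def)
  have c1: "c1 > 0" unfolding c1_def using q th a by (intro divide_pos_pos mult_pos_pos) auto
  have "c > 1"
  proof -
    have "\<theta> * p > 1" using q th tk by (simp add: p_def distrib_left)
    then have "\<theta> * p * p + (\<theta> * p - p) > 1 * p + (1 - p)"
      using p by (intro add_strict_mono mult_strict_right_mono diff_strict_right_mono) auto
    then show ?thesis by (simp add: c_def power2_eq_square algebra_simps)
  qed
  then have c01: "c1 < c0" using c1 by (simp add: c0_def)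
  interpret m: jmap \<theta> c0 c1 by unfold_locales (use th c1 c01 in auto)
  have cc: "c0 / c1 = c" using c1 by (simp add: c0_def)
  have "4 * c0 * c1 * \<theta> + c1^2 * (\<theta> - 1)^2 = (c1 * (2 * \<theta> * p + (\<theta> - 1)))^2"
    by (simp add: c0_def c_def power2_eq_square algebra_simps)
  then have sq: "sqrt (4 * c0 * c1 * \<theta> + c1^2 * (\<theta> - 1)^2) = c1 * (2 * \<theta> * p + (\<theta> - 1))"
    using c1 th p by simp
  have sbp: "s_b \<theta> c0 c1 = p" unfolding s_b_def sq using th c1 by (simp add: field_simps)
  have saq: "s_a \<theta> c0 c1 = - (q + 1)" unfolding s_a_def sq using th c1 by (simp add: field_simps p_def k_def)
  have w: "s_b \<theta> c0 c1 + c0 / c1 = \<theta> * p * (p + 1)" "s_a \<theta> c0 c1 + c0 / c1 = \<theta> * q * (q + 1)"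
  proof -
    show "s_b \<theta> c0 c1 + c0 / c1 = \<theta> * p * (p + 1)" unfolding cc sbp c_def by (simp add: power2_eq_square algebra_simps)
    have e: "\<theta> * q = \<theta> * p - 1" using tk by (simp add: p_def algebra_simps)
    have "- (q + 1) + (\<theta> * p^2 + (\<theta> - 1) * p) = \<theta> * q * (q + 1)" using e by algebra
    then show "s_a \<theta> c0 c1 + c0 / c1 = \<theta> * q * (q + 1)" unfolding cc saq c_def .
  qed
  have "(- (q + 1) + 1) / (- (q + 1)) = q / (q + 1)" using q(1) by (simp add: field_simps)
  then have Ja: "J_a \<theta> c0 c1 = c1 * (\<theta> * q * (q + 1)) * (q / (q + 1)) powr k"
    unfolding m.J_a_eq m.jr_def using w(2) by (simp add: saq m.c_def k_def)
  also have "\<dots> = a" using q(1) th by (simp add: c1_def)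
  finally have JA: "J_a \<theta> c0 c1 = a" .
  have Jb: "J_b \<theta> c0 c1 = c1 * (\<theta> * p * (p + 1)) * ((p + 1) / p) powr k"
    unfolding m.J_b_eq m.jr_def using w(1) by (simp add: sbp m.c_def k_def)
  have "(q / (q + 1)) powr k * ((q + 1) / q) powr k = 1" using q(1) by (simp flip: powr_mult)
  then have "J_a \<theta> c0 c1 * R q = J_b \<theta> c0 c1"
  proof -
    assume XW: "(q / (q + 1)) powr k * ((q + 1) / q) powr k = 1"
    have gen: "A * (t * Z) * X * (P / Z * (Y * W)) = A * (t * P) * Y * (X * W)" if "Z \<noteq> 0" for A t Z X P Y W :: real
      using that by (simp add: field_simps)
    show ?thesis
      unfolding Ja Jb R_def p_def[symmetric]
      using gen[of "q * (q + 1)" c1 \<theta> _ "p * (p + 1)" "((p + 1) / p) powr k" "((q + 1) / q) powr k"] q(1) XW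
      by (simp add: mult.assoc)
  qed
  then have "J_b \<theta> c0 c1 = b" using JA q(2) a by simp
  then show ?thesis using c1 c01 JA by blast
qed

section \<open>Integrability along the curve\<close>

lemma integrable_powr_near_zero:
  assumes "-1 < (p::real)" "0 \<le> l"
  shows "set_integrable lborel {-l..l} (\<lambda>x. \<bar>x\<bar> powr p)"
proof -
  have pos: "set_integrable lborel {0..l} (\<lambda>x. x powr p)"
  proof -
    have "(\<lambda>x. x powr p) integrable_on {0..l}"
      using has_integral_powr_from_0[OF assms] by blast
    then have "(\<lambda>x. x powr p) absolutely_integrable_on {0..l}"
      by (rule nonnegative_absolutely_integrable_1) auto
    then have "integrable (completion lborel) (\<lambda>x. indicator {0..l} x *\<^sub>R x powr p)"
      by (simp add: set_integrable_def)
    then show ?thesis unfolding set_integrable_def by (subst (asm) integrable_completion) auto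
  qed
  then have p1: "set_integrable lborel {0..l} (\<lambda>x. \<bar>x\<bar> powr p)"
    by (rule set_integrable_cong[THEN iffD1, rotated -1]) auto
  have "integrable lborel (\<lambda>x. indicator {0..l} (0 + (-1) * x) *\<^sub>R (\<bar>0 + (-1) * x\<bar> powr p))"
    by (rule lborel_integrable_real_affine[OF p1[unfolded set_integrable_def]]) auto
  moreover have "indicator {0..l} (0 + (-1) * x) = (indicator {-l..0} x :: real)" for x by (auto simp: indicator_def)
  ultimately have "set_integrable lborel {-l..0} (\<lambda>x. \<bar>x\<bar> powr p)" unfolding set_integrable_def by simp
  from set_integrable_Un[OF this p1] have "set_integrable lborel ({-l..0} \<union> {0..l}) (\<lambda>x. \<bar>x\<bar> powr p)" by simp
  also have "{-l..0} \<union> {0..l} = {-l..l}" using assms by auto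
  finally show ?thesis .
qed

lemma abs_ln_le:
  assumes "0 < (d::real)" shows "\<bar>ln d\<bar> \<le> 4 * d powr (-1/4) + d"
proof -
  have "ln d \<le> d" using ln_le_minus_one[OF assms] by linarith
  moreover have "- ln d = 4 * ln (d powr (-1/4))" using assms by (simp add: ln_powr)
  moreover have "ln (d powr (-1/4)) \<le> d powr (-1/4)" using ln_le_minus_one[of "d powr (-1/4)"] assms by simp
  moreover have "0 \<le> d powr (-1/4)" by simp
  ultimately show ?thesis using assms by linarith
qed

text \<open>A majorant for the product of a logarithm at y and inverse square roots at a and b. The
  logarithm costs a power -1/4, and d^(-1/4) e^(-1/2) is at most d^(-3/4) + e^(-3/4), which is still
  integrable.\<close>

definition dom :: "real \<Rightarrow> real \<Rightarrow> real \<Rightarrow> real \<Rightarrow> real" where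
  "dom a b y x = \<bar>x - y\<bar> powr (-3/4) + \<bar>x - a\<bar> powr (-3/4) + \<bar>x - b\<bar> powr (-3/4)"

text \<open>The growth of I' at the ends: J minus its critical value vanishes to second order at a
  critical point, so the inverse map behaves like a square root at a and b.\<close>

definition edge :: "real \<Rightarrow> real \<Rightarrow> real \<Rightarrow> real" where
  "edge a b x = \<bar>x - a\<bar> powr (-1/2) + \<bar>x - b\<bar> powr (-1/2)"

lemma edge_nonneg: "0 \<le> edge a b x"
  by (auto simp: edge_def)

lemma dom_measurable [measurable]: "dom a b y \<in> borel_measurable borel"
  and edge_measurable [measurable]: "edge a b \<in> borel_measurable borel"
  unfolding dom_def[abs_def] edge_def[abs_def] by measurable

text \<open>The bound is the same for all y in [a,b]; this uniformity feeds Fubini's theorem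
  later.\<close>

lemma powr_shift_integrable:
  assumes "-1 < (p::real)" "a \<le> y" "y \<le> b" "a \<le> b"
  shows "set_integrable lborel {a<..<b} (\<lambda>x. \<bar>x - y\<bar> powr p)"
    and "(LINT x:{a<..<b}|lborel. \<bar>x - y\<bar> powr p) \<le> (LINT x:{-(b-a)..b-a}|lborel. \<bar>x\<bar> powr p)"
proof -
  let ?l = "b - a"
  have i: "set_integrable lborel {-?l..?l} (\<lambda>x. \<bar>x\<bar> powr p)" by (rule integrable_powr_near_zero) (use assms in auto)
  have j: "integrable lborel (\<lambda>x. indicator {-?l..?l} (-y + 1 * x) *\<^sub>R (\<bar>-y + 1 * x\<bar> powr p))"
    by (rule lborel_integrable_real_affine[OF i[unfolded set_integrable_def]]) auto
  have meas: "(\<lambda>x. indicator {a<..<b} x *\<^sub>R (\<bar>x - y\<bar> powr p)) \<in> borel_measurable lborel" by measurable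
  have le: "indicator {a<..<b} x *\<^sub>R (\<bar>x - y\<bar> powr p) \<le> indicator {-?l..?l} (-y + 1 * x) *\<^sub>R (\<bar>-y + 1 * x\<bar> powr p)" for x
    using assms by (auto simp: indicator_def)
  show k: "set_integrable lborel {a<..<b} (\<lambda>x. \<bar>x - y\<bar> powr p)"
    unfolding set_integrable_def by (rule Bochner_Integration.integrable_bound[OF j meas]) (use le in \<open>auto simp: indicator_def\<close>)
  have "(LINT x:{a<..<b}|lborel. \<bar>x - y\<bar> powr p) \<le> (LINT x|lborel. indicator {-?l..?l} (-y + 1 * x) *\<^sub>R (\<bar>-y + 1 * x\<bar> powr p))"
    unfolding set_lebesgue_integral_def by (rule integral_mono[OF k[unfolded set_integrable_def] j]) (rule le)
  also have "\<dots> = (LINT x:{-?l..?l}|lborel. \<bar>x\<bar> powr p)"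
    unfolding set_lebesgue_integral_def
    using lborel_integral_real_affine[of 1 "\<lambda>x. indicator {-?l..?l} x *\<^sub>R (\<bar>x\<bar> powr p)" "-y"] by simp
  finally show "(LINT x:{a<..<b}|lborel. \<bar>x - y\<bar> powr p) \<le> (LINT x:{-?l..?l}|lborel. \<bar>x\<bar> powr p)" .
qed

lemma edge_integrable: "a \<le> b \<Longrightarrow> set_integrable lborel {a<..<b} (edge a b)"
  unfolding edge_def[abs_def] using powr_shift_integrable(1)[of "-1/2" a a b] powr_shift_integrable(1)[of "-1/2" a b b]
  by (intro set_integral_add) auto

lemma dom_integrable:
  assumes "a \<le> y" "y \<le> b"
  shows "set_integrable lborel {a<..<b} (dom a b y)"
    and "(LINT x:{a<..<b}|lborel. dom a b y x) \<le> 3 * (LINT x:{-(b-a)..b-a}|lborel. \<bar>x\<bar> powr (-3/4))"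
proof -
  have p: "-1 < (-3/4::real)" by simp
  note I = powr_shift_integrable[OF p]
  have i1: "set_integrable lborel {a<..<b} (\<lambda>x. \<bar>x - y\<bar> powr (-3/4))"
    "set_integrable lborel {a<..<b} (\<lambda>x. \<bar>x - a\<bar> powr (-3/4))"
    "set_integrable lborel {a<..<b} (\<lambda>x. \<bar>x - b\<bar> powr (-3/4))"
    by (rule I(1); use assms in simp)+
  show "set_integrable lborel {a<..<b} (dom a b y)"
    unfolding dom_def[abs_def] by (intro set_integral_add i1)
  have "(LINT x:{a<..<b}|lborel. dom a b y x) = (LINT x:{a<..<b}|lborel. \<bar>x - y\<bar> powr (-3/4))
    + (LINT x:{a<..<b}|lborel. \<bar>x - a\<bar> powr (-3/4)) + (LINT x:{a<..<b}|lborel. \<bar>x - b\<bar> powr (-3/4))"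
    using set_integral_add(2)[OF set_integral_add(1)[OF i1(1,2)] i1(3)] set_integral_add(2)[OF i1(1,2)]
    unfolding dom_def by simp
  also have "\<dots> \<le> 3 * (LINT x:{-(b-a)..b-a}|lborel. \<bar>x\<bar> powr (-3/4))"
    using I(2)[of a y b] I(2)[of a a b] I(2)[of a b b] assms by linarith
  finally show "(LINT x:{a<..<b}|lborel. dom a b y x) \<le> 3 * (LINT x:{-(b-a)..b-a}|lborel. \<bar>x\<bar> powr (-3/4))" .
qed

lemma ln_edge_le_dom:
  assumes "a < b"
  shows "\<exists>C>0. \<forall>y\<in>{a..b}. \<forall>x\<in>{a<..<b}. (1 + \<bar>ln \<bar>x - y\<bar>\<bar>) * edge a b x \<le> C * dom a b y x"
proof -
  define l where "l = b - a"
  have l: "l > 0" using assms by (simp add: l_def)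
  define C where "C = 4 + (1 + l) * l powr (1/4)"
  have C: "C > 0" using l by (simp add: C_def add_pos_nonneg)
  \<comment> \<open>As e is at most l, a constant may be multiplied by (l/e)^(1/4), which is at
    least 1, to reach the exponent needed in the majorant.\<close>
  have lq: "1 \<le> l powr (1/4) * e powr (-1/4)" if "0 < e" "e \<le> l" for e
  proof -
    have "l powr (-1/4) \<le> e powr (-1/4)" using that by (intro powr_mono2') auto
    then have "l powr (1/4) * l powr (-1/4) \<le> l powr (1/4) * e powr (-1/4)" by (intro mult_left_mono) auto
    then show ?thesis using l by (simp flip: powr_add)
  qed
  have key: "(1 + \<bar>ln d\<bar>) * e powr (-1/2) \<le> C * (d powr (-3/4) + e powr (-3/4))"
    if d: "0 \<le> d" "d \<le> l" and e: "0 < e" "e \<le> l" for d e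
  proof (cases "d = 0")
    \<comment> \<open>Here \<open>ln 0 = 0\<close> and \<open>0 powr _ = 0\<close>, so only the
      powers of e remain on both sides.\<close>
    case True
    have "e powr (-1/2) = 1 * e powr (-1/2)" by simp
    also have "\<dots> \<le> (l powr (1/4) * e powr (-1/4)) * e powr (-1/2)" by (rule mult_right_mono[OF lq[OF e]]) auto
    also have "\<dots> = l powr (1/4) * e powr (-3/4)" by (simp add: mult.assoc flip: powr_add)
    also have "\<dots> \<le> C * e powr (-3/4)" unfolding C_def using l by (intro mult_right_mono) (auto simp: algebra_simps)
    finally show ?thesis using True by simp
  next
    case False
    then have d0: "d > 0" using d by simp
    have "1 + \<bar>ln d\<bar> \<le> 4 * d powr (-1/4) + (1 + l)" using abs_ln_le[OF d0] d by linarith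
    also have "(1 + l) \<le> (1 + l) * (l powr (1/4) * d powr (-1/4))"
      using mult_left_mono[OF lq[OF d0 d(2)], of "1 + l"] l by simp
    finally have 1: "1 + \<bar>ln d\<bar> \<le> C * d powr (-1/4)" by (simp add: C_def algebra_simps)
    have 2: "d powr (-1/4) * e powr (-1/2) \<le> d powr (-3/4) + e powr (-3/4)"
    proof (cases "d \<le> e")
      case True
      then have "e powr (-1/2) \<le> d powr (-1/2)" using d0 by (intro powr_mono2') auto
      then have "d powr (-1/4) * e powr (-1/2) \<le> d powr (-1/4) * d powr (-1/2)" by (intro mult_left_mono) auto
      also have "\<dots> = d powr (-3/4)" by (simp flip: powr_add)
      finally show ?thesis using powr_ge_zero[of e "-3/4"] by linarith
    next
      case False
      then have "d powr (-1/4) \<le> e powr (-1/4)" using e by (intro powr_mono2') auto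
      then have "d powr (-1/4) * e powr (-1/2) \<le> e powr (-1/4) * e powr (-1/2)" by (intro mult_right_mono) auto
      also have "\<dots> = e powr (-3/4)" by (simp flip: powr_add)
      finally show ?thesis using powr_ge_zero[of d "-3/4"] by linarith
    qed
    have "(1 + \<bar>ln d\<bar>) * e powr (-1/2) \<le> (C * d powr (-1/4)) * e powr (-1/2)" by (rule mult_right_mono[OF 1]) auto
    also have "\<dots> = C * (d powr (-1/4) * e powr (-1/2))" by simp
    also have "\<dots> \<le> C * (d powr (-3/4) + e powr (-3/4))" by (rule mult_left_mono[OF 2]) (use C in auto)
    finally show ?thesis .
  qed
  have "(1 + \<bar>ln \<bar>x - y\<bar>\<bar>) * edge a b x \<le> (2 * C) * dom a b y x" if "y \<in> {a..b}" "x \<in> {a<..<b}" for x y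
  proof -
    have r: "0 \<le> \<bar>x - y\<bar>" "\<bar>x - y\<bar> \<le> l" "0 < \<bar>x - a\<bar>" "\<bar>x - a\<bar> \<le> l" "0 < \<bar>x - b\<bar>" "\<bar>x - b\<bar> \<le> l"
      using that by (auto simp: l_def)
    have "(1 + \<bar>ln \<bar>x - y\<bar>\<bar>) * edge a b x = (1 + \<bar>ln \<bar>x - y\<bar>\<bar>) * \<bar>x - a\<bar> powr (-1/2) + (1 + \<bar>ln \<bar>x - y\<bar>\<bar>) * \<bar>x - b\<bar> powr (-1/2)"
      by (simp add: edge_def distrib_left)
    also have "\<dots> \<le> C * (\<bar>x - y\<bar> powr (-3/4) + \<bar>x - a\<bar> powr (-3/4)) + C * (\<bar>x - y\<bar> powr (-3/4) + \<bar>x - b\<bar> powr (-3/4))"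
      by (intro add_mono key r)
    also have "\<dots> \<le> 2 * C * dom a b y x"
      using C by (simp add: dom_def distrib_left) 
    finally show ?thesis .
  qed
  then show ?thesis using C by (intro exI[of _ "2 * C"]) auto
qed

lemma set_integrable_mult_bounded:
  fixes f g :: "real \<Rightarrow> complex"
  assumes f: "set_integrable lborel S f" and g: "set_borel_measurable lborel S g"
    and K: "\<And>x. x \<in> S \<Longrightarrow> norm (g x) \<le> K"
  shows "set_integrable lborel S (\<lambda>x. g x * f x)"
proof -
  have fi: "integrable lborel (\<lambda>x. indicator S x *\<^sub>R f x)" using f by (simp add: set_integrable_def)
  have eq: "indicator S x *\<^sub>R (g x * f x) = (indicator S x *\<^sub>R g x) * (indicator S x *\<^sub>R f x)" for x
    by (simp add: indicator_def)
  show ?thesis unfolding set_integrable_def eq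
  proof (rule Bochner_Integration.integrable_bound[where f = "\<lambda>x. K * norm (indicator S x *\<^sub>R f x)"])
    show "integrable lborel (\<lambda>x. K * norm (indicator S x *\<^sub>R f x))" using fi by (intro integrable_mult_right integrable_norm)
    show "(\<lambda>x. indicator S x *\<^sub>R g x * indicator S x *\<^sub>R f x) \<in> borel_measurable lborel"
      by (rule borel_measurable_times[OF g[unfolded set_borel_measurable_def] borel_measurable_integrable[OF fi]])
    show "AE x in lborel. norm (indicator S x *\<^sub>R g x * indicator S x *\<^sub>R f x) \<le> norm (K * norm (indicator S x *\<^sub>R f x))"
    proof (rule AE_I2)
      fix x show "norm (indicator S x *\<^sub>R g x * indicator S x *\<^sub>R f x) \<le> norm (K * norm (indicator S x *\<^sub>R f x))"
        using K[of x] by (cases "x \<in> S") (auto simp: norm_mult abs_mult intro!: mult_right_mono)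
    qed
  qed
qed

text \<open>f' is differentiable and vanishes at p, hence |f' z| is at most K |z - p| nearby; the
  mean value inequality on the ball of radius |s - p| supplies the second factor |s - p|.\<close>

lemma double_zero_bound:
  fixes f :: "complex \<Rightarrow> complex"
  assumes "open S" "f holomorphic_on S" "p \<in> S" "deriv f p = 0"
  shows "\<exists>K>0. \<exists>d>0. \<forall>s\<in>ball p d. norm (f s - f p) \<le> K * norm (s - p)^2"
proof -
  have hd: "deriv f holomorphic_on S" using holomorphic_deriv assms by blast
  have "(deriv f has_field_derivative deriv (deriv f) p) (at p)"
    using holomorphic_derivI[OF hd assms(1,3)] .
  then obtain k where k: "\<And>z. deriv f z - deriv f p = k z * (z - p)" "isCont k p"
    unfolding CARAT_DERIV by blast
  obtain d1 where d1: "d1 > 0" "ball p d1 \<subseteq> S" using assms openE by blast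
  obtain d2 where d2: "d2 > 0" "\<And>z. dist z p < d2 \<Longrightarrow> dist (k z) (k p) < 1"
    using k(2) unfolding continuous_at_eps_delta by (metis zero_less_one)
  define d where "d = min d1 d2"
  define K where "K = norm (k p) + 1"
  have K: "K > 0" by (simp add: K_def add_nonneg_pos)
  have "norm (f s - f p) \<le> K * norm (s - p)^2" if s: "s \<in> ball p d" for s
  proof -
    have "norm (f s - f p) \<le> (K * norm (s - p)) * norm (s - p)"
    proof (rule field_differentiable_bound[where S = "cball p (norm (s - p))" and f' = "deriv f"])
      fix z assume z: "z \<in> cball p (norm (s - p))"
      then have zs: "z \<in> ball p d" using s by (auto simp: dist_norm norm_minus_commute)
      then have "z \<in> S" using d1 by (auto simp: d_def)
      then show "(f has_field_derivative deriv f z) (at z within cball p (norm (s - p)))"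
        using holomorphic_derivI[OF assms(2,1)] has_field_derivative_at_within by blast
      have "dist (k z) (k p) < 1" using zs d2(2)[of z] by (auto simp: d_def dist_commute)
      then have "norm (k z) \<le> K" using norm_triangle_ineq2[of "k z" "k p"] by (auto simp: K_def dist_norm)
      then have "norm (k z) * norm (z - p) \<le> K * norm (s - p)"
        using z K by (intro mult_mono) (auto simp: dist_norm norm_minus_commute)
      then show "norm (deriv f z) \<le> K * norm (s - p)"
        using k(1)[of z] assms(4) by (simp add: norm_mult)
    qed (auto simp: dist_norm norm_minus_commute)
    then show ?thesis by (simp add: power2_eq_square mult.assoc)
  qed
  then show ?thesis using K d1(1) d2(1) by (intro exI[of _ K] conjI exI[of _ d]) (auto simp: d_def)
qed

section \<open>The logarithmic derivative of J\<close>

context jmap begin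

definition slit :: "complex set" where "slit = {s. (s + 1) / s \<notin> \<real>\<^sub>\<le>\<^sub>0}"

lemma slit_eq: "slit = {s. Im s \<noteq> 0 \<or> Re s < -1 \<or> Re s > 0}"
proof -
  have "s \<in> slit \<longleftrightarrow> Re s < -1 \<or> Re s > 0" if "Im s = 0" for s
  proof -
    have s: "s = of_real (Re s)" using that by (simp add: complex_eq_iff)
    show ?thesis
    proof
      assume "Re s < -1 \<or> Re s > 0" then show "s \<in> slit" using off_cut_real[of "Re s"] s by (simp add: slit_def)
    next
      assume sl: "s \<in> slit"
      show "Re s < -1 \<or> Re s > 0"
      proof (rule ccontr)
        assume n: "\<not> ?thesis"
        have "(s + 1) / s = of_real ((Re s + 1) / Re s)" by (subst (1 2) s) simp
        moreover have "(Re s + 1) / Re s \<le> 0" using n by (auto simp: divide_le_0_iff)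
        ultimately show False using sl by (simp add: slit_def complex_nonpos_Reals_iff)
      qed
    qed
  qed
  then show ?thesis using off_cut_upper by (auto simp: slit_def)
qed

lemma open_slit: "open slit"
  unfolding slit_eq by (intro open_Collect_disj open_Collect_neq open_Collect_less continuous_intros)

lemma J_holomorphic: "J holomorphic_on slit"
  unfolding holomorphic_on_open[OF open_slit] using J_has_derivative by (auto simp: slit_def)

definition qf :: "complex \<Rightarrow> complex" where
  "qf s = s * (s + 1) * (s + of_real c) / ((s - of_real sa) * (s - of_real sb))"

lemma deriv_J_qf:
  assumes "s \<in> slit" "s \<noteq> - of_real c" "s \<noteq> of_real sa" "s \<noteq> of_real sb"
  shows "(J has_field_derivative J s / qf s) (at s)" "J s \<noteq> 0" "qf s \<noteq> 0"
proof -
  have s1: "s \<noteq> 0" "s + 1 \<noteq> 0" using assms(1) unfolding slit_def by auto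
  have s2: "s + of_real c \<noteq> 0" using assms(2) by (simp add: eq_neg_iff_add_eq_0)
  note s = s1 s2
  show "qf s \<noteq> 0" using s assms by (simp add: qf_def)
  have Jeq: "J s = of_real c1 * (s + of_real c) * ((s + 1) / s) powr of_real (1 / \<theta>)"
    unfolding Jt_def using c1 by (simp add: distrib_left c0_eq flip: of_real_mult)
  show "J s \<noteq> 0" unfolding Jeq using s c1 by simp
  have "J s / qf s = of_real c1 * ((s + 1) / s) powr (of_real (1 / \<theta>)) *
     ((s - of_real sa) * (s - of_real sb)) / (s * (s + 1))"
  proof -
    have "C * W * R / (u * W / D) = C * R * D / u" if "W \<noteq> 0" for C W R u D :: complex
      using that by simp
    then show ?thesis unfolding Jeq qf_def using s by blast
  qed
  then show "(J has_field_derivative J s / qf s) (at s)" using J_has_derivative[of s] assms(1) by (simp add: slit_def)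
qed

lemma deriv_J_crit: "deriv J (of_real sa) = 0" "deriv J (of_real sb) = 0"
  using J_has_derivative[OF off_cut_real, of sa] J_has_derivative[OF off_cut_real, of sb] sa_less sb_pos
  by (auto intro!: DERIV_imp_deriv)

end

section \<open>The upper arc parametrised by x = J(s)\<close>

locale jcurve = jmap +
  assumes Jab: "J_a \<theta> c0 c1 < J_b \<theta> c0 c1"
begin

abbreviation "a \<equiv> J_a \<theta> c0 c1"
abbreviation "b \<equiv> J_b \<theta> c0 c1"
abbreviation "I \<equiv> Iplus \<theta> c0 c1"

lemma I_is: "is_Iplus \<theta> c0 c1 I"
  unfolding Iplus_def by (rule someI_ex[OF is_Iplus_exists[OF Jab]])

lemma I_cont: "continuous_on {a..b} I" and I_a: "I a = of_real sa" and I_b: "I b = of_real sb"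
  and I_upper: "x \<in> {a<..<b} \<Longrightarrow> Im (I x) > 0" and J_I: "x \<in> {a<..<b} \<Longrightarrow> J (I x) = of_real x"
  using I_is by (auto simp: is_Iplus_def)

lemma a_pos: "0 < a" using J_a_pos .

lemma I_radius: "x \<in> {a<..<b} \<Longrightarrow> wa < cmod (I x + of_real c)" "x \<in> {a<..<b} \<Longrightarrow> cmod (I x + of_real c) < wb"
  using curve_radius[of "I x"] I_upper[of x] J_I[of x] by auto

text \<open>This is 1 / J' at I x, since J' = J / q and J (I x) = x.\<close>

definition I' :: "real \<Rightarrow> complex" where "I' x = qf (I x) / of_real x"

lemma I_ne: assumes "x \<in> {a<..<b}" shows "I x \<noteq> of_real r"
  using I_upper[OF assms] by auto

lemma I_slit: "x \<in> {a<..<b} \<Longrightarrow> I x \<in> slit" using I_upper[of x] by (auto simp: slit_eq)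

lemma I_has_deriv:
  assumes x: "x \<in> {a<..<b}" shows "(I has_vector_derivative I' x) (at x)"
proof -
  have x0: "x > 0" using x a_pos by auto
  have nn: "I x \<noteq> - of_real c" using I_ne[OF x, of "-c"] by simp
  note D = deriv_J_qf[OF I_slit[OF x] nn I_ne[OF x] I_ne[OF x]]
  have "(I has_vector_derivative (1 / (J (I x) / qf (I x)))) (at x)"
  proof (rule has_vector_derivative_implicit[where g = J and h = complex_of_real])
    show "isCont I x" by (rule continuous_on_interior[OF I_cont]) (use x in auto)
    show "(complex_of_real has_vector_derivative 1) (at x)"
      using has_vector_derivative_of_real[OF DERIV_ident] by simp
    have "\<forall>\<^sub>F y in at x. y \<in> {a<..<b}" by (rule eventually_at_in_open') (use x in auto)
    then show "\<forall>\<^sub>F y in at x. J (I y) = of_real y" by eventually_elim (rule J_I)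
  qed (use D J_I[OF x] in auto)
  then show ?thesis using J_I[OF x] by (simp add: I'_def)
qed

text \<open>Near p this is the double zero of J - J(p). The second entry of \<open>M\<close> covers
  the arc away from p, where |I x - p| is at least d while the left side is at most b - a.\<close>

lemma critical_bound:
  assumes p: "p = sa \<or> p = sb"
  shows "\<exists>K>0. \<forall>x\<in>{a<..<b}. \<bar>x - jr p\<bar> \<le> K * cmod (I x - of_real p)^2"
proof -
  have ps: "of_real p \<in> slit" and Jp: "J (of_real p) = of_real (jr p)"
    using p sa_less sb_pos J_of_real[of p] by (auto simp: slit_eq)
  have pab: "jr p \<in> {a..b}" using p Jab by (auto simp: J_a_eq J_b_eq)
  obtain K d where K: "K > 0" "d > 0" "\<And>s. s \<in> ball (of_real p) d \<Longrightarrow> norm (J s - J (of_real p)) \<le> K * norm (s - of_real p)^2"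
    using double_zero_bound[OF open_slit J_holomorphic ps] deriv_J_crit p by blast
  define M where "M = max K ((b - a) / d^2)"
  have "\<bar>x - jr p\<bar> \<le> M * cmod (I x - of_real p)^2" if x: "x \<in> {a<..<b}" for x
  proof (cases "I x \<in> ball (of_real p) d")
    case True
    have "\<bar>x - jr p\<bar> = norm (J (I x) - J (of_real p))"
      unfolding J_I[OF x] Jp by (metis of_real_diff norm_of_real)
    also have "\<dots> \<le> K * norm (I x - of_real p)^2" using K(3)[OF True] .
    also have "\<dots> \<le> M * norm (I x - of_real p)^2" by (intro mult_right_mono) (auto simp: M_def)
    finally show ?thesis .
  next
    case False
    then have "d^2 \<le> cmod (I x - of_real p)^2" using K(2) by (intro power_mono) (auto simp: dist_norm norm_minus_commute)
    have "\<bar>x - jr p\<bar> \<le> b - a" using x pab by auto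
    also have "\<dots> = ((b - a) / d^2) * d^2" using K(2) by simp
    also have "\<dots> \<le> ((b - a) / d^2) * cmod (I x - of_real p)^2"
      using \<open>d^2 \<le> _\<close> Jab by (intro mult_left_mono) auto
    also have "\<dots> \<le> M * cmod (I x - of_real p)^2" by (intro mult_right_mono) (auto simp: M_def)
    finally show ?thesis .
  qed
  moreover have "M > 0" using K(1) by (simp add: M_def)
  ultimately show ?thesis by blast
qed

lemma inverse_critical_bound:
  assumes p: "p = sa \<or> p = sb"
  shows "\<exists>K>0. \<forall>x\<in>{a<..<b}. 1 / cmod (I x - of_real p) \<le> K * \<bar>x - jr p\<bar> powr (-1/2)"
proof -
  obtain K where K: "K > 0" "\<And>x. x \<in> {a<..<b} \<Longrightarrow> \<bar>x - jr p\<bar> \<le> K * cmod (I x - of_real p)^2"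
    using critical_bound[OF p] by blast
  have "1 / cmod (I x - of_real p) \<le> sqrt K * \<bar>x - jr p\<bar> powr (-1/2)" if x: "x \<in> {a<..<b}" for x
  proof -
    have d: "\<bar>x - jr p\<bar> > 0" using x p by (auto simp: J_a_eq J_b_eq)
    have n: "cmod (I x - of_real p) > 0" using I_ne[OF x] by simp
    have "sqrt \<bar>x - jr p\<bar> \<le> sqrt (K * cmod (I x - of_real p)^2)" using K(2)[OF x] by (rule real_sqrt_le_mono)
    also have "\<dots> = sqrt K * cmod (I x - of_real p)" by (simp add: real_sqrt_mult)
    finally have "1 / cmod (I x - of_real p) \<le> sqrt K / sqrt \<bar>x - jr p\<bar>" using d n by (simp add: field_simps)
    also have "\<dots> = sqrt K * \<bar>x - jr p\<bar> powr (-1/2)" using d by (simp add: powr_minus_divide powr_half_sqrt)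
    finally show ?thesis .
  qed
  then show ?thesis using K(1) by (intro exI[of _ "sqrt K"]) auto
qed

lemma inverse_edge_bound:
  assumes p: "p = sa \<or> p = sb"
  shows "\<exists>K>0. \<forall>x\<in>{a<..<b}. 1 / cmod (I x - of_real p) \<le> K * edge a b x"
proof -
  obtain K where K: "K > 0" "\<And>x. x \<in> {a<..<b} \<Longrightarrow> 1 / cmod (I x - of_real p) \<le> K * \<bar>x - jr p\<bar> powr (-1/2)"
    using inverse_critical_bound[OF p] by blast
  have "\<bar>x - jr p\<bar> powr (-1/2) \<le> edge a b x" for x using p by (auto simp: edge_def J_a_eq J_b_eq)
  then have "1 / cmod (I x - of_real p) \<le> K * edge a b x" if "x \<in> {a<..<b}" for x
    using K(2)[OF that] K(1) by (meson less_imp_le mult_left_mono order_trans)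
  then show ?thesis using K(1) by blast
qed

text \<open>Partial fractions separate the two poles of q, and each is bounded by
  \<open>edge\<close>; the factors of the numerator are bounded because the curve lies within
  distance \<open>wb\<close> of - c.\<close>

lemma I'_bound: "\<exists>K>0. \<forall>x\<in>{a<..<b}. cmod (I' x) \<le> K * edge a b x"
proof -
  obtain Ka where Ka: "Ka > 0" "\<And>x. x \<in> {a<..<b} \<Longrightarrow> 1 / cmod (I x - of_real sa) \<le> Ka * edge a b x"
    using inverse_edge_bound[of sa] by blast
  obtain Kb where Kb: "Kb > 0" "\<And>x. x \<in> {a<..<b} \<Longrightarrow> 1 / cmod (I x - of_real sb) \<le> Kb * edge a b x"
    using inverse_edge_bound[of sb] by blast
  define M where "M = (wb + c) * (wb + c + 1) * wb"
  have M: "M > 0" using wa_pos wab c_gt_1 unfolding M_def by (intro mult_pos_pos) auto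
  define K where "K = M / a / (sb - sa) * (Ka + Kb)"
  have Kp: "K > 0" using M a_pos sab Ka(1) Kb(1) by (simp add: K_def)
  have "cmod (I' x) \<le> K * edge a b x" if x: "x \<in> {a<..<b}" for x
  proof -
    define t where "t = I x"
    have ne: "t - of_real sa \<noteq> 0" "t - of_real sb \<noteq> 0" using I_ne[OF x] by (auto simp: t_def)
    have tc: "cmod (t + of_real c) \<le> wb" using I_radius[OF x] by (simp add: t_def)
    have t0: "cmod t \<le> wb + c"
      using norm_triangle_ineq4[of "t + of_real c" "of_real c"] tc c_gt_1 by simp
    have t1: "cmod (t + 1) \<le> wb + c + 1" using norm_triangle_ineq[of t 1] t0 by simp
    have num: "cmod t * cmod (t + 1) * cmod (t + of_real c) \<le> M"
      unfolding M_def using t0 t1 tc wa_pos wab c_gt_1 by (intro mult_mono) auto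
    have "1 / ((t - of_real sa) * (t - of_real sb)) = (1 / (t - of_real sb) - 1 / (t - of_real sa)) / of_real (sb - sa)"
    proof -
      have "1 / B - 1 / A = (A - B) / (A * B)" if "A \<noteq> 0" "B \<noteq> 0" for A B :: complex
        using that by (simp add: field_simps)
      from this[OF ne] have "1 / (t - of_real sb) - 1 / (t - of_real sa) = of_real (sb - sa) / ((t - of_real sa) * (t - of_real sb))"
        by simp
      then show ?thesis using sab by simp
    qed
    then have "cmod (1 / ((t - of_real sa) * (t - of_real sb))) = cmod (1 / (t - of_real sb) - 1 / (t - of_real sa)) / (sb - sa)"
      using sab by (metis norm_divide norm_of_real abs_of_pos diff_gt_0_iff_gt)
    also have "\<dots> \<le> (1 / cmod (t - of_real sb) + 1 / cmod (t - of_real sa)) / (sb - sa)"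
      using sab norm_triangle_ineq4[of "1 / (t - of_real sb)" "1 / (t - of_real sa)"]
      by (intro divide_right_mono) (auto simp: norm_divide)
    also have "\<dots> \<le> (Kb * edge a b x + Ka * edge a b x) / (sb - sa)"
      using Ka(2)[OF x] Kb(2)[OF x] sab by (intro divide_right_mono add_mono) (auto simp: t_def)
    finally have den: "cmod (1 / ((t - of_real sa) * (t - of_real sb))) \<le> (Ka + Kb) * edge a b x / (sb - sa)"
      by (simp add: algebra_simps)
    have "cmod (I' x) = (cmod t * cmod (t + 1) * cmod (t + of_real c)) * cmod (1 / ((t - of_real sa) * (t - of_real sb))) / x"
      using x a_pos by (simp add: I'_def qf_def t_def norm_mult norm_divide)
    also have "\<dots> \<le> M * ((Ka + Kb) * edge a b x / (sb - sa)) / a"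
      using x a_pos M edge_nonneg[of a b x] Ka(1) Kb(1) sab
      by (intro frac_le mult_mono num den mult_nonneg_nonneg divide_nonneg_nonneg) auto
    also have "\<dots> = K * edge a b x" by (simp add: K_def mult_ac)
    finally show ?thesis .
  qed
  then show ?thesis using Kp by blast
qed

lemma qf_continuous: "continuous_on (- {of_real sa, of_real sb}) qf"
  unfolding qf_def by (intro continuous_intros) auto

lemma I'_cont: "continuous_on {a<..<b} I'"
proof -
  have "continuous_on {a<..<b} (\<lambda>x. qf (I x))"
    by (rule continuous_on_compose2[OF qf_continuous continuous_on_subset[OF I_cont]]) (use I_ne in auto)
  then show ?thesis unfolding I'_def using a_pos by (intro continuous_intros) auto
qed

lemma I'_integrable: "set_integrable lborel {a<..<b} I'"
proof -
  obtain K where K: "K > 0" "\<And>x. x \<in> {a<..<b} \<Longrightarrow> cmod (I' x) \<le> K * edge a b x" using I'_bound by blast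
  have "set_integrable lborel {a<..<b} (\<lambda>x. K * edge a b x)"
    using edge_integrable[of a b] Jab by (simp add: set_integrable_mult_right)
  then show ?thesis
  proof (rule set_integrable_bound)
    show "set_borel_measurable lborel {a<..<b} I'"
      unfolding set_borel_measurable_def
      using borel_measurable_continuous_on_indicator[OF _ I'_cont] by simp
  qed (use K edge_nonneg[of a b] in \<open>auto intro!: AE_I2\<close>)
qed

lemma continuous_times_I'_integrable:
  assumes "continuous_on {a..b} g" shows "set_integrable lborel {a<..<b} (\<lambda>x. g x * I' x)"
proof -
  have "bounded (g ` {a..b})" using compact_continuous_image[OF assms] compact_imp_bounded by blast
  then obtain K where K: "\<And>x. x \<in> {a..b} \<Longrightarrow> norm (g x) \<le> K" unfolding bounded_iff by blast
  have "set_borel_measurable lborel {a<..<b} g"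
    unfolding set_borel_measurable_def
    using borel_measurable_continuous_on_indicator[OF _ continuous_on_subset[OF assms, of "{a<..<b}"]] by force
  then show ?thesis by (rule set_integrable_mult_bounded[OF I'_integrable, where K = K]) (use K in auto)
qed

end

section \<open>Cauchy integrals over the curve\<close>

lemma set_LINT_of_has_integral_Icc:
  fixes f :: "real \<Rightarrow> complex"
  assumes "set_integrable lborel {l<..<u} f" "(f has_integral v) {l..u}"
  shows "(LINT x:{l<..<u}|lborel. f x) = v"
  using set_borel_integral_eq_integral(2)[OF assms(1)] assms(2)
  by (simp add: has_integral_Icc_iff_Ioo integral_unique)

lemma set_LINT_Icc_of_has_integral:
  fixes f :: "real \<Rightarrow> complex"
  assumes "continuous_on {l..u} f" "(f has_integral v) {l..u}"
  shows "set_integrable lborel {l..u} f" "(LINT x:{l..u}|lborel. f x) = v"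
  using set_borel_integral_eq_integral(2)[OF borel_integrable_atLeastAtMost'[OF assms(1)]] assms
  by (simp_all add: integral_unique borel_integrable_atLeastAtMost')

context jcurve begin

lemma shifted_I_off_cut:
  assumes "x \<in> {a..b}" shows "I x + of_real c \<notin> \<real>\<^sub>\<le>\<^sub>0"
proof -
  consider "x \<in> {a<..<b}" | "x = a" | "x = b" using assms by fastforce
  then show ?thesis
  proof cases
    case 1 then show ?thesis using I_upper[OF 1] by (auto simp: complex_nonpos_Reals_iff)
  next
    case 2 then show ?thesis using wa_pos by (auto simp: I_a complex_nonpos_Reals_iff)
  next
    case 3 then show ?thesis using wa_pos wab by (auto simp: I_b complex_nonpos_Reals_iff)
  qed
qed

text \<open>F is a primitive in the coordinate z = ln (s + c), and the factor s + c is ds/dz. The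
  ends of the arc are real and correspond to z = ln \<open>wa\<close> and z = ln
  \<open>wb\<close>.\<close>

lemma curve_primitive:
  assumes F: "\<And>x. x \<in> {a..b} \<Longrightarrow> (F has_field_derivative f (I x) * (I x + of_real c)) (at (Ln (I x + of_real c)))"
  shows "((\<lambda>x. f (I x) * I' x) has_integral F (of_real (ln wb)) - F (of_real (ln wa))) {a..b}"
proof -
  define G where "G x = F (Ln (I x + of_real c))" for x
  have ends: "G a = F (of_real (ln wa))" "G b = F (of_real (ln wb))"
    using wa_pos wab by (simp_all add: G_def I_a I_b Ln_of_real flip: of_real_add)
  have cL: "continuous_on {a..b} (\<lambda>x. Ln (I x + of_real c))"
    by (intro continuous_intros I_cont) (use shifted_I_off_cut in auto)
  have "continuous_on {a..b} G" unfolding G_def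
  proof (rule continuous_on_compose2[OF _ cL])
    show "continuous_on ((\<lambda>x. Ln (I x + of_real c)) ` {a..b}) F"
      by (rule continuous_at_imp_continuous_on) (use F DERIV_isCont in blast)
  qed auto
  moreover have "(G has_vector_derivative f (I x) * I' x) (at x)" if x: "x \<in> {a<..<b}" for x
  proof -
    have xx: "x \<in> {a..b}" using x by auto
    have ne: "I x + of_real c \<noteq> 0" using shifted_I_off_cut[OF xx] by auto
    have L: "((\<lambda>z. Ln (z + of_real c)) has_field_derivative inverse (I x + of_real c)) (at (I x))"
      using shifted_I_off_cut[OF xx] by (auto intro!: derivative_eq_intros simp: divide_inverse)
    from DERIV_chain2[where f = F and g = "\<lambda>z. Ln (z + of_real c)", OF F[OF xx] L]
    have "((\<lambda>z. F (Ln (z + of_real c))) has_field_derivative f (I x)) (at (I x))"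
      using ne by (simp add: mult.assoc)
    from field_vector_diff_chain_at[OF I_has_deriv[OF x] this]
    show ?thesis by (simp add: o_def G_def[abs_def] mult.commute)
  qed
  ultimately have "((\<lambda>x. f (I x) * I' x) has_integral G b - G a) {a..b}"
    using Jab by (intro fundamental_theorem_of_calculus_interior) auto
  then show ?thesis by (simp add: ends)
qed

lemma real_primitive:
  fixes F f :: "complex \<Rightarrow> complex"
  assumes "0 < l" "l \<le> u"
    and F: "\<And>w. w \<in> {l..u} \<Longrightarrow> (F has_field_derivative f (of_real (w - c)) * of_real w) (at (of_real (ln w)))"
  shows "((\<lambda>x. f (of_real x)) has_integral F (of_real (ln u)) - F (of_real (ln l))) {l - c..u - c}"
proof -
  have "((\<lambda>x. F (of_real (ln (x + c)))) has_vector_derivative f (of_real x)) (at x within {l-c..u-c})"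
    if x: "x \<in> {l-c..u-c}" for x
  proof -
    have w: "x + c \<in> {l..u}" "x + c > 0" using x assms(1) by auto
    have "((\<lambda>x. ln (x + c)) has_real_derivative inverse (x + c)) (at x)"
      using w by (auto intro!: derivative_eq_intros simp: divide_inverse)
    then have *: "((\<lambda>x. complex_of_real (ln (x + c))) has_vector_derivative of_real (inverse (x + c))) (at x)"
      by (rule has_vector_derivative_of_real)
    have "((\<lambda>x. F (of_real (ln (x + c)))) has_vector_derivative f (of_real x)) (at x)"
    proof -
      have "x + c \<noteq> 0" using w(2) by linarith
      then have "of_real (inverse (x + c)) * of_real (x + c) = (1::complex)"
        by (simp only: of_real_mult[symmetric]) (simp add: field_simps)
      then have "of_real (inverse (x + c)) * (f (of_real (x + c - c)) * of_real (x + c)) = f (of_real x)"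
        by (simp add: mult.left_commute[of _ "f _"])
      then show ?thesis using field_vector_diff_chain_at[OF *  F[OF w(1)]] unfolding o_def by (simp only:)
    qed
    then show ?thesis by (rule has_vector_derivative_at_within)
  qed
  then have "((\<lambda>x. f (of_real x)) has_integral F (of_real (ln (u - c + c))) - F (of_real (ln (l - c + c)))) {l - c..u - c}"
    using assms(2) by (intro fundamental_theorem_of_calculus) auto
  then show ?thesis by simp
qed

text \<open>Points left of - c are placed on the line Im z = pi, and moving to the right on the axis
  decreases the distance to - c; this exchanges the two limits.\<close>

lemma real_primitive_neg:
  fixes F f :: "complex \<Rightarrow> complex"
  assumes "0 < l" "l \<le> u"
    and F: "\<And>w. w \<in> {l..u} \<Longrightarrow> (F has_field_derivative f (of_real (- w - c)) * of_real (- w)) (at (Complex (ln w) pi))"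
  shows "((\<lambda>x. f (of_real x)) has_integral F (Complex (ln l) pi) - F (Complex (ln u) pi)) {- u - c..- l - c}"
proof -
  have "((\<lambda>x. F (Complex (ln (- x - c)) pi)) has_vector_derivative f (of_real x)) (at x within {-u-c..-l-c})"
    if x: "x \<in> {-u-c..-l-c}" for x
  proof -
    have w: "- x - c \<in> {l..u}" "- x - c > 0" using x assms(1) by auto
    have "((\<lambda>x. ln (- x - c)) has_real_derivative inverse (x + c)) (at x)"
      using w by (auto intro!: derivative_eq_intros simp: divide_inverse) (simp add: field_simps)
    then have "((\<lambda>x. complex_of_real (ln (- x - c))) has_vector_derivative of_real (inverse (x + c))) (at x)"
      by (rule has_vector_derivative_of_real)
    then have "((\<lambda>x. Complex (ln (- x - c)) pi) has_vector_derivative of_real (inverse (x + c))) (at x)"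
      unfolding Complex_eq by (simp add: has_vector_derivative_add_const)
    from field_vector_diff_chain_at[OF this F[OF w(1)]]
    have "((\<lambda>x. F (Complex (ln (- x - c)) pi)) has_vector_derivative 
        of_real (inverse (x + c)) * (f (of_real (- (- x - c) - c)) * of_real (- (- x - c)))) (at x)"
      by (simp add: o_def)
    also have "of_real (inverse (x + c)) * (f (of_real (- (- x - c) - c)) * of_real (- (- x - c))) = f (of_real x)"
    proof -
      have "x + c \<noteq> 0" using w(2) by linarith
      then have "of_real (inverse (x + c)) * of_real (- (- x - c)) = (1::complex)"
        by (simp only: of_real_mult[symmetric] minus_diff_eq minus_minus) (simp add: field_simps)
      then show ?thesis by (simp add: mult.left_commute[of _ "f _"])
    qed
    finally show ?thesis by (rule has_vector_derivative_at_within)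
  qed
  then have "((\<lambda>x. f (of_real x)) has_integral F (Complex (ln (- (- l - c) - c)) pi) - F (Complex (ln (- (- u - c) - c)) pi)) {- u - c..- l - c}"
    using assms(2) by (intro fundamental_theorem_of_calculus) auto
  then show ?thesis by simp
qed

text \<open>The part of the closed upper half-plane enclosed by the curve; \<open>Dout\<close> is
  the other part. Both contain the arc itself, and on the real axis they meet at the critical
  points.\<close>

definition Din :: "complex set" where
  "Din = {s. (Im s > 0 \<and> Im (J s) \<le> 0) \<or> (Im s = 0 \<and> sa \<le> Re s \<and> Re s \<le> sb)}"

definition Dout :: "complex set" where
  "Dout = {s. (Im s > 0 \<and> Im (J s) \<ge> 0) \<or> (Im s = 0 \<and> (Re s \<le> sa \<or> sb \<le> Re s))}"

lemma I_in_D: assumes "x \<in> {a..b}" shows "I x \<in> Din" "I x \<in> Dout"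
proof -
  consider "x \<in> {a<..<b}" | "x = a" | "x = b" using assms by fastforce
  then have "I x \<in> Din \<and> I x \<in> Dout"
    using I_upper[of x] J_I[of x] sab by cases (auto simp: Din_def Dout_def I_a I_b)
  then show "I x \<in> Din" "I x \<in> Dout" by auto
qed

lemma Din_of_real: "of_real x \<in> Din \<longleftrightarrow> sa \<le> x \<and> x \<le> sb"
  and Dout_of_real: "of_real x \<in> Dout \<longleftrightarrow> x \<le> sa \<or> sb \<le> x"
  by (simp_all add: Din_def Dout_def)

lemma exp_shift_bottom: "Im z = 0 \<Longrightarrow> exp z - of_real c = of_real (exp (Re z) - c)"
  and exp_shift_top: "Im z = pi \<Longrightarrow> exp z - of_real c = of_real (- exp (Re z) - c)"
  by (simp_all add: exp_eq_polar[of z] cis.ctr complex_eq_iff)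

lemma exp_rcis: "exp z = rcis (exp (Re z)) (Im z)"
  by (simp add: rcis_def cis_conv_exp exp_eq_polar[of z])

lemma Ln_curve: assumes "x \<in> {a..b}" 
  shows "0 \<le> Im (Ln (I x + of_real c))" "Im (Ln (I x + of_real c)) < pi"
    "exp (Ln (I x + of_real c)) = I x + of_real c"
proof -
  have ne: "I x + of_real c \<noteq> 0" using shifted_I_off_cut[OF assms] by auto
  then show "exp (Ln (I x + of_real c)) = I x + of_real c" by simp
  have "Im (I x + of_real c) \<ge> 0" using I_in_D(1)[OF assms] by (auto simp: Din_def)
  then show "0 \<le> Im (Ln (I x + of_real c))" using Im_Ln_pos_le[OF ne] by blast
  show "Im (Ln (I x + of_real c)) < pi" using Im_Ln_less_pi[OF shifted_I_off_cut[OF assms]] .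
qed

lemma segment_to_horizontal:
  assumes "w \<in> closed_segment z (Complex (Re z) h)"
  shows "Re w = Re z" "min (Im z) h \<le> Im w" "Im w \<le> max (Im z) h"
proof -
  obtain t where t: "0 \<le> t" "t \<le> 1" "w = (1 - t) *\<^sub>R z + t *\<^sub>R Complex (Re z) h"
    using assms unfolding closed_segment_def by auto
  show "Re w = Re z" unfolding t(3) by (simp add: algebra_simps)
  have i: "Im w = (1 - t) * Im z + t * h" unfolding t(3) by simp
  have "Im w \<in> closed_segment (Im z) h" unfolding i closed_segment_def using t by auto
  then show "min (Im z) h \<le> Im w" "Im w \<le> max (Im z) h"
    by (auto simp: closed_segment_eq_real_ivl split: if_splits)
qed

lemma segment_horizontal:
  assumes "w \<in> closed_segment (Complex p h) (Complex q h)"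
  shows "Im w = h" "min p q \<le> Re w" "Re w \<le> max p q"
proof -
  obtain t where t: "0 \<le> t" "t \<le> 1" "w = (1 - t) *\<^sub>R Complex p h + t *\<^sub>R Complex q h"
    using assms unfolding closed_segment_def by auto
  show "Im w = h" unfolding t(3) by (simp add: algebra_simps)
  have i: "Re w = (1 - t) * p + t * q" unfolding t(3) by simp
  have "Re w \<in> closed_segment p q" unfolding i closed_segment_def using t by auto
  then show "min p q \<le> Re w" "Re w \<le> max p q"
    by (auto simp: closed_segment_eq_real_ivl split: if_splits)
qed

text \<open>Cauchy's theorem for the region between the arc and the segment from \<open>sa\<close>
  to \<open>sb\<close>. In the coordinate z the region is reached vertically from the line Im z = 0,
  since lowering the angle keeps Im J negative; so f ds has a primitive there, and both integrals
  are its difference between the same two ends.\<close>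

lemma cauchy_in:
  assumes U: "open U" "f holomorphic_on U" "Din \<subseteq> U"
  shows "(LINT x:{a<..<b}|lborel. f (I x) * I' x) = (LINT x:{sa<..<sb}|lborel. f (of_real x))"
proof -
  define S where "S = {z. exp z - of_real c \<in> U}"
  define fh where "fh z = f (exp z - of_real c) * exp z" for z
  have "open S" unfolding S_def using open_vimage[OF U(1), of "\<lambda>z. exp z - of_real c"]
    by (simp add: vimage_def continuous_intros)
  have "f \<circ> (\<lambda>z. exp z - of_real c) holomorphic_on S"
    by (rule holomorphic_on_compose_gen[OF _ U(2)]) (auto simp: S_def intro!: holomorphic_intros)
  then have fh: "fh holomorphic_on S" unfolding fh_def by (auto simp: o_def intro!: holomorphic_intros)
  define T where "T = {z. 0 \<le> Im z \<and> Im z < pi \<and> exp z - of_real c \<in> Din}"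
  \<comment> \<open>The inside lies in the annulus, so the part of the base line below it stays
    between ln \<open>wa\<close> and ln \<open>wb\<close>, that is, inside.\<close>
  have rad: "wa \<le> exp (Re z) \<and> exp (Re z) \<le> wb" if z: "z \<in> T" for z
  proof (cases "Im z = 0")
    case True
    then show ?thesis using z exp_shift_bottom[OF True] by (simp add: T_def Din_of_real del: of_real_diff)
  next
    case False
    then have v: "0 < Im z" "Im z < pi" using z by (auto simp: T_def)
    have "Im (exp z - of_real c) > 0"
      using rcis_upper[of "exp (Re z)" "Im z"] v by (simp add: exp_rcis[of z])
    then have "Im (J (exp z - of_real c)) \<le> 0" using z by (auto simp: T_def Din_def)
    from curve_radius[OF \<open>Im (exp z - of_real c) > 0\<close> this] show ?thesis by simp
  qed
  have base: "z \<in> S" if "Im z = 0" "wa \<le> exp (Re z)" "exp (Re z) \<le> wb" for z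
  proof -
    have "exp z - of_real c \<in> Din" using that exp_shift_bottom[OF that(1)] by (simp add: Din_of_real del: of_real_diff)
    then show ?thesis using U(3) by (auto simp: S_def)
  qed
  obtain F where F: "\<And>z. z \<in> T \<Longrightarrow> (F has_field_derivative fh z) (at z)"
  proof (rule primitive_on_vertical_star[OF \<open>open S\<close> fh, of T 0 "ln wa"])
    fix z assume z: "z \<in> T"
    show "closed_segment z (Complex (Re z) 0) \<subseteq> S"
    proof
      fix w assume "w \<in> closed_segment z (Complex (Re z) 0)"
      note w = segment_to_horizontal[OF this]
      have Imw: "0 \<le> Im w" "Im w \<le> Im z" using w z by (auto simp: T_def)
      consider "Im w = 0" | "Im w = Im z" | "0 < Im w \<and> Im w < Im z" using Imw by linarith
      then show "w \<in> S"
      proof cases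
        case 1 then show ?thesis using base[of w] rad[OF z] w(1) by auto
      next
        case 2 then have "w = z" using w(1) by (simp add: complex_eq_iff)
        then show ?thesis using z U(3) by (auto simp: T_def S_def)
      next
        case 3
        have v: "0 < Im z" "Im z < pi" using 3 z by (auto simp: T_def)
        have "Im (exp z - of_real c) > 0"
          using rcis_upper[of "exp (Re z)" "Im z"] v by (simp add: exp_rcis[of z])
        then have "Im (J (exp z - of_real c)) \<le> 0" using z by (auto simp: T_def Din_def)
        then have "Im (J (rcis (exp (Re w)) (Im w) - of_real c)) < 0"
          using Im_J_rotate_down[of "exp (Re z)" "Im w" "Im z"] 3 v w(1) by (simp add: exp_rcis[of z])
        moreover have "Im (exp w - of_real c) > 0"
          using rcis_upper[of "exp (Re w)" "Im w"] 3 v by (simp add: exp_rcis[of w])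
        ultimately have "exp w - of_real c \<in> Din" by (simp add: Din_def exp_rcis[of w])
        then show ?thesis using U(3) by (auto simp: S_def)
      qed
    qed
    show "closed_segment (Complex (Re z) 0) (Complex (ln wa) 0) \<subseteq> S"
    proof
      fix w assume "w \<in> closed_segment (Complex (Re z) 0) (Complex (ln wa) 0)"
      note w = segment_horizontal[OF this]
      have "ln wa \<le> Re z" using rad[OF z] wa_pos ln_mono[of wa "exp (Re z)"] by simp
      then have "ln wa \<le> Re w" "Re w \<le> Re z" using w by auto
      then have "wa \<le> exp (Re w)" "exp (Re w) \<le> exp (Re z)" using wa_pos exp_le_cancel_iff[of "ln wa" "Re w"] by auto
      then show "w \<in> S" using w rad[OF z] by (intro base) linarith+
    qed
  qed auto
  have 1: "((\<lambda>x. f (I x) * I' x) has_integral F (of_real (ln wb)) - F (of_real (ln wa))) {a..b}"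
  proof (rule curve_primitive)
    fix x assume x: "x \<in> {a..b}"
    have "Ln (I x + of_real c) \<in> T" using Ln_curve[OF x] I_in_D[OF x] by (simp add: T_def)
    from F[OF this] show "(F has_field_derivative f (I x) * (I x + of_real c)) (at (Ln (I x + of_real c)))"
      using Ln_curve(3)[OF x] by (simp add: fh_def)
  qed
  have 2: "((\<lambda>x. f (of_real x)) has_integral F (of_real (ln wb)) - F (of_real (ln wa))) {wa - c..wb - c}"
  proof (rule real_primitive)
    fix w assume w: "w \<in> {wa..wb}"
    then have w0: "w > 0" using wa_pos by auto
    then have e: "exp (of_real (ln w)) = complex_of_real w" by (simp add: exp_of_real)
    have "exp (of_real (ln w)) - of_real c = complex_of_real (w - c)" by (simp add: e)
    then have "complex_of_real (ln w) \<in> T" using w by (simp add: T_def Din_of_real del: of_real_diff)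
    from F[OF this] show "(F has_field_derivative f (of_real (w - c)) * of_real w) (at (of_real (ln w)))"
      by (simp add: fh_def e)
  qed (use wa_pos wab in auto)
  have fcont: "continuous_on Din f" using holomorphic_on_imp_continuous_on[OF U(2)] U(3) continuous_on_subset by blast
  have fI: "continuous_on {a..b} (\<lambda>x. f (I x))"
    by (rule continuous_on_compose2[OF fcont I_cont]) (use I_in_D in auto)
  have fR: "continuous_on {sa..sb} (\<lambda>x. f (of_real x))"
    by (rule continuous_on_compose2[OF fcont]) (auto intro!: continuous_intros simp: Din_def)
  have "(LINT x:{a<..<b}|lborel. f (I x) * I' x) = F (of_real (ln wb)) - F (of_real (ln wa))"
    by (rule set_LINT_of_has_integral_Icc[OF continuous_times_I'_integrable[OF fI] 1])
  also have "\<dots> = (LINT x:{sa<..<sb}|lborel. f (of_real x))"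
  proof (rule sym, rule set_LINT_of_has_integral_Icc)
    show "set_integrable lborel {sa<..<sb} (\<lambda>x. f (of_real x))"
      by (rule set_integrable_subset[OF borel_integrable_atLeastAtMost'[OF fR]]) auto
  qed (use 2 in simp)
  finally show ?thesis .
qed

text \<open>Comparison with 1/(1 + x^2): by compactness on the bounded part, by the decay hypothesis
  beyond.\<close>

lemma real_decay_integrable:
  fixes g :: "real \<Rightarrow> complex"
  assumes A: "closed A" "continuous_on A g" and M: "\<And>x. x \<in> A \<Longrightarrow> R0 \<le> \<bar>x\<bar> \<Longrightarrow> norm (g x) \<le> M / x^2"
  shows "set_integrable lborel A g"
proof -
  define R where "R = max R0 1"
  have "compact (A \<inter> {-R..R})" by (rule closed_Int_compact[OF A(1)]) simp
  then have "compact (g ` (A \<inter> {-R..R}))" by (intro compact_continuous_image continuous_on_subset[OF A(2)]) auto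
  then have "bounded (g ` (A \<inter> {-R..R}))" by (rule compact_imp_bounded)
  then obtain K where "\<forall>y\<in>g ` (A \<inter> {-R..R}). norm y \<le> K" unfolding bounded_iff by blast
  then have K: "norm (g x) \<le> K" if "x \<in> A \<inter> {-R..R}" for x using that by blast
  define C where "C = max (\<bar>K\<bar> * (1 + R^2)) (2 * \<bar>M\<bar>)"
  have C: "norm (g x) \<le> C * inverse (1 + x^2)" if x: "x \<in> A" for x
  proof (cases "\<bar>x\<bar> \<le> R")
    case True
    then have x2: "x^2 \<le> R^2" using power_mono[of "\<bar>x\<bar>" R 2] by simp
    have "x \<in> A \<inter> {-R..R}" using x True by (simp add: abs_le_iff)
    then have "norm (g x) \<le> \<bar>K\<bar>" using K order_trans[OF _ abs_ge_self] by blast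
    also have "\<bar>K\<bar> = (\<bar>K\<bar> * (1 + x^2)) * inverse (1 + x^2)"
    proof -
      have "(1 + x^2) * inverse (1 + x^2) = 1" by (rule right_inverse) (use zero_le_power2[of x] in linarith)
      then show ?thesis by (simp only: mult.assoc mult_1_right)
    qed
    also have "\<dots> \<le> C * inverse (1 + x^2)"
    proof (rule mult_right_mono)
      have "\<bar>K\<bar> * (1 + x^2) \<le> \<bar>K\<bar> * (1 + R^2)" using x2 by (intro mult_left_mono) auto
      then show "\<bar>K\<bar> * (1 + x^2) \<le> C" by (simp add: C_def)
    qed simp
    finally show ?thesis .
  next
    case False
    then have x1: "1 \<le> \<bar>x\<bar>" "R0 \<le> \<bar>x\<bar>" by (auto simp: R_def)
    then have x2: "1 \<le> x^2" using one_le_power[of "\<bar>x\<bar>" 2] by simp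
    have "norm (g x) \<le> M / x^2" by (rule M[OF x x1(2)])
    also have "\<dots> \<le> \<bar>M\<bar> / x^2" by (intro divide_right_mono) auto
    also have "\<dots> \<le> (2 * \<bar>M\<bar>) * inverse (1 + x^2)"
    proof -
      have "1 + x^2 \<le> 2 * x^2" "0 < x^2" using x2 by linarith+
      then have "1 / x^2 \<le> 2 * inverse (1 + x^2)" by (simp add: divide_simps)
      from mult_left_mono[OF this, of "\<bar>M\<bar>"] show ?thesis by simp
    qed
    also have "\<dots> \<le> C * inverse (1 + x^2)" by (intro mult_right_mono) (auto simp: C_def)
    finally show ?thesis .
  qed
  have "set_integrable lborel UNIV (\<lambda>x::real. inverse (1 + x^2))"
    using integrable_inverse_1_plus_square by (simp add: einterval_def)
  then have "set_integrable lborel A (\<lambda>x::real. inverse (1 + x^2))"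
    by (rule set_integrable_subset) (use A(1) in auto)
  then have "set_integrable lborel A (\<lambda>x::real. C * inverse (1 + x^2))" by (simp add: set_integrable_mult_right)
  then show ?thesis
  proof (rule set_integrable_bound)
    show "set_borel_measurable lborel A g"
      unfolding set_borel_measurable_def
      using borel_measurable_continuous_on_indicator[OF _ A(2)] A(1) by simp
    show "AE x in lborel. x \<in> A \<longrightarrow> norm (g x) \<le> norm (C * inverse (1 + x^2))"
    proof (intro AE_I2 impI)
      fix x assume "x \<in> A" from C[OF this] show "norm (g x) \<le> norm (C * inverse (1 + x^2))"
        by (rule order_trans) simp
    qed
  qed
qed

text \<open>The outside is reached vertically from the line Im z = pi, the axis left of - c. The
  real axis passes through - c and runs to infinity, the two places that the coordinate z sends to
  infinity, so it is first cut off at the radii 1/n and n about - c. The two half circles contribute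
  nothing in the limit: the large one by the decay of f, the small one because f is bounded near -
  c.\<close>

lemma cauchy_out:
  assumes U: "open U" "f holomorphic_on U" "Dout \<subseteq> U"
    and M: "\<And>s. 0 \<le> Im s \<Longrightarrow> R0 \<le> cmod s \<Longrightarrow> cmod (f s) \<le> M / cmod s ^ 2"
  shows "set_integrable lborel ({..sa} \<union> {sb..}) (\<lambda>x. f (of_real x))"
    and "(LINT x:{a<..<b}|lborel. f (I x) * I' x) = - (LINT x:{..sa} \<union> {sb..}|lborel. f (of_real x))"
proof -
  define S where "S = {z. exp z - of_real c \<in> U}"
  define fh where "fh z = f (exp z - of_real c) * exp z" for z
  have "open S" unfolding S_def using open_vimage[OF U(1), of "\<lambda>z. exp z - of_real c"]
    by (simp add: vimage_def continuous_intros)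
  have "f \<circ> (\<lambda>z. exp z - of_real c) holomorphic_on S"
    by (rule holomorphic_on_compose_gen[OF _ U(2)]) (auto simp: S_def intro!: holomorphic_intros)
  then have fh: "fh holomorphic_on S" unfolding fh_def by (auto simp: o_def intro!: holomorphic_intros)
  define T where "T = {z. 0 \<le> Im z \<and> Im z \<le> pi \<and> exp z - of_real c \<in> Dout}"
  have top: "exp z - of_real c \<in> Dout" if "Im z = pi" for z
  proof -
    have "- exp (Re z) - c \<le> sa" using sa_gt exp_gt_zero[of "Re z"] by linarith
    then show ?thesis unfolding exp_shift_top[OF that] Dout_of_real by simp
  qed
  have mid: "exp w - of_real c \<in> Dout" if w: "0 < Im w" "Im w < pi" and J: "Im (J (rcis (exp (Re w)) (Im w) - of_real c)) \<ge> 0" for w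
    using rcis_upper[of "exp (Re w)" "Im w"] w J by (simp add: Dout_def exp_rcis[of w])
  \<comment> \<open>A whole upper half circle whose radius avoids the open annulus lies outside the
    curve; this serves both the real axis and the two half circles.\<close>
  have outer: "w \<in> T" if w: "0 \<le> Im w" "Im w \<le> pi" "exp (Re w) \<le> wa \<or> wb \<le> exp (Re w)" for w
  proof -
    consider "Im w = 0" | "Im w = pi" | "0 < Im w \<and> Im w < pi" using w(1,2) by linarith
    then have "exp w - of_real c \<in> Dout"
    proof cases
      case 1
      then show ?thesis unfolding exp_shift_bottom[OF 1] Dout_of_real using w(3) by auto
    next
      case 2 then show ?thesis by (rule top)
    next
      case 3
      then show ?thesis using Im_J_pos_outer[of "exp (Re w)" "Im w"] w(3) by (intro mid) auto
    qed
    then show ?thesis using w by (simp add: T_def)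
  qed
  obtain F where F: "\<And>z. z \<in> T \<Longrightarrow> (F has_field_derivative fh z) (at z)"
  proof (rule primitive_on_vertical_star[OF \<open>open S\<close> fh, of T pi 0])
    fix z assume z: "z \<in> T"
    show "closed_segment z (Complex (Re z) pi) \<subseteq> S"
    proof
      fix w assume "w \<in> closed_segment z (Complex (Re z) pi)"
      note w = segment_to_horizontal[OF this]
      have Imw: "Im z \<le> Im w" "Im w \<le> pi" "0 \<le> Im z" using w z by (auto simp: T_def)
      consider "Im w = pi" | "Im w = Im z" | "Im z < Im w \<and> Im w < pi" using Imw by linarith
      then have "exp w - of_real c \<in> Dout"
      proof cases
        case 1 then show ?thesis by (rule top)
      next
        case 2 then have "w = z" using w(1) by (simp add: complex_eq_iff)
        then show ?thesis using z by (simp add: T_def)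
      next
        case 3
        show ?thesis
        proof (cases "Im z = 0")
          case True
          then have "exp (Re z) - c \<le> sa \<or> sb \<le> exp (Re z) - c"
            using z unfolding T_def mem_Collect_eq exp_shift_bottom[OF True] Dout_of_real by simp
          then have "exp (Re z) \<le> wa \<or> wb \<le> exp (Re z)" by auto
          then show ?thesis using Im_J_pos_outer[of "exp (Re w)" "Im w"] 3 True w(1) by (intro mid) auto
        next
          case False
          then have v: "0 < Im z" "Im z < pi" using 3 Imw by auto
          have "Im (exp z - of_real c) > 0"
            using rcis_upper[of "exp (Re z)" "Im z"] v by (simp add: exp_rcis[of z])
          then have "Im (J (exp z - of_real c)) \<ge> 0" using z by (auto simp: T_def Dout_def)
          then have "Im (J (rcis (exp (Re w)) (Im w) - of_real c)) > 0"
            using Im_J_rotate_up[of "exp (Re z)" "Im z" "Im w"] 3 v w(1) by (simp add: exp_rcis[of z])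
          then show ?thesis using 3 v by (intro mid) auto
        qed
      qed
      then show "w \<in> S" using U(3) by (auto simp: S_def)
    qed
    show "closed_segment (Complex (Re z) pi) (Complex 0 pi) \<subseteq> S"
    proof
      fix w assume "w \<in> closed_segment (Complex (Re z) pi) (Complex 0 pi)"
      note w = segment_horizontal[OF this]
      then show "w \<in> S" using top[of w] U(3) by (auto simp: S_def)
    qed
  qed auto
  have curve: "((\<lambda>x. f (I x) * I' x) has_integral F (of_real (ln wb)) - F (of_real (ln wa))) {a..b}"
  proof (rule curve_primitive)
    fix x assume x: "x \<in> {a..b}"
    have "Ln (I x + of_real c) \<in> T" using Ln_curve[OF x] I_in_D[OF x] by (simp add: T_def)
    from F[OF this] show "(F has_field_derivative f (I x) * (I x + of_real c)) (at (Ln (I x + of_real c)))"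
      using Ln_curve(3)[OF x] by (simp add: fh_def)
  qed
  have pos: "((\<lambda>x. f (of_real x)) has_integral F (of_real (ln u)) - F (of_real (ln l))) {l - c..u - c}"
    if lu: "0 < l" "l \<le> u" "u \<le> wa \<or> wb \<le> l" for l u
  proof (rule real_primitive[OF lu(1,2)])
    fix w assume w: "w \<in> {l..u}"
    then have w0: "w > 0" using lu by auto
    then have e: "exp (of_real (ln w)) = complex_of_real w" by (simp add: exp_of_real)
    have "complex_of_real (ln w) \<in> T" using w lu w0 by (intro outer) auto
    from F[OF this] show "(F has_field_derivative f (of_real (w - c)) * of_real w) (at (of_real (ln w)))"
      by (simp add: fh_def e)
  qed
  have neg: "((\<lambda>x. f (of_real x)) has_integral F (Complex (ln l) pi) - F (Complex (ln u) pi)) {- u - c..- l - c}"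
    if lu: "0 < l" "l \<le> u" for l u
  proof (rule real_primitive_neg[OF lu])
    fix w assume w: "w \<in> {l..u}"
    then have w0: "w > 0" using lu by auto
    have e: "exp (Complex (ln w) pi) = - complex_of_real w" 
      using exp_shift_top[of "Complex (ln w) pi"] w0 by (simp add: diff_eq_eq)
    have "Complex (ln w) pi \<in> T" using top[of "Complex (ln w) pi"] by (simp add: T_def)
    from F[OF this] show "(F has_field_derivative f (of_real (- w - c)) * of_real (- w)) (at (Complex (ln w) pi))"
      by (simp add: fh_def e)
  qed
  \<comment> \<open>Up to sign, the integral of f over the upper half circle of radius exp u about -
    c.\<close>
  define V where "V u = F (of_real u) - F (Complex u pi)" for u
  have V: "cmod (V u) \<le> K * exp u * pi" 
    if u: "exp u \<le> wa \<or> wb \<le> exp u" and K: "\<And>s. 0 \<le> Im s \<Longrightarrow> cmod (s + of_real c) = exp u \<Longrightarrow> cmod (f s) \<le> K" for u K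
  proof -
    have "cmod (F (of_real u) - F (Complex u pi)) \<le> (K * exp u) * cmod (of_real u - Complex u pi)"
    proof (rule field_differentiable_bound[where S = "closed_segment (Complex u 0) (Complex u pi)" and f' = fh])
      fix z assume "z \<in> closed_segment (Complex u 0) (Complex u pi)"
      note z = segment_to_horizontal[of z "Complex u 0" pi, simplified, OF this]
      have Imz: "0 \<le> Im z" "Im z \<le> pi" using z by auto
      have zT: "z \<in> T" using Imz u z(1) by (intro outer) auto
      then show "(F has_field_derivative fh z) (at z within closed_segment (Complex u 0) (Complex u pi))"
        using F has_field_derivative_at_within by blast
      have "0 \<le> Im (exp z - of_real c)" using zT by (auto simp: T_def Dout_def)
      then have "cmod (f (exp z - of_real c)) \<le> K" by (rule K) (simp add: z)
      then show "cmod (fh z) \<le> K * exp u" by (simp add: fh_def norm_mult z mult_right_mono)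
    qed (auto simp: complex_of_real_def)
    also have "cmod (of_real u - Complex u pi) = pi" by (simp add: complex_of_real_def cmod_def)
    finally show ?thesis by (simp add: V_def)
  qed
  have fcont: "continuous_on Dout f" using holomorphic_on_imp_continuous_on[OF U(2)] U(3) continuous_on_subset by blast
  have fI: "continuous_on {a..b} (\<lambda>x. f (I x))"
    by (rule continuous_on_compose2[OF fcont I_cont]) (use I_in_D in auto)
  define A where "A = {..sa} \<union> {sb..}"
  have fR: "continuous_on A (\<lambda>x. f (of_real x))"
    by (rule continuous_on_compose2[OF fcont]) (auto intro!: continuous_intros simp: Dout_def A_def)
  show intA: "set_integrable lborel ({..sa} \<union> {sb..}) (\<lambda>x. f (of_real x))"
    unfolding A_def[symmetric]
  proof (rule real_decay_integrable[OF _ fR])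
    show "closed A" unfolding A_def by auto
    fix x assume "R0 \<le> \<bar>x\<bar>" then show "cmod (f (of_real x)) \<le> M / x^2" using M[of "of_real x"] by simp
  qed
  have curveL: "(LINT x:{a<..<b}|lborel. f (I x) * I' x) = F (of_real (ln wb)) - F (of_real (ln wa))"
    by (rule set_LINT_of_has_integral_Icc[OF continuous_times_I'_integrable[OF fI] curve])
  \<comment> \<open>From \<open>N\<close> on, the cut-off radii satisfy 1/n < \<open>wa\<close> and
    \<open>wb\<close> < n, so both half circles lie outside the curve.\<close>
  define N where "N = nat \<lceil>max wb (1 / wa)\<rceil> + 1"
  have N: "1 / real n < wa" "wb < real n" "0 < real n" if "n \<ge> N" for n
  proof -
    have "max wb (1 / wa) < real n" using that unfolding N_def by linarith
    then have *: "wb < real n" "1 / wa < real n" by auto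
    then show "wb < real n" by simp
    show n0: "0 < real n" using * wa_pos wab by linarith
    show "1 / real n < wa" using *(2) wa_pos n0 by (simp add: field_simps)
  qed
  define An where "An n = {- real n - c..- (1 / real n) - c} \<union> {1 / real n - c..sa} \<union> {sb..real n - c}" for n
  define f1 where "f1 x = f (complex_of_real x)" for x
  have AnLim: "(\<lambda>n. LINT x:An n|lborel. f1 x) \<longlonglongrightarrow> (LINT x:A|lborel. f1 x)"
    unfolding set_lebesgue_integral_def
  proof (rule integral_dominated_convergence[where w = "\<lambda>x. norm (indicator A x *\<^sub>R f1 x)"])
    have m: "(\<lambda>x. indicator A x *\<^sub>R f1 x) \<in> borel_measurable lborel"
      using intA unfolding A_def[symmetric] f1_def[symmetric] set_integrable_def by (rule borel_measurable_integrable)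
    then show "(\<lambda>x. indicator A x *\<^sub>R f1 x) \<in> borel_measurable lborel" .
    have AnA: "An n \<subseteq> A" for n
    proof -
      have "0 \<le> 1 / real n" by simp
      then have q: "- (1 / real n) - c \<le> sa" using sa_gt by linarith
      show ?thesis unfolding An_def A_def using q by (intro Un_least Un_mono subsetI) auto
    qed
    have An_sets: "An n \<in> sets lborel" for n unfolding An_def by (intro sets.Un) auto
    show "(\<lambda>x. indicator (An n) x *\<^sub>R f1 x) \<in> borel_measurable lborel" for n
    proof -
      have eq: "indicator (An n) x *\<^sub>R f1 x = indicator (An n) x *\<^sub>R (indicator A x *\<^sub>R f1 x)" for x
        using AnA[of n] by (auto simp: indicator_def)
      have "(\<lambda>x. indicator (An n) x *\<^sub>R (indicator A x *\<^sub>R f1 x)) \<in> borel_measurable lborel"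
        by (rule borel_measurable_scaleR[OF borel_measurable_indicator m]) (rule An_sets)
      then show ?thesis by (simp only: eq[symmetric])
    qed
    show "integrable lborel (\<lambda>x. norm (indicator A x *\<^sub>R f1 x))"
      using intA unfolding A_def[symmetric] f1_def[symmetric] set_integrable_def by (rule integrable_norm)
    show "AE x in lborel. norm (indicator (An n) x *\<^sub>R f1 x) \<le> norm (indicator A x *\<^sub>R f1 x)" for n
      using AnA[of n] by (intro AE_I2) (auto simp: indicator_def)
    \<comment> \<open>The sets \<open>An n\<close> exhaust \<open>A\<close> except for the point -
      c.\<close>
    have "AE x in lborel. x \<noteq> - c" by (rule AE_lborel_singleton)
    then show "AE x in lborel. (\<lambda>n. indicator (An n) x *\<^sub>R f1 x) \<longlonglongrightarrow> indicator A x *\<^sub>R f1 x"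
    proof eventually_elim
      case (elim x)
      have "\<forall>\<^sub>F n in sequentially. (indicator (An n) x :: real) = indicator A x"
      proof (cases "x \<in> A")
        case False
        then have "x \<notin> An n" for n using AnA[of n] by blast
        then show ?thesis using False by (simp add: indicator_def)
      next
        case True
        define m where "m = nat \<lceil>max (\<bar>x\<bar> + c + 1) (1 / \<bar>x + c\<bar>)\<rceil> + 1"
        have "x \<in> An n" if n: "n \<ge> m" for n
        proof -
          have "real (nat \<lceil>max (\<bar>x\<bar> + c + 1) (1 / \<bar>x + c\<bar>)\<rceil>) < real n" using n unfolding m_def by simp
          then have "max (\<bar>x\<bar> + c + 1) (1 / \<bar>x + c\<bar>) < real n" by (rule le_less_trans[OF real_nat_ceiling_ge])
          then have *: "\<bar>x\<bar> + c + 1 < real n" "1 / \<bar>x + c\<bar> < real n" by auto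
          have n0: "real n > 0" using * c_gt_1 by linarith
          have "1 / real n < \<bar>x + c\<bar>" using *(2) elim n0 by (simp add: field_simps)
          then have "x + c \<le> - (1 / real n) \<or> 1 / real n \<le> x + c" by linarith
          moreover have "- real n - c \<le> x" "x \<le> real n - c" using *(1) c_gt_1 by linarith+
          moreover have "x \<le> sa \<or> sb \<le> x" using True by (auto simp: A_def)
          ultimately show ?thesis unfolding An_def Un_iff atLeastAtMost_iff by linarith
        qed
        then show ?thesis using True by (auto simp: eventually_sequentially indicator_def)
      qed
      then show ?case by (intro tendsto_eventually) (auto elim: eventually_mono)
    qed
  qed
  have An_eq: "(LINT x:An n|lborel. f1 x) = V (ln (real n)) - V (ln (1 / real n)) - (F (of_real (ln wb)) - F (of_real (ln wa)))"
    if n: "n \<ge> N" for n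
  proof -
    have n1: "1 / real n \<le> real n" using N[OF n] wab wa_pos by linarith
    have h1: "(f1 has_integral F (Complex (ln (1 / real n)) pi) - F (Complex (ln (real n)) pi)) {- real n - c..- (1 / real n) - c}"
      unfolding f1_def using neg[of "1 / real n" "real n"] N[OF n] n1 by simp
    have h2: "(f1 has_integral F (of_real (ln wa)) - F (of_real (ln (1 / real n)))) {1 / real n - c..sa}"
      unfolding f1_def using pos[of "1 / real n" wa] N[OF n] by simp
    have h3: "(f1 has_integral F (of_real (ln (real n))) - F (of_real (ln wb))) {sb..real n - c}"
      unfolding f1_def using pos[of wb "real n"] N[OF n] wab wa_pos by simp
    have r: "0 < 1 / real n" using N[OF n] by simp
    have sub: "{- real n - c..- (1 / real n) - c} \<subseteq> A" "{1 / real n - c..sa} \<subseteq> A" "{sb..real n - c} \<subseteq> A"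
    proof -
      have "- (1 / real n) - c \<le> sa" using r sa_gt by linarith
      then show "{- real n - c..- (1 / real n) - c} \<subseteq> A" unfolding A_def by (intro subsetI) simp
    qed (simp_all add: A_def subset_iff)
    have fc: "continuous_on X f1" if "X \<subseteq> A" for X
      unfolding f1_def using continuous_on_subset[OF fR that] .
    note c = fc[OF sub(1)] fc[OF sub(2)] fc[OF sub(3)]
    note i = c[THEN borel_integrable_atLeastAtMost']
    have d1: "{- real n - c..- (1 / real n) - c} \<inter> {1 / real n - c..sa} = {}" using r by (intro equals0I) simp
    have d2: "({- real n - c..- (1 / real n) - c} \<union> {1 / real n - c..sa}) \<inter> {sb..real n - c} = {}"
    proof (intro equals0I)
      fix x assume "x \<in> ({- real n - c..- (1 / real n) - c} \<union> {1 / real n - c..sa}) \<inter> {sb..real n - c}"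
      then have "x \<le> - (1 / real n) - c \<or> x \<le> sa" "sb \<le> x" by auto
      then show False using r sab sa_gt by linarith
    qed
    have "set_integrable lborel ({- real n - c..- (1 / real n) - c} \<union> {1 / real n - c..sa}) f1"
      by (rule set_integrable_Un[OF i(1,2)]) auto
    from set_integral_Un[OF d2 this i(3)] 
    have "(LINT x:An n|lborel. f1 x) = (LINT x:{- real n - c..- (1 / real n) - c} \<union> {1 / real n - c..sa}|lborel. f1 x) + (LINT x:{sb..real n - c}|lborel. f1 x)"
      by (simp only: An_def)
    also have "(LINT x:{- real n - c..- (1 / real n) - c} \<union> {1 / real n - c..sa}|lborel. f1 x)
      = (LINT x:{- real n - c..- (1 / real n) - c}|lborel. f1 x) + (LINT x:{1 / real n - c..sa}|lborel. f1 x)"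
      by (rule set_integral_Un[OF d1 i(1,2)])
    finally show ?thesis
      using set_LINT_Icc_of_has_integral(2)[OF c(1) h1] set_LINT_Icc_of_has_integral(2)[OF c(2) h2]
        set_LINT_Icc_of_has_integral(2)[OF c(3) h3] by (simp add: V_def)
  qed
  have V1: "(\<lambda>n. V (ln (real n))) \<longlonglongrightarrow> 0"
  proof (rule tendsto_0_le[where K = "4 * \<bar>M\<bar> * pi"])
    show "(\<lambda>n. 1 / real n) \<longlonglongrightarrow> 0" by (rule lim_1_over_n)
    show "\<forall>\<^sub>F n in sequentially. norm (V (ln (real n))) \<le> norm (1 / real n) * (4 * \<bar>M\<bar> * pi)"
      unfolding eventually_sequentially
    proof (intro exI allI impI)
      fix n assume n: "n \<ge> max N (nat \<lceil>max (R0 + c) (2 * c)\<rceil> + 1)"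
      \<comment> \<open>With n > 2c a point at distance n from - c has modulus at least n/2, whence
        the factor 4 in the bound.\<close>
      then have n1: "n \<ge> N" and n2: "R0 + c < real n" "2 * c < real n" by linarith+
      have "cmod (V (ln (real n))) \<le> (4 * \<bar>M\<bar> / real n^2) * exp (ln (real n)) * pi"
      proof (rule V)
        fix s assume s: "0 \<le> Im s" "cmod (s + of_real c) = exp (ln (real n))"
        have sn: "real n - c \<le> cmod s" using norm_triangle_ineq[of s "of_real c"] s(2) N[OF n1] c_gt_1 by simp
        then have h: "real n / 2 \<le> cmod s" "R0 \<le> cmod s" using n2 by auto
        have "cmod (f s) \<le> M / cmod s^2" using M s(1) h(2) by blast
        also have "\<dots> \<le> \<bar>M\<bar> / (real n / 2)^2" using h(1) N[OF n1] by (intro frac_le power_mono) auto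
        finally show "cmod (f s) \<le> 4 * \<bar>M\<bar> / real n^2" by (simp add: power_divide mult.commute)
      qed (use N[OF n1] in simp)
      then show "norm (V (ln (real n))) \<le> norm (1 / real n) * (4 * \<bar>M\<bar> * pi)"
        using N[OF n1] by (simp add: power2_eq_square)
    qed
  qed
  have V2: "(\<lambda>n. V (ln (1 / real n))) \<longlonglongrightarrow> 0"
  proof -
    have "- of_real c \<in> U" using U(3) sa_gt by (auto simp: Dout_def)
    then have "isCont f (- of_real c)"
      using holomorphic_on_imp_continuous_on[OF U(2)] U(1) by (simp add: continuous_on_eq_continuous_at)
    then obtain d where d: "d > 0" "\<And>s. dist s (- of_real c) < d \<Longrightarrow> dist (f s) (f (- of_real c)) < 1"
      unfolding continuous_at_eps_delta by (metis zero_less_one)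
    define K where "K = cmod (f (- of_real c)) + 1"
    show ?thesis
    proof (rule tendsto_0_le[where K = "K * pi"])
      show "(\<lambda>n. 1 / real n) \<longlonglongrightarrow> 0" by (rule lim_1_over_n)
      show "\<forall>\<^sub>F n in sequentially. norm (V (ln (1 / real n))) \<le> norm (1 / real n) * (K * pi)"
        unfolding eventually_sequentially
      proof (intro exI allI impI)
        fix n assume n: "n \<ge> max N (nat \<lceil>1 / d\<rceil> + 1)"
        then have n1: "n \<ge> N" and n2: "1 / d < real n" by linarith+
        have n3: "1 / real n < d" using n2 d(1) N[OF n1] by (simp add: field_simps)
        have "cmod (V (ln (1 / real n))) \<le> K * exp (ln (1 / real n)) * pi"
        proof (rule V)
          fix s assume s: "0 \<le> Im s" "cmod (s + of_real c) = exp (ln (1 / real n))"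
          then have "dist s (- of_real c) < d" using n3 N[OF n1] by (simp add: dist_norm)
          then have "dist (f s) (f (- of_real c)) < 1" by (rule d(2))
          then show "cmod (f s) \<le> K" using norm_triangle_ineq2[of "f s" "f (- of_real c)"] by (simp add: K_def dist_norm)
        qed (use N[OF n1] in simp)
        then show "norm (V (ln (1 / real n))) \<le> norm (1 / real n) * (K * pi)" using N[OF n1] by simp
      qed
    qed
  qed
  have lim: "(\<lambda>n. V (ln (real n)) - V (ln (1 / real n)) - (F (of_real (ln wb)) - F (of_real (ln wa))))
     \<longlonglongrightarrow> 0 - 0 - (F (of_real (ln wb)) - F (of_real (ln wa)))"
    by (intro tendsto_intros V1 V2)
  have "\<forall>\<^sub>F n in sequentially. V (ln (real n)) - V (ln (1 / real n)) - (F (of_real (ln wb)) - F (of_real (ln wa)))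
      = (LINT x:An n|lborel. f1 x)"
    unfolding eventually_sequentially by (intro exI[of _ N] allI impI An_eq[symmetric])
  from LIMSEQ_unique[OF AnLim Lim_transform_eventually[OF lim this]]
  have "(LINT x:A|lborel. f1 x) = - (F (of_real (ln wb)) - F (of_real (ln wa)))" by simp
  then show "(LINT x:{a<..<b}|lborel. f (I x) * I' x) = - (LINT x:{..sa} \<union> {sb..}|lborel. f (of_real x))"
    using curveL by (simp add: A_def f1_def)
qed

end

section \<open>The logarithmic kernel\<close>

lemma Ln_tendsto_real:
  assumes "(f \<longlongrightarrow> complex_of_real r) F" "r > 0" shows "((\<lambda>n. Ln (f n)) \<longlongrightarrow> of_real (ln r)) F"
proof -
  have "((\<lambda>n. Ln (f n)) \<longlongrightarrow> Ln (of_real r)) F"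
    by (rule tendsto_Ln[OF assms(1)]) (use assms(2) in \<open>simp add: complex_nonpos_Reals_iff\<close>)
  then show ?thesis using assms(2) by (simp add: Ln_of_real)
qed

text \<open>The two points approach the axis from opposite sides. For negative p and q the limits of
  the arguments are therefore pi and - pi, and they cancel; negating both points reduces this case
  to the positive one.\<close>

lemma Ln_pair_tendsto:
  fixes p q :: real and e :: "nat \<Rightarrow> real"
  assumes pq: "(p > 0 \<and> q > 0) \<or> (p < 0 \<and> q < 0)" and e: "e \<longlonglongrightarrow> 0" "\<And>n. e n > 0"
  shows "(\<lambda>n. Ln (Complex p (e n)) + Ln (Complex q (- e n))) \<longlonglongrightarrow> of_real (ln \<bar>p\<bar> + ln \<bar>q\<bar>)"
proof (cases "p > 0")
  case True
  then have q: "q > 0" using pq by auto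
  have "(\<lambda>n. Complex p (e n)) \<longlonglongrightarrow> of_real p" "(\<lambda>n. Complex q (- e n)) \<longlonglongrightarrow> of_real q"
    using tendsto_Complex[OF tendsto_const e(1), of p] tendsto_Complex[OF tendsto_const tendsto_minus[OF e(1)], of q]
    by (simp_all add: complex_of_real_def)
  from tendsto_add[OF Ln_tendsto_real[OF this(1) True] Ln_tendsto_real[OF this(2) q]] True q
  show ?thesis by simp
next
  case False
  then have p: "p < 0" and q: "q < 0" using pq by auto
  have eq: "Ln (Complex p (e n)) + Ln (Complex q (- e n)) = Ln (Complex (- p) (- e n)) + Ln (Complex (- q) (e n))" for n
  proof -
    have "Ln (- Complex (- p) (- e n)) = Ln (Complex (- p) (- e n)) + \<i> * pi"
      using Ln_minus[of "Complex (- p) (- e n)"] p e(2)[of n] by (simp add: complex_eq_iff)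
    moreover have "Ln (- Complex (- q) (e n)) = Ln (Complex (- q) (e n)) - \<i> * pi"
      using Ln_minus[of "Complex (- q) (e n)"] q e(2)[of n] by (simp add: complex_eq_iff)
    moreover have "- Complex (- p) (- e n) = Complex p (e n)" "- Complex (- q) (e n) = Complex q (- e n)"
      by (simp_all add: complex_eq_iff)
    ultimately show ?thesis by simp
  qed
  have "(\<lambda>n. Complex (- p) (- e n)) \<longlonglongrightarrow> of_real (- p)" "(\<lambda>n. Complex (- q) (e n)) \<longlonglongrightarrow> of_real (- q)"
    using tendsto_Complex[OF tendsto_const tendsto_minus[OF e(1)], of "- p"] tendsto_Complex[OF tendsto_const e(1), of "- q"]
    by (simp_all add: complex_of_real_def del: of_real_minus)
  from tendsto_add[OF Ln_tendsto_real[OF this(1)] Ln_tendsto_real[OF this(2)]] p q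
  show ?thesis unfolding eq by simp
qed

lemma norm_Ln_le: "z \<noteq> 0 \<Longrightarrow> cmod (Ln z) \<le> \<bar>ln (cmod z)\<bar> + pi"
  using cmod_le[of "Ln z"] Im_Ln_le_pi[of z] mpi_less_Im_Ln[of z] by (simp add: Re_Ln)

lemma abs_ln_between:
  assumes "0 < l" "l \<le> d" "d \<le> u" shows "\<bar>ln d\<bar> \<le> \<bar>ln l\<bar> + \<bar>ln (u::real)\<bar>"
proof -
  have "ln l \<le> ln d" "ln d \<le> ln u" using assms by auto
  then show ?thesis by linarith
qed

lemma powr_diff_bounds:
  fixes x y \<theta> :: real
  assumes "\<theta> > 1" "0 < l" "l \<le> x" "l \<le> y"
  shows "\<theta> * l powr (\<theta> - 1) * \<bar>x - y\<bar> \<le> \<bar>x powr \<theta> - y powr \<theta>\<bar>"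
proof -
  have *: "\<theta> * l powr (\<theta> - 1) * (x - y) \<le> x powr \<theta> - y powr \<theta>" if "y < x" "l \<le> y" for x y
  proof -
    have "\<exists>z>y. z < x \<and> x powr \<theta> - y powr \<theta> = (x - y) * (\<theta> * z powr (\<theta> - 1))"
      by (rule MVT2[OF that(1)]) (use that assms in \<open>auto intro!: derivative_eq_intros\<close>)
    then obtain z where z: "y < z" "x powr \<theta> - y powr \<theta> = (x - y) * (\<theta> * z powr (\<theta> - 1))" by auto
    have "l powr (\<theta> - 1) \<le> z powr (\<theta> - 1)" using assms that z by (intro powr_mono2) auto
    then have "\<theta> * l powr (\<theta> - 1) * (x - y) \<le> \<theta> * z powr (\<theta> - 1) * (x - y)"
      using assms that by (intro mult_right_mono mult_left_mono) auto
    then show ?thesis using z(2) by (simp add: mult_ac)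
  qed
  consider "x = y" | "y < x" | "x < y" by linarith
  then show ?thesis
  proof cases
    case 2 then show ?thesis using *[of y x] assms by simp
  next
    case 3 then show ?thesis using *[of x y] assms by (simp add: abs_minus_commute)
  qed auto
qed

lemma set_LINT_at_symmetric_limit:
  fixes g :: "real \<Rightarrow> complex"
  assumes "integrable lborel g"
  shows "(\<lambda>n. LINT x:{- real n..real n}|lborel. g x) \<longlonglongrightarrow> (LINT x|lborel. g x)"
  unfolding set_lebesgue_integral_def
proof (rule integral_dominated_convergence[where w = "\<lambda>x. norm (g x)"])
  show "g \<in> borel_measurable lborel" using assms by simp
  then show "(\<lambda>x. indicator {- real n..real n} x *\<^sub>R g x) \<in> borel_measurable lborel" for n
    by (intro borel_measurable_scaleR borel_measurable_indicator) auto
  show "integrable lborel (\<lambda>x. norm (g x))" using assms by simp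
  show "AE x in lborel. norm (indicator {- real n..real n} x *\<^sub>R g x) \<le> norm (g x)" for n
    by (intro AE_I2) (auto simp: indicator_def)
  show "AE x in lborel. (\<lambda>n. indicator {- real n..real n} x *\<^sub>R g x) \<longlonglongrightarrow> g x"
  proof (intro AE_I2)
    fix x :: real
    obtain m :: nat where m: "\<bar>x\<bar> \<le> real m" using real_arch_simple by blast
    have "indicator {- real n..real n} x *\<^sub>R g x = g x" if "n \<ge> m" for n
    proof -
      have "real m \<le> real n" using that by simp
      then show ?thesis using m by (simp add: abs_le_iff indicator_def)
    qed
    then show "(\<lambda>n. indicator {- real n..real n} x *\<^sub>R g x) \<longlonglongrightarrow> g x"
      by (intro tendsto_eventually) (auto simp: eventually_sequentially)
  qed
qed

lemma real_kernel_integrable: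
  assumes "Im s > 0"
  shows "integrable lborel (\<lambda>x. 1 / cmod (of_real x - s) ^ 2)" "(LINT x|lborel. 1 / cmod (of_real x - s) ^ 2) = pi / Im s"
proof -
  define q where "q = Im s"
  have q: "q > 0" using assms by (simp add: q_def)
  define g where "g x = inverse (1 + x^2)" for x :: real
  have gi: "integrable lborel g"
    using integrable_inverse_1_plus_square by (simp add: einterval_def set_integrable_def g_def[abs_def])
  have gv: "(LINT x|lborel. g x) = pi"
    using LBINT_inverse_1_plus_square by (simp add: interval_lebesgue_integral_def einterval_def set_lebesgue_integral_def g_def)
  have eq: "1 / cmod (of_real x - s)^2 = g (- Re s / q + (1/q) * x) / q^2" for x
  proof -
    have "cmod (of_real x - s)^2 = (x - Re s)^2 + q^2" by (simp add: cmod_power2 q_def)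
    also have "\<dots> = q^2 * (1 + (- Re s / q + (1/q) * x)^2)" using q by (simp add: field_simps power2_eq_square)
    finally show ?thesis by (simp add: g_def divide_inverse)
  qed
  show "integrable lborel (\<lambda>x. 1 / cmod (of_real x - s) ^ 2)"
    unfolding eq using lborel_integrable_real_affine[OF gi, of "1/q" "- Re s / q"] q by (intro integrable_divide) auto
  have "pi = \<bar>1 / q\<bar> *\<^sub>R (LINT x|lborel. g (- Re s / q + (1/q) * x))"
    using lborel_integral_real_affine[of "1/q" g "- Re s / q"] q gv by simp
  then have "(LINT x|lborel. g (- Re s / q + (1/q) * x)) = pi * q" using q by (simp add: field_simps)
  then show "(LINT x|lborel. 1 / cmod (of_real x - s) ^ 2) = pi / Im s"
    unfolding eq using q by (simp add: power2_eq_square q_def)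
qed

text \<open>These integrals over the whole line are what remains of the pole at s once the real-axis
  pieces inside and outside the curve are recombined: the double pole contributes 0, the product of
  the conjugate pair contributes pi / Im s.\<close>

lemma real_kernel_complex:
  assumes "Im s > 0"
  shows "integrable lborel (\<lambda>x. 1 / (of_real x - s) ^ 2)" "(LINT x|lborel. 1 / (of_real x - s) ^ 2) = 0"
    "integrable lborel (\<lambda>x. 1 / ((of_real x - s) * (of_real x - cnj s)))"
    "(LINT x|lborel. 1 / ((of_real x - s) * (of_real x - cnj s))) = of_real (pi / Im s)"
proof -
  have ne: "of_real x - s \<noteq> 0" for x using assms by (auto simp: complex_eq_iff)
  have cont: "continuous_on UNIV (\<lambda>x. 1 / (of_real x - s) ^ 2)"
    using ne by (intro continuous_intros) auto
  show i1: "integrable lborel (\<lambda>x. 1 / (of_real x - s) ^ 2)"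
  proof (rule Bochner_Integration.integrable_bound[OF real_kernel_integrable(1)[OF assms]])
    show "(\<lambda>x. 1 / (of_real x - s) ^ 2) \<in> borel_measurable lborel"
      using borel_measurable_continuous_onI[OF cont] by simp
  qed (auto simp: norm_divide norm_power)
  have eq: "1 / ((of_real x - s) * (of_real x - cnj s)) = of_real (1 / cmod (of_real x - s) ^ 2)" for x
  proof -
    have "of_real x - cnj s = cnj (of_real x - s)" by simp
    then have "(of_real x - s) * (of_real x - cnj s) = of_real (cmod (of_real x - s) ^ 2)"
      by (metis complex_norm_square of_real_power)
    then show ?thesis by simp
  qed
  show "integrable lborel (\<lambda>x. 1 / ((of_real x - s) * (of_real x - cnj s)))"
    unfolding eq by (rule integrable_of_real[OF real_kernel_integrable(1)[OF assms]])
  have "(LINT x|lborel. complex_of_real (1 / cmod (of_real x - s) ^ 2)) = of_real (LINT x|lborel. 1 / cmod (of_real x - s) ^ 2)"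
    by (rule integral_of_real[OF real_kernel_integrable(1)[OF assms]])
  then show "(LINT x|lborel. 1 / ((of_real x - s) * (of_real x - cnj s))) = of_real (pi / Im s)"
    unfolding eq real_kernel_integrable(2)[OF assms] .
  have "(LINT x:{- real n..real n}|lborel. 1 / (of_real x - s) ^ 2) = 1 / (of_real (- real n) - s) - 1 / (of_real (real n) - s)" for n
  proof (rule set_LINT_Icc_of_has_integral(2))
    show "continuous_on {- real n..real n} (\<lambda>x. 1 / (of_real x - s) ^ 2)" using cont continuous_on_subset by blast
    have "((\<lambda>x. 1 / (of_real x - s) ^ 2) has_integral (- 1 / (of_real (real n) - s)) - (- 1 / (of_real (- real n) - s))) {- real n..real n}"
    proof (rule fundamental_theorem_of_calculus)
      fix x :: real
      have "((\<lambda>z. - 1 / (z - s)) has_field_derivative 1 / (of_real x - s)^2) (at (of_real x))"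
        using ne[of x] by (auto intro!: derivative_eq_intros simp: power2_eq_square)
      from has_vector_derivative_real_field[OF this]
      show "((\<lambda>x. - 1 / (of_real x - s)) has_vector_derivative 1 / (of_real x - s)^2) (at x within {- real n..real n})"
        by (simp add: has_vector_derivative_at_within)
    qed simp
    then show "((\<lambda>x. 1 / (of_real x - s) ^ 2) has_integral 1 / (of_real (- real n) - s) - 1 / (of_real (real n) - s)) {- real n..real n}"
      by simp
  qed
  moreover have "(\<lambda>n. 1 / (of_real (- real n) - s) - 1 / (of_real (real n) - s)) \<longlonglongrightarrow> 0 - 0"
  proof (intro tendsto_diff)
    have "filterlim (\<lambda>n. - s + of_real (real n)) at_infinity sequentially"
      by (rule tendsto_add_filterlim_at_infinity[OF tendsto_const]) 
         (simp add: filterlim_at_infinity_conv_norm_at_top filterlim_real_sequentially)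
    from tendsto_inverse_0[THEN filterlim_compose, OF this]
    show "(\<lambda>n. 1 / (of_real (real n) - s)) \<longlonglongrightarrow> 0" by (simp add: divide_inverse)
    have "filterlim (\<lambda>n. - s + of_real (- real n)) at_infinity sequentially"
      by (rule tendsto_add_filterlim_at_infinity[OF tendsto_const]) 
         (simp add: filterlim_at_infinity_conv_norm_at_top filterlim_real_sequentially)
    from tendsto_inverse_0[THEN filterlim_compose, OF this]
    show "(\<lambda>n. 1 / (of_real (- real n) - s)) \<longlonglongrightarrow> 0" by (simp add: divide_inverse minus_diff_commute)
  qed
  ultimately have "(\<lambda>n. LINT x:{- real n..real n}|lborel. 1 / (of_real x - s) ^ 2) \<longlonglongrightarrow> 0" by simp
  then show "(LINT x|lborel. 1 / (of_real x - s) ^ 2) = 0"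
    using LIMSEQ_unique[OF set_LINT_at_symmetric_limit[OF i1]] by simp
qed

section \<open>Analytic continuations of the two logarithms\<close>

context jcurve begin

lemma jr_has_derivative:
  assumes "x < -1 \<or> x > 0"
  shows "\<exists>C>0. (jr has_real_derivative C * ((x - sa) * (x - sb)) / (x * (x + 1))) (at x)"
proof -
  define C where "C = c1 * ((x + 1) / x) powr (1 / \<theta>)"
  have q: "(x + 1) / x > 0" using assms by (auto simp: zero_less_divide_iff)
  have "(x + 1) / x \<noteq> 0" using q by (rule less_imp_neq[symmetric])
  then have "((x + 1) / x) powr (1 / \<theta>) > 0" by (simp only: powr_gt_zero not_False_eq_True)
  then have C: "C > 0" unfolding C_def by (rule mult_pos_pos[OF c1])
  define d where "d = C * ((x - sa) * (x - sb)) / (x * (x + 1))"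
  have "((complex_of_real x + 1) / of_real x) powr of_real (1 / \<theta>) = of_real (((x + 1) / x) powr (1 / \<theta>))"
    using powr_of_real[of "(x + 1) / x" "1 / \<theta>"] q by simp
  then have "of_real c1 * ((of_real x + 1) / of_real x) powr (of_real (1 / \<theta>)) *
     ((of_real x - of_real sa) * (of_real x - of_real sb)) / (of_real x * (of_real x + 1)) = complex_of_real d"
    by (simp add: d_def C_def)
  then have "(J has_field_derivative of_real d) (at (of_real x))"
    using J_has_derivative[OF off_cut_real[OF assms]] by simp
  then have "((\<lambda>x. J (of_real x)) has_vector_derivative of_real d) (at x)"
    by (rule has_vector_derivative_real_field)
  then have dR: "((\<lambda>x. Re (J (of_real x))) has_real_derivative d) (at x)"
    unfolding has_vector_derivative_complex_iff has_real_derivative_iff_has_vector_derivative by simp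
  have "open ({..<-1} \<union> {0<..} :: real set)" by auto
  then have "\<forall>\<^sub>F y in nhds x. y \<in> {..<-1} \<union> {0<..}" by (rule eventually_nhds_in_open) (use assms in auto)
  then have "\<forall>\<^sub>F y in nhds x. Re (J (of_real y)) = jr y"
    by eventually_elim (auto simp: J_of_real)
  from DERIV_cong_ev[OF refl this refl] have "(jr has_real_derivative d) (at x)" using dR by simp
  then show ?thesis using C unfolding d_def by blast
qed

text \<open>On the positive axis \<open>sb\<close> is the only critical point of \<open>jr\<close>,
  and it is a minimum. Likewise \<open>sa\<close> gives a maximum on the part of the axis left of
  -1.\<close>

lemma jr_ge_b: assumes "x > 0" shows "b \<le> jr x"
proof (cases "sb \<le> x")
  case True
  have "jr sb \<le> jr x"
  proof (rule DERIV_nonneg_imp_nondecreasing[OF True])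
    fix z assume z: "sb \<le> z" "z \<le> x"
    have p: "z > 0" using z sb_pos by linarith
    then obtain C where C: "C > 0" "(jr has_real_derivative C * ((z - sa) * (z - sb)) / (z * (z + 1))) (at z)"
      using jr_has_derivative by blast
    moreover have "0 \<le> C * ((z - sa) * (z - sb)) / (z * (z + 1))"
      using C(1) z p sab by (intro divide_nonneg_nonneg mult_nonneg_nonneg) auto
    ultimately show "\<exists>y. (jr has_real_derivative y) (at z) \<and> 0 \<le> y" by blast
  qed
  then show ?thesis by (simp add: J_b_eq)
next
  case False
  have "jr sb \<le> jr x"
  proof (rule DERIV_nonpos_imp_nonincreasing[where f = jr and a = x and b = sb])
    show "x \<le> sb" using False by simp
    fix z assume z: "x \<le> z" "z \<le> sb"
    have p: "z > 0" using z assms by linarith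
    then obtain C where C: "C > 0" "(jr has_real_derivative C * ((z - sa) * (z - sb)) / (z * (z + 1))) (at z)"
      using jr_has_derivative by blast
    have A: "(z - sa) * (z - sb) \<le> 0" using z p sa_less by (intro mult_nonneg_nonpos) auto
    have B: "0 \<le> z * (z + 1)" using p by (intro mult_nonneg_nonneg) auto
    have "C * ((z - sa) * (z - sb)) / (z * (z + 1)) \<le> 0"
      by (rule divide_nonpos_nonneg[OF mult_nonneg_nonpos[OF less_imp_le[OF C(1)] A] B])
    then show "\<exists>y. (jr has_real_derivative y) (at z) \<and> y \<le> 0" using C by blast
  qed
  then show ?thesis by (simp add: J_b_eq)
qed

lemma jr_le_a: assumes "x < -1" shows "jr x \<le> a"
proof (cases "x \<le> sa")
  case True
  have "jr x \<le> jr sa"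
  proof (rule DERIV_nonneg_imp_nondecreasing[OF True])
    fix z assume z: "x \<le> z" "z \<le> sa"
    have p: "z < -1" using z sa_less by linarith
    then obtain C where C: "C > 0" "(jr has_real_derivative C * ((z - sa) * (z - sb)) / (z * (z + 1))) (at z)"
      using jr_has_derivative by blast
    have A: "0 \<le> (z - sa) * (z - sb)" using z p sab by (intro mult_nonpos_nonpos) auto
    have B: "0 \<le> z * (z + 1)" using p by (intro mult_nonpos_nonpos) auto
    have "0 \<le> C * ((z - sa) * (z - sb)) / (z * (z + 1))"
      by (rule divide_nonneg_nonneg[OF mult_nonneg_nonneg[OF less_imp_le[OF C(1)] A] B])
    then show "\<exists>y. (jr has_real_derivative y) (at z) \<and> 0 \<le> y" using C by blast
  qed
  then show ?thesis by (simp add: J_a_eq)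
next
  case False
  have "jr x \<le> jr sa"
  proof (rule DERIV_nonpos_imp_nonincreasing[where f = jr and a = sa and b = x])
    show "sa \<le> x" using False by simp
    fix z assume z: "sa \<le> z" "z \<le> x"
    have p: "z < -1" using z assms by linarith
    then obtain C where C: "C > 0" "(jr has_real_derivative C * ((z - sa) * (z - sb)) / (z * (z + 1))) (at z)"
      using jr_has_derivative by blast
    have A: "(z - sa) * (z - sb) \<le> 0" using z p sb_pos by (intro mult_nonneg_nonpos) auto
    have B: "0 \<le> z * (z + 1)" using p by (intro mult_nonpos_nonpos) auto
    have "C * ((z - sa) * (z - sb)) / (z * (z + 1)) \<le> 0"
      by (rule divide_nonpos_nonneg[OF mult_nonneg_nonpos[OF less_imp_le[OF C(1)] A] B])
    then show "\<exists>y. (jr has_real_derivative y) (at z) \<and> y \<le> 0" using C by blast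
  qed
  then show ?thesis by (simp add: J_a_eq)
qed

text \<open>The $\theta$-th power of the map continues analytically across the cut $[-1,0]$;
  \<open>Q0\<close> is this continuation multiplied by $s/(s+1)$.\<close>
definition Q0 :: "complex \<Rightarrow> complex" where
  "Q0 s = of_real (c1 powr \<theta>) * exp (of_real \<theta> * Ln (s + of_real c))"

text \<open>J s - (y - i eta), divided by s so that it tends to c1 at infinity and its logarithm
  stays bounded there.\<close>

definition eo_arg :: "real \<Rightarrow> real \<Rightarrow> complex \<Rightarrow> complex" where
  "eo_arg y \<eta> s = (J s - Complex y (- \<eta>)) / s"

text \<open>s times J^theta - (y^theta + i eta): since s J^theta = (s + 1) \<open>Q0\<close>, the
  factor s removes the pole at 0.\<close>

definition ei_arg :: "real \<Rightarrow> real \<Rightarrow> complex \<Rightarrow> complex" where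
  "ei_arg y \<eta> s = (s + 1) * Q0 s - Complex (y powr \<theta>) \<eta> * s"

definition eo where "eo y \<eta> s = Ln (eo_arg y \<eta> s)"
text \<open>With this sign the terms Ln s cancel in \<open>eo - ei\<close>, which leaves the two
  logarithms of the kernel.\<close>

definition ei where "ei y \<eta> s = - Ln (ei_arg y \<eta> s)"
definition Uo where "Uo y \<eta> = {s \<in> slit. eo_arg y \<eta> s \<notin> \<real>\<^sub>\<le>\<^sub>0}"
definition Ui where "Ui y \<eta> = {s \<in> {s. s + of_real c \<notin> \<real>\<^sub>\<le>\<^sub>0}. ei_arg y \<eta> s \<notin> \<real>\<^sub>\<le>\<^sub>0}"

lemma slit_nonzero: "s \<in> slit \<Longrightarrow> s \<noteq> 0" by (auto simp: slit_eq)

lemma eo_arg_holomorphic: "eo_arg y \<eta> holomorphic_on slit"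
  unfolding eo_arg_def by (intro holomorphic_intros J_holomorphic) (use slit_nonzero in auto)

lemma open_Uo: "open (Uo y \<eta>)"
proof -
  have "open (slit \<inter> eo_arg y \<eta> -` (- \<real>\<^sub>\<le>\<^sub>0))"
    by (rule continuous_open_preimage[OF holomorphic_on_imp_continuous_on[OF eo_arg_holomorphic] open_slit]) 
       (simp add: open_Compl)
  also have "slit \<inter> eo_arg y \<eta> -` (- \<real>\<^sub>\<le>\<^sub>0) = Uo y \<eta>" by (auto simp: Uo_def)
  finally show ?thesis .
qed

lemma eo_holomorphic: "eo y \<eta> holomorphic_on Uo y \<eta>"
proof -
  have "eo_arg y \<eta> holomorphic_on Uo y \<eta>"
    by (rule holomorphic_on_subset[OF eo_arg_holomorphic]) (auto simp: Uo_def)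
  then show ?thesis unfolding eo_def by (intro holomorphic_intros) (auto simp: Uo_def)
qed

lemma open_shifted: "open {s. s + complex_of_real c \<notin> \<real>\<^sub>\<le>\<^sub>0}"
proof -
  have "open ((\<lambda>s. s + complex_of_real c) -` (- \<real>\<^sub>\<le>\<^sub>0))"
    by (intro open_vimage open_Compl closed_nonpos_Reals_complex continuous_intros)
  then show ?thesis by (simp add: vimage_def)
qed

lemma Q0_holomorphic: "Q0 holomorphic_on {s. s + of_real c \<notin> \<real>\<^sub>\<le>\<^sub>0}"
  unfolding Q0_def by (intro holomorphic_intros) auto

lemma ei_arg_holomorphic: "ei_arg y \<eta> holomorphic_on {s. s + of_real c \<notin> \<real>\<^sub>\<le>\<^sub>0}"
  unfolding ei_arg_def by (intro holomorphic_intros Q0_holomorphic)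

lemma open_Ui: "open (Ui y \<eta>)"
proof -
  have "open ({s. s + of_real c \<notin> \<real>\<^sub>\<le>\<^sub>0} \<inter> ei_arg y \<eta> -` (- \<real>\<^sub>\<le>\<^sub>0))"
    by (rule continuous_open_preimage[OF holomorphic_on_imp_continuous_on[OF ei_arg_holomorphic] open_shifted]) 
       (simp add: open_Compl)
  also have "{s. s + of_real c \<notin> \<real>\<^sub>\<le>\<^sub>0} \<inter> ei_arg y \<eta> -` (- \<real>\<^sub>\<le>\<^sub>0) = Ui y \<eta>" by (auto simp: Ui_def)
  finally show ?thesis .
qed

lemma ei_holomorphic: "ei y \<eta> holomorphic_on Ui y \<eta>"
proof -
  have "ei_arg y \<eta> holomorphic_on Ui y \<eta>"
    by (rule holomorphic_on_subset[OF ei_arg_holomorphic]) (auto simp: Ui_def)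
  then show ?thesis unfolding ei_def by (intro holomorphic_intros holomorphic_on_Ln) (auto simp: Ui_def)
qed

lemma quotient_off_cut:
  assumes "Im s > 0" "Im z > 0" shows "z / s \<notin> \<real>\<^sub>\<le>\<^sub>0"
proof
  assume "z / s \<in> \<real>\<^sub>\<le>\<^sub>0"
  then obtain r where r: "r \<le> 0" "z / s = of_real r" by (auto simp: nonpos_Reals_def)
  have "s \<noteq> 0" using assms by auto
  then have "z = of_real r * s" using r(2) by (simp add: field_simps)
  then have "Im z = r * Im s" by simp
  then show False using assms r(1) mult_nonpos_nonneg[of r "Im s"] by auto
qed

lemma product_off_cut:
  assumes "Im s > 0" "Im z < 0" shows "s * z \<notin> \<real>\<^sub>\<le>\<^sub>0"
proof
  assume "s * z \<in> \<real>\<^sub>\<le>\<^sub>0"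
  then obtain r where r: "r \<le> 0" "s * z = of_real r" by (auto simp: nonpos_Reals_def)
  have "s \<noteq> 0" using assms by auto
  then have z: "z = of_real r / s" using r(2) by (simp add: field_simps)
  have "Im z = - r * Im s / ((Re s)^2 + (Im s)^2)" unfolding z by (simp add: Im_divide power2_eq_square)
  moreover have "0 \<le> - r * Im s / ((Re s)^2 + (Im s)^2)"
    using assms r(1) by (intro divide_nonneg_nonneg mult_nonneg_nonneg) auto
  ultimately show False using assms by auto
qed

text \<open>Outside the curve Im J is nonnegative, so subtracting y - i eta leads into the open
  upper half-plane, and a quotient of two points of the upper half-plane avoids the cut. On the axis
  the imaginary part is eta / x.\<close>

lemma Dout_subset_Uo: assumes "\<eta> > 0" shows "Dout \<subseteq> Uo y \<eta>"
proof
  fix s assume s: "s \<in> Dout"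
  show "s \<in> Uo y \<eta>"
  proof (cases "Im s > 0")
    case True
    then have "Im (J s) \<ge> 0" using s by (auto simp: Dout_def)
    then have "eo_arg y \<eta> s \<notin> \<real>\<^sub>\<le>\<^sub>0" unfolding eo_arg_def
      using True assms by (intro quotient_off_cut) auto
    then show ?thesis using True by (auto simp: Uo_def slit_eq)
  next
    case False
    then have I0: "Im s = 0" and R: "Re s \<le> sa \<or> sb \<le> Re s" using s by (auto simp: Dout_def)
    then have x: "Re s < -1 \<or> Re s > 0" using sa_less sb_pos by auto
    have s_eq: "s = of_real (Re s)" using I0 by (simp add: complex_eq_iff)
    have "Im (eo_arg y \<eta> s) = \<eta> / Re s"
      unfolding eo_arg_def by (subst (1 2) s_eq) (simp add: J_of_real[OF x] Im_divide_of_real)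
    then have "eo_arg y \<eta> s \<notin> \<real>\<^sub>\<le>\<^sub>0" using assms x by (auto simp: complex_nonpos_Reals_iff)
    then show ?thesis using x by (auto simp: Uo_def slit_eq)
  qed
qed

lemma Q0_upper:
  assumes "Im s > 0"
  shows "(s + 1) * Q0 s = s * (of_real (c1 powr \<theta>) * exp (of_real \<theta> * Lam s))"
proof -
  have s: "s \<noteq> 0" "s + 1 \<noteq> 0" using assms by (auto simp: complex_eq_iff)
  have "of_real \<theta> * Lam s = of_real \<theta> * Ln (s + of_real c) + (Ln (s + 1) - Ln s)"
    unfolding Lam_def using th by (simp add: distrib_left)
  then have "exp (of_real \<theta> * Lam s) = exp (of_real \<theta> * Ln (s + of_real c)) * ((s + 1) / s)"
    using s by (simp add: exp_add exp_diff)
  then show ?thesis using s by (simp add: Q0_def)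
qed

lemma Q0_real: assumes "- c < x" shows "Q0 (of_real x) = of_real ((c1 * (x + c)) powr \<theta>)"
proof -
  have p: "x + c > 0" using assms by simp
  have "exp (of_real \<theta> * Ln (of_real x + of_real c)) = complex_of_real (exp (\<theta> * ln (x + c)))"
    using p Ln_of_real[of "x + c"] by (simp add: exp_of_real[symmetric])
  moreover have "(c1 * (x + c)) powr \<theta> = c1 powr \<theta> * exp (\<theta> * ln (x + c))"
    using p c1 powr_mult[of c1 "x + c" \<theta>] by (simp add: powr_def[of "x + c"])
  ultimately show ?thesis unfolding Q0_def by (simp only: of_real_mult)
qed

text \<open>Inside the curve Im Lam lies in (- pi / theta, 0], so the argument of J^theta lies in (-
  pi, 0].\<close>

lemma Im_Q_nonpos:
  assumes "Im s > 0" "Im (J s) \<le> 0"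
  shows "Im (of_real (c1 powr \<theta>) * exp (of_real \<theta> * Lam s)) \<le> 0"
proof -
  have "Im (Lam s) \<le> 0" using sgn_Im_J[OF assms(1)] assms(2) by (auto simp: sgn_if split: if_splits)
  moreover have "- pi < \<theta> * Im (Lam s)" using Im_Lam_bounds(1)[OF assms(1)] th by (simp add: field_simps)
  ultimately have "sin (- (\<theta> * Im (Lam s))) \<ge> 0" using th by (intro sin_ge_zero) (auto simp: mult_nonneg_nonpos)
  then show ?thesis by (simp add: Im_exp mult_nonneg_nonpos)
qed

text \<open>The mirror situation: inside, Im J^theta is at most 0, so subtracting y^theta + i eta
  leads into the open lower half-plane, and the product with a point of the upper half-plane avoids
  the cut. On the axis the imaginary part is - eta x, and at x = 0 the value is (c1 c)^theta >
  0.\<close>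

lemma Din_subset_Ui: assumes "\<eta> > 0" shows "Din \<subseteq> Ui y \<eta>"
proof
  fix s assume s: "s \<in> Din"
  show "s \<in> Ui y \<eta>"
  proof (cases "Im s > 0")
    case True
    define Q where "Q = of_real (c1 powr \<theta>) * exp (of_real \<theta> * Lam s)"
    have "Im Q \<le> 0" unfolding Q_def using Im_Q_nonpos True s by (auto simp: Din_def)
    then have "s * (Q - Complex (y powr \<theta>) \<eta>) \<notin> \<real>\<^sub>\<le>\<^sub>0" using True assms by (intro product_off_cut) auto
    moreover have "s * (Q - Complex (y powr \<theta>) \<eta>) = ei_arg y \<eta> s"
      unfolding ei_arg_def Q0_upper[OF True] Q_def[symmetric] by (simp add: algebra_simps)
    ultimately show ?thesis using True by (auto simp: Ui_def complex_nonpos_Reals_iff)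
  next
    case False
    then have I0: "Im s = 0" and R: "sa \<le> Re s" "Re s \<le> sb" using s by (auto simp: Din_def)
    have s_eq: "s = of_real (Re s)" using I0 by (simp add: complex_eq_iff)
    have p: "- c < Re s" using R sa_gt by linarith
    have e: "ei_arg y \<eta> s = of_real ((Re s + 1) * (c1 * (Re s + c)) powr \<theta>) - Complex (y powr \<theta>) \<eta> * of_real (Re s)"
      unfolding ei_arg_def by (subst (1 2 3) s_eq) (simp add: Q0_real[OF p])
    have "ei_arg y \<eta> s \<notin> \<real>\<^sub>\<le>\<^sub>0"
    proof (cases "Re s = 0")
      case True
      then show ?thesis unfolding e using c1 c_gt_1 by (simp add: complex_nonpos_Reals_iff)
    next
      case False
      then show ?thesis unfolding e using assms by (simp add: complex_nonpos_Reals_iff)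
    qed
    then show ?thesis using p I0 by (auto simp: Ui_def complex_nonpos_Reals_iff)
  qed
qed

text \<open>On the arc \<open>Lam\<close> is real, so J^theta takes the value x^theta. The arguments
  of all factors are placed so that the logarithms of the quotient and of the product split without
  a multiple of 2 pi i.\<close>

lemma eo_minus_ei_curve:
  assumes x: "x \<in> {a<..<b}" and \<eta>: "\<eta> > 0"
  shows "eo y \<eta> (I x) - ei y \<eta> (I x) = Ln (Complex (x - y) \<eta>) + Ln (Complex (x powr \<theta> - y powr \<theta>) (- \<eta>))"
proof -
  define t where "t = I x"
  have t: "Im t > 0" "J t = of_real x" using I_upper[OF x] J_I[OF x] by (auto simp: t_def)
  have t0: "t \<noteq> 0" using t by auto
  have x0: "x > 0" using x a_pos by auto
  have L0: "Im (Lam t) = 0" using J_pos_of_Im_zero(2)[OF t(1)] t(2) by simp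
  have "of_real x = of_real c1 * exp (Lam t)" using J_upper[OF t(1)] t(2) by simp
  moreover have Lr: "Lam t = of_real (Re (Lam t))" using L0 by (simp add: complex_eq_iff)
  ultimately have "complex_of_real x = of_real (c1 * exp (Re (Lam t)))" by (metis exp_of_real of_real_mult)
  then have xe: "x = c1 * exp (Re (Lam t))" by (simp only: of_real_eq_iff)
  have "of_real (c1 powr \<theta>) * exp (of_real \<theta> * Lam t) = complex_of_real (c1 powr \<theta> * exp (\<theta> * Re (Lam t)))"
    by (subst Lr) (simp flip: exp_of_real)
  also have "c1 powr \<theta> * exp (\<theta> * Re (Lam t)) = x powr \<theta>"
    unfolding xe using c1 by (simp add: powr_def ln_mult exp_add distrib_left)
  finally have "(t + 1) * Q0 t = t * of_real (x powr \<theta>)" using Q0_upper[OF t(1)] by simp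
  then have ia: "ei_arg y \<eta> t = t * Complex (x powr \<theta> - y powr \<theta>) (- \<eta>)"
    unfolding ei_arg_def by (simp add: complex_eq_iff algebra_simps)
  have oa: "eo_arg y \<eta> t = Complex (x - y) \<eta> / t" 
  proof -
    have "of_real x - Complex y (- \<eta>) = Complex (x - y) \<eta>" by (simp add: complex_eq_iff)
    then show ?thesis unfolding eo_arg_def t(2) by simp
  qed
  have Lt: "0 < Im (Ln t)" "Im (Ln t) < pi" using Im_Ln_pos_lt_imp[OF t(1)] by auto
  define z where "z = Complex (x - y) \<eta>"
  define w where "w = Complex (x powr \<theta> - y powr \<theta>) (- \<eta>)"
  have z: "Im z > 0" "z \<noteq> 0" using \<eta> by (auto simp: z_def complex_eq_iff)
  have w: "Im w < 0" "w \<noteq> 0" using \<eta> by (auto simp: w_def complex_eq_iff)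
  have Lz: "0 < Im (Ln z)" "Im (Ln z) < pi" using Im_Ln_pos_lt_imp[OF z(1)] by auto
  have Lw: "Im (Ln w) < 0" using Im_Ln_pos_le[OF w(2)] w(1) Im_Ln_le_pi[OF w(2)] by linarith
  have "- pi < Im (Ln w)" using mpi_less_Im_Ln[OF w(2)] .
  then have 1: "Ln (t * w) = Ln t + Ln w" using Lt Lw t0 w by (intro Ln_times_simple) auto
  have 2: "Ln (z / t) = Ln z - Ln t"
    by (rule Ln_unique) (use Lz Lt t0 z in \<open>auto simp: exp_diff\<close>)
  show ?thesis unfolding eo_def ei_def t_def[symmetric] oa ia z_def[symmetric] w_def[symmetric] 1 2 by simp
qed

lemma eo_arg_at_infinity: "(eo_arg y \<eta> \<longlongrightarrow> of_real c1) at_infinity"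
proof -
  have i: "((\<lambda>s::complex. 1 / s) \<longlongrightarrow> 0) at_infinity"
    using tendsto_inverse_0 by (simp add: divide_inverse)
  have "((\<lambda>s::complex. (1 + 1 / s) powr of_real (1 / \<theta>)) \<longlongrightarrow> (1 + 0) powr of_real (1 / \<theta>)) at_infinity"
    by (intro tendsto_intros i) auto
  then have "((\<lambda>s::complex. (of_real c1 + of_real c0 * (1 / s)) * (1 + 1 / s) powr of_real (1 / \<theta>) - Complex y (- \<eta>) * (1 / s))
      \<longlongrightarrow> (of_real c1 + of_real c0 * 0) * 1 - Complex y (- \<eta>) * 0) at_infinity"
    by (intro tendsto_diff tendsto_mult tendsto_add tendsto_const i) simp
  then have "((\<lambda>s::complex. (of_real c1 + of_real c0 * (1 / s)) * (1 + 1 / s) powr of_real (1 / \<theta>) - Complex y (- \<eta>) * (1 / s)) \<longlongrightarrow> of_real c1) at_infinity"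
    by simp
  moreover have "\<forall>\<^sub>F s in at_infinity. (of_real c1 + of_real c0 * (1 / s)) * (1 + 1 / s) powr of_real (1 / \<theta>) - Complex y (- \<eta>) * (1 / s) = eo_arg y \<eta> s"
    unfolding eventually_at_infinity
  proof (intro exI allI impI)
    fix s :: complex assume "1 \<le> norm s"
    then have s: "s \<noteq> 0" by auto
    have "1 + 1 / s = (s + 1) / s" using s by (simp add: field_simps)
    then have "eo_arg y \<eta> s = ((of_real c1 * s + of_real c0) * (1 + 1 / s) powr of_real (1 / \<theta>) - Complex y (- \<eta>)) / s"
      by (simp add: eo_arg_def Jt_def)
    also have "\<dots> = (of_real c1 + of_real c0 * (1 / s)) * (1 + 1 / s) powr of_real (1 / \<theta>) - Complex y (- \<eta>) * (1 / s)"
      by (simp add: diff_divide_distrib add_divide_distrib s distrib_right)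
    finally show "(of_real c1 + of_real c0 * (1 / s)) * (1 + 1 / s) powr of_real (1 / \<theta>) - Complex y (- \<eta>) * (1 / s) = eo_arg y \<eta> s" by simp
  qed
  ultimately show ?thesis by (rule Lim_transform_eventually)
qed

lemma eo_bounded_at_infinity: "\<exists>R M. \<forall>s. R \<le> cmod s \<longrightarrow> cmod (eo y \<eta> s) \<le> M"
proof -
  have "((\<lambda>s. eo y \<eta> s) \<longlongrightarrow> of_real (ln c1)) at_infinity"
    unfolding eo_def by (rule Ln_tendsto_real[OF eo_arg_at_infinity c1])
  then have "\<forall>\<^sub>F s in at_infinity. dist (eo y \<eta> s) (of_real (ln c1)) < 1" by (rule tendstoD) simp
  then obtain R where R: "\<And>s. R \<le> cmod s \<Longrightarrow> dist (eo y \<eta> s) (of_real (ln c1)) < 1"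
    unfolding eventually_at_infinity by blast
  have "cmod (eo y \<eta> s) \<le> \<bar>ln c1\<bar> + 1" if "R \<le> cmod s" for s
    using R[OF that] norm_triangle_ineq2[of "eo y \<eta> s" "of_real (ln c1)"] by (simp add: dist_norm)
  then show ?thesis by blast
qed

lemma eo_deriv:
  assumes s: "Im s > 0" "Im (J s) > 0" and \<eta>: "\<eta> > 0"
  shows "deriv (eo y \<eta>) s = (J s / qf s) / (J s - Complex y (- \<eta>)) - 1 / s"
proof (rule DERIV_imp_deriv)
  have sl: "s \<in> slit" and s0: "s \<noteq> 0" using s by (auto simp: slit_eq)
  have ne: "s \<noteq> - of_real c" "s \<noteq> of_real sa" "s \<noteq> of_real sb" using s by auto
  have sD: "s \<in> Dout" using s by (simp add: Dout_def)
  have nr: "(J s - Complex y (- \<eta>)) / s \<notin> \<real>\<^sub>\<le>\<^sub>0" using Dout_subset_Uo[OF \<eta>, of y] sD by (auto simp: Uo_def eo_arg_def)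
  have z: "J s - Complex y (- \<eta>) \<noteq> 0" using s \<eta> by (auto simp: complex_eq_iff)
  have "((\<lambda>s. (J s - Complex y (- \<eta>)) / s) has_field_derivative
      (J s / qf s * s - (J s - Complex y (- \<eta>)) * 1) / (s * s)) (at s)"
    by (rule DERIV_divide) (use s0 deriv_J_qf(1)[OF sl ne] in \<open>auto intro!: derivative_eq_intros\<close>)
  from DERIV_chain2[OF has_field_derivative_Ln[OF nr] this]
  have "(eo y \<eta> has_field_derivative inverse ((J s - Complex y (- \<eta>)) / s) * ((J s / qf s * s - (J s - Complex y (- \<eta>)) * 1) / (s * s))) (at s)"
    unfolding eo_def[abs_def] eo_arg_def[abs_def] .
  also have "inverse ((J s - Complex y (- \<eta>)) / s) * ((J s / qf s * s - (J s - Complex y (- \<eta>)) * 1) / (s * s))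
     = (J s / qf s) / (J s - Complex y (- \<eta>)) - 1 / s"
  proof -
    have "inverse (Z / s) * ((D * s - Z * 1) / (s * s)) = D / Z - 1 / s" if "Z \<noteq> 0" for Z D
      using that s0 by (simp add: field_simps)
    from this[OF z] show ?thesis .
  qed
  finally show "(eo y \<eta> has_field_derivative (J s / qf s) / (J s - Complex y (- \<eta>)) - 1 / s) (at s)" .
qed

end

lemma set_LINT_cnj: "(LINT x:S|M. cnj (f x)) = cnj (LINT x:S|M. f x)"
  unfolding set_lebesgue_integral_def complex_cnj_scaleR[symmetric] by (rule Bochner_Integration.integral_cnj)

lemma set_integrable_cnj: "set_integrable M S f \<Longrightarrow> set_integrable M S (\<lambda>x. cnj (f x))"
  unfolding set_integrable_def complex_cnj_scaleR[symmetric] by (rule integrable_cnj)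

lemma set_integrable_of_integrable:
  fixes f :: "real \<Rightarrow> complex"
  shows "integrable lborel f \<Longrightarrow> S \<in> sets lborel \<Longrightarrow> set_integrable lborel S f"
  unfolding set_integrable_def by (rule integrable_mult_indicator)

section \<open>The kernel identity for eta > 0\<close>

context jcurve begin

definition rout :: "real set" where "rout = {..sa} \<union> {sb..}"

lemma rout_borel [simp, measurable]: "rout \<in> sets borel" by (auto simp: rout_def)

lemma rout_sets: "rout \<in> sets lborel" by simp

lemma split_real_line:
  fixes g :: "real \<Rightarrow> complex"
  assumes "set_integrable lborel rout g" "set_integrable lborel {sa<..<sb} g"
  shows "integrable lborel g" "(LINT x|lborel. g x) = (LINT x:rout|lborel. g x) + (LINT x:{sa<..<sb}|lborel. g x)"
proof -
  have U: "rout \<union> {sa<..<sb} = UNIV" "rout \<inter> {sa<..<sb} = {}" using sab by (auto simp: rout_def)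
  have "set_integrable lborel UNIV g" using set_integrable_Un[OF assms rout_sets] U(1) by simp
  then show "integrable lborel g" by (simp add: set_integrable_def)
  show "(LINT x|lborel. g x) = (LINT x:rout|lborel. g x) + (LINT x:{sa<..<sb}|lborel. g x)"
    using set_integral_Un[OF U(2) assms] unfolding U(1) by (simp add: set_lebesgue_integral_def)
qed

text \<open>The imaginary parts on the real axis of the outer continuation outside the curve and of
  the inner one inside; they are the defect of the identity for eta > 0.\<close>

definition Imb :: "real \<Rightarrow> real \<Rightarrow> real \<Rightarrow> real" where
  "Imb y \<eta> x = (if x \<in> rout then Im (eo y \<eta> (of_real x)) else Im (ei y \<eta> (of_real x)))"

definition Kc :: "real \<Rightarrow> real \<Rightarrow> real \<Rightarrow> complex" where
  "Kc y \<eta> x = Ln (Complex (x - y) \<eta>) + Ln (Complex (x powr \<theta> - y powr \<theta>) (- \<eta>))"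

text \<open>On the arc the kernel is \<open>eo - ei\<close>. The part with \<open>eo\<close> is
  pushed outwards and picks up the double pole at s0, the part with \<open>ei\<close> is pushed
  inwards. In the second integral the pole cnj s0 lies in the lower half-plane and leaves no
  residue; after conjugation its kernel on the axis is again 1/(x - s0)^2, so both integrals combine
  to the imaginary parts \<open>Imb\<close>.\<close>

lemma regularized_kernel_identity:
  assumes s: "Im s0 > 0" "Im (J s0) > 0" and \<eta>: "\<eta> > 0"
  shows "(LINT x:{a<..<b}|lborel. Kc y \<eta> x * (I' x / (I x - s0)^2))
      - (LINT x:{a<..<b}|lborel. cnj (Kc y \<eta> x * (I' x / (I x - cnj s0)^2)))
    = 2 * of_real pi * \<i> * deriv (eo y \<eta>) s0
      - 2 * \<i> * (LINT x|lborel. of_real (Imb y \<eta> x) / (of_real x - s0)^2)"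
    and "integrable lborel (\<lambda>x. of_real (Imb y \<eta> x) / (of_real x - s0)^2)"
proof -
  define e f where "e = eo y \<eta>" and "f = ei y \<eta>"
  define w where "w = s0 - cnj s0"
  define h1 h2 h3 where "h1 z = 1 / (z - s0)^2" and "h2 z = 1 / ((z - s0) * (z - cnj s0))"
    and "h3 z = 1 / (z - cnj s0)^2" for z
  define d0 where "d0 = deriv e s0"
  define U where "U = Uo y \<eta> \<inter> - {cnj s0}"
  have w: "w = 2 * \<i> * of_real (Im s0)" "w \<noteq> 0" using s by (auto simp: w_def complex_eq_iff)
  have sD: "s0 \<in> Dout" using s by (simp add: Dout_def)
  have sU: "s0 \<in> Uo y \<eta>" using Dout_subset_Uo[OF \<eta>] sD by blast
  have oU: "open U" unfolding U_def by (intro open_Int open_Uo open_Compl) auto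
  have sU2: "s0 \<in> U" using sU s by (auto simp: U_def complex_eq_iff)
  have DU: "Dout \<subseteq> U" using Dout_subset_Uo[OF \<eta>] s by (auto simp: U_def Dout_def)
  define A1 where "A1 z = (if z = s0 then deriv e s0 else (e z - e s0) / (z - s0))" for z
  have "A1 holomorphic_on Uo y \<eta>"
    unfolding A1_def[abs_def] e_def by (rule pole_lemma[OF eo_holomorphic]) (use sU open_Uo in \<open>simp add: interior_open\<close>)
  then have A1: "A1 holomorphic_on U" by (rule holomorphic_on_subset) (auto simp: U_def)
  \<comment> \<open>Besides the constant term, the linear one must be removed to make the quotient
    regular at s0. The term d0 w / ((z - s0) (z - cnj s0)) has residue d0 at s0 and, unlike a bare
    simple pole, the decay |z|^(-2) that \<open>cauchy_out\<close> asks for.\<close>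
  define B1 where "B1 z = A1 z - d0 * w / (z - cnj s0)" for z
  have B1: "B1 holomorphic_on U" unfolding B1_def by (intro holomorphic_intros A1) (auto simp: U_def)
  have B10: "B1 s0 = 0" using w by (simp add: B1_def A1_def d0_def w_def)
  define G where "G z = (if z = s0 then deriv B1 s0 else (B1 z - B1 s0) / (z - s0))" for z
  have G: "G holomorphic_on U"
    unfolding G_def[abs_def] by (rule pole_lemma[OF B1]) (use sU2 oU in \<open>simp add: interior_open\<close>)
  have Geq: "e z * h1 z = G z + e s0 * h1 z + d0 * w * h2 z" if "z \<noteq> s0" for z
  proof -
    have "G z = B1 z / (z - s0)" using that by (simp add: G_def B10)
    also have "\<dots> = (e z - e s0) / (z - s0)^2 - d0 * w / ((z - s0) * (z - cnj s0))"
      using that by (simp add: B1_def A1_def power2_eq_square diff_divide_distrib mult.commute)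
    finally show ?thesis by (simp add: h1_def h2_def diff_divide_distrib)
  qed
  obtain R M where RM: "\<And>z. R \<le> cmod z \<Longrightarrow> cmod (e z) \<le> M" using eo_bounded_at_infinity unfolding e_def by blast
  define R0 where "R0 = max R (2 * cmod s0 + 1)"
  have far: "cmod (h1 z) \<le> 4 / cmod z^2" "cmod (h2 z) \<le> 4 / cmod z^2" "cmod (h3 z) \<le> 4 / cmod z^2" "z \<noteq> s0" "cmod (e z) \<le> M"
    if "R0 \<le> cmod z" for z
  proof -
    have z1: "2 * cmod s0 + 1 \<le> cmod z" "R \<le> cmod z" using that by (auto simp: R0_def)
    have zp: "cmod z > 0" using z1(1) norm_ge_zero[of s0] by linarith
    have l1: "cmod z / 2 \<le> cmod (z - s0)" using norm_triangle_ineq2[of z s0] z1 by linarith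
    have l2: "cmod z / 2 \<le> cmod (z - cnj s0)" 
      using norm_triangle_ineq2[of z "cnj s0"] z1 complex_mod_cnj[of s0] by linarith
    have m: "1 / (p * q) \<le> 4 / cmod z^2" if "cmod z / 2 \<le> p" "cmod z / 2 \<le> q" for p q
    proof -
      have "0 \<le> p" using that(1) zp by linarith
      then have "(cmod z / 2) * (cmod z / 2) \<le> p * q" using that zp mult_mono[of "cmod z / 2" p "cmod z / 2" q] by simp
      moreover have "0 < (cmod z / 2) * (cmod z / 2)" using zp by simp
      ultimately have "1 / (p * q) \<le> 1 / ((cmod z / 2) * (cmod z / 2))" by (intro divide_left_mono) auto
      then show ?thesis by (simp add: power2_eq_square)
    qed
    show "cmod (h1 z) \<le> 4 / cmod z^2" "cmod (h2 z) \<le> 4 / cmod z^2" "cmod (h3 z) \<le> 4 / cmod z^2"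
      using m[OF l1 l1] m[OF l1 l2] m[OF l2 l2] by (simp_all add: h1_def h2_def h3_def norm_divide norm_mult norm_power power2_eq_square)
    show "z \<noteq> s0"
    proof
      assume "z = s0"
      then have "2 * cmod z + 1 \<le> cmod z" using z1(1) by simp
      then show False using norm_ge_zero[of z] by linarith
    qed
    show "cmod (e z) \<le> M" using RM z1 by blast
  qed
  have Gb: "cmod (G z) \<le> (4 * \<bar>M\<bar> + 4 * cmod (e s0) + 4 * cmod (d0 * w)) / cmod z^2" if "R0 \<le> cmod z" for z
  proof -
    note b = far[OF that]
    have "G z = e z * h1 z - e s0 * h1 z - d0 * w * h2 z" using Geq[OF b(4)] by simp
    then have "cmod (G z) = cmod (e z * h1 z - e s0 * h1 z - d0 * w * h2 z)" by (rule arg_cong)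
    then have "cmod (G z) \<le> cmod (e z) * cmod (h1 z) + cmod (e s0) * cmod (h1 z) + cmod (d0 * w) * cmod (h2 z)"
      using norm_triangle_ineq4[of "e z * h1 z - e s0 * h1 z" "d0 * w * h2 z"]
        norm_triangle_ineq4[of "e z * h1 z" "e s0 * h1 z"]
      unfolding norm_mult[of "e z"] norm_mult[of "e s0"] norm_mult[of "d0 * w"] by linarith
    also have "\<dots> \<le> \<bar>M\<bar> * (4 / cmod z^2) + cmod (e s0) * (4 / cmod z^2) + cmod (d0 * w) * (4 / cmod z^2)"
      using b by (intro add_mono mult_mono b) auto
    finally show ?thesis by (simp add: add_divide_distrib mult.commute)
  qed
  have hol3: "(\<lambda>z. e z * h3 z) holomorphic_on U"
    unfolding h3_def e_def by (intro holomorphic_intros holomorphic_on_subset[OF eo_holomorphic]) (auto simp: U_def)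
  have b3: "cmod (e z * h3 z) \<le> (4 * \<bar>M\<bar>) / cmod z^2" if "R0 \<le> cmod z" for z
  proof -
    have "cmod (e z) * cmod (h3 z) \<le> \<bar>M\<bar> * (4 / cmod z^2)" using far[OF that] by (intro mult_mono) auto
    then show ?thesis by (simp add: norm_mult mult.commute)
  qed
  note outG = cauchy_out[OF oU G DU Gb, folded rout_def]
  note out3 = cauchy_out[OF oU hol3 DU b3, folded rout_def]
  define V where "V = - {s0, cnj s0}"
  have oV: "open V" unfolding V_def by (intro open_Compl) auto
  have DV: "Din \<subseteq> V" using s by (auto simp: V_def Din_def)
  have hV: "h1 holomorphic_on V" "h2 holomorphic_on V" 
    unfolding h1_def h2_def by (intro holomorphic_intros; auto simp: V_def)+
  note in1 = cauchy_in[OF oV hV(1) DV] 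
  note in2 = cauchy_in[OF oV hV(2) DV] 
  define W where "W = Ui y \<eta> \<inter> V"
  have oW: "open W" unfolding W_def by (intro open_Int open_Ui oV)
  have DW: "Din \<subseteq> W" using Din_subset_Ui[OF \<eta>] DV by (auto simp: W_def)
  have fW: "f holomorphic_on W" unfolding f_def by (rule holomorphic_on_subset[OF ei_holomorphic]) (auto simp: W_def)
  have fhW: "(\<lambda>z. f z * h1 z) holomorphic_on W" "(\<lambda>z. f z * h3 z) holomorphic_on W"
    unfolding h1_def h3_def by (intro holomorphic_intros fW; auto simp: W_def V_def)+
  note inf1 = cauchy_in[OF oW fhW(1) DW]
  note inf3 = cauchy_in[OF oW fhW(2) DW]
  have contI: "continuous_on {a..b} (\<lambda>x. g (I x))" if "g holomorphic_on X" "Din \<subseteq> X \<or> Dout \<subseteq> X" for g X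
  proof (rule continuous_on_compose2[OF holomorphic_on_imp_continuous_on[OF that(1)] I_cont])
    show "I ` {a..b} \<subseteq> X" using I_in_D that(2) by blast
  qed
  note intI = continuous_times_I'_integrable[OF contI]
  have iG: "set_integrable lborel {a<..<b} (\<lambda>x. G (I x) * I' x)" by (rule intI[OF G]) (use DU in auto)
  have ih: "set_integrable lborel {a<..<b} (\<lambda>x. h1 (I x) * I' x)" "set_integrable lborel {a<..<b} (\<lambda>x. h2 (I x) * I' x)"
    by (rule intI[OF hV(1)], use DV in simp, rule intI[OF hV(2)], use DV in simp)
  have if1: "set_integrable lborel {a<..<b} (\<lambda>x. (f (I x) * h1 (I x)) * I' x)" by (rule intI[OF fhW(1)]) (use DW in auto)
  have if3: "set_integrable lborel {a<..<b} (\<lambda>x. (f (I x) * h3 (I x)) * I' x)" by (rule intI[OF fhW(2)]) (use DW in auto)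
  have ie3: "set_integrable lborel {a<..<b} (\<lambda>x. (e (I x) * h3 (I x)) * I' x)" by (rule intI[OF hol3]) (use DU in auto)
  have Is0: "I x \<noteq> s0" if "x \<in> {a<..<b}" for x using J_I[OF that] s by auto
  have i1: "set_integrable lborel {a<..<b} (\<lambda>x. G (I x) * I' x + e s0 * (h1 (I x) * I' x) + d0 * w * (h2 (I x) * I' x))"
    by (intro set_integral_add set_integrable_mult_right iG ih)
  have L1: "(LINT x:{a<..<b}|lborel. G (I x) * I' x + e s0 * (h1 (I x) * I' x) + d0 * w * (h2 (I x) * I' x))
     = (LINT x:{a<..<b}|lborel. G (I x) * I' x) + e s0 * (LINT x:{a<..<b}|lborel. h1 (I x) * I' x)
       + d0 * w * (LINT x:{a<..<b}|lborel. h2 (I x) * I' x)"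
    by (subst set_integral_add(2), intro set_integral_add set_integrable_mult_right iG ih, intro set_integrable_mult_right ih,
        subst set_integral_add(2), rule iG, intro set_integrable_mult_right ih) simp
  have eG: "G (I x) * I' x + e s0 * (h1 (I x) * I' x) + d0 * w * (h2 (I x) * I' x) = (e (I x) * h1 (I x)) * I' x" 
    if "x \<in> {a<..<b}" for x
    unfolding Geq[OF Is0[OF that]] by (simp add: algebra_simps)
  have ie1: "set_integrable lborel {a<..<b} (\<lambda>x. (e (I x) * h1 (I x)) * I' x)"
    using i1 by (rule set_integrable_cong[THEN iffD1, rotated -1]) (use eG in auto)
  have Le1: "(LINT x:{a<..<b}|lborel. (e (I x) * h1 (I x)) * I' x) = (LINT x:{a<..<b}|lborel. G (I x) * I' x) + e s0 * (LINT x:{a<..<b}|lborel. h1 (I x) * I' x)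
       + d0 * w * (LINT x:{a<..<b}|lborel. h2 (I x) * I' x)"
    unfolding L1[symmetric] by (rule set_lebesgue_integral_cong) (use eG in auto)
  define r1 r2 where "r1 x = h1 (of_real x)" and "r2 x = h2 (of_real x)" for x :: real
  have r: "integrable lborel r1" "(LINT x|lborel. r1 x) = 0" "integrable lborel r2" "(LINT x|lborel. r2 x) = of_real (pi / Im s0)"
    using real_kernel_complex[OF s(1)] by (auto simp: r1_def[abs_def] r2_def[abs_def] h1_def h2_def)
  have rS: "set_integrable lborel S r1" "set_integrable lborel S r2" if "S \<in> sets lborel" for S
    using set_integrable_of_integrable that r by auto
  have rA: "set_integrable lborel rout r1" "set_integrable lborel rout r2" 
    "set_integrable lborel {sa<..<sb} r1" "set_integrable lborel {sa<..<sb} r2"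
    using rS[OF rout_sets] rS[of "{sa<..<sb}"] by simp_all
  have spl1: "(LINT x:rout|lborel. r1 x) + (LINT x:{sa<..<sb}|lborel. r1 x) = 0"
    using split_real_line(2)[OF rA(1,3)] r by simp
  have spl2: "(LINT x:rout|lborel. r2 x) + (LINT x:{sa<..<sb}|lborel. r2 x) = of_real (pi / Im s0)"
    using split_real_line(2)[OF rA(2,4)] r by simp
  have GR: "set_integrable lborel rout (\<lambda>x. G (of_real x))" using outG(1) by blast
  have i2: "set_integrable lborel rout (\<lambda>x. G (of_real x) + e s0 * r1 x + d0 * w * r2 x)"
    by (intro set_integral_add set_integrable_mult_right GR rA)
  have eR: "G (of_real x) + e s0 * r1 x + d0 * w * r2 x = e (of_real x) * r1 x" for x
  proof -
    have "of_real x \<noteq> s0" using s by auto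
    from Geq[OF this] show ?thesis by (simp add: r1_def r2_def)
  qed
  have ieR: "set_integrable lborel rout (\<lambda>x. e (of_real x) * r1 x)" using i2 by (simp only: eR)
  have LeR: "(LINT x:rout|lborel. e (of_real x) * r1 x) = (LINT x:rout|lborel. G (of_real x)) 
     + e s0 * (LINT x:rout|lborel. r1 x) + d0 * w * (LINT x:rout|lborel. r2 x)"
    unfolding eR[symmetric]
    by (subst set_integral_add(2), intro set_integral_add set_integrable_mult_right GR rA, intro set_integrable_mult_right rA,
        subst set_integral_add(2), rule GR, intro set_integrable_mult_right rA) simp
  \<comment> \<open>The poles of the subtracted terms lie outside the curve, so their arc integrals
    equal real integrals over (\<open>sa\<close>, \<open>sb\<close>); together with the outer pieces
    these fill the real line.\<close>
  have "(LINT x:{a<..<b}|lborel. (e (I x) * h1 (I x)) * I' x) = - (LINT x:rout|lborel. G (of_real x))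
     + e s0 * (LINT x:{sa<..<sb}|lborel. r1 x) + d0 * w * (LINT x:{sa<..<sb}|lborel. r2 x)"
    unfolding Le1 using outG(2) in1 in2 by (simp add: r1_def r2_def)
  also have "\<dots> = - (LINT x:rout|lborel. e (of_real x) * r1 x) + e s0 * ((LINT x:rout|lborel. r1 x) + (LINT x:{sa<..<sb}|lborel. r1 x))
     + d0 * w * ((LINT x:rout|lborel. r2 x) + (LINT x:{sa<..<sb}|lborel. r2 x))"
    unfolding LeR by (simp add: algebra_simps)
  also have "\<dots> = - (LINT x:rout|lborel. e (of_real x) * r1 x) + 2 * of_real pi * \<i> * d0"
    unfolding spl1 spl2 w(1) using s by simp
  finally have A1v: "(LINT x:{a<..<b}|lborel. (e (I x) * h1 (I x)) * I' x) = - (LINT x:rout|lborel. e (of_real x) * r1 x) + 2 * of_real pi * \<i> * d0" .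
  have Kcx: "Kc y \<eta> x = e (I x) - f (I x)" if "x \<in> {a<..<b}" for x
    using eo_minus_ei_curve[OF that \<eta>] by (simp add: Kc_def e_def f_def)
  have T1: "(LINT x:{a<..<b}|lborel. Kc y \<eta> x * (I' x / (I x - s0)^2))
     = - (LINT x:rout|lborel. e (of_real x) * r1 x) + 2 * of_real pi * \<i> * d0 - (LINT x:{sa<..<sb}|lborel. f (of_real x) * r1 x)"
  proof -
    have "(LINT x:{a<..<b}|lborel. Kc y \<eta> x * (I' x / (I x - s0)^2))
       = (LINT x:{a<..<b}|lborel. (e (I x) * h1 (I x)) * I' x - (f (I x) * h1 (I x)) * I' x)"
      by (rule set_lebesgue_integral_cong) (auto simp: Kcx h1_def left_diff_distrib diff_divide_distrib)
    also have "\<dots> = (LINT x:{a<..<b}|lborel. (e (I x) * h1 (I x)) * I' x) - (LINT x:{a<..<b}|lborel. (f (I x) * h1 (I x)) * I' x)"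
      by (rule set_integral_diff(2)[OF ie1 if1])
    finally show ?thesis unfolding A1v inf1 by (simp add: r1_def)
  qed
  have T2: "(LINT x:{a<..<b}|lborel. Kc y \<eta> x * (I' x / (I x - cnj s0)^2))
     = - (LINT x:rout|lborel. e (of_real x) * h3 (of_real x)) - (LINT x:{sa<..<sb}|lborel. f (of_real x) * h3 (of_real x))"
  proof -
    have "(LINT x:{a<..<b}|lborel. Kc y \<eta> x * (I' x / (I x - cnj s0)^2))
       = (LINT x:{a<..<b}|lborel. (e (I x) * h3 (I x)) * I' x - (f (I x) * h3 (I x)) * I' x)"
      by (rule set_lebesgue_integral_cong) (auto simp: Kcx h3_def left_diff_distrib diff_divide_distrib)
    also have "\<dots> = (LINT x:{a<..<b}|lborel. (e (I x) * h3 (I x)) * I' x) - (LINT x:{a<..<b}|lborel. (f (I x) * h3 (I x)) * I' x)"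
      by (rule set_integral_diff(2)[OF ie3 if3])
    finally show ?thesis unfolding inf3 using out3(2) by simp
  qed
  \<comment> \<open>On the real axis conjugation exchanges the poles s0 and cnj s0, which gives the
    two integrals the same kernel.\<close>
  have h3c: "cnj (h3 (of_real x)) = r1 x" for x by (simp add: h3_def r1_def h1_def)
  have T2c: "(LINT x:{a<..<b}|lborel. cnj (Kc y \<eta> x * (I' x / (I x - cnj s0)^2)))
     = - (LINT x:rout|lborel. cnj (e (of_real x)) * r1 x) - (LINT x:{sa<..<sb}|lborel. cnj (f (of_real x)) * r1 x)"
    unfolding set_LINT_cnj T2 by (simp add: set_LINT_cnj[symmetric] h3c)
  have icR: "set_integrable lborel rout (\<lambda>x. cnj (e (of_real x)) * r1 x)"
    using set_integrable_cnj[OF out3(1)] by (simp add: h3c)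
  have contS: "continuous_on {sa..sb} (\<lambda>x. g (of_real x))" if "g holomorphic_on W" for g :: "complex \<Rightarrow> complex"
    by (rule continuous_on_compose2[OF holomorphic_on_imp_continuous_on[OF that]])
       (use DW in \<open>auto intro!: continuous_intros simp: Din_of_real subset_iff\<close>)
  have ifR: "set_integrable lborel {sa<..<sb} (\<lambda>x. f (of_real x) * r1 x)"
    unfolding r1_def by (rule set_integrable_subset[OF borel_integrable_atLeastAtMost'[OF contS[OF fhW(1)]]]) auto
  have "set_integrable lborel {sa<..<sb} (\<lambda>x. f (of_real x) * h3 (of_real x))"
    by (rule set_integrable_subset[OF borel_integrable_atLeastAtMost'[OF contS[OF fhW(2)]]]) auto
  from set_integrable_cnj[OF this] have ifcR: "set_integrable lborel {sa<..<sb} (\<lambda>x. cnj (f (of_real x)) * r1 x)"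
    by (simp add: h3c)
  define m where "m x = of_real (Imb y \<eta> x) / (of_real x - s0)^2" for x
  have mo: "2 * \<i> * m x = e (of_real x) * r1 x - cnj (e (of_real x)) * r1 x" if "x \<in> rout" for x
  proof -
    have "2 * \<i> * of_real (Im (e (of_real x))) = e (of_real x) - cnj (e (of_real x))" by (simp add: complex_eq_iff)
    then show ?thesis using that by (simp add: m_def Imb_def r1_def h1_def e_def diff_divide_distrib[symmetric])
  qed
  have mi: "2 * \<i> * m x = f (of_real x) * r1 x - cnj (f (of_real x)) * r1 x" if "x \<in> {sa<..<sb}" for x
  proof -
    have nr: "x \<notin> rout" using that by (auto simp: rout_def)
    have "2 * \<i> * of_real (Im (f (of_real x))) = f (of_real x) - cnj (f (of_real x))" by (simp add: complex_eq_iff)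
    then show ?thesis using nr by (simp add: m_def Imb_def r1_def h1_def f_def diff_divide_distrib[symmetric])
  qed
  have m1: "set_integrable lborel rout (\<lambda>x. 2 * \<i> * m x)"
    using set_integral_diff(1)[OF ieR icR] by (rule set_integrable_cong[THEN iffD1, rotated -1]) (use mo in auto)
  have m2: "set_integrable lborel {sa<..<sb} (\<lambda>x. 2 * \<i> * m x)"
    using set_integral_diff(1)[OF ifR ifcR] by (rule set_integrable_cong[THEN iffD1, rotated -1]) (use mi in auto)
  have v1: "(LINT x:rout|lborel. 2 * \<i> * m x) = (LINT x:rout|lborel. e (of_real x) * r1 x) - (LINT x:rout|lborel. cnj (e (of_real x)) * r1 x)"
    unfolding set_integral_diff(2)[OF ieR icR, symmetric] by (rule set_lebesgue_integral_cong) (use mo in auto)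
  have v2: "(LINT x:{sa<..<sb}|lborel. 2 * \<i> * m x) = (LINT x:{sa<..<sb}|lborel. f (of_real x) * r1 x) - (LINT x:{sa<..<sb}|lborel. cnj (f (of_real x)) * r1 x)"
    unfolding set_integral_diff(2)[OF ifR ifcR, symmetric] by (rule set_lebesgue_integral_cong) (use mi in auto)
  have "integrable lborel (\<lambda>x. (1 / (2 * \<i>)) * (2 * \<i> * m x))"
    by (rule integrable_mult_right) (rule split_real_line(1)[OF m1 m2])
  moreover have "(1 / (2 * \<i>)) * (2 * \<i> * m x) = m x" for x by simp
  ultimately have "integrable lborel (\<lambda>x. m x)" by (simp only:)
  then show mint: "integrable lborel (\<lambda>x. of_real (Imb y \<eta> x) / (of_real x - s0)^2)"
    by (simp only: m_def)
  have "2 * \<i> * (LINT x|lborel. m x) = (LINT x|lborel. 2 * \<i> * m x)" by simp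
  also have "\<dots> = (LINT x:rout|lborel. 2 * \<i> * m x) + (LINT x:{sa<..<sb}|lborel. 2 * \<i> * m x)"
    by (rule split_real_line(2)[OF m1 m2])
  finally have mv: "2 * \<i> * (LINT x|lborel. m x) = \<dots>" .
  show "(LINT x:{a<..<b}|lborel. Kc y \<eta> x * (I' x / (I x - s0)^2))
      - (LINT x:{a<..<b}|lborel. cnj (Kc y \<eta> x * (I' x / (I x - cnj s0)^2)))
    = 2 * of_real pi * \<i> * deriv (eo y \<eta>) s0
      - 2 * \<i> * (LINT x|lborel. of_real (Imb y \<eta> x) / (of_real x - s0)^2)"
    unfolding m_def[symmetric] mv v1 v2 T1 T2c d0_def e_def by simp
qed

end

section \<open>The kernel identity in the limit of vanishing eta\<close>

context jcurve begin

definition Kr :: "real \<Rightarrow> real \<Rightarrow> real" where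
  "Kr x y = ln \<bar>x - y\<bar> + ln \<bar>x powr \<theta> - y powr \<theta>\<bar>"

text \<open>Minus the x-derivative of 1/(I x - s) - 1/(cnj (I x) - s), the jump of the Cauchy kernel
  between the two arcs.\<close>

definition kap :: "complex \<Rightarrow> real \<Rightarrow> complex" where
  "kap s x = I' x / (I x - s)^2 - cnj (I' x) / (cnj (I x) - s)^2"

text \<open>As a > 0, |x^theta - y^theta| is at least theta a^(theta - 1) |x - y|, so both
  logarithms are controlled by ln |x - y|. The constant depends neither on eta in (0,1] nor on the
  points.\<close>

lemma kernel_bounds:
  "\<exists>C>0. \<forall>y\<in>{a<..<b}. \<forall>x\<in>{a<..<b}. \<bar>Kr x y\<bar> \<le> C * (1 + \<bar>ln \<bar>x - y\<bar>\<bar>)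
     \<and> (\<forall>\<eta>. 0 < \<eta> \<longrightarrow> \<eta> \<le> 1 \<longrightarrow> x \<noteq> y \<longrightarrow> cmod (Kc y \<eta> x) \<le> C * (1 + \<bar>ln \<bar>x - y\<bar>\<bar>))"
proof -
  define k where "k = \<theta> * a powr (\<theta> - 1)"
  have k: "k > 0" using th a_pos by (simp add: k_def)
  define u1 u2 where "u1 = b - a + 1" and "u2 = b powr \<theta> + 1"
  define C where "C = 2 + \<bar>ln u1\<bar> + \<bar>ln k\<bar> + \<bar>ln u2\<bar> + 2 * pi"
  have C: "C > 0" "2 \<le> C" unfolding C_def using pi_gt_zero by linarith+
  have "\<bar>Kr x y\<bar> \<le> C * (1 + \<bar>ln \<bar>x - y\<bar>\<bar>)
     \<and> (\<forall>\<eta>. 0 < \<eta> \<longrightarrow> \<eta> \<le> 1 \<longrightarrow> x \<noteq> y \<longrightarrow> cmod (Kc y \<eta> x) \<le> C * (1 + \<bar>ln \<bar>x - y\<bar>\<bar>))"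
    if y: "y \<in> {a<..<b}" and x: "x \<in> {a<..<b}" for x y
  proof (cases "x = y")
    case True
    then show ?thesis using C by (simp add: Kr_def)
  next
    case False
    define d where "d = \<bar>x - y\<bar>"
    define p where "p = x powr \<theta> - y powr \<theta>"
    have d: "0 < d" "d \<le> b - a" using False x y by (auto simp: d_def)
    have p1: "k * d \<le> \<bar>p\<bar>" unfolding k_def d_def p_def
      using powr_diff_bounds[OF th a_pos, of x y] x y by auto
    have "x powr \<theta> \<le> b powr \<theta>" "y powr \<theta> \<le> b powr \<theta>" "0 \<le> x powr \<theta>" "0 \<le> y powr \<theta>"
      using x y a_pos th by (auto intro!: powr_mono2)
    then have p2: "\<bar>p\<bar> \<le> b powr \<theta>" unfolding p_def by linarith
    have kd: "0 < k * d" using k d by simp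
    have lkd: "\<bar>ln (k * d)\<bar> \<le> \<bar>ln k\<bar> + \<bar>ln d\<bar>" using k d by (simp add: ln_mult)
    have l1: "\<bar>ln r\<bar> \<le> \<bar>ln d\<bar> + \<bar>ln u1\<bar>" if "d \<le> r" "r \<le> u1" for r by (rule abs_ln_between[OF d(1) that])
    have l2: "\<bar>ln r\<bar> \<le> \<bar>ln k\<bar> + \<bar>ln d\<bar> + \<bar>ln u2\<bar>" if "\<bar>p\<bar> \<le> r" "r \<le> u2" for r
      using abs_ln_between[OF kd, of r u2] p1 that lkd by linarith
    have fin: "2 * \<bar>ln d\<bar> + (\<bar>ln u1\<bar> + \<bar>ln k\<bar> + \<bar>ln u2\<bar> + 2 * pi) \<le> C * (1 + \<bar>ln d\<bar>)"
    proof -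
      have "2 * \<bar>ln d\<bar> \<le> C * \<bar>ln d\<bar>" by (rule mult_right_mono[OF C(2)]) simp
      then show ?thesis by (simp add: distrib_left) (simp add: C_def)
    qed
    have "\<bar>ln d\<bar> \<le> \<bar>ln d\<bar> + \<bar>ln u1\<bar>" "\<bar>ln \<bar>p\<bar>\<bar> \<le> \<bar>ln k\<bar> + \<bar>ln d\<bar> + \<bar>ln u2\<bar>"
      using l2[of "\<bar>p\<bar>"] p2 by (auto simp: u2_def)
    then have "\<bar>Kr x y\<bar> \<le> 2 * \<bar>ln d\<bar> + (\<bar>ln u1\<bar> + \<bar>ln k\<bar> + \<bar>ln u2\<bar> + 2 * pi)"
      unfolding Kr_def d_def[symmetric] p_def[symmetric] using pi_gt_zero by linarith
    moreover have "cmod (Kc y \<eta> x) \<le> 2 * \<bar>ln d\<bar> + (\<bar>ln u1\<bar> + \<bar>ln k\<bar> + \<bar>ln u2\<bar> + 2 * pi)" if e: "0 < \<eta>" "\<eta> \<le> 1" for \<eta>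
    proof -
      define z w where "z = Complex (x - y) \<eta>" and "w = Complex p (- \<eta>)"
      have nz: "z \<noteq> 0" "w \<noteq> 0" using e by (auto simp: z_def w_def complex_eq_iff)
      have "d \<le> cmod z" "cmod z \<le> u1" 
        using abs_Re_le_cmod[of z] cmod_le[of z] d e by (auto simp: z_def d_def u1_def)
      then have 1: "cmod (Ln z) \<le> \<bar>ln d\<bar> + \<bar>ln u1\<bar> + pi" using norm_Ln_le[OF nz(1)] l1 by (meson add_right_mono order_trans)
      have "\<bar>p\<bar> \<le> cmod w" "cmod w \<le> u2" 
        using abs_Re_le_cmod[of w] cmod_le[of w] p2 e by (auto simp: w_def u2_def)
      then have 2: "cmod (Ln w) \<le> \<bar>ln k\<bar> + \<bar>ln d\<bar> + \<bar>ln u2\<bar> + pi" using norm_Ln_le[OF nz(2)] l2 by (meson add_right_mono order_trans)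
      have "cmod (Kc y \<eta> x) \<le> cmod (Ln z) + cmod (Ln w)"
        unfolding Kc_def z_def w_def p_def by (rule norm_triangle_ineq)
      then show ?thesis using 1 2 by linarith
    qed
    ultimately show ?thesis using fin unfolding d_def[symmetric] by (meson order_trans)
  qed
  then show ?thesis using C by blast
qed

text \<open>The arc is compact and misses s, because J is real on the part of it that lies in the
  open upper half-plane. As the arc lies in the closed upper half-plane, its distance from cnj s is
  at least Im s.\<close>

lemma curve_distance:
  assumes "Im s > 0" "Im (J s) > 0"
  shows "\<exists>d>0. \<forall>x\<in>{a..b}. d \<le> cmod (I x - s) \<and> d \<le> cmod (I x - cnj s)"
proof -
  have "compact (I ` {a..b})" by (intro compact_continuous_image I_cont) simp
  then have cl: "closed (I ` {a..b})" by (rule compact_imp_closed)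
  have pts: "Im (I x) = 0 \<or> Im (J (I x)) = 0" "0 \<le> Im (I x)" if xx: "x \<in> {a..b}" for x
  proof -
    consider "x \<in> {a<..<b}" | "x = a" | "x = b" using xx by fastforce
    then have "(Im (I x) = 0 \<or> Im (J (I x)) = 0) \<and> 0 \<le> Im (I x)"
      using J_I[of x] I_upper[of x] by cases (auto simp: I_a I_b)
    then show "Im (I x) = 0 \<or> Im (J (I x)) = 0" "0 \<le> Im (I x)" by auto
  qed
  have "s \<notin> I ` {a..b}" using pts(1) assms by fastforce
  from separate_point_closed[OF cl this] obtain d where d: "d > 0" "\<And>t. t \<in> I ` {a..b} \<Longrightarrow> d \<le> dist s t" by blast
  have "cmod (I x - cnj s) \<ge> Im s" if "x \<in> {a..b}" for x
    using abs_Im_le_cmod[of "I x - cnj s"] pts(2)[OF that] assms by simp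
  moreover have "d \<le> cmod (I x - s)" if "x \<in> {a..b}" for x
    using d(2)[OF imageI[OF that]] by (simp add: dist_norm norm_minus_commute[of s])
  ultimately have "min d (Im s) \<le> cmod (I x - s) \<and> min d (Im s) \<le> cmod (I x - cnj s)" if "x \<in> {a..b}" for x
    using that by (meson min.coboundedI1 min.coboundedI2)
  moreover have "min d (Im s) > 0" using d(1) assms(1) by simp
  ultimately show ?thesis by blast
qed

lemma kap_parts_bound:
  assumes "Im s > 0" "Im (J s) > 0"
  shows "\<exists>C>0. \<forall>x\<in>{a<..<b}. cmod (I' x / (I x - s)^2) \<le> C * edge a b x
     \<and> cmod (I' x / (I x - cnj s)^2) \<le> C * edge a b x \<and> cmod (kap s x) \<le> 2 * C * edge a b x"
proof -
  obtain d where d: "d > 0" "\<And>x. x \<in> {a..b} \<Longrightarrow> d \<le> cmod (I x - s)" "\<And>x. x \<in> {a..b} \<Longrightarrow> d \<le> cmod (I x - cnj s)"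
    using curve_distance[OF assms] by blast
  obtain K where K: "K > 0" "\<And>x. x \<in> {a<..<b} \<Longrightarrow> cmod (I' x) \<le> K * edge a b x" using I'_bound by blast
  have *: "cmod (I' x / z^2) \<le> K / d^2 * edge a b x" if "x \<in> {a<..<b}" "d \<le> cmod z" for x z
  proof -
    have "cmod (I' x / z^2) = cmod (I' x) / cmod z^2" by (simp add: norm_divide norm_power)
    also have "\<dots> \<le> (K * edge a b x) / d^2"
      using K that d(1) edge_nonneg[of a b x] by (intro frac_le power_mono mult_nonneg_nonneg) auto
    finally show ?thesis by simp
  qed
  have "cmod (I' x / (I x - s)^2) \<le> K / d^2 * edge a b x
     \<and> cmod (I' x / (I x - cnj s)^2) \<le> K / d^2 * edge a b x \<and> cmod (kap s x) \<le> 2 * (K / d^2) * edge a b x"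
    if x: "x \<in> {a<..<b}" for x
  proof -
    have xx: "x \<in> {a..b}" using x by auto
    have 1: "cmod (I' x / (I x - s)^2) \<le> K / d^2 * edge a b x" by (rule *[OF x d(2)[OF xx]])
    have 2: "cmod (I' x / (I x - cnj s)^2) \<le> K / d^2 * edge a b x" by (rule *[OF x d(3)[OF xx]])
    have "cnj (I' x) / (cnj (I x) - s)^2 = cnj (I' x / (I x - cnj s)^2)" by simp
    then have "cmod (cnj (I' x) / (cnj (I x) - s)^2) = cmod (I' x / (I x - cnj s)^2)" by (simp only: complex_mod_cnj)
    then have "cmod (kap s x) \<le> 2 * (K / d^2) * edge a b x"
      using norm_triangle_ineq4[of "I' x / (I x - s)^2" "cnj (I' x) / (cnj (I x) - s)^2"] 1 2 unfolding kap_def by linarith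
    then show ?thesis using 1 2 by blast
  qed
  then show ?thesis using K(1) d(1) by (intro exI[of _ "K / d^2"]) auto
qed

lemma I_cont_open: "continuous_on {a<..<b} I"
  by (rule continuous_on_subset[OF I_cont]) auto

lemma kap_parts_cont:
  assumes "Im s > 0" "Im (J s) > 0"
  shows "continuous_on {a<..<b} (\<lambda>x. I' x / (I x - s)^2)" "continuous_on {a<..<b} (\<lambda>x. I' x / (I x - cnj s)^2)"
    "continuous_on {a<..<b} (kap s)"
proof -
  obtain d where d: "d > 0" "\<And>x. x \<in> {a..b} \<Longrightarrow> d \<le> cmod (I x - s)" "\<And>x. x \<in> {a..b} \<Longrightarrow> d \<le> cmod (I x - cnj s)"
    using curve_distance[OF assms] by blast
  have ne: "I x - s \<noteq> 0" "I x - cnj s \<noteq> 0" if "x \<in> {a<..<b}" for x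
    using d(1) d(2)[of x] d(3)[of x] that by auto
  show 1: "continuous_on {a<..<b} (\<lambda>x. I' x / (I x - s)^2)"
    using ne by (intro continuous_intros I'_cont I_cont_open) auto
  show 2: "continuous_on {a<..<b} (\<lambda>x. I' x / (I x - cnj s)^2)"
    using ne by (intro continuous_intros I'_cont I_cont_open) auto
  have "kap s = (\<lambda>x. I' x / (I x - s)^2 - cnj (I' x / (I x - cnj s)^2))" by (auto simp: kap_def)
  then show "continuous_on {a<..<b} (kap s)" by (simp only:) (intro continuous_intros 1 2)
qed

text \<open>The bound of the kernel, uniform in eta, times \<open>edge\<close> is below a multiple
  of \<open>dom\<close>. Pointwise the phases cancel by \<open>Ln_pair_tendsto\<close>, for x - y
  and x^theta - y^theta have the same sign.\<close>

lemma dominated_kernel_limit: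
  assumes y: "y \<in> {a<..<b}" and g: "continuous_on {a<..<b} g"
    and gb: "\<And>x. x \<in> {a<..<b} \<Longrightarrow> cmod (g x) \<le> C * edge a b x" and C: "C > 0"
    and e: "e \<longlonglongrightarrow> 0" "\<And>n. 0 < e n" "\<And>n. e n \<le> 1"
  shows "(\<lambda>n. LINT x:{a<..<b}|lborel. Kc y (e n) x * g x) \<longlonglongrightarrow> (LINT x:{a<..<b}|lborel. of_real (Kr x y) * g x)"
    and "set_integrable lborel {a<..<b} (\<lambda>x. of_real (Kr x y) * g x)"
proof -
  obtain C1 where C1: "C1 > 0" and Kb: "\<And>x. x \<in> {a<..<b} \<Longrightarrow> \<bar>Kr x y\<bar> \<le> C1 * (1 + \<bar>ln \<bar>x - y\<bar>\<bar>)"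
    "\<And>x \<eta>. x \<in> {a<..<b} \<Longrightarrow> 0 < \<eta> \<Longrightarrow> \<eta> \<le> 1 \<Longrightarrow> x \<noteq> y \<Longrightarrow> cmod (Kc y \<eta> x) \<le> C1 * (1 + \<bar>ln \<bar>x - y\<bar>\<bar>)"
    using kernel_bounds y by blast
  obtain C2 where C2: "C2 > 0" "\<And>x. x \<in> {a<..<b} \<Longrightarrow> (1 + \<bar>ln \<bar>x - y\<bar>\<bar>) * edge a b x \<le> C2 * dom a b y x"
    using ln_edge_le_dom[OF Jab] y by fastforce
  define D where "D x = C1 * C * C2 * dom a b y x" for x
  have bnd: "\<bar>k\<bar> * cmod (g x) \<le> D x" if x: "x \<in> {a<..<b}" and k: "\<bar>k\<bar> \<le> C1 * (1 + \<bar>ln \<bar>x - y\<bar>\<bar>)" for k x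
  proof -
    have "\<bar>k\<bar> * cmod (g x) \<le> (C1 * (1 + \<bar>ln \<bar>x - y\<bar>\<bar>)) * (C * edge a b x)"
      using k gb[OF x] C1 by (intro mult_mono) auto
    also have "\<dots> = C1 * C * ((1 + \<bar>ln \<bar>x - y\<bar>\<bar>) * edge a b x)" by simp
    also have "\<dots> \<le> C1 * C * (C2 * dom a b y x)" using C2(2)[OF x] C1 C by (intro mult_left_mono) auto
    finally show ?thesis by (simp add: D_def)
  qed
  have Dint: "set_integrable lborel {a<..<b} D"
    unfolding D_def[abs_def] using dom_integrable(1)[of a y b] y by (intro set_integrable_mult_right) auto
  have gm: "(\<lambda>x. indicator {a<..<b} x *\<^sub>R g x) \<in> borel_measurable borel"
    using borel_measurable_continuous_on_indicator[OF _ g] by simp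
  have Krm: "(\<lambda>x. Kr x y) \<in> borel_measurable borel" unfolding Kr_def by measurable
  have lim_meas: "(\<lambda>x. indicator {a<..<b} x *\<^sub>R (of_real (Kr x y) * g x)) \<in> borel_measurable borel"
  proof -
    have "(\<lambda>x. of_real (Kr x y) * (indicator {a<..<b} x *\<^sub>R g x)) \<in> borel_measurable borel"
      by (intro borel_measurable_times gm measurable_compose[OF Krm borel_measurable_of_real])
    then show ?thesis by (simp add: mult_scaleR_right)
  qed
  show "set_integrable lborel {a<..<b} (\<lambda>x. of_real (Kr x y) * g x)"
  proof (rule set_integrable_bound[OF Dint])
    show "set_borel_measurable lborel {a<..<b} (\<lambda>x. of_real (Kr x y) * g x)"
      using lim_meas by (simp add: set_borel_measurable_def)
    show "AE x in lborel. x \<in> {a<..<b} \<longrightarrow> norm (of_real (Kr x y) * g x) \<le> norm (D x)"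
    proof (intro AE_I2 impI)
      fix x assume x: "x \<in> {a<..<b}"
      from bnd[OF this Kb(1)[OF this]] show "norm (of_real (Kr x y) * g x) \<le> norm (D x)"
        by (simp add: norm_mult)
    qed
  qed
  show "(\<lambda>n. LINT x:{a<..<b}|lborel. Kc y (e n) x * g x) \<longlonglongrightarrow> (LINT x:{a<..<b}|lborel. of_real (Kr x y) * g x)"
    unfolding set_lebesgue_integral_def
  proof (rule integral_dominated_convergence[where w = "\<lambda>x. indicator {a<..<b} x *\<^sub>R D x"])
    show "(\<lambda>x. indicator {a<..<b} x *\<^sub>R (of_real (Kr x y) * g x)) \<in> borel_measurable lborel" using lim_meas by simp
    show "integrable lborel (\<lambda>x. indicator {a<..<b} x *\<^sub>R D x)" using Dint by (simp add: set_integrable_def)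
    show "(\<lambda>x. indicator {a<..<b} x *\<^sub>R (Kc y (e n) x * g x)) \<in> borel_measurable lborel" for n
    proof -
      have "Im z \<noteq> 0 \<Longrightarrow> z \<notin> \<real>\<^sub>\<le>\<^sub>0" for z by (auto simp: complex_nonpos_Reals_iff)
      then have "continuous_on {a<..<b} (Kc y (e n))"
        unfolding Kc_def using e(2)[of n] a_pos
        by (intro continuous_intros) (auto simp: complex_nonpos_Reals_iff less_imp_neq[symmetric])
      then have "continuous_on {a<..<b} (\<lambda>x. Kc y (e n) x * g x)" by (intro continuous_intros g)
      from borel_measurable_continuous_on_indicator[OF _ this] show ?thesis by simp
    qed
    have ne: "AE x in lborel. x \<noteq> y" by (rule AE_lborel_singleton)
    then show "AE x in lborel. norm (indicator {a<..<b} x *\<^sub>R (Kc y (e n) x * g x)) \<le> indicator {a<..<b} x *\<^sub>R D x" for n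
    proof eventually_elim
      case (elim x)
      show ?case
      proof (cases "x \<in> {a<..<b}")
        case True
        have "\<bar>cmod (Kc y (e n) x)\<bar> * cmod (g x) \<le> D x"
          using bnd[OF True, of "cmod (Kc y (e n) x)"] Kb(2)[OF True e(2) e(3) elim, of n] by simp
        then show ?thesis using True by (simp add: norm_mult)
      qed simp
    qed
    show "AE x in lborel. (\<lambda>n. indicator {a<..<b} x *\<^sub>R (Kc y (e n) x * g x)) \<longlonglongrightarrow> indicator {a<..<b} x *\<^sub>R (of_real (Kr x y) * g x)"
      using ne
    proof eventually_elim
      case (elim x)
      show ?case
      proof (cases "x \<in> {a<..<b}")
        case True
        have "(x - y > 0 \<and> x powr \<theta> - y powr \<theta> > 0) \<or> (x - y < 0 \<and> x powr \<theta> - y powr \<theta> < 0)"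
          using elim True y a_pos th by (auto simp: neq_iff intro!: powr_less_mono2)
        from Ln_pair_tendsto[OF this e(1,2)] show ?thesis
          unfolding Kc_def Kr_def by (intro tendsto_intros)
      qed simp
    qed
  qed
qed

lemma Imb_bound: assumes "\<eta> > 0" shows "\<bar>Imb y \<eta> x\<bar> \<le> pi"
proof -
  have L: "\<bar>Im (Ln z)\<bar> \<le> pi" if "z \<notin> \<real>\<^sub>\<le>\<^sub>0" for z
  proof -
    have "z \<noteq> 0" using that by auto
    then show ?thesis using Im_Ln_le_pi[of z] mpi_less_Im_Ln[of z] by linarith
  qed
  show ?thesis
  proof (cases "x \<in> rout")
    case True
    then have "complex_of_real x \<in> Uo y \<eta>" using Dout_subset_Uo[OF assms] Dout_of_real by (auto simp: rout_def)
    then show ?thesis using L True by (simp add: Imb_def eo_def Uo_def)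
  next
    case False
    then have "complex_of_real x \<in> Din" by (simp add: Din_of_real rout_def)
    then have "complex_of_real x \<in> Ui y \<eta>" using Din_subset_Ui[OF assms] by blast
    then show ?thesis using L False by (simp add: Imb_def ei_def Ui_def)
  qed
qed

text \<open>At eta = 0 the arguments of both logarithms are positive on the real axis, because y
  lies strictly between a and b. Outside the curve, J is at least b for x > 0 and at most a for x <
  -1, so (J x - y)/x > 0.\<close>

lemma Imb_tendsto_0:
  assumes y: "y \<in> {a<..<b}" and e: "e \<longlonglongrightarrow> 0"
  shows "(\<lambda>n. Imb y (e n) x) \<longlonglongrightarrow> 0"
proof (cases "x \<in> rout")
  case True
  then have x: "x < -1 \<or> x > 0" using sa_less sb_pos by (auto simp: rout_def)
  have pos: "(jr x - y) / x > 0"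
  proof (cases "x > 0")
    case True then show ?thesis using jr_ge_b[OF True] y by simp
  next
    case False then show ?thesis using x jr_le_a[of x] y by (intro divide_neg_neg) auto
  qed
  have "(\<lambda>n. (J (of_real x) - Complex y (- e n)) / of_real x) \<longlonglongrightarrow> (of_real (jr x) - Complex y (- 0)) / of_real x"
    unfolding J_of_real[OF x] using x
    by (intro tendsto_divide tendsto_diff tendsto_const tendsto_Complex tendsto_minus e) auto
  also have "(of_real (jr x) - Complex y (- 0)) / of_real x = of_real ((jr x - y) / x)"
    by (simp add: complex_of_real_def[symmetric])
  finally have "(\<lambda>n. Ln ((J (of_real x) - Complex y (- e n)) / of_real x)) \<longlonglongrightarrow> of_real (ln ((jr x - y) / x))"
    using Ln_tendsto_real pos by blast
  from tendsto_Im[OF this] show ?thesis using True by (simp add: Imb_def eo_def eo_arg_def)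
next
  case False
  then have x: "sa < x" "x < sb" by (auto simp: rout_def)
  have xc: "- c < x" using x sa_gt by linarith
  define P where "P = (c1 * (x + c)) powr \<theta>"
  have P: "P > 0" using xc c1 by (simp add: P_def)
  \<comment> \<open>The limit of \<open>ei_arg\<close>. Off [-1,0] it is x (J^theta - y^theta),
    positive for the same reason as outside; on [-1,0] it is a sum of two nonnegative terms that do
    not vanish together.\<close>
  define m where "m = (x + 1) * P - y powr \<theta> * x"
  have m: "m > 0"
  proof (cases "x < -1 \<or> x > 0")
    case True
    then have q: "(x + 1) / x > 0" by (auto simp: zero_less_divide_iff)
    have "jr x powr \<theta> = P * (((x + 1) / x) powr (1 / \<theta>)) powr \<theta>"
      unfolding jr_def P_def using xc c1 q by (subst powr_mult) auto
    also have "(((x + 1) / x) powr (1 / \<theta>)) powr \<theta> = (x + 1) / x" using q th abs_of_pos[OF q] by (simp add: powr_powr abs_divide)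
    finally have jP: "x * jr x powr \<theta> = (x + 1) * P" using True by (auto simp: field_simps)
    then have mj: "m = x * (jr x powr \<theta> - y powr \<theta>)" by (simp add: m_def algebra_simps)
    show ?thesis
    proof (cases "x > 0")
      case True
      have "y powr \<theta> < jr x powr \<theta>" using jr_ge_b[OF True] y a_pos th by (intro powr_less_mono2) auto
      then show ?thesis unfolding mj using True by simp
    next
      case False
      then have xm: "x < -1" using True by auto
      have "jr x > 0" unfolding jr_def using c1 xc q by (intro mult_pos_pos) auto
      then have "jr x powr \<theta> < y powr \<theta>" using jr_le_a[OF xm] y th by (intro powr_less_mono2) auto
      then show ?thesis unfolding mj using xm by (intro mult_neg_neg) auto
    qed
  next
    case False
    then have "0 \<le> (x + 1) * P" "0 \<le> - x * y powr \<theta>" using P mult_nonneg_nonneg[of "- x" "y powr \<theta>"] by auto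
    moreover have "(x + 1) * P > 0 \<or> - x * y powr \<theta> > 0"
    proof (cases "x = -1")
      case True then show ?thesis using y a_pos by simp
    next
      case f: False
      then show ?thesis using False P by (intro disjI1 mult_pos_pos) auto
    qed
    ultimately show ?thesis unfolding m_def by (simp add: mult.commute) linarith
  qed
  have "(\<lambda>n. (of_real x + 1) * Q0 (of_real x) - Complex (y powr \<theta>) (e n) * of_real x) \<longlonglongrightarrow> 
     (of_real x + 1) * Q0 (of_real x) - Complex (y powr \<theta>) 0 * of_real x"
    by (intro tendsto_intros e)
  also have "(of_real x + 1) * Q0 (of_real x) - Complex (y powr \<theta>) 0 * of_real x = complex_of_real m"
    unfolding Q0_real[OF xc] m_def P_def complex_of_real_def[symmetric] by simp
  finally have "(\<lambda>n. Ln ((of_real x + 1) * Q0 (of_real x) - Complex (y powr \<theta>) (e n) * of_real x)) \<longlonglongrightarrow> of_real (ln m)"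
    using Ln_tendsto_real m by blast
  from tendsto_minus[OF tendsto_Im[OF this]] show ?thesis using False by (simp add: Imb_def ei_def ei_arg_def)
qed

text \<open>The right-hand side is 2 pi i times the s-derivative of log ((J s - y)/s), the residue
  at s0 left by the outer continuation.\<close>

lemma kernel_identity:
  assumes y: "y \<in> {a<..<b}" and s: "Im s0 > 0" "Im (J s0) > 0"
  shows "set_integrable lborel {a<..<b} (\<lambda>x. of_real (Kr x y) * kap s0 x)"
    and "(LINT x:{a<..<b}|lborel. of_real (Kr x y) * kap s0 x)
      = 2 * of_real pi * \<i> * ((J s0 / qf s0) / (J s0 - of_real y) - 1 / s0)"
proof -
  define e where "e n = 1 / (real n + 1)" for n
  have e: "e \<longlonglongrightarrow> 0" "\<And>n. 0 < e n" "\<And>n. e n \<le> 1"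
    using LIMSEQ_inverse_real_of_nat by (simp_all add: e_def[abs_def] divide_inverse add.commute inverse_le_1_iff)
  obtain C where C: "C > 0" "\<And>x. x \<in> {a<..<b} \<Longrightarrow> cmod (I' x / (I x - s0)^2) \<le> C * edge a b x"
     "\<And>x. x \<in> {a<..<b} \<Longrightarrow> cmod (I' x / (I x - cnj s0)^2) \<le> C * edge a b x"
     "\<And>x. x \<in> {a<..<b} \<Longrightarrow> cmod (kap s0 x) \<le> 2 * C * edge a b x"
    using kap_parts_bound[OF s] by blast
  note lim1 = dominated_kernel_limit[OF y kap_parts_cont(1)[OF s] C(2) C(1) e]
  note lim2 = dominated_kernel_limit[OF y kap_parts_cont(2)[OF s] C(3) C(1) e]
  have "2 * C > 0" using C(1) by simp
  from dominated_kernel_limit(2)[OF y kap_parts_cont(3)[OF s] C(4) this e]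
  show "set_integrable lborel {a<..<b} (\<lambda>x. of_real (Kr x y) * kap s0 x)" .
  have lim2c: "(\<lambda>n. LINT x:{a<..<b}|lborel. cnj (Kc y (e n) x * (I' x / (I x - cnj s0)^2)))
     \<longlonglongrightarrow> (LINT x:{a<..<b}|lborel. cnj (of_real (Kr x y) * (I' x / (I x - cnj s0)^2)))"
    unfolding set_LINT_cnj by (intro tendsto_cnj lim2(1))
  have z: "J s0 - of_real y \<noteq> 0" using s by (auto simp: complex_eq_iff)
  have "(\<lambda>n. (J s0 / qf s0) / (J s0 - Complex y (- e n)) - 1 / s0) \<longlonglongrightarrow> (J s0 / qf s0) / (J s0 - Complex y (- 0)) - 1 / s0"
    using z by (intro tendsto_intros e) (simp add: complex_of_real_def)
  then have lim3: "(\<lambda>n. deriv (eo y (e n)) s0) \<longlonglongrightarrow> (J s0 / qf s0) / (J s0 - of_real y) - 1 / s0"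
    by (simp add: eo_deriv[OF s e(2)] complex_of_real_def)
  have lim4: "(\<lambda>n. LINT x|lborel. of_real (Imb y (e n) x) / (of_real x - s0)^2) \<longlonglongrightarrow> integral\<^sup>L lborel (\<lambda>x::real. 0::complex)"
  proof (rule integral_dominated_convergence[where f = "\<lambda>x. 0" and w = "\<lambda>x. pi * (1 / cmod (of_real x - s0)^2)"])
    show "(\<lambda>x. of_real (Imb y (e n) x) / (of_real x - s0)^2) \<in> borel_measurable lborel" for n
      using regularized_kernel_identity(2)[OF s e(2)] by (rule borel_measurable_integrable)
    show "integrable lborel (\<lambda>x. pi * (1 / cmod (of_real x - s0)^2))"
      by (intro integrable_mult_right real_kernel_integrable s)
    show "AE x in lborel. norm (of_real (Imb y (e n) x) / (of_real x - s0)^2) \<le> pi * (1 / cmod (of_real x - s0)^2)" for n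
      using Imb_bound[OF e(2)] by (intro AE_I2) (auto simp: norm_divide norm_power intro!: divide_right_mono)
    show "AE x in lborel. (\<lambda>n. of_real (Imb y (e n) x) / (of_real x - s0)^2) \<longlonglongrightarrow> 0"
    proof (intro AE_I2)
      fix x
      have "of_real x - s0 \<noteq> 0" using s by (auto simp: complex_eq_iff)
      then have "(\<lambda>n. of_real (Imb y (e n) x) / (of_real x - s0)^2) \<longlonglongrightarrow> of_real 0 / (of_real x - s0)^2"
        by (intro tendsto_intros Imb_tendsto_0[OF y e(1)]) auto
      then show "(\<lambda>n. of_real (Imb y (e n) x) / (of_real x - s0)^2) \<longlonglongrightarrow> 0" by simp
    qed
  qed simp
  have L: "(\<lambda>n. (LINT x:{a<..<b}|lborel. Kc y (e n) x * (I' x / (I x - s0)^2))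
      - (LINT x:{a<..<b}|lborel. cnj (Kc y (e n) x * (I' x / (I x - cnj s0)^2))))
     \<longlonglongrightarrow> (LINT x:{a<..<b}|lborel. of_real (Kr x y) * (I' x / (I x - s0)^2))
      - (LINT x:{a<..<b}|lborel. cnj (of_real (Kr x y) * (I' x / (I x - cnj s0)^2)))"
    by (intro tendsto_diff lim1(1) lim2c)
  have Rr: "(\<lambda>n. 2 * of_real pi * \<i> * deriv (eo y (e n)) s0 - 2 * \<i> * (LINT x|lborel. of_real (Imb y (e n) x) / (of_real x - s0)^2))
     \<longlonglongrightarrow> 2 * of_real pi * \<i> * ((J s0 / qf s0) / (J s0 - of_real y) - 1 / s0) - 2 * \<i> * integral\<^sup>L lborel (\<lambda>x::real. 0::complex)"
    by (intro tendsto_diff tendsto_mult tendsto_const lim3 lim4)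
  have eq: "(LINT x:{a<..<b}|lborel. of_real (Kr x y) * (I' x / (I x - s0)^2))
      - (LINT x:{a<..<b}|lborel. cnj (of_real (Kr x y) * (I' x / (I x - cnj s0)^2)))
     = 2 * of_real pi * \<i> * ((J s0 / qf s0) / (J s0 - of_real y) - 1 / s0)"
    using LIMSEQ_unique[OF L[unfolded regularized_kernel_identity(1)[OF s e(2)]] Rr] by simp
  have "(LINT x:{a<..<b}|lborel. of_real (Kr x y) * kap s0 x)
    = (LINT x:{a<..<b}|lborel. of_real (Kr x y) * (I' x / (I x - s0)^2) - cnj (of_real (Kr x y) * (I' x / (I x - cnj s0)^2)))"
    by (rule set_lebesgue_integral_cong) (auto simp: kap_def algebra_simps)
  also have "\<dots> = (LINT x:{a<..<b}|lborel. of_real (Kr x y) * (I' x / (I x - s0)^2))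
      - (LINT x:{a<..<b}|lborel. cnj (of_real (Kr x y) * (I' x / (I x - cnj s0)^2)))"
    by (rule set_integral_diff(2)[OF lim1(2) set_integrable_cnj[OF lim2(2)]])
  finally show "(LINT x:{a<..<b}|lborel. of_real (Kr x y) * kap s0 x)
      = 2 * of_real pi * \<i> * ((J s0 / qf s0) / (J s0 - of_real y) - 1 / s0)" unfolding eq .
qed

lemma kernel_uniform_bound:
  assumes s: "Im s0 > 0" "Im (J s0) > 0"
  shows "\<exists>C>0. \<forall>y\<in>{a<..<b}. \<forall>x\<in>{a<..<b}. \<bar>Kr x y\<bar> * cmod (kap s0 x) \<le> C * dom a b y x"
proof -
  obtain C1 where C1: "C1 > 0" "\<And>x y. x \<in> {a<..<b} \<Longrightarrow> y \<in> {a<..<b} \<Longrightarrow> \<bar>Kr x y\<bar> \<le> C1 * (1 + \<bar>ln \<bar>x - y\<bar>\<bar>)"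
    using kernel_bounds by blast
  obtain C2 where C2: "C2 > 0" "\<And>x y. y \<in> {a..b} \<Longrightarrow> x \<in> {a<..<b} \<Longrightarrow> (1 + \<bar>ln \<bar>x - y\<bar>\<bar>) * edge a b x \<le> C2 * dom a b y x"
    using ln_edge_le_dom[OF Jab] by blast
  obtain C where C: "C > 0" "\<And>x. x \<in> {a<..<b} \<Longrightarrow> cmod (kap s0 x) \<le> 2 * C * edge a b x"
    using kap_parts_bound[OF s] by blast
  have "\<bar>Kr x y\<bar> * cmod (kap s0 x) \<le> (C1 * (2 * C) * C2) * dom a b y x" if "y \<in> {a<..<b}" "x \<in> {a<..<b}" for x y
  proof -
    have yy: "y \<in> {a..b}" using that by auto
    have "\<bar>Kr x y\<bar> * cmod (kap s0 x) \<le> (C1 * (1 + \<bar>ln \<bar>x - y\<bar>\<bar>)) * (2 * C * edge a b x)"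
      using C1 C that by (intro mult_mono) auto
    also have "\<dots> = C1 * (2 * C) * ((1 + \<bar>ln \<bar>x - y\<bar>\<bar>) * edge a b x)" by simp
    also have "\<dots> \<le> C1 * (2 * C) * (C2 * dom a b y x)" using C2(2)[OF yy that(2)] C1 C by (intro mult_left_mono) auto
    finally show ?thesis by simp
  qed
  then show ?thesis using C1(1) C2(1) C(1) by (intro exI[of _ "C1 * (2 * C) * C2"]) auto
qed

end

section \<open>The resolvent of an equilibrium measure\<close>

context jcurve begin

lemma jr_gt_b: assumes "sb < x" shows "b < jr x"
proof -
  have D: "\<exists>y. (jr has_real_derivative y) (at z) \<and> y > 0" if "sb < z" for z
  proof -
    have p: "z > 0" using that sb_pos by linarith
    then obtain C where C: "C > 0" "(jr has_real_derivative C * ((z - sa) * (z - sb)) / (z * (z + 1))) (at z)"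
      using jr_has_derivative by blast
    moreover have "0 < C * ((z - sa) * (z - sb)) / (z * (z + 1))"
      using C(1) that p sab by (intro divide_pos_pos mult_pos_pos) auto
    ultimately show ?thesis by blast
  qed
  have m: "sb < (sb + x) / 2" "(sb + x) / 2 < x" using assms by auto
  have "jr ((sb + x) / 2) < jr x"
    by (rule DERIV_pos_imp_increasing[where f = jr, OF m(2)]) (use m D in auto)
  moreover have "b \<le> jr ((sb + x) / 2)" using sb_pos assms by (intro jr_ge_b) auto
  ultimately show ?thesis by linarith
qed

lemma jr_lt_a: assumes "x < sa" shows "jr x < a"
proof -
  have D: "\<exists>y. (jr has_real_derivative y) (at z) \<and> y > 0" if "z < sa" for z
  proof -
    have p: "z < -1" using that sa_less by linarith
    then obtain C where C: "C > 0" "(jr has_real_derivative C * ((z - sa) * (z - sb)) / (z * (z + 1))) (at z)"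
      using jr_has_derivative by blast
    have A: "0 < (z - sa) * (z - sb)" using that sab by (intro mult_neg_neg) auto
    have B: "0 < z * (z + 1)" using p by (intro mult_neg_neg) auto
    have "0 < C * ((z - sa) * (z - sb)) / (z * (z + 1))"
      by (rule divide_pos_pos[OF mult_pos_pos[OF C(1) A] B])
    then show ?thesis using C by blast
  qed
  have m: "x < (sa + x) / 2" "(sa + x) / 2 < sa" using assms by auto
  have "jr x < jr ((sa + x) / 2)"
    by (rule DERIV_pos_imp_increasing[where f = jr, OF m(1)]) (use m D in auto)
  moreover have "jr ((sa + x) / 2) \<le> a" using sa_less assms by (intro jr_le_a) auto
  ultimately show ?thesis by linarith
qed

text \<open>Points s close to a critical point, slightly above the axis and on its outer side, whose
  images avoid the vertical strip over [a,b]. The factor 4 arises from |s - p| being at most 3h/2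
  and from the distance at least h/2 between s and the arc; it makes the kernels at s comparable
  with the one at p, uniformly in h.\<close>

lemma approach_critical:
  fixes p sg h :: real
  assumes p: "(p = sb \<and> sg = 1) \<or> (p = sa \<and> sg = -1)" and h: "0 < h" "h < wa"
  shows "\<exists>s. Im s > 0 \<and> Im (J s) > 0 \<and> cmod (s - of_real p) \<le> 2 * h \<and> (sg = 1 \<longrightarrow> b < Re (J s)) \<and> (sg = -1 \<longrightarrow> Re (J s) < a)
     \<and> (\<forall>x\<in>{a<..<b}. cmod (I x - of_real p) \<le> 4 * cmod (I x - s) \<and> cmod (I x - of_real p) \<le> 4 * cmod (I x - cnj s))"
proof -
  define \<xi> where "\<xi> = p + sg * h"
  have xi: "\<xi> < -1 \<or> \<xi> > 0" using p h sa_less sb_pos by (auto simp: \<xi>_def)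
  define g where "g = (if sg = 1 then jr \<xi> - b else a - jr \<xi>)"
  have g: "g > 0" using p h jr_gt_b[of \<xi>] jr_lt_a[of \<xi>] by (auto simp: g_def \<xi>_def)
  have "isCont J (of_real \<xi>)" by (rule J_isCont[OF off_cut_real[OF xi]])
  then obtain d where d: "d > 0" "\<And>z. dist z (of_real \<xi>) < d \<Longrightarrow> dist (J z) (J (of_real \<xi>)) < g"
    unfolding continuous_at_eps_delta using g by blast
  \<comment> \<open>The height is small enough for Re J to stay beyond the critical value and for s
    to keep the distance h/2 from the annulus.\<close>
  define e where "e = min (h / 2) (d / 2)"
  have e: "0 < e" "e \<le> h / 2" "e < d" using h d by (auto simp: e_def)
  define s where "s = Complex \<xi> e"
  have sx: "s - of_real \<xi> = \<i> * of_real e" by (simp add: s_def complex_eq_iff)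
  have "dist s (of_real \<xi>) = e" using e by (simp add: dist_norm sx norm_mult)
  then have "dist (J s) (J (of_real \<xi>)) < g" using d(2) e by simp
  then have "\<bar>Re (J s) - jr \<xi>\<bar> < g"
    using abs_Re_le_cmod[of "J s - J (of_real \<xi>)"] by (simp add: dist_norm J_of_real[OF xi])
  then have Rej: "(sg = 1 \<longrightarrow> b < Re (J s)) \<and> (sg = -1 \<longrightarrow> Re (J s) < a)" by (auto simp: g_def abs_less_iff)
  have Ims: "Im s > 0" using e by (simp add: s_def)
  have rad: "(sg = 1 \<and> wb + h \<le> cmod (s + of_real c)) \<or> (sg = -1 \<and> cmod (s + of_real c) \<le> wa - h / 2)"
    using p
  proof
    assume a: "p = sb \<and> sg = 1"
    have "wb + h \<le> cmod (s + of_real c)"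
      using abs_Re_le_cmod[of "s + of_real c"] a h sb_pos c_gt_1 by (simp add: s_def \<xi>_def)
    then show ?thesis using a by blast
  next
    assume a: "p = sa \<and> sg = -1"
    have "s + of_real c = of_real (wa - h) + \<i> * of_real e" using a by (simp add: s_def \<xi>_def complex_eq_iff)
    then have "cmod (s + of_real c) \<le> cmod (of_real (wa - h)) + cmod (\<i> * of_real e)" using norm_triangle_ineq by metis
    also have "\<dots> = (wa - h) + e" using h e by (simp only: norm_of_real norm_mult) simp
    finally show ?thesis using a e by auto
  qed
  have ImJ: "Im (J s) > 0" by (rule Im_J_pos_of_radius[OF Ims]) (use rad h in auto)
  have sp: "cmod (s - of_real p) \<le> h + e"
  proof -
    have "s - of_real p = of_real (sg * h) + \<i> * of_real e" by (simp add: s_def \<xi>_def complex_eq_iff)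
    then have "cmod (s - of_real p) \<le> cmod (of_real (sg * h)) + cmod (\<i> * of_real e)" using norm_triangle_ineq by metis
    also have "\<dots> = h + e" using h e p by (auto simp: norm_mult)
    finally show ?thesis .
  qed
  have "cmod (I x - of_real p) \<le> 4 * cmod (I x - s) \<and> cmod (I x - of_real p) \<le> 4 * cmod (I x - cnj s)" if x: "x \<in> {a<..<b}" for x
  proof -
    have tri: "cmod (I x - of_real p) \<le> cmod (I x - s) + cmod (s - of_real p)"
      using norm_triangle_ineq[of "I x - s" "s - of_real p"] by simp
    have d1: "h / 2 \<le> cmod (I x - s)"
      using rad
    proof
      assume "sg = 1 \<and> wb + h \<le> cmod (s + of_real c)"
      then show ?thesis using I_radius(2)[OF x] norm_triangle_ineq2[of "s + of_real c" "I x + of_real c"] h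
        by (simp add: norm_minus_commute)
    next
      assume "sg = -1 \<and> cmod (s + of_real c) \<le> wa - h / 2"
      then show ?thesis using I_radius(1)[OF x] norm_triangle_ineq2[of "I x + of_real c" "s + of_real c"] h by simp
    qed
    have 1: "cmod (I x - of_real p) \<le> 4 * cmod (I x - s)" using tri d1 sp e by linarith
    have "cmod (I x - s)^2 \<le> cmod (I x - cnj s)^2"
      unfolding cmod_power2 using mult_pos_pos[OF I_upper[OF x] Ims] by (simp add: power2_eq_square algebra_simps)
    then have "cmod (I x - s) \<le> cmod (I x - cnj s)" by (simp add: power2_le_iff_abs_le)
    then show ?thesis using 1 by linarith
  qed
  then show ?thesis using Ims ImJ Rej sp e h by (intro exI[of _ s]) auto
qed

end

text \<open>The inequality is conditional on integrability because the integral of a non-integrable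
  function has the default value 0.\<close>

locale equilibrium = jcurve +
  fixes V V' V'' \<psi> :: "real \<Rightarrow> real" and L :: real
  assumes V_deriv: "\<And>x. x \<ge> 0 \<Longrightarrow> (V has_real_derivative V' x) (at x within {0..})"
    and V'_deriv: "\<And>x. x \<ge> 0 \<Longrightarrow> (V' has_real_derivative V'' x) (at x within {0..})"
    and V''_cont: "continuous_on {0..} V''"
    and psi_nonneg: "\<And>x. x \<in> {J_a \<theta> c0 c1<..<J_b \<theta> c0 c1} \<Longrightarrow> \<psi> x \<ge> 0"
    and psi_cont: "continuous_on {J_a \<theta> c0 c1<..<J_b \<theta> c0 c1} \<psi>"
    and psi_int: "set_integrable lborel {J_a \<theta> c0 c1<..<J_b \<theta> c0 c1} \<psi>"
    and psi_mass: "(LINT x:{J_a \<theta> c0 c1<..<J_b \<theta> c0 c1}|lborel. \<psi> x) = 1"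
    and EL_int: "\<And>x. x \<in> {J_a \<theta> c0 c1..J_b \<theta> c0 c1} \<Longrightarrow>
        set_integrable lborel {J_a \<theta> c0 c1<..<J_b \<theta> c0 c1} (\<lambda>y. \<psi> y * ln \<bar>x - y\<bar>)"
      "\<And>x. x \<in> {J_a \<theta> c0 c1..J_b \<theta> c0 c1} \<Longrightarrow>
        set_integrable lborel {J_a \<theta> c0 c1<..<J_b \<theta> c0 c1} (\<lambda>y. \<psi> y * ln \<bar>x powr \<theta> - y powr \<theta>\<bar>)"
    and EL_eq: "\<And>x. x \<in> {J_a \<theta> c0 c1..J_b \<theta> c0 c1} \<Longrightarrow>
        (LINT y:{J_a \<theta> c0 c1<..<J_b \<theta> c0 c1}|lborel. \<psi> y * ln \<bar>x - y\<bar>)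
        + (LINT y:{J_a \<theta> c0 c1<..<J_b \<theta> c0 c1}|lborel. \<psi> y * ln \<bar>x powr \<theta> - y powr \<theta>\<bar>) = V x + L"
    and EL_le: "\<And>x. x > 0 \<Longrightarrow>
        set_integrable lborel {J_a \<theta> c0 c1<..<J_b \<theta> c0 c1} (\<lambda>y. \<psi> y * ln \<bar>x - y\<bar>) \<Longrightarrow>
        set_integrable lborel {J_a \<theta> c0 c1<..<J_b \<theta> c0 c1} (\<lambda>y. \<psi> y * ln \<bar>x powr \<theta> - y powr \<theta>\<bar>) \<Longrightarrow>
        (LINT y:{J_a \<theta> c0 c1<..<J_b \<theta> c0 c1}|lborel. \<psi> y * ln \<bar>x - y\<bar>)
        + (LINT y:{J_a \<theta> c0 c1<..<J_b \<theta> c0 c1}|lborel. \<psi> y * ln \<bar>x powr \<theta> - y powr \<theta>\<bar>) \<le> V x + L"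
begin

lemma V_cont: "continuous_on {0..} V" and V'_cont: "continuous_on {0..} V'"
  using V_deriv V'_deriv by (auto simp: continuous_on_eq_continuous_within intro: DERIV_continuous)

lemma V_at: "x > 0 \<Longrightarrow> (V has_real_derivative V' x) (at x)"
  and V'_at: "x > 0 \<Longrightarrow> (V' has_real_derivative V'' x) (at x)"
  using V_deriv[of x] V'_deriv[of x] at_within_interior[of x "{0..}"] by auto

lemma psi_mult_integrable:
  fixes g :: "real \<Rightarrow> real"
  assumes "continuous_on {a..b} g" shows "set_integrable lborel {a<..<b} (\<lambda>y. \<psi> y * g y)"
proof -
  have "compact (g ` {a..b})" by (intro compact_continuous_image assms) simp
  then have "bounded (g ` {a..b})" by (rule compact_imp_bounded)
  then obtain K where K: "\<And>y. y \<in> g ` {a..b} \<Longrightarrow> norm y \<le> K" unfolding bounded_iff by blast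
  have "set_integrable lborel {a<..<b} (\<lambda>y. K * \<psi> y)" using psi_int by (rule set_integrable_mult_right)
  then show ?thesis
  proof (rule set_integrable_bound)
    have "continuous_on {a<..<b} g" by (rule continuous_on_subset[OF assms]) auto
    then have "continuous_on {a<..<b} (\<lambda>y. \<psi> y * g y)" by (intro continuous_intros psi_cont)
    from borel_measurable_continuous_on_indicator[OF _ this]
    show "set_borel_measurable lborel {a<..<b} (\<lambda>y. \<psi> y * g y)" by (simp add: set_borel_measurable_def)
    show "AE y in lborel. y \<in> {a<..<b} \<longrightarrow> norm (\<psi> y * g y) \<le> norm (K * \<psi> y)"
    proof (intro AE_I2 impI)
      fix y assume y: "y \<in> {a<..<b}"
      have "\<bar>g y\<bar> \<le> \<bar>K\<bar>" using K[of "g y"] y by auto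
      then have "\<bar>\<psi> y\<bar> * \<bar>g y\<bar> \<le> \<bar>\<psi> y\<bar> * \<bar>K\<bar>" by (intro mult_left_mono) auto
      then show "norm (\<psi> y * g y) \<le> norm (K * \<psi> y)" by (simp add: abs_mult mult.commute)
    qed
  qed
qed

definition G :: "complex \<Rightarrow> complex" where
  "G z = (LINT y:{a<..<b}|lborel. of_real (\<psi> y) / (z - of_real y))"

lemma psi_complex: "set_integrable lborel {a<..<b} (\<lambda>y. complex_of_real (\<psi> y))"
proof -
  have "integrable lborel (\<lambda>y. complex_of_real (indicator {a<..<b} y *\<^sub>R \<psi> y))"
    using psi_int unfolding set_integrable_def by (rule integrable_of_real)
  then show ?thesis unfolding set_integrable_def by (simp add: scaleR_conv_of_real)
qed

lemma G_integrable: 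
  assumes "Im z > 0" shows "set_integrable lborel {a<..<b} (\<lambda>y. of_real (\<psi> y) / (z - of_real y))"
proof -
  have ne: "z - of_real y \<noteq> 0" for y using assms by (auto simp: complex_eq_iff)
  have "set_integrable lborel {a<..<b} (\<lambda>y. (1 / (z - of_real y)) * of_real (\<psi> y))"
  proof (rule set_integrable_mult_bounded[OF psi_complex, where K = "1 / Im z"])
    have "continuous_on {a<..<b} (\<lambda>y. 1 / (z - of_real y))" using ne by (intro continuous_intros) auto
    from borel_measurable_continuous_on_indicator[OF _ this]
    show "set_borel_measurable lborel {a<..<b} (\<lambda>y. 1 / (z - of_real y))" by (simp add: set_borel_measurable_def)
    fix y show "norm (1 / (z - of_real y)) \<le> 1 / Im z"
      using abs_Im_le_cmod[of "z - of_real y"] assms by (auto simp: norm_divide intro!: frac_le)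
  qed
  then show ?thesis by simp
qed

text \<open>Integrate \<open>kernel_identity\<close> against psi(y) dy and exchange the integrals:
  for fixed x the inner integral over y is V x + L by the Euler-Lagrange equation. The exchange is
  licensed by \<open>dom\<close>, whose x-integral is bounded by \<open>Md\<close> for all y; the
  total mass 1 produces the term - 1/s0.\<close>

lemma fubini_identity:
  assumes s: "Im s0 > 0" "Im (J s0) > 0"
  shows "2 * of_real pi * \<i> * (G (J s0) * (J s0 / qf s0) - 1 / s0)
    = (LINT x:{a<..<b}|lborel. of_real (V x + L) * kap s0 x)"
proof -
  let ?S = "{a<..<b}"
  obtain C where C: "C > 0" "\<And>x y. y \<in> ?S \<Longrightarrow> x \<in> ?S \<Longrightarrow> \<bar>Kr x y\<bar> * cmod (kap s0 x) \<le> C * dom a b y x"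
    using kernel_uniform_bound[OF s] by blast
  define Md where "Md = 3 * (LINT x:{-(b-a)..b-a}|lborel. \<bar>x\<bar> powr (-3/4))"
  define F where "F y x = (indicator ?S y *\<^sub>R \<psi> y) *\<^sub>R (of_real (Kr x y) * (indicator ?S x *\<^sub>R kap s0 x))" for y x
  have pm: "(\<lambda>y. indicator ?S y *\<^sub>R \<psi> y) \<in> borel_measurable borel"
    using borel_measurable_integrable[OF psi_int[unfolded set_integrable_def]] by simp
  have km: "(\<lambda>x. indicator ?S x *\<^sub>R kap s0 x) \<in> borel_measurable borel"
    using borel_measurable_continuous_on_indicator[OF _ kap_parts_cont(3)[OF s]] by simp
  have Krm: "(\<lambda>p. Kr (snd p) (fst p)) \<in> borel_measurable (lborel \<Otimes>\<^sub>M lborel)" unfolding Kr_def by measurable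
  have Fm: "(\<lambda>p. F (fst p) (snd p)) \<in> borel_measurable (lborel \<Otimes>\<^sub>M lborel)"
  proof -
    have 1: "(\<lambda>p. indicator ?S (fst p) *\<^sub>R \<psi> (fst p)) \<in> borel_measurable (lborel \<Otimes>\<^sub>M lborel)"
      by (rule measurable_compose[OF measurable_fst, of "\<lambda>y. indicator ?S y *\<^sub>R \<psi> y" lborel borel lborel]) (use pm in simp)
    have 2: "(\<lambda>p. complex_of_real (Kr (snd p) (fst p))) \<in> borel_measurable (lborel \<Otimes>\<^sub>M lborel)"
      by (rule measurable_compose[OF Krm borel_measurable_of_real])
    have 3: "(\<lambda>p. indicator ?S (snd p) *\<^sub>R kap s0 (snd p)) \<in> borel_measurable (lborel \<Otimes>\<^sub>M lborel)"
      by (rule measurable_compose[OF measurable_snd, of "\<lambda>x. indicator ?S x *\<^sub>R kap s0 x" lborel borel lborel]) (use km in simp)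
    show ?thesis unfolding F_def by (rule borel_measurable_scaleR[OF 1 borel_measurable_times[OF 2 3]])
  qed
  have Ki: "integrable lborel (\<lambda>x. of_real (Kr x y) * (indicator ?S x *\<^sub>R kap s0 x))" if "y \<in> ?S" for y
    using kernel_identity(1)[OF that s] by (simp add: set_integrable_def)
  have i2: "integrable lborel (\<lambda>x. F y x)" for y
    unfolding F_def
  proof (rule integrable_scaleR_right)
    assume "indicator ?S y *\<^sub>R \<psi> y \<noteq> 0"
    then have "y \<in> ?S" by (auto simp: indicator_def split: if_splits)
    then show "integrable lborel (\<lambda>x. of_real (Kr x y) * (indicator ?S x *\<^sub>R kap s0 x))" by (rule Ki)
  qed
  have nb: "(\<integral>x. norm (F y x) \<partial>lborel) \<le> indicator ?S y *\<^sub>R (C * Md * \<psi> y)" for y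
  proof (cases "y \<in> ?S")
    case True
    have "(\<integral>x. norm (F y x) \<partial>lborel) \<le> (\<integral>x. \<psi> y * C * (indicator ?S x *\<^sub>R dom a b y x) \<partial>lborel)"
    proof (rule integral_mono)
      show "integrable lborel (\<lambda>x. norm (F y x))" using i2 by (rule integrable_norm)
      show "integrable lborel (\<lambda>x. \<psi> y * C * (indicator ?S x *\<^sub>R dom a b y x))"
        using dom_integrable(1)[of a y b] True by (intro integrable_mult_right) (simp add: set_integrable_def)
      fix x
      show "norm (F y x) \<le> \<psi> y * C * (indicator ?S x *\<^sub>R dom a b y x)"
      proof (cases "x \<in> ?S")
        case x: True
        have "\<psi> y * (\<bar>Kr x y\<bar> * cmod (kap s0 x)) \<le> \<psi> y * (C * dom a b y x)"
          using C(2)[OF True x] psi_nonneg[OF True] by (intro mult_left_mono)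
        then show ?thesis using True x psi_nonneg[OF True] by (simp add: F_def norm_mult mult.assoc)
      qed (simp add: F_def)
    qed
    also have "\<dots> = \<psi> y * C * (LINT x:?S|lborel. dom a b y x)" by (simp add: set_lebesgue_integral_def)
    also have "\<dots> \<le> \<psi> y * C * Md"
      using dom_integrable(2)[of a y b] True psi_nonneg[OF True] C(1) unfolding Md_def by (intro mult_left_mono) auto
    finally show ?thesis using True by (simp add: mult_ac)
  qed (simp add: F_def)
  have i1: "integrable lborel (\<lambda>y. \<integral>x. norm (F y x) \<partial>lborel)"
  proof (rule Bochner_Integration.integrable_bound)
    show "integrable lborel (\<lambda>y. indicator ?S y *\<^sub>R (C * Md * \<psi> y))"
      using set_integrable_mult_right[OF psi_int, of "C * Md"] by (simp add: set_integrable_def)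
    have "(\<lambda>p. norm (F (fst p) (snd p))) \<in> borel_measurable (lborel \<Otimes>\<^sub>M lborel)"
      by (rule measurable_compose[OF Fm borel_measurable_norm])
    then show "(\<lambda>y. \<integral>x. norm (F y x) \<partial>lborel) \<in> borel_measurable lborel"
      by (intro lborel.borel_measurable_lebesgue_integral) (simp add: case_prod_unfold)
    show "AE y in lborel. norm (\<integral>x. norm (F y x) \<partial>lborel) \<le> norm (indicator ?S y *\<^sub>R (C * Md * \<psi> y))"
    proof (intro AE_I2)
      fix y
      have "norm (\<integral>x. norm (F y x) \<partial>lborel) = (\<integral>x. norm (F y x) \<partial>lborel)" by (simp add: integral_nonneg)
      also have "\<dots> \<le> norm (indicator ?S y *\<^sub>R (C * Md * \<psi> y))" using nb[of y] by (simp only: real_norm_def)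
      finally show "norm (\<integral>x. norm (F y x) \<partial>lborel) \<le> norm (indicator ?S y *\<^sub>R (C * Md * \<psi> y))" .
    qed
  qed
  have Fint: "integrable (lborel \<Otimes>\<^sub>M lborel) (case_prod F)"
  proof (rule lborel_pair.Fubini_integrable)
    show "case_prod F \<in> borel_measurable (lborel \<Otimes>\<^sub>M lborel)" using Fm by (simp add: case_prod_unfold)
  qed (use i1 i2 in auto)
  from lborel_pair.Fubini_integral[OF Fint]
  have fub: "(\<integral>x. (\<integral>y. F y x \<partial>lborel) \<partial>lborel) = (\<integral>y. (\<integral>x. F y x \<partial>lborel) \<partial>lborel)" .
  have z: "Im (J s0) > 0" using s by simp
  have "(\<integral>y. (\<integral>x. F y x \<partial>lborel) \<partial>lborel)
     = (\<integral>y. indicator ?S y *\<^sub>R (2 * of_real pi * \<i> * (J s0 / qf s0) * (of_real (\<psi> y) / (J s0 - of_real y)) - 2 * of_real pi * \<i> * (1 / s0) * of_real (\<psi> y)) \<partial>lborel)"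
  proof (rule Bochner_Integration.integral_cong[OF refl])
    fix y
    show "(\<integral>x. F y x \<partial>lborel) = indicator ?S y *\<^sub>R (2 * of_real pi * \<i> * (J s0 / qf s0) * (of_real (\<psi> y) / (J s0 - of_real y)) - 2 * of_real pi * \<i> * (1 / s0) * of_real (\<psi> y))"
    proof (cases "y \<in> ?S")
      case True
      have "(\<integral>x. F y x \<partial>lborel) = (\<integral>x. of_real (\<psi> y) * (indicator ?S x *\<^sub>R (of_real (Kr x y) * kap s0 x)) \<partial>lborel)"
        using True by (intro Bochner_Integration.integral_cong refl) (simp add: F_def scaleR_conv_of_real mult_ac)
      also have "\<dots> = of_real (\<psi> y) * (LINT x:?S|lborel. of_real (Kr x y) * kap s0 x)"
        unfolding set_lebesgue_integral_def by (rule integral_mult_right_zero)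
      also have "\<dots> = 2 * of_real pi * \<i> * (J s0 / qf s0) * (of_real (\<psi> y) / (J s0 - of_real y)) - 2 * of_real pi * \<i> * (1 / s0) * of_real (\<psi> y)"
        unfolding kernel_identity(2)[OF True s] by (simp add: scaleR_conv_of_real algebra_simps)
      finally show ?thesis using True by simp
    qed (simp add: F_def)
  qed
  also have "\<dots> = (LINT y:?S|lborel. 2 * of_real pi * \<i> * (J s0 / qf s0) * (of_real (\<psi> y) / (J s0 - of_real y)) - 2 * of_real pi * \<i> * (1 / s0) * of_real (\<psi> y))"
    by (simp add: set_lebesgue_integral_def)
  also have "\<dots> = (LINT y:?S|lborel. 2 * of_real pi * \<i> * (J s0 / qf s0) * (of_real (\<psi> y) / (J s0 - of_real y))) - (LINT y:?S|lborel. 2 * of_real pi * \<i> * (1 / s0) * of_real (\<psi> y))"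
    by (rule set_integral_diff(2); intro set_integrable_mult_right G_integrable z psi_complex)
  also have "(LINT y:?S|lborel. 2 * of_real pi * \<i> * (J s0 / qf s0) * (of_real (\<psi> y) / (J s0 - of_real y))) = 2 * of_real pi * \<i> * (J s0 / qf s0) * G (J s0)"
    by (simp only: set_integral_mult_right G_def)
  also have "(LINT y:?S|lborel. 2 * of_real pi * \<i> * (1 / s0) * of_real (\<psi> y)) = 2 * of_real pi * \<i> * (1 / s0) * (LINT y:?S|lborel. of_real (\<psi> y))"
    by (simp only: set_integral_mult_right)
  also have "(LINT y:?S|lborel. complex_of_real (\<psi> y)) = 1"
  proof -
    have "(LINT y:?S|lborel. complex_of_real (\<psi> y)) = (\<integral>y. complex_of_real (indicator ?S y *\<^sub>R \<psi> y) \<partial>lborel)"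
      unfolding set_lebesgue_integral_def by (simp add: scaleR_conv_of_real)
    also have "\<dots> = of_real (\<integral>y. indicator ?S y *\<^sub>R \<psi> y \<partial>lborel)" by (rule integral_complex_of_real)
    finally show ?thesis using psi_mass by (simp add: set_lebesgue_integral_def)
  qed
  finally have lhs: "(\<integral>y. (\<integral>x. F y x \<partial>lborel) \<partial>lborel) = 2 * of_real pi * \<i> * (G (J s0) * (J s0 / qf s0) - 1 / s0)"
    by (simp add: algebra_simps)
  have "(\<integral>x. (\<integral>y. F y x \<partial>lborel) \<partial>lborel) = (\<integral>x. indicator ?S x *\<^sub>R (of_real (V x + L) * kap s0 x) \<partial>lborel)"
  proof (rule Bochner_Integration.integral_cong[OF refl])
    fix x
    show "(\<integral>y. F y x \<partial>lborel) = indicator ?S x *\<^sub>R (of_real (V x + L) * kap s0 x)"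
    proof (cases "x \<in> ?S")
      case True
      then have xx: "x \<in> {a..b}" by auto
      have "(\<integral>y. F y x \<partial>lborel) = (\<integral>y. complex_of_real (indicator ?S y *\<^sub>R (\<psi> y * ln \<bar>x - y\<bar> + \<psi> y * ln \<bar>x powr \<theta> - y powr \<theta>\<bar>)) * kap s0 x \<partial>lborel)"
        by (rule Bochner_Integration.integral_cong[OF refl]) (use True in \<open>simp add: F_def Kr_def scaleR_conv_of_real algebra_simps\<close>)
      also have "\<dots> = (\<integral>y. complex_of_real (indicator ?S y *\<^sub>R (\<psi> y * ln \<bar>x - y\<bar> + \<psi> y * ln \<bar>x powr \<theta> - y powr \<theta>\<bar>)) \<partial>lborel) * kap s0 x"
        by (rule integral_mult_left_zero)
      also have "(\<integral>y. complex_of_real (indicator ?S y *\<^sub>R (\<psi> y * ln \<bar>x - y\<bar> + \<psi> y * ln \<bar>x powr \<theta> - y powr \<theta>\<bar>)) \<partial>lborel)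
         = of_real (LINT y:?S|lborel. \<psi> y * ln \<bar>x - y\<bar> + \<psi> y * ln \<bar>x powr \<theta> - y powr \<theta>\<bar>)"
        unfolding set_lebesgue_integral_def by (rule integral_complex_of_real)
      also have "(LINT y:?S|lborel. \<psi> y * ln \<bar>x - y\<bar> + \<psi> y * ln \<bar>x powr \<theta> - y powr \<theta>\<bar>) = V x + L"
        using set_integral_add(2)[OF EL_int[OF xx]] EL_eq[OF xx] by simp
      finally show ?thesis using True by simp
    qed (simp add: F_def)
  qed
  then show ?thesis unfolding lhs[symmetric] fub[symmetric] by (simp add: set_lebesgue_integral_def)
qed

definition ker :: "complex \<Rightarrow> real \<Rightarrow> complex" where
  "ker s x = 1 / (I x - s) - 1 / (cnj (I x) - s)"

definition Mom :: "complex \<Rightarrow> complex" where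
  "Mom s = (LINT x:{a<..<b}|lborel. of_real (V' x) * ker s x) / (2 * of_real pi * \<i>)"

lemma sub_pos: "{a..b} \<subseteq> {0..}" using a_pos by auto

lemma I_deriv_cnj: "x \<in> {a<..<b} \<Longrightarrow> ((\<lambda>x. cnj (I x)) has_vector_derivative cnj (I' x)) (at x)"
  by (rule has_vector_derivative_cnj[OF I_has_deriv])

lemma resolvent_deriv:
  assumes "x \<in> {a<..<b}" "I x \<noteq> s" "cnj (I x) \<noteq> s"
  shows "(ker s has_vector_derivative - kap s x) (at x)"
proof -
  have d: "((\<lambda>z. 1 / (z - s)) has_field_derivative - 1 / (z - s)^2) (at z)" if "z \<noteq> s" for z
    using that by (auto intro!: derivative_eq_intros simp: power2_eq_square)
  have "((\<lambda>x. 1 / (I x - s)) has_vector_derivative I' x * (- 1 / (I x - s)^2)) (at x)"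
    using field_vector_diff_chain_at[OF I_has_deriv[OF assms(1)] d[OF assms(2)]] by (simp add: o_def)
  moreover have "((\<lambda>x. 1 / (cnj (I x) - s)) has_vector_derivative cnj (I' x) * (- 1 / (cnj (I x) - s)^2)) (at x)"
    using field_vector_diff_chain_at[OF I_deriv_cnj[OF assms(1)] d[OF assms(3)]] by (simp add: o_def)
  ultimately have "(ker s has_vector_derivative I' x * (- 1 / (I x - s)^2) - cnj (I' x) * (- 1 / (cnj (I x) - s)^2)) (at x)"
    unfolding ker_def[abs_def] by (rule has_vector_derivative_diff)
  then show ?thesis by (simp add: kap_def)
qed

lemma ker_cont:
  assumes "\<And>x. x \<in> {a..b} \<Longrightarrow> I x \<noteq> s" "\<And>x. x \<in> {a..b} \<Longrightarrow> cnj (I x) \<noteq> s"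
  shows "continuous_on {a..b} (ker s)"
  unfolding ker_def[abs_def] using assms by (intro continuous_intros I_cont) auto

lemma ker_ends: "ker s a = 0" "ker s b = 0" by (simp_all add: ker_def I_a I_b)

lemma curve_avoids:
  assumes s: "Im s > 0" "Im (J s) > 0" and x: "x \<in> {a..b}" shows "I x \<noteq> s" "cnj (I x) \<noteq> s"
proof -
  obtain d where d: "d > 0" "d \<le> cmod (I x - s)" "d \<le> cmod (I x - cnj s)" using curve_distance[OF s] x by blast
  then show "I x \<noteq> s" by auto
  show "cnj (I x) \<noteq> s" using d by auto
qed

text \<open>Integration by parts moves the derivative from the jump \<open>ker\<close> to V. The
  boundary terms vanish because the two arcs meet at the ends, where the jump is zero; the constant
  L disappears on differentiation.\<close>

lemma resolvent_identity:
  assumes s: "Im s0 > 0" "Im (J s0) > 0"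
  shows "G (J s0) * (J s0 / qf s0) = 1 / s0 + Mom s0"
proof -
  note av = curve_avoids[OF s]
  define W where "W x = of_real (V x + L) * ker s0 x" for x
  have kc: "continuous_on {a..b} (ker s0)" using av by (rule ker_cont)
  have Vc: "continuous_on {a..b} V" "continuous_on {a..b} V'" 
    using V_cont V'_cont sub_pos continuous_on_subset by blast+
  have Wc: "continuous_on {a..b} W" unfolding W_def by (intro continuous_intros Vc kc)
  have Wd: "(W has_vector_derivative of_real (V' x) * ker s0 x - of_real (V x + L) * kap s0 x) (at x)" if x: "x \<in> {a<..<b}" for x
  proof -
    have x0: "x > 0" using x a_pos by auto
    have "((\<lambda>x. V x + L) has_real_derivative V' x) (at x)" using V_at[OF x0] by (auto intro!: derivative_eq_intros)
    then have 1: "((\<lambda>x. complex_of_real (V x + L)) has_vector_derivative of_real (V' x)) (at x)"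
      by (rule has_vector_derivative_of_real)
    have xx: "x \<in> {a..b}" using x by auto
    from has_vector_derivative_mult[OF 1 resolvent_deriv[OF x av[OF xx]]]
    show ?thesis unfolding W_def[abs_def] by simp
  qed
  have hi: "((\<lambda>x. of_real (V' x) * ker s0 x - of_real (V x + L) * kap s0 x) has_integral W b - W a) {a..b}"
    using Jab by (intro fundamental_theorem_of_calculus_interior Wc Wd) auto
  have i1: "set_integrable lborel {a<..<b} (\<lambda>x. of_real (V' x) * ker s0 x)"
    by (rule set_integrable_subset[OF borel_integrable_atLeastAtMost']) (auto intro!: continuous_intros Vc kc)
  have i2: "set_integrable lborel {a<..<b} (\<lambda>x. of_real (V x + L) * kap s0 x)"
  proof -
    obtain C where C: "C > 0" "\<And>x. x \<in> {a<..<b} \<Longrightarrow> cmod (kap s0 x) \<le> 2 * C * edge a b x"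
      using kap_parts_bound[OF s] by blast
    have "set_integrable lborel {a<..<b} (kap s0)"
    proof (rule set_integrable_bound)
      show "set_integrable lborel {a<..<b} (\<lambda>x. 2 * C * edge a b x)"
        using edge_integrable[of a b] Jab by (intro set_integrable_mult_right) auto
      show "set_borel_measurable lborel {a<..<b} (kap s0)"
        using borel_measurable_continuous_on_indicator[OF _ kap_parts_cont(3)[OF s]] by (simp add: set_borel_measurable_def)
      show "AE x in lborel. x \<in> {a<..<b} \<longrightarrow> norm (kap s0 x) \<le> norm (2 * C * edge a b x)"
      proof (intro AE_I2 impI)
        fix x assume "x \<in> {a<..<b}" from C(2)[OF this] show "norm (kap s0 x) \<le> norm (2 * C * edge a b x)"
          by (rule order_trans) simp
      qed
    qed
    moreover have cV: "continuous_on {a..b} (\<lambda>x. complex_of_real (V x + L))" by (intro continuous_intros Vc)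
    then have "bounded ((\<lambda>x. complex_of_real (V x + L)) ` {a..b})" using compact_continuous_image compact_imp_bounded by blast
    then obtain K where K: "\<And>x. x \<in> {a..b} \<Longrightarrow> norm (complex_of_real (V x + L)) \<le> K" unfolding bounded_iff by blast
    moreover have "continuous_on {a<..<b} (\<lambda>x. complex_of_real (V x + L))" by (rule continuous_on_subset[OF cV]) auto
    from borel_measurable_continuous_on_indicator[OF _ this]
    have "set_borel_measurable lborel {a<..<b} (\<lambda>x. complex_of_real (V x + L))" by (simp add: set_borel_measurable_def)
    ultimately show ?thesis using K by (intro set_integrable_mult_bounded[where K = K]) auto
  qed
  have "(LINT x:{a<..<b}|lborel. of_real (V' x) * ker s0 x - of_real (V x + L) * kap s0 x) = W b - W a"
    by (rule set_LINT_of_has_integral_Icc[OF set_integral_diff(1)[OF i1 i2] hi])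
  then have "(LINT x:{a<..<b}|lborel. of_real (V' x) * ker s0 x) - (LINT x:{a<..<b}|lborel. of_real (V x + L) * kap s0 x) = 0"
    by (simp only: set_integral_diff(2)[OF i1 i2] W_def ker_ends mult_zero_right diff_self)
  then have "(LINT x:{a<..<b}|lborel. of_real (V' x) * ker s0 x) = (LINT x:{a<..<b}|lborel. of_real (V x + L) * kap s0 x)"
    by (rule eq_iff_diff_eq_0[THEN iffD2])
  then have "2 * of_real pi * \<i> * (G (J s0) * (J s0 / qf s0) - 1 / s0) = 2 * of_real pi * \<i> * Mom s0"
    unfolding fubini_identity[OF s] Mom_def by simp
  then have "G (J s0) * (J s0 / qf s0) - 1 / s0 = Mom s0" by (subst (asm) mult_cancel_left) simp
  then show ?thesis by (simp add: algebra_simps)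
qed

section \<open>Boundedness of the resolvent off the support and the endpoint conditions\<close>

lemma V_lipschitz: "\<exists>C\<ge>0. \<forall>x\<in>{0..b+1}. \<forall>y\<in>{0..b+1}. \<bar>V x - V y\<bar> \<le> C * \<bar>x - y\<bar>"
proof -
  have "continuous_on {0..b+1} V'" by (rule continuous_on_subset[OF V'_cont]) auto
  then have "bounded (V' ` {0..b+1})" using compact_continuous_image compact_imp_bounded by blast
  then obtain K where K: "\<And>x. x \<in> {0..b+1} \<Longrightarrow> norm (V' x) \<le> K" unfolding bounded_iff by blast
  have "norm (V x - V y) \<le> \<bar>K\<bar> * norm (x - y)" if "x \<in> {0..b+1}" "y \<in> {0..b+1}" for x y
  proof (rule field_differentiable_bound[where S = "{0..b+1}" and f' = V'])
    fix z assume z: "z \<in> {0..b+1}"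
    then show "(V has_field_derivative V' z) (at z within {0..b+1})"
      using V_deriv[of z] by (auto intro: has_field_derivative_subset)
    show "norm (V' z) \<le> \<bar>K\<bar>" using K[OF z] by linarith
  qed (use that in auto)
  then show ?thesis by (intro exI[of _ "\<bar>K\<bar>"]) auto
qed

text \<open>The variational inequality keeps the potential from growing like a square root outside the
  support; concavity of the logarithm turns this into a bound for the resolvent.\<close>
lemma resolvent_bound_right: "\<exists>C. \<forall>x>b. (LINT y:{a<..<b}|lborel. \<psi> y * (1 / (x - y))) \<le> C"
proof -
  obtain K where K: "K \<ge> 0" "\<And>x y. x \<in> {0..b+1} \<Longrightarrow> y \<in> {0..b+1} \<Longrightarrow> \<bar>V x - V y\<bar> \<le> K * \<bar>x - y\<bar>" using V_lipschitz by blast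
  have bp: "b > 0" using a_pos Jab by linarith
  have bin: "b \<in> {a..b}" using Jab by auto
  have near: "(LINT y:{a<..<b}|lborel. \<psi> y * (1 / (x - y))) \<le> K" if x: "b < x" "x \<le> b + 1" for x
  proof -
    have i1: "set_integrable lborel {a<..<b} (\<lambda>y. \<psi> y * ln \<bar>x - y\<bar>)"
      by (rule psi_mult_integrable) (use x in \<open>auto intro!: continuous_intros\<close>)
    have pw: "y powr \<theta> < x powr \<theta>" if "y \<in> {a..b}" for y using that x th a_pos by (intro powr_less_mono2) auto
    have i2: "set_integrable lborel {a<..<b} (\<lambda>y. \<psi> y * ln \<bar>x powr \<theta> - y powr \<theta>\<bar>)"
    proof (rule psi_mult_integrable, intro continuous_intros)
      show "\<forall>y\<in>{a..b}. \<bar>x powr \<theta> - y powr \<theta>\<bar> \<noteq> 0" using pw by fastforce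
    qed (use a_pos in auto)
    have i3: "set_integrable lborel {a<..<b} (\<lambda>y. \<psi> y * (1 / (x - y)))"
      by (rule psi_mult_integrable) (use x in \<open>auto intro!: continuous_intros\<close>)
    note j = EL_int[OF bin]
    have le1: "(LINT y:{a<..<b}|lborel. (x - b) * (\<psi> y * (1 / (x - y)))) \<le> (LINT y:{a<..<b}|lborel. \<psi> y * ln \<bar>x - y\<bar> - \<psi> y * ln \<bar>b - y\<bar>)"
    proof (rule set_integral_mono)
      fix y assume y: "y \<in> {a<..<b}"
      \<comment> \<open>The inequality ln t <= t - 1 at t = (b - y)/(x - y) bounds x - b times the
        resolvent kernel by a difference of logarithms.\<close>
      have "ln ((b - y) / (x - y)) \<le> (b - y) / (x - y) - 1" using y x by (intro ln_le_minus_one) auto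
      moreover have "ln ((b - y) / (x - y)) = ln (b - y) - ln (x - y)" using y x by (simp add: ln_divide_pos)
      moreover have "(b - y) / (x - y) - 1 = - ((x - b) / (x - y))" using y x by (simp add: field_simps)
      ultimately have "(x - b) / (x - y) \<le> ln (x - y) - ln (b - y)" by linarith
      from mult_left_mono[OF this psi_nonneg[OF y]]
      show "(x - b) * (\<psi> y * (1 / (x - y))) \<le> \<psi> y * ln \<bar>x - y\<bar> - \<psi> y * ln \<bar>b - y\<bar>"
        using y x by (simp add: right_diff_distrib mult_ac)
    qed (intro set_integrable_mult_right set_integral_diff i1 i3 j)+
    have le2: "(LINT y:{a<..<b}|lborel. \<psi> y * ln \<bar>b powr \<theta> - y powr \<theta>\<bar>) \<le> (LINT y:{a<..<b}|lborel. \<psi> y * ln \<bar>x powr \<theta> - y powr \<theta>\<bar>)"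
    proof (rule set_integral_mono[OF j(2) i2])
      fix y assume y: "y \<in> {a<..<b}"
      have "y powr \<theta> < b powr \<theta>" "b powr \<theta> \<le> x powr \<theta>" using y x th a_pos bp by (auto intro!: powr_less_mono2 powr_mono2)
      then have "ln \<bar>b powr \<theta> - y powr \<theta>\<bar> \<le> ln \<bar>x powr \<theta> - y powr \<theta>\<bar>" by simp
      then show "\<psi> y * ln \<bar>b powr \<theta> - y powr \<theta>\<bar> \<le> \<psi> y * ln \<bar>x powr \<theta> - y powr \<theta>\<bar>"
        by (rule mult_left_mono[OF _ psi_nonneg[OF y]])
    qed
    have "(x - b) * (LINT y:{a<..<b}|lborel. \<psi> y * (1 / (x - y))) \<le> V x - V b"
    proof -
      have "x > 0" using x bp by linarith
      from le1 le2 EL_le[OF this i1 i2] EL_eq[OF bin] show ?thesis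
        unfolding set_integral_mult_right set_integral_diff(2)[OF i1 j(1)] by linarith
    qed
    also have "\<dots> \<le> (x - b) * K" using K(2)[of x b] x bp by (simp add: abs_le_iff mult.commute)
    finally show ?thesis using x by simp
  qed
  have far: "(LINT y:{a<..<b}|lborel. \<psi> y * (1 / (x - y))) \<le> 1" if x: "b + 1 < x" for x
  proof -
    have "(LINT y:{a<..<b}|lborel. \<psi> y * (1 / (x - y))) \<le> (LINT y:{a<..<b}|lborel. \<psi> y)"
    proof (rule set_integral_mono[OF _ psi_int])
      show "set_integrable lborel {a<..<b} (\<lambda>y. \<psi> y * (1 / (x - y)))"
        by (rule psi_mult_integrable) (use x in \<open>auto intro!: continuous_intros\<close>)
      fix y assume y: "y \<in> {a<..<b}"
      then have "1 / (x - y) \<le> 1" using x by simp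
      from mult_left_mono[OF this psi_nonneg[OF y]] show "\<psi> y * (1 / (x - y)) \<le> \<psi> y" by simp
    qed
    then show ?thesis using psi_mass by simp
  qed
  show ?thesis
  proof (intro exI allI impI)
    fix x assume "b < x"
    then show "(LINT y:{a<..<b}|lborel. \<psi> y * (1 / (x - y))) \<le> max K 1"
      using near[of x] far[of x] by (cases "x \<le> b + 1") auto
  qed
qed

text \<open>The mirror image at a. The variational inequality is used for 0 < x < a; for x <= 0 the
  distance to the support is at least a.\<close>

lemma resolvent_bound_left: "\<exists>C. \<forall>x<a. (LINT y:{a<..<b}|lborel. \<psi> y * (1 / (y - x))) \<le> C"
proof -
  obtain K where K: "K \<ge> 0" "\<And>x y. x \<in> {0..b+1} \<Longrightarrow> y \<in> {0..b+1} \<Longrightarrow> \<bar>V x - V y\<bar> \<le> K * \<bar>x - y\<bar>" using V_lipschitz by blast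
  have ain: "a \<in> {a..b}" using Jab by auto
  have near: "(LINT y:{a<..<b}|lborel. \<psi> y * (1 / (y - x))) \<le> K" if x: "0 < x" "x < a" for x
  proof -
    have i1: "set_integrable lborel {a<..<b} (\<lambda>y. \<psi> y * ln \<bar>x - y\<bar>)"
      by (rule psi_mult_integrable) (use x in \<open>auto intro!: continuous_intros\<close>)
    have pw: "x powr \<theta> < y powr \<theta>" if "y \<in> {a..b}" for y using that x th a_pos by (intro powr_less_mono2) auto
    have i2: "set_integrable lborel {a<..<b} (\<lambda>y. \<psi> y * ln \<bar>x powr \<theta> - y powr \<theta>\<bar>)"
    proof (rule psi_mult_integrable, intro continuous_intros)
      show "\<forall>y\<in>{a..b}. \<bar>x powr \<theta> - y powr \<theta>\<bar> \<noteq> 0" using pw by fastforce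
    qed (use a_pos in auto)
    have i3: "set_integrable lborel {a<..<b} (\<lambda>y. \<psi> y * (1 / (y - x)))"
      by (rule psi_mult_integrable) (use x in \<open>auto intro!: continuous_intros\<close>)
    note j = EL_int[OF ain]
    have le1: "(LINT y:{a<..<b}|lborel. (a - x) * (\<psi> y * (1 / (y - x)))) \<le> (LINT y:{a<..<b}|lborel. \<psi> y * ln \<bar>x - y\<bar> - \<psi> y * ln \<bar>a - y\<bar>)"
    proof (rule set_integral_mono)
      fix y assume y: "y \<in> {a<..<b}"
      have "ln ((y - a) / (y - x)) \<le> (y - a) / (y - x) - 1" using y x by (intro ln_le_minus_one) auto
      moreover have "ln ((y - a) / (y - x)) = ln (y - a) - ln (y - x)" using y x by (simp add: ln_divide_pos)
      moreover have "(y - a) / (y - x) - 1 = - ((a - x) / (y - x))" using y x by (simp add: field_simps)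
      ultimately have "(a - x) / (y - x) \<le> ln (y - x) - ln (y - a)" by linarith
      from mult_left_mono[OF this psi_nonneg[OF y]]
      show "(a - x) * (\<psi> y * (1 / (y - x))) \<le> \<psi> y * ln \<bar>x - y\<bar> - \<psi> y * ln \<bar>a - y\<bar>"
        using y x by (simp add: right_diff_distrib mult_ac)
    qed (intro set_integrable_mult_right set_integral_diff i1 i3 j)+
    have le2: "(LINT y:{a<..<b}|lborel. \<psi> y * ln \<bar>a powr \<theta> - y powr \<theta>\<bar>) \<le> (LINT y:{a<..<b}|lborel. \<psi> y * ln \<bar>x powr \<theta> - y powr \<theta>\<bar>)"
    proof (rule set_integral_mono[OF j(2) i2])
      fix y assume y: "y \<in> {a<..<b}"
      have "a powr \<theta> < y powr \<theta>" "x powr \<theta> \<le> a powr \<theta>" using y x th a_pos by (auto intro!: powr_less_mono2 powr_mono2)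
      then have "ln \<bar>a powr \<theta> - y powr \<theta>\<bar> \<le> ln \<bar>x powr \<theta> - y powr \<theta>\<bar>" by simp
      then show "\<psi> y * ln \<bar>a powr \<theta> - y powr \<theta>\<bar> \<le> \<psi> y * ln \<bar>x powr \<theta> - y powr \<theta>\<bar>"
        by (rule mult_left_mono[OF _ psi_nonneg[OF y]])
    qed
    have "(a - x) * (LINT y:{a<..<b}|lborel. \<psi> y * (1 / (y - x))) \<le> V x - V a"
      using le1 le2 EL_le[OF x(1) i1 i2] EL_eq[OF ain]
      unfolding set_integral_mult_right set_integral_diff(2)[OF i1 j(1)] by linarith
    also have "\<dots> \<le> (a - x) * K" using K(2)[of x a] x Jab by (simp add: abs_le_iff mult.commute)
    finally show ?thesis using x by simp
  qed
  have far: "(LINT y:{a<..<b}|lborel. \<psi> y * (1 / (y - x))) \<le> 1 / a" if x: "x \<le> 0" for x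
  proof -
    have "(LINT y:{a<..<b}|lborel. \<psi> y * (1 / (y - x))) \<le> (LINT y:{a<..<b}|lborel. (1 / a) * \<psi> y)"
    proof (rule set_integral_mono)
      show "set_integrable lborel {a<..<b} (\<lambda>y. \<psi> y * (1 / (y - x)))"
        by (rule psi_mult_integrable) (use x a_pos in \<open>auto intro!: continuous_intros\<close>)
      show "set_integrable lborel {a<..<b} (\<lambda>y. (1 / a) * \<psi> y)" by (rule set_integrable_mult_right[OF psi_int])
      fix y assume y: "y \<in> {a<..<b}"
      then have "1 / (y - x) \<le> 1 / a" using x a_pos by (intro divide_left_mono) auto
      from mult_left_mono[OF this psi_nonneg[OF y]] show "\<psi> y * (1 / (y - x)) \<le> (1 / a) * \<psi> y" by simp
    qed
    then show ?thesis using psi_mass by simp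
  qed
  show ?thesis
  proof (intro exI allI impI)
    fix x assume "x < a"
    then show "(LINT y:{a<..<b}|lborel. \<psi> y * (1 / (y - x))) \<le> max K (1 / a)"
      using near[of x] far[of x] by (cases "x \<le> 0") auto
  qed
qed

lemma G_norm_bound:
  assumes "Im z > 0" "\<And>y. y \<in> {a<..<b} \<Longrightarrow> 0 < g y \<and> g y \<le> cmod (z - of_real y)" "continuous_on {a..b} (\<lambda>y. 1 / g y)"
  shows "cmod (G z) \<le> (LINT y:{a<..<b}|lborel. \<psi> y * (1 / g y))"
proof -
  have "cmod (G z) \<le> (LINT y:{a<..<b}|lborel. norm (of_real (\<psi> y) / (z - of_real y)))"
    unfolding G_def by (rule set_integral_norm_bound[OF G_integrable[OF assms(1)]])
  also have "\<dots> \<le> (LINT y:{a<..<b}|lborel. \<psi> y * (1 / g y))"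
  proof (rule set_integral_mono)
    show "set_integrable lborel {a<..<b} (\<lambda>y. norm (of_real (\<psi> y) / (z - of_real y)))"
      using G_integrable[OF assms(1)] by (rule set_integrable_norm)
    show "set_integrable lborel {a<..<b} (\<lambda>y. \<psi> y * (1 / g y))" by (rule psi_mult_integrable[OF assms(3)])
    fix y assume y: "y \<in> {a<..<b}"
    have "1 / cmod (z - of_real y) \<le> 1 / g y" using assms(2)[OF y] by (intro divide_left_mono) (auto intro!: mult_pos_pos)
    from mult_left_mono[OF this psi_nonneg[OF y]]
    show "norm (of_real (\<psi> y) / (z - of_real y)) \<le> \<psi> y * (1 / g y)"
      using psi_nonneg[OF y] by (simp add: norm_divide)
  qed
  finally show ?thesis .
qed

text \<open>|z - y| is at least |Re z - y|, so off the strip the complex resolvent is dominated by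
  the real one at Re z.\<close>

lemma G_bounded_off_support: "\<exists>C. \<forall>z. Im z > 0 \<longrightarrow> (b < Re z \<or> Re z < a) \<longrightarrow> cmod (G z) \<le> C"
proof -
  obtain C1 where C1: "\<And>x. x > b \<Longrightarrow> (LINT y:{a<..<b}|lborel. \<psi> y * (1 / (x - y))) \<le> C1" using resolvent_bound_right by blast
  obtain C2 where C2: "\<And>x. x < a \<Longrightarrow> (LINT y:{a<..<b}|lborel. \<psi> y * (1 / (y - x))) \<le> C2" using resolvent_bound_left by blast
  have "cmod (G z) \<le> max C1 C2" if z: "Im z > 0" "b < Re z \<or> Re z < a" for z
    using z(2)
  proof
    assume r: "b < Re z"
    have "cmod (G z) \<le> (LINT y:{a<..<b}|lborel. \<psi> y * (1 / (Re z - y)))"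
    proof (rule G_norm_bound[OF z(1)])
      fix y assume "y \<in> {a<..<b}"
      then show "0 < Re z - y \<and> Re z - y \<le> cmod (z - of_real y)" using r complex_Re_le_cmod[of "z - of_real y"] by simp
    qed (use r in \<open>auto intro!: continuous_intros\<close>)
    then show ?thesis using C1[OF r] by linarith
  next
    assume r: "Re z < a"
    have "cmod (G z) \<le> (LINT y:{a<..<b}|lborel. \<psi> y * (1 / (y - Re z)))"
    proof (rule G_norm_bound[OF z(1)])
      fix y assume "y \<in> {a<..<b}"
      then show "0 < y - Re z \<and> y - Re z \<le> cmod (z - of_real y)" using r abs_Re_le_cmod[of "z - of_real y"] by simp
    qed (use r in \<open>auto intro!: continuous_intros\<close>)
    then show ?thesis using C2[OF r] by linarith
  qed
  then show ?thesis by blast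
qed

text \<open>One integrable majorant serves all s with the comparability of
  \<open>approach_critical\<close>, so the limit s to p can be taken under the integral. The factor
  8 comes from two kernels, each with the factor 4.\<close>

lemma ker_dominated_integrable:
  assumes "p = sa \<or> p = sb"
  shows "\<exists>C. set_integrable lborel {a<..<b} (\<lambda>x. C * edge a b x) \<and> C \<ge> 0 \<and>
    (\<forall>s. (\<forall>x\<in>{a<..<b}. cmod (I x - of_real p) \<le> 4 * cmod (I x - s) \<and> cmod (I x - of_real p) \<le> 4 * cmod (I x - cnj s))
      \<longrightarrow> (\<forall>x\<in>{a<..<b}. cmod (of_real (V' x) * ker s x) \<le> C * edge a b x))"
proof -
  obtain K where K: "K > 0" "\<And>x. x \<in> {a<..<b} \<Longrightarrow> 1 / cmod (I x - of_real p) \<le> K * edge a b x"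
    using inverse_edge_bound[OF assms] by blast
  have "continuous_on {a..b} V'" by (rule continuous_on_subset[OF V'_cont sub_pos])
  then have "bounded (V' ` {a..b})" using compact_continuous_image compact_imp_bounded by blast
  then obtain M where M: "\<And>x. x \<in> {a..b} \<Longrightarrow> norm (V' x) \<le> M" unfolding bounded_iff by blast
  define C where "C = \<bar>M\<bar> * (8 * K)"
  have "cmod (of_real (V' x) * ker s x) \<le> C * edge a b x"
    if s: "\<forall>x\<in>{a<..<b}. cmod (I x - of_real p) \<le> 4 * cmod (I x - s) \<and> cmod (I x - of_real p) \<le> 4 * cmod (I x - cnj s)"
      and x: "x \<in> {a<..<b}" for s x
  proof -
    have n: "0 < cmod (I x - of_real p)" using I_ne[OF x] by simp
    have inv: "cmod (1 / z) \<le> 4 * (K * edge a b x)" if "cmod (I x - of_real p) \<le> 4 * cmod z" for z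
    proof -
      have "cmod (1 / z) = 4 * (1 / (4 * cmod z))" by (simp add: norm_divide)
      also have "\<dots> \<le> 4 * (1 / cmod (I x - of_real p))" using n that by (intro mult_left_mono divide_left_mono) (auto intro!: mult_pos_pos)
      also have "\<dots> \<le> 4 * (K * edge a b x)" using K(2)[OF x] by simp
      finally show ?thesis .
    qed
    have 1: "cmod (1 / (I x - s)) \<le> 4 * (K * edge a b x)" by (rule inv) (use s x in blast)
    have eq: "cmod (cnj (I x) - s) = cmod (I x - cnj s)" by (metis complex_cnj_cnj complex_cnj_diff complex_mod_cnj)
    have 2: "cmod (1 / (cnj (I x) - s)) \<le> 4 * (K * edge a b x)" by (rule inv) (unfold eq, use s x in blast)
    have "cmod (ker s x) \<le> 8 * K * edge a b x"
      unfolding ker_def using norm_triangle_ineq4[of "1 / (I x - s)" "1 / (cnj (I x) - s)"] 1 2 by linarith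
    moreover have "cmod (of_real (V' x)) \<le> \<bar>M\<bar>" using M[of x] x by auto
    ultimately have "cmod (of_real (V' x)) * cmod (ker s x) \<le> \<bar>M\<bar> * (8 * K * edge a b x)" by (intro mult_mono) auto
    then show ?thesis by (simp add: C_def norm_mult mult.assoc)
  qed
  moreover have "set_integrable lborel {a<..<b} (\<lambda>x. C * edge a b x)"
    using edge_integrable[of a b] Jab by (intro set_integrable_mult_right) auto
  moreover have "C \<ge> 0" using K by (simp add: C_def)
  ultimately show ?thesis by blast
qed

lemma critical_ker_cont: "continuous_on {a<..<b} (\<lambda>x. of_real (V' x) * ker (of_real p) x)"
proof -
  have "continuous_on {a<..<b} V'" by (rule continuous_on_subset[OF V'_cont]) (use a_pos in auto)
  moreover have "cnj (I x) \<noteq> of_real p" if "x \<in> {a<..<b}" for x using I_upper[OF that] by (auto simp: complex_eq_iff)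
  ultimately show ?thesis unfolding ker_def using I_ne[of _ p] by (intro continuous_intros I_cont_open) auto
qed

lemma critical_ker_integrable:
  assumes "p = sa \<or> p = sb" shows "set_integrable lborel {a<..<b} (\<lambda>x. of_real (V' x) * ker (of_real p) x)"
proof -
  obtain C where C: "set_integrable lborel {a<..<b} (\<lambda>x. C * edge a b x)" "C \<ge> 0"
    "\<And>s x. (\<forall>x\<in>{a<..<b}. cmod (I x - of_real p) \<le> 4 * cmod (I x - s) \<and> cmod (I x - of_real p) \<le> 4 * cmod (I x - cnj s))
      \<Longrightarrow> x\<in>{a<..<b} \<Longrightarrow> cmod (of_real (V' x) * ker s x) \<le> C * edge a b x"
    using ker_dominated_integrable[OF assms] by blast
  show ?thesis
  proof (rule set_integrable_bound[OF C(1)])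
    show "set_borel_measurable lborel {a<..<b} (\<lambda>x. of_real (V' x) * ker (of_real p) x)"
      using borel_measurable_continuous_on_indicator[OF _ critical_ker_cont] by (simp add: set_borel_measurable_def)
    show "AE x in lborel. x \<in> {a<..<b} \<longrightarrow> norm (of_real (V' x) * ker (of_real p) x) \<le> norm (C * edge a b x)"
    proof (intro AE_I2 impI)
      fix x assume "x \<in> {a<..<b}"
      then have "cmod (of_real (V' x) * ker (of_real p) x) \<le> C * edge a b x" by (intro C(3)) auto
      then show "norm (of_real (V' x) * ker (of_real p) x) \<le> norm (C * edge a b x)" by (rule order_trans) simp
    qed
  qed
qed

lemma endpoint_condition:
  assumes p: "p = sa \<or> p = sb"
  shows "Mom (of_real p) = - 1 / of_real p"
proof -
  define sg :: real where "sg = (if p = sb then 1 else -1)"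
  have psg: "(p = sb \<and> sg = 1) \<or> (p = sa \<and> sg = -1)" using p by (auto simp: sg_def)
  have sg: "sg = 1 \<or> sg = -1" by (simp add: sg_def)
  obtain C where C: "set_integrable lborel {a<..<b} (\<lambda>x. C * edge a b x)" "C \<ge> 0"
    "\<And>s x. (\<forall>x\<in>{a<..<b}. cmod (I x - of_real p) \<le> 4 * cmod (I x - s) \<and> cmod (I x - of_real p) \<le> 4 * cmod (I x - cnj s))
      \<Longrightarrow> x\<in>{a<..<b} \<Longrightarrow> cmod (of_real (V' x) * ker s x) \<le> C * edge a b x"
    using ker_dominated_integrable[OF p] by blast
  obtain CG where CG: "\<And>z. Im z > 0 \<Longrightarrow> b < Re z \<or> Re z < a \<Longrightarrow> cmod (G z) \<le> CG" using G_bounded_off_support by blast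
  \<comment> \<open>The factor \<open>wa / 2\<close> keeps every h n in the range that
    \<open>approach_critical\<close> admits.\<close>
  define h where "h n = wa / 2 * (1 / (real n + 1))" for n
  have h: "0 < h n" "h n < wa" for n
  proof -
    show "0 < h n" using wa_pos by (simp add: h_def)
    have le: "wa / 2 * (1 / (real n + 1)) \<le> wa / 2 * 1" using wa_pos by (intro mult_left_mono) auto
    have hf: "t / 2 * 1 < t" if "t > 0" for t :: real using that by simp
    show "h n < wa" unfolding h_def by (rule le_less_trans[OF le hf[OF wa_pos]])
  qed
  have h0: "h \<longlonglongrightarrow> 0"
    unfolding h_def[abs_def] using LIMSEQ_inverse_real_of_nat by (intro tendsto_mult_right_zero) (simp add: divide_inverse add.commute)
  have "\<forall>n. \<exists>s. Im s > 0 \<and> Im (J s) > 0 \<and> cmod (s - of_real p) \<le> 2 * h n \<and> (sg = 1 \<longrightarrow> b < Re (J s)) \<and> (sg = -1 \<longrightarrow> Re (J s) < a)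
     \<and> (\<forall>x\<in>{a<..<b}. cmod (I x - of_real p) \<le> 4 * cmod (I x - s) \<and> cmod (I x - of_real p) \<le> 4 * cmod (I x - cnj s))"
    using approach_critical[OF psg h] by blast
  then obtain s where s: "\<And>n. Im (s n) > 0" "\<And>n. Im (J (s n)) > 0" "\<And>n. cmod (s n - of_real p) \<le> 2 * h n"
    "\<And>n. (sg = 1 \<longrightarrow> b < Re (J (s n))) \<and> (sg = -1 \<longrightarrow> Re (J (s n)) < a)"
    "\<And>n. \<forall>x\<in>{a<..<b}. cmod (I x - of_real p) \<le> 4 * cmod (I x - s n) \<and> cmod (I x - of_real p) \<le> 4 * cmod (I x - cnj (s n))"
    by metis
  have sp: "s \<longlonglongrightarrow> of_real p"
  proof (rule LIM_zero_cancel, rule tendsto_0_le[where K = 2, OF h0])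
    show "\<forall>\<^sub>F n in sequentially. norm (s n - of_real p) \<le> norm (h n) * 2"
      using s(3) h by (intro always_eventually) (auto simp: mult.commute abs_of_pos)
  qed
  have pslit: "of_real p \<in> slit" using p sa_less sb_pos by (auto simp: slit_eq)
  \<comment> \<open>\<open>qf\<close> has a pole at p, so the quotient J / qf is read as J', which
    is continuous at p and vanishes there.\<close>
  have dJ: "deriv J (s n) = J (s n) / qf (s n)" for n
  proof (rule DERIV_imp_deriv, rule deriv_J_qf(1))
    show "s n \<in> slit" using s(1)[of n] by (auto simp: slit_eq)
    show "s n \<noteq> - of_real c" "s n \<noteq> of_real sa" "s n \<noteq> of_real sb" using s(1)[of n] by auto
  qed
  have "isCont (deriv J) (of_real p)"
    using holomorphic_on_imp_continuous_on[OF holomorphic_deriv[OF J_holomorphic open_slit]] open_slit pslit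
    by (simp add: continuous_on_eq_continuous_at)
  then have "(\<lambda>n. deriv J (s n)) \<longlonglongrightarrow> deriv J (of_real p)" using sp by (rule isCont_tendsto_compose)
  then have dJ0: "(\<lambda>n. J (s n) / qf (s n)) \<longlonglongrightarrow> 0" using deriv_J_crit p by (auto simp: dJ)
  have lhs: "(\<lambda>n. G (J (s n)) * (J (s n) / qf (s n))) \<longlonglongrightarrow> 0"
  proof (rule tendsto_0_le[OF dJ0, where K = CG])
    show "\<forall>\<^sub>F n in sequentially. norm (G (J (s n)) * (J (s n) / qf (s n))) \<le> norm (J (s n) / qf (s n)) * CG"
    proof (intro always_eventually allI)
      fix n
      have "cmod (G (J (s n))) \<le> CG" using CG[OF s(2)[of n]] s(4)[of n] sg by auto
      from mult_left_mono[OF this, of "norm (J (s n) / qf (s n))"]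
      show "norm (G (J (s n)) * (J (s n) / qf (s n))) \<le> norm (J (s n) / qf (s n)) * CG"
        by (simp only: norm_mult norm_ge_zero mult.commute[of "norm (G _)"])
    qed
  qed
  have V'c: "continuous_on {a..b} V'" by (rule continuous_on_subset[OF V'_cont sub_pos])
  have "(\<lambda>n. LINT x:{a<..<b}|lborel. of_real (V' x) * ker (s n) x) \<longlonglongrightarrow> (LINT x:{a<..<b}|lborel. of_real (V' x) * ker (of_real p) x)"
    unfolding set_lebesgue_integral_def
  proof (rule integral_dominated_convergence[where w = "\<lambda>x. indicator {a<..<b} x *\<^sub>R (C * edge a b x)"])
    show "(\<lambda>x. indicator {a<..<b} x *\<^sub>R (of_real (V' x) * ker (of_real p) x)) \<in> borel_measurable lborel"
      using borel_measurable_continuous_on_indicator[OF _ critical_ker_cont] by simp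
    show "(\<lambda>x. indicator {a<..<b} x *\<^sub>R (of_real (V' x) * ker (s n) x)) \<in> borel_measurable lborel" for n
    proof -
      have "continuous_on {a..b} (\<lambda>x. of_real (V' x) * ker (s n) x)"
        by (intro continuous_intros V'c ker_cont curve_avoids s(1,2))
      then have "continuous_on {a<..<b} (\<lambda>x. of_real (V' x) * ker (s n) x)" by (rule continuous_on_subset) auto
      from borel_measurable_continuous_on_indicator[OF _ this] show ?thesis by simp
    qed
    show "integrable lborel (\<lambda>x. indicator {a<..<b} x *\<^sub>R (C * edge a b x))" using C(1) by (simp add: set_integrable_def)
    show "AE x in lborel. norm (indicator {a<..<b} x *\<^sub>R (of_real (V' x) * ker (s n) x)) \<le> indicator {a<..<b} x *\<^sub>R (C * edge a b x)" for n
      using C(3)[OF s(5)] by (intro AE_I2) (auto simp: indicator_def)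
    show "AE x in lborel. (\<lambda>n. indicator {a<..<b} x *\<^sub>R (of_real (V' x) * ker (s n) x)) \<longlonglongrightarrow> indicator {a<..<b} x *\<^sub>R (of_real (V' x) * ker (of_real p) x)"
    proof (intro AE_I2)
      fix x
      show "(\<lambda>n. indicator {a<..<b} x *\<^sub>R (of_real (V' x) * ker (s n) x)) \<longlonglongrightarrow> indicator {a<..<b} x *\<^sub>R (of_real (V' x) * ker (of_real p) x)"
      proof (cases "x \<in> {a<..<b}")
        case True
        have "I x - of_real p \<noteq> 0" "cnj (I x) - of_real p \<noteq> 0" using I_upper[OF True] by (auto simp: complex_eq_iff)
        then show ?thesis unfolding ker_def by (intro tendsto_intros sp)
      qed simp
    qed
  qed
  then have "(\<lambda>n. 1 / s n + Mom (s n)) \<longlonglongrightarrow> 1 / of_real p + Mom (of_real p)"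
    unfolding Mom_def using p sa_less sb_pos by (intro tendsto_intros sp) auto
  moreover have "1 / s n + Mom (s n) = G (J (s n)) * (J (s n) / qf (s n))" for n
    using resolvent_identity[OF s(1,2)[of n]] by simp
  ultimately have "1 / of_real p + Mom (of_real p) = 0" using lhs LIMSEQ_unique by simp
  then show ?thesis by (simp add: eq_neg_iff_add_eq_0 add.commute)
qed

end

section \<open>Moments of the potential\<close>

lemma quadratic_partial_fractions:
  fixes p q t u v :: complex
  assumes "p \<noteq> q" "t \<noteq> p" "t \<noteq> q"
  shows "(t + u) * (t + v) / ((t - p) * (t - q))
    = 1 + (p + u) * (p + v) / (p - q) * (1 / (t - p)) + (q + u) * (q + v) / (q - p) * (1 / (t - q))"
proof -
  define A B where "A = (p + u) * (p + v) / (p - q)" and "B = (q + u) * (q + v) / (q - p)"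
  have A: "A * (p - q) = (p + u) * (p + v)" and B: "B * (q - p) = (q + u) * (q + v)" using assms by (simp_all add: A_def B_def)
  have "(p - q) * ((t - p) * (t - q) + A * (t - q) + B * (t - p)) 
      = (p - q) * ((t - p) * (t - q)) + A * (p - q) * (t - q) - B * (q - p) * (t - p)"
    by (simp add: algebra_simps)
  also have "\<dots> = (p - q) * ((t + u) * (t + v))" unfolding A B by (simp add: algebra_simps)
  finally have e: "(t + u) * (t + v) = (t - p) * (t - q) + A * (t - q) + B * (t - p)" using assms(1) by simp
  have "1 + A * (1 / (t - p)) + B * (1 / (t - q)) = ((t - p) * (t - q) + A * (t - q) + B * (t - p)) / ((t - p) * (t - q))"
    using assms by (simp add: field_simps)
  then show ?thesis unfolding e A_def B_def by simp
qed

lemma has_real_derivative_ln_cmod: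
  fixes f :: "real \<Rightarrow> complex"
  assumes f: "(f has_vector_derivative f') (at x)" and nz: "f x \<noteq> 0"
  shows "((\<lambda>x. ln (cmod (f x))) has_real_derivative Re (f' / f x)) (at x)"
proof -
  have R: "((\<lambda>x. Re (f x)) has_real_derivative Re f') (at x)" and I: "((\<lambda>x. Im (f x)) has_real_derivative Im f') (at x)"
    using f by (simp_all add: has_real_derivative_iff_has_vector_derivative has_vector_derivative_complex_iff)
  define n where "n = (Re (f x))^2 + (Im (f x))^2"
  have n: "n > 0" using nz by (simp add: n_def complex_neq_0)
  have "((\<lambda>x. (Re (f x))^2 + (Im (f x))^2) has_real_derivative 2 * Re (f x) * Re f' + 2 * Im (f x) * Im f') (at x)"
    using DERIV_add[OF DERIV_power[OF R, of 2] DERIV_power[OF I, of 2]] by (simp add: mult_ac)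
  from DERIV_cdivide[OF DERIV_chain2[OF DERIV_ln_divide[OF n[unfolded n_def]] this], of 2]
  have "((\<lambda>x. ln ((Re (f x))^2 + (Im (f x))^2) / 2) has_real_derivative Re (f' / f x)) (at x)"
    by (simp add: Re_divide n_def[symmetric] add_divide_distrib mult_ac)
  moreover have "ln (cmod z) = ln ((Re z)^2 + (Im z)^2) / 2" for z
    by (simp add: cmod_def ln_sqrt)
  ultimately show ?thesis by (simp only:)
qed

lemma poisson_kernel_integral:
  fixes x0 e d :: real
  assumes "e > 0" "d > 0"
  shows "integrable lborel (\<lambda>y. indicator {x0 - d..x0 + d} y * (e / ((x0 - y)^2 + e^2)))"
    and "(\<integral>y. indicator {x0 - d..x0 + d} y * (e / ((x0 - y)^2 + e^2)) \<partial>lborel) = 2 * arctan (d / e)"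
proof -
  have nz: "(x0 - y)^2 + e^2 \<noteq> 0" for y using assms by (simp add: add_nonneg_eq_0_iff)
  have cont: "continuous_on {x0 - d..x0 + d} (\<lambda>y. e / ((x0 - y)^2 + e^2))" using nz by (intro continuous_intros) auto
  have "((\<lambda>y. arctan ((y - x0) / e)) has_real_derivative e / ((x0 - y)^2 + e^2)) (at y)" for y
  proof -
    have "1 + ((y - x0) / e)^2 = ((x0 - y)^2 + e^2) / e^2" using assms by (simp add: field_simps power2_eq_square)
    then show ?thesis using assms nz[of y]
      by (auto intro!: derivative_eq_intros simp: field_simps power2_eq_square)
  qed
  then have "((\<lambda>y. e / ((x0 - y)^2 + e^2)) has_integral arctan ((x0 + d - x0) / e) - arctan ((x0 - d - x0) / e)) {x0 - d..x0 + d}"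
    using assms by (intro fundamental_theorem_of_calculus) (auto simp: has_real_derivative_iff_has_vector_derivative intro: has_vector_derivative_at_within)
  then have hi: "integral {x0 - d..x0 + d} (\<lambda>y. e / ((x0 - y)^2 + e^2)) = 2 * arctan (d / e)"
    by (simp add: integral_unique arctan_minus)
  have si: "set_integrable lborel {x0 - d..x0 + d} (\<lambda>y. e / ((x0 - y)^2 + e^2))" by (rule borel_integrable_atLeastAtMost'[OF cont])
  show "integrable lborel (\<lambda>y. indicator {x0 - d..x0 + d} y * (e / ((x0 - y)^2 + e^2)))"
    using si by (simp add: set_integrable_def)
  show "(\<integral>y. indicator {x0 - d..x0 + d} y * (e / ((x0 - y)^2 + e^2)) \<partial>lborel) = 2 * arctan (d / e)"
    using set_borel_integral_eq_integral(2)[OF si] hi by (simp add: set_lebesgue_integral_def)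
qed

text \<open>The kernel e / ((x0 - y)^2 + e^2) has total mass pi and concentrates at x0. The error
  splits into the oscillation of f on [x0 - d, x0 + d], the tail bounded by e F / d^2, and the mass
  pi - 2 arctan (d/e) missing from the window.\<close>

lemma poisson_kernel_limit:
  fixes f :: "real \<Rightarrow> real" and \<epsilon> :: "nat \<Rightarrow> real"
  assumes f: "set_integrable lborel {a<..<b} f" and cont: "continuous_on {a<..<b} f" and x0: "x0 \<in> {a<..<b}"
    and eps: "\<And>n. \<epsilon> n > 0" and eps0: "\<epsilon> \<longlonglongrightarrow> 0"
  shows "(\<lambda>n. LINT y:{a<..<b}|lborel. f y * (\<epsilon> n / ((x0 - y)^2 + (\<epsilon> n)^2))) \<longlonglongrightarrow> pi * f x0"
proof (rule LIMSEQ_I)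
  fix r :: real assume r: "r > 0"
  \<comment> \<open>The mass of the window is at most pi, so an oscillation below this value
    contributes at most r/2.\<close>
  define \<eta> where "\<eta> = r / (2 * pi)"
  have eta: "\<eta> > 0" "\<eta> * pi = r / 2" using r by (simp_all add: \<eta>_def)
  define F where "F = (LINT y:{a<..<b}|lborel. \<bar>f y\<bar>)"
  have fi: "integrable lborel (\<lambda>y. indicator {a<..<b} y * \<bar>f y\<bar>)"
    using set_integrable_abs[OF f] by (simp add: set_integrable_def)
  have "isCont f x0" using cont x0 by (simp add: continuous_on_eq_continuous_at)
  then obtain d1 where d1: "d1 > 0" "\<And>y. dist y x0 < d1 \<Longrightarrow> dist (f y) (f x0) < \<eta>"
    unfolding continuous_at_eps_delta using eta by blast
  define d where "d = min (d1 / 2) (min ((x0 - a) / 2) ((b - x0) / 2))"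
  have d: "d > 0" "d < d1" "a < x0 - d" "x0 + d < b" using d1 x0 by (auto simp: d_def min_def field_simps)
  let ?S = "{x0 - d..x0 + d}"
  let ?P = "\<lambda>e y. e / ((x0 - y)^2 + e^2)"
  have bound: "\<bar>(LINT y:{a<..<b}|lborel. f y * ?P e y) - pi * f x0\<bar>
      \<le> r / 2 + e * F / d^2 + \<bar>f x0\<bar> * \<bar>2 * arctan (d / e) - pi\<bar>" if e: "e > 0" for e
  proof -
    note Pk = poisson_kernel_integral[OF e d(1), of x0]
    have Pn: "0 \<le> ?P e y" for y using e by simp
    define g where "g y = indicator {a<..<b} y * (f y * ?P e y) - f x0 * (indicator ?S y * ?P e y)" for y
    have nz: "(x0 - y)^2 + e^2 \<noteq> 0" for y using e by (simp add: add_nonneg_eq_0_iff)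
    have "continuous_on {a<..<b} (\<lambda>y. f y * ?P e y)" using nz cont by (intro continuous_intros) auto
    from borel_measurable_continuous_on_indicator[OF _ this]
    have m: "(\<lambda>y. indicator {a<..<b} y *\<^sub>R (f y * ?P e y)) \<in> borel_measurable lborel" by simp
    have i1: "integrable lborel (\<lambda>y. indicator {a<..<b} y * (f y * ?P e y))"
    proof (rule Bochner_Integration.integrable_bound)
      show "integrable lborel (\<lambda>y. 1 / e * (indicator {a<..<b} y * \<bar>f y\<bar>))" using fi by (rule integrable_mult_right)
      show "(\<lambda>y. indicator {a<..<b} y * (f y * ?P e y)) \<in> borel_measurable lborel" using m by simp
      show "AE y in lborel. norm (indicator {a<..<b} y * (f y * ?P e y)) \<le> norm (1 / e * (indicator {a<..<b} y * \<bar>f y\<bar>))"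
      proof (intro AE_I2)
        fix y
        have "?P e y \<le> e / e^2" using e by (intro divide_left_mono) (auto intro!: mult_pos_pos add_nonneg_pos)
        also have "e / e^2 = 1 / e" using e by (simp add: power2_eq_square)
        finally have "\<bar>f y\<bar> * ?P e y \<le> \<bar>f y\<bar> * (1 / e)" by (rule mult_left_mono) simp
        then have *: "indicator {a<..<b} y * (\<bar>f y\<bar> * ?P e y) \<le> indicator {a<..<b} y * (\<bar>f y\<bar> * (1 / e))" by (rule mult_left_mono) simp
        have "norm (indicator {a<..<b} y * (f y * ?P e y)) = indicator {a<..<b} y * (\<bar>f y\<bar> * ?P e y)"
          using Pn[of y] by (simp only: real_norm_def abs_mult abs_of_nonneg) simp
        also note *
        also have "indicator {a<..<b} y * (\<bar>f y\<bar> * (1 / e)) = norm (1 / e * (indicator {a<..<b} y * \<bar>f y\<bar>))" using e by (simp add: abs_mult)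
        finally show "norm (indicator {a<..<b} y * (f y * ?P e y)) \<le> norm (1 / e * (indicator {a<..<b} y * \<bar>f y\<bar>))" .
      qed
    qed
    have i2: "integrable lborel (\<lambda>y. f x0 * (indicator ?S y * ?P e y))" by (rule integrable_mult_right[OF Pk(1)])
    have gi: "integrable lborel g" unfolding g_def by (rule Bochner_Integration.integrable_diff[OF i1 i2])
    have gv: "integral\<^sup>L lborel g = (LINT y:{a<..<b}|lborel. f y * ?P e y) - f x0 * (2 * arctan (d / e))"
      unfolding g_def Bochner_Integration.integral_diff[OF i1 i2] integral_mult_right_zero Pk(2)
      by (simp add: set_lebesgue_integral_def)
    have "norm (integral\<^sup>L lborel g) \<le> (\<integral>y. \<eta> * (indicator ?S y * ?P e y) + e / d^2 * (indicator {a<..<b} y * \<bar>f y\<bar>) \<partial>lborel)"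
    proof (rule Bochner_Integration.integral_norm_bound_integral[OF gi])
      show "integrable lborel (\<lambda>y. \<eta> * (indicator ?S y * ?P e y) + e / d^2 * (indicator {a<..<b} y * \<bar>f y\<bar>))"
        by (intro Bochner_Integration.integrable_add integrable_mult_right Pk(1) fi)
      fix y
      show "norm (g y) \<le> \<eta> * (indicator ?S y * ?P e y) + e / d^2 * (indicator {a<..<b} y * \<bar>f y\<bar>)"
      proof (cases "y \<in> ?S")
        case True
        have yab: "y \<in> {a<..<b}" using True d by auto
        have "\<bar>f y - f x0\<bar> \<le> \<eta>" using d1(2)[of y] True d by (auto simp: dist_real_def abs_le_iff abs_less_iff)
        then have "\<bar>f y - f x0\<bar> * ?P e y \<le> \<eta> * ?P e y" using Pn by (intro mult_right_mono) auto
        moreover have "g y = (f y - f x0) * ?P e y" unfolding g_def using True yab by (simp add: left_diff_distrib diff_divide_distrib)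
        then have "norm (g y) = \<bar>f y - f x0\<bar> * ?P e y" using Pn[of y] by (simp only: real_norm_def abs_mult abs_of_nonneg)
        moreover have "0 \<le> e / d^2 * (indicator {a<..<b} y * \<bar>f y\<bar>)" using e by simp
        ultimately show ?thesis using True by simp
      next
        case False
        then have "d \<le> \<bar>x0 - y\<bar>" by auto
        then have "d^2 \<le> (x0 - y)^2" using d(1) abs_le_square_iff[of d "x0 - y"] by simp
        then have "?P e y \<le> e / d^2" using e d(1) by (intro divide_left_mono) (auto intro!: mult_pos_pos add_nonneg_pos add_increasing2)
        then have "\<bar>f y\<bar> * ?P e y \<le> \<bar>f y\<bar> * (e / d^2)" by (intro mult_left_mono) auto
        then have *: "indicator {a<..<b} y * (\<bar>f y\<bar> * ?P e y) \<le> indicator {a<..<b} y * (\<bar>f y\<bar> * (e / d^2))" by (rule mult_left_mono) simp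
        have "norm (g y) = indicator {a<..<b} y * (\<bar>f y\<bar> * ?P e y)"
          unfolding g_def using False e by (cases "y \<in> {a<..<b}") (simp_all add: abs_mult)
        also note *
        finally show ?thesis using False by (simp add: mult_ac)
      qed
    qed
    also have "\<dots> = \<eta> * (2 * arctan (d / e)) + e / d^2 * F"
      unfolding Bochner_Integration.integral_add[OF integrable_mult_right[OF Pk(1)] integrable_mult_right[OF fi]] integral_mult_right_zero Pk(2)
      by (simp add: F_def set_lebesgue_integral_def)
    also have "\<dots> \<le> r / 2 + e * F / d^2"
    proof -
      have "2 * arctan (d / e) \<le> pi" using arctan_ubound[of "d / e"] by linarith
      then have "\<eta> * (2 * arctan (d / e)) \<le> \<eta> * pi" using eta by (intro mult_left_mono) auto
      then show ?thesis using eta by simp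
    qed
    finally have 1: "\<bar>(LINT y:{a<..<b}|lborel. f y * ?P e y) - f x0 * (2 * arctan (d / e))\<bar> \<le> r / 2 + e * F / d^2" by (simp only: gv real_norm_def)
    have "\<bar>f x0 * (2 * arctan (d / e)) - pi * f x0\<bar> = \<bar>f x0\<bar> * \<bar>2 * arctan (d / e) - pi\<bar>"
      unfolding abs_mult[symmetric] by (simp add: algebra_simps)
    with 1 show ?thesis by linarith
  qed
  have lim: "(\<lambda>n. \<epsilon> n * F / d^2 + \<bar>f x0\<bar> * \<bar>2 * arctan (d / \<epsilon> n) - pi\<bar>) \<longlonglongrightarrow> 0 * F / d^2 + \<bar>f x0\<bar> * \<bar>2 * (pi / 2) - pi\<bar>"
  proof (intro tendsto_intros eps0)
    have ev: "\<forall>\<^sub>F n in sequentially. \<epsilon> n > 0" using eps by simp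
    have "filterlim \<epsilon> (at_right 0) sequentially" using eps0 ev by (intro tendsto_imp_filterlim_at_right)
    then have "filterlim (\<lambda>n. inverse (\<epsilon> n)) at_top sequentially" by (rule filterlim_compose[OF filterlim_inverse_at_top_right])
    then have "filterlim (\<lambda>n. d * inverse (\<epsilon> n)) at_top sequentially" by (rule filterlim_tendsto_pos_mult_at_top[OF tendsto_const d(1)])
    then show "(\<lambda>n. arctan (d / \<epsilon> n)) \<longlonglongrightarrow> pi / 2" unfolding divide_inverse[of d] by (rule filterlim_compose[OF tendsto_arctan_at_top])
  qed (use d in auto)
  then have "(\<lambda>n. \<epsilon> n * F / d^2 + \<bar>f x0\<bar> * \<bar>2 * arctan (d / \<epsilon> n) - pi\<bar>) \<longlonglongrightarrow> 0" by simp
  then have "\<forall>\<^sub>F n in sequentially. \<epsilon> n * F / d^2 + \<bar>f x0\<bar> * \<bar>2 * arctan (d / \<epsilon> n) - pi\<bar> < r / 2"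
    by (rule order_tendstoD(2)) (use r in simp)
  then obtain N where N: "\<And>n. n \<ge> N \<Longrightarrow> \<epsilon> n * F / d^2 + \<bar>f x0\<bar> * \<bar>2 * arctan (d / \<epsilon> n) - pi\<bar> < r / 2"
    unfolding eventually_sequentially by blast
  show "\<exists>N. \<forall>n\<ge>N. norm ((LINT y:{a<..<b}|lborel. f y * ?P (\<epsilon> n) y) - pi * f x0) < r"
  proof (intro exI allI impI)
    fix n assume "N \<le> n"
    from N[OF this] bound[OF eps[of n]] show "norm ((LINT y:{a<..<b}|lborel. f y * ?P (\<epsilon> n) y) - pi * f x0) < r"
      unfolding real_norm_def by linarith
  qed
qed

section \<open>The system for the parameters and the resolvent formula\<close>

context equilibrium begin

text \<open>Both quotients have the same constant term 1, which cancels; only the poles at the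
  critical points remain, each in the form of the jump kernel.\<close>

lemma critical_difference:
  assumes x: "x \<in> {a<..<b}"
  shows "(I x + u) * (I x + v) / ((I x - of_real sa) * (I x - of_real sb))
    - (cnj (I x) + u) * (cnj (I x) + v) / ((cnj (I x) - of_real sa) * (cnj (I x) - of_real sb))
    = (of_real sa + u) * (of_real sa + v) / of_real (sa - sb) * ker (of_real sa) x
    + (of_real sb + u) * (of_real sb + v) / of_real (sb - sa) * ker (of_real sb) x"
proof -
  have ne: "complex_of_real sa \<noteq> of_real sb" using sab by simp
  have c: "cnj (I x) \<noteq> of_real p" for p using I_upper[OF x] by (auto simp: complex_eq_iff)
  show ?thesis
    unfolding quadratic_partial_fractions[OF ne I_ne[OF x] I_ne[OF x]] quadratic_partial_fractions[OF ne c c] ker_def of_real_diff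
    by (simp only: right_diff_distrib) (simp only: algebra_simps)
qed

text \<open>\<open>endpoint_condition\<close> gives the pole at p the weight - 1/p = 1/(0 - p). The
  resulting sum is the partial fraction expansion of the same quotient at t = 0, without its
  constant term 1.\<close>

lemma rational_moment:
  "(LINT x:{a<..<b}|lborel. of_real (V' x) * ((I x + u) * (I x + v) / ((I x - of_real sa) * (I x - of_real sb))
    - (cnj (I x) + u) * (cnj (I x) + v) / ((cnj (I x) - of_real sa) * (cnj (I x) - of_real sb)))) / (2 * of_real pi * \<i>)
    = u * v / of_real (sa * sb) - 1"
proof -
  define A B where "A = (of_real sa + u) * (of_real sa + v) / of_real (sa - sb)" and "B = (of_real sb + u) * (of_real sb + v) / of_real (sb - sa)"
  have i: "set_integrable lborel {a<..<b} (\<lambda>x. of_real (V' x) * ker (of_real sa) x)" "set_integrable lborel {a<..<b} (\<lambda>x. of_real (V' x) * ker (of_real sb) x)"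
    by (rule critical_ker_integrable; simp)+
  have "(LINT x:{a<..<b}|lborel. of_real (V' x) * ((I x + u) * (I x + v) / ((I x - of_real sa) * (I x - of_real sb))
    - (cnj (I x) + u) * (cnj (I x) + v) / ((cnj (I x) - of_real sa) * (cnj (I x) - of_real sb))))
    = (LINT x:{a<..<b}|lborel. A * (of_real (V' x) * ker (of_real sa) x) + B * (of_real (V' x) * ker (of_real sb) x))"
  proof (rule set_lebesgue_integral_cong, simp, intro allI impI)
    fix x assume "x \<in> {a<..<b}"
    show "of_real (V' x) * ((I x + u) * (I x + v) / ((I x - of_real sa) * (I x - of_real sb))
    - (cnj (I x) + u) * (cnj (I x) + v) / ((cnj (I x) - of_real sa) * (cnj (I x) - of_real sb)))
      = A * (of_real (V' x) * ker (of_real sa) x) + B * (of_real (V' x) * ker (of_real sb) x)"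
      unfolding critical_difference[OF \<open>x \<in> {a<..<b}\<close>] A_def[symmetric] B_def[symmetric] by (simp only: distrib_left mult.left_commute)
  qed
  also have "\<dots> = A * (LINT x:{a<..<b}|lborel. of_real (V' x) * ker (of_real sa) x) + B * (LINT x:{a<..<b}|lborel. of_real (V' x) * ker (of_real sb) x)"
    by (simp only: set_integral_add(2)[OF set_integrable_mult_right[OF i(1)] set_integrable_mult_right[OF i(2)]] set_integral_mult_right)
  finally have "(LINT x:{a<..<b}|lborel. of_real (V' x) * ((I x + u) * (I x + v) / ((I x - of_real sa) * (I x - of_real sb))
    - (cnj (I x) + u) * (cnj (I x) + v) / ((cnj (I x) - of_real sa) * (cnj (I x) - of_real sb)))) / (2 * of_real pi * \<i>)
    = A * Mom (of_real sa) + B * Mom (of_real sb)"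
    by (simp add: Mom_def add_divide_distrib)
  also have "\<dots> = A * (1 / (0 - of_real sa)) + B * (1 / (0 - of_real sb))"
    using endpoint_condition[of sa] endpoint_condition[of sb] by simp
  also have "\<dots> = (0 + u) * (0 + v) / ((0 - of_real sa) * (0 - of_real sb)) - 1"
    using quadratic_partial_fractions[of "of_real sa" "of_real sb" 0 u v] sab sa_less sb_pos by (simp add: A_def B_def)
  finally show ?thesis by simp
qed

lemma qf_quotients:
  assumes "z \<noteq> of_real sa" "z \<noteq> of_real sb"
  shows "z \<noteq> 0 \<Longrightarrow> qf z / z = (z + 1) * (z + of_real c) / ((z - of_real sa) * (z - of_real sb))"
    and "z \<noteq> -1 \<Longrightarrow> qf z / (z + 1) = (z + 0) * (z + of_real c) / ((z - of_real sa) * (z - of_real sb))"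
  using assms by (simp_all add: qf_def add_eq_0_iff2)

lemma qf_cnj: "qf (cnj s) = cnj (qf s)" by (simp add: qf_def)

lemma curve_I': "x \<in> {a<..<b} \<Longrightarrow> of_real x * I' x = qf (I x)"
  using a_pos by (simp add: I'_def)

text \<open>As x I' = q(I), dividing by I or by I + 1 cancels a factor of q and leaves the quotients
  of \<open>rational_moment\<close> with v = c and u = 1 or u = 0. Since sa sb = - c / theta, their
  values are - theta - 1 and - 1; the sign is absorbed because the upper arc is traversed
  backwards.\<close>

lemma contour_moments:
  shows "(LINT x:{a<..<b}|lborel. of_real (V' x * x) * (cnj (I' x) / cnj (I x) - I' x / I x)) / (2 * of_real pi * \<i>) = of_real (1 + \<theta>)"
    and "(LINT x:{a<..<b}|lborel. of_real (V' x * x) * (cnj (I' x) / (cnj (I x) + 1) - I' x / (I x + 1))) / (2 * of_real pi * \<i>) = 1"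
proof -
  have eq: "of_real (V' x * x) * (cnj (I' x) / cnj (I x) - I' x / I x)
      = - (of_real (V' x) * ((I x + 1) * (I x + of_real c) / ((I x - of_real sa) * (I x - of_real sb))
        - (cnj (I x) + 1) * (cnj (I x) + of_real c) / ((cnj (I x) - of_real sa) * (cnj (I x) - of_real sb))))"
      "of_real (V' x * x) * (cnj (I' x) / (cnj (I x) + 1) - I' x / (I x + 1))
      = - (of_real (V' x) * ((I x + 0) * (I x + of_real c) / ((I x - of_real sa) * (I x - of_real sb))
        - (cnj (I x) + 0) * (cnj (I x) + of_real c) / ((cnj (I x) - of_real sa) * (cnj (I x) - of_real sb))))"
      if x: "x \<in> {a<..<b}" for x
  proof -
    have n: "I x \<noteq> of_real r" "cnj (I x) \<noteq> of_real r" for r using I_upper[OF x] by (auto simp: complex_eq_iff)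
    have n0: "I x \<noteq> 0" "cnj (I x) \<noteq> 0" "I x \<noteq> -1" "cnj (I x) \<noteq> -1" using n[of 0] n[of "-1"] by auto
    have e: "of_real (V' x * x) * (cnj (I' x) / w - I' x / w') = - (of_real (V' x) * (qf (I x) / w' - qf (cnj (I x)) / w))" for w w'
      unfolding qf_cnj curve_I'[OF x, symmetric] by (simp add: algebra_simps)
    show "of_real (V' x * x) * (cnj (I' x) / cnj (I x) - I' x / I x)
      = - (of_real (V' x) * ((I x + 1) * (I x + of_real c) / ((I x - of_real sa) * (I x - of_real sb))
        - (cnj (I x) + 1) * (cnj (I x) + of_real c) / ((cnj (I x) - of_real sa) * (cnj (I x) - of_real sb))))"
      unfolding e qf_quotients(1)[OF n(1) n(1) n0(1)] qf_quotients(1)[OF n(2) n(2) n0(2)] ..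
    show "of_real (V' x * x) * (cnj (I' x) / (cnj (I x) + 1) - I' x / (I x + 1))
      = - (of_real (V' x) * ((I x + 0) * (I x + of_real c) / ((I x - of_real sa) * (I x - of_real sb))
        - (cnj (I x) + 0) * (cnj (I x) + of_real c) / ((cnj (I x) - of_real sa) * (cnj (I x) - of_real sb))))"
      unfolding e qf_quotients(2)[OF n(1) n(1) n0(3)] qf_quotients(2)[OF n(2) n(2) n0(4)] ..
  qed
  have neg: "(LINT x:{a<..<b}|lborel. - f x) = - (LINT x:{a<..<b}|lborel. f x)" for f :: "real \<Rightarrow> complex"
    by (simp add: set_lebesgue_integral_def)
  have cong: "(LINT x:{a<..<b}|lborel. f x) = (LINT x:{a<..<b}|lborel. g x)" if "\<And>x. x \<in> {a<..<b} \<Longrightarrow> f x = g x" for f g :: "real \<Rightarrow> complex"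
    by (rule set_lebesgue_integral_cong) (use that in auto)
  have v: "1 * complex_of_real c / of_real (sa * sb) - 1 = - of_real (1 + \<theta>)" "complex_of_real c / of_real (sa * sb) = - of_real \<theta>"
  proof -
    have "c / (sa * sb) = - \<theta>" unfolding s_prod using th c_gt_1 by simp
    then show "complex_of_real c / of_real (sa * sb) = - of_real \<theta>" by (metis of_real_divide of_real_minus)
    then show "1 * complex_of_real c / of_real (sa * sb) - 1 = - of_real (1 + \<theta>)" by simp
  qed
  have l: "(LINT x:{a<..<b}|lborel. of_real (V' x * x) * (cnj (I' x) / cnj (I x) - I' x / I x)) = (LINT x:{a<..<b}|lborel. - (of_real (V' x) * ((I x + 1) * (I x + of_real c) / ((I x - of_real sa) * (I x - of_real sb))
        - (cnj (I x) + 1) * (cnj (I x) + of_real c) / ((cnj (I x) - of_real sa) * (cnj (I x) - of_real sb)))))"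
    "(LINT x:{a<..<b}|lborel. of_real (V' x * x) * (cnj (I' x) / (cnj (I x) + 1) - I' x / (I x + 1))) = (LINT x:{a<..<b}|lborel. - (of_real (V' x) * ((I x + 0) * (I x + of_real c) / ((I x - of_real sa) * (I x - of_real sb))
        - (cnj (I x) + 0) * (cnj (I x) + of_real c) / ((cnj (I x) - of_real sa) * (cnj (I x) - of_real sb)))))"
    by (rule cong, erule eq)+
  show "(LINT x:{a<..<b}|lborel. of_real (V' x * x) * (cnj (I' x) / cnj (I x) - I' x / I x)) / (2 * of_real pi * \<i>) = of_real (1 + \<theta>)"
    unfolding l(1) neg minus_divide_left[symmetric] rational_moment[of 1 "of_real c"] v(1) by (rule minus_minus)
  show "(LINT x:{a<..<b}|lborel. of_real (V' x * x) * (cnj (I' x) / (cnj (I x) + 1) - I' x / (I x + 1))) / (2 * of_real pi * \<i>) = 1"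
    unfolding l(2) neg minus_divide_left[symmetric] rational_moment[of 0 "of_real c"] by simp
qed

text \<open>This brings the factor q(s) of the resolvent identity under the integral sign: apart
  from a constant, the correction terms have poles only at \<open>sa\<close> and \<open>sb\<close>,
  where the integrals against V' are known.\<close>

lemma qf_divided_difference:
  assumes t: "t \<noteq> of_real sa" "t \<noteq> of_real sb" "t \<noteq> 0" and s: "s \<noteq> of_real sa" "s \<noteq> of_real sb" "s \<noteq> 0" and ts: "t \<noteq> s"
  defines "Ba \<equiv> (of_real sa + 1) * (of_real sa + of_real c) / (of_real sa - of_real sb)"
    and "Bb \<equiv> (of_real sb + 1) * (of_real sb + of_real c) / (of_real sb - of_real sa)"
  shows "qf t / (t - s) = qf s / (t - s) + 1 - Ba * of_real sa / (s - of_real sa) * (1 / (t - of_real sa))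
    - Bb * of_real sb / (s - of_real sb) * (1 / (t - of_real sb))"
proof -
  have ne: "complex_of_real sa \<noteq> of_real sb" using sab by simp
  \<comment> \<open>Multiplying the expansion of q(z)/z by z puts q in a form whose difference
    between t and s can be taken pole by pole.\<close>
  have h: "qf z = z + Ba * (z / (z - of_real sa)) + Bb * (z / (z - of_real sb))" if "z \<noteq> of_real sa" "z \<noteq> of_real sb" "z \<noteq> 0" for z
  proof -
    have "qf z / z = 1 + Ba * (1 / (z - of_real sa)) + Bb * (1 / (z - of_real sb))"
      unfolding qf_quotients(1)[OF that] quadratic_partial_fractions[OF ne that(1,2)] Ba_def Bb_def ..
    then have "qf z = z * (1 + Ba * (1 / (z - of_real sa)) + Bb * (1 / (z - of_real sb)))" using that(3) by (simp add: field_simps)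
    then show ?thesis by (simp add: distrib_left mult_ac)
  qed
  have d: "t / (t - p) - s / (s - p) = - (p / (s - p) * (1 / (t - p))) * (t - s)" if "t \<noteq> p" "s \<noteq> p" for p
  proof -
    have "t / (t - p) - s / (s - p) = (t * (s - p) - s * (t - p)) / ((t - p) * (s - p))" using that by (simp add: diff_frac_eq)
    also have "t * (s - p) - s * (t - p) = - p * (t - s)" by (simp add: algebra_simps)
    finally show ?thesis by (simp add: mult_ac)
  qed
  have "qf t - qf s = (t - s) + Ba * (t / (t - of_real sa) - s / (s - of_real sa)) + Bb * (t / (t - of_real sb) - s / (s - of_real sb))"
    unfolding h[OF t] h[OF s] by (simp add: right_diff_distrib)
  also have "\<dots> = (1 - Ba * of_real sa / (s - of_real sa) * (1 / (t - of_real sa)) - Bb * of_real sb / (s - of_real sb) * (1 / (t - of_real sb))) * (t - s)"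
    unfolding d[OF t(1) s(1)] d[OF t(2) s(2)] by (simp add: algebra_simps)
  finally have "qf t = qf s + (1 - Ba * of_real sa / (s - of_real sa) * (1 / (t - of_real sa)) - Bb * of_real sb / (s - of_real sb) * (1 / (t - of_real sb))) * (t - s)"
    by (simp add: algebra_simps)
  then have "qf t / (t - s) = qf s / (t - s) + (1 - Ba * of_real sa / (s - of_real sa) * (1 / (t - of_real sa)) - Bb * of_real sb / (s - of_real sb) * (1 / (t - of_real sb)))"
    using ts by (simp only: add_divide_distrib nonzero_mult_div_cancel_right right_minus_eq not_False_eq_True)
  then show ?thesis by simp
qed

text \<open>Multiply \<open>resolvent_identity\<close> by q(s). By partial fractions the endpoint
  values turn the correction terms into q(s)/s - 1, which absorbs the summand q(s)/s of the identity
  and leaves the constant 1.\<close>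

lemma resolvent_times_J:
  assumes s: "Im s > 0" "Im (J s) > 0"
  shows "J s * G (J s) = 1 + (LINT x:{a<..<b}|lborel. of_real (V' x) * (qf (I x) / (I x - s) - qf (cnj (I x)) / (cnj (I x) - s))) / (2 * of_real pi * \<i>)"
proof -
  define Ba Bb where "Ba = (of_real sa + 1) * (of_real sa + of_real c) / (complex_of_real sa - of_real sb)"
    and "Bb = (of_real sb + 1) * (of_real sb + of_real c) / (complex_of_real sb - of_real sa)"
  define Ca Cb where "Ca = Ba * of_real sa / (s - of_real sa)" and "Cb = Bb * of_real sb / (s - of_real sb)"
  have sr: "s \<noteq> of_real r" for r using s by auto
  have s0: "s \<noteq> 0" using s by auto
  have ne: "complex_of_real sa \<noteq> of_real sb" using sab by simp
  have sl: "s \<in> slit" using s by (auto simp: slit_eq)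
  have q0: "qf s \<noteq> 0" using deriv_J_qf(3)[OF sl _ sr sr] sr[of "-c"] by simp
  have i: "set_integrable lborel {a<..<b} (\<lambda>x. of_real (V' x) * ker (of_real sa) x)" "set_integrable lborel {a<..<b} (\<lambda>x. of_real (V' x) * ker (of_real sb) x)"
    by (rule critical_ker_integrable; simp)+
  have iS: "set_integrable lborel {a<..<b} (\<lambda>x. of_real (V' x) * ker s x)"
  proof -
    have "continuous_on {a..b} V'" using V'_cont sub_pos continuous_on_subset by blast
    then show ?thesis
      by (intro set_integrable_subset[OF borel_integrable_atLeastAtMost']) (auto intro!: continuous_intros ker_cont curve_avoids[OF s])
  qed
  have "(LINT x:{a<..<b}|lborel. of_real (V' x) * (qf (I x) / (I x - s) - qf (cnj (I x)) / (cnj (I x) - s)))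
     = (LINT x:{a<..<b}|lborel. qf s * (of_real (V' x) * ker s x) - Ca * (of_real (V' x) * ker (of_real sa) x) - Cb * (of_real (V' x) * ker (of_real sb) x))"
  proof (rule set_lebesgue_integral_cong, simp, intro allI impI)
    fix x assume x: "x \<in> {a<..<b}"
    have n: "I x \<noteq> of_real r" "cnj (I x) \<noteq> of_real r" for r using I_upper[OF x] by (auto simp: complex_eq_iff)
    have n0: "I x \<noteq> 0" "cnj (I x) \<noteq> 0" using n[of 0] by auto
    have av: "I x \<noteq> s" "cnj (I x) \<noteq> s" using curve_avoids[OF s, of x] x by auto
    show "of_real (V' x) * (qf (I x) / (I x - s) - qf (cnj (I x)) / (cnj (I x) - s))
      = qf s * (of_real (V' x) * ker s x) - Ca * (of_real (V' x) * ker (of_real sa) x) - Cb * (of_real (V' x) * ker (of_real sb) x)"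
      unfolding qf_divided_difference[OF n(1) n(1) n0(1) sr sr s0 av(1)] qf_divided_difference[OF n(2) n(2) n0(2) sr sr s0 av(2)]
        Ba_def[symmetric] Bb_def[symmetric] Ca_def[symmetric] Cb_def[symmetric] ker_def
      by (simp add: right_diff_distrib distrib_left mult_ac)
  qed
  also have "\<dots> = qf s * (LINT x:{a<..<b}|lborel. of_real (V' x) * ker s x) - Ca * (LINT x:{a<..<b}|lborel. of_real (V' x) * ker (of_real sa) x) - Cb * (LINT x:{a<..<b}|lborel. of_real (V' x) * ker (of_real sb) x)"
    by (simp only: set_integral_diff(2)[OF set_integral_diff(1)[OF set_integrable_mult_right[OF iS] set_integrable_mult_right[OF i(1)]] set_integrable_mult_right[OF i(2)]]
      set_integral_diff(2)[OF set_integrable_mult_right[OF iS] set_integrable_mult_right[OF i(1)]] set_integral_mult_right)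
  finally have "(LINT x:{a<..<b}|lborel. of_real (V' x) * (qf (I x) / (I x - s) - qf (cnj (I x)) / (cnj (I x) - s))) / (2 * of_real pi * \<i>)
     = qf s * Mom s - Ca * Mom (of_real sa) - Cb * Mom (of_real sb)"
    by (simp only: Mom_def diff_divide_distrib times_divide_eq_right)
  also have "\<dots> = qf s * Mom s + Ba * (1 / (s - of_real sa)) + Bb * (1 / (s - of_real sb))"
    using endpoint_condition[of sa] endpoint_condition[of sb] sa_less sb_pos by (simp add: Ca_def Cb_def)
  also have "Ba * (1 / (s - of_real sa)) + Bb * (1 / (s - of_real sb)) = qf s / s - 1" 
    unfolding qf_quotients(1)[OF sr sr s0] quadratic_partial_fractions[OF ne sr sr] Ba_def Bb_def by simp
  then have "qf s * Mom s + Ba * (1 / (s - of_real sa)) + Bb * (1 / (s - of_real sb)) = qf s * Mom s + (qf s / s - 1)" by simp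
  also have "\<dots> = qf s * (1 / s + Mom s) - 1" by (simp add: algebra_simps)
  also have "\<dots> = J s * G (J s) - 1" unfolding resolvent_identity[OF s, symmetric] using q0 by simp
  finally show ?thesis by simp
qed

end

section \<open>The density by Stieltjes inversion\<close>

context equilibrium begin

text \<open>The real part of log ((I x - s)/(cnj (I x) - s)); at s = I x0 it is minus the logarithm
  in the density formula.\<close>

definition lg :: "complex \<Rightarrow> real \<Rightarrow> real" where
  "lg s x = ln (cmod (I x - s)) - ln (cmod (cnj (I x) - s))"

text \<open>The derivative of x V'(x).\<close>

definition W :: "real \<Rightarrow> real" where "W x = V'' x * x + V' x"

lemma W_cont: "continuous_on {a..b} W"
proof -
  have "continuous_on {a..b} V'" "continuous_on {a..b} V''" using V'_cont V''_cont sub_pos continuous_on_subset by blast+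
  then show ?thesis unfolding W_def[abs_def] by (intro continuous_intros)
qed

lemma lg_cont:
  assumes "\<And>x. x \<in> S \<Longrightarrow> I x \<noteq> s" "\<And>x. x \<in> S \<Longrightarrow> cnj (I x) \<noteq> s" "S \<subseteq> {a..b}"
  shows "continuous_on S (lg s)"
proof -
  have "continuous_on S I" by (rule continuous_on_subset[OF I_cont assms(3)])
  then show ?thesis unfolding lg_def[abs_def] using assms by (intro continuous_intros) auto
qed

lemma lg_ends: "lg s a = 0" "lg s b = 0" by (simp_all add: lg_def I_a I_b)

lemma lg_deriv:
  assumes x: "x \<in> {a<..<b}" and ne: "I x \<noteq> s" "cnj (I x) \<noteq> s"
  shows "(lg s has_real_derivative Re (I' x / (I x - s) - cnj (I' x) / (cnj (I x) - s))) (at x)"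
proof -
  have 1: "((\<lambda>x. I x - s) has_vector_derivative I' x) (at x)" "((\<lambda>x. cnj (I x) - s) has_vector_derivative cnj (I' x)) (at x)"
    using has_vector_derivative_diff[OF I_has_deriv[OF x] has_vector_derivative_const[of s]]
      has_vector_derivative_diff[OF I_deriv_cnj[OF x] has_vector_derivative_const[of s]] by simp_all
  have 2: "I x - s \<noteq> 0" "cnj (I x) - s \<noteq> 0" using ne by auto
  show ?thesis
    unfolding lg_def[abs_def] minus_complex.sel
    by (rule DERIV_diff[OF has_real_derivative_ln_cmod[OF 1(1) 2(1)] has_real_derivative_ln_cmod[OF 1(2) 2(2)]])
qed

text \<open>Division by 2 pi i turns the imaginary part into - 1/(2 pi) times a real part, and Re
  (I'/(I - s)) is the derivative of ln |I - s|. Integration by parts moves the derivative to x V';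
  the boundary terms vanish because \<open>lg\<close> is 0 at both ends.\<close>

lemma Im_resolvent:
  assumes s: "Im s > 0" "Im (J s) > 0"
  shows "Im (J s * G (J s)) = (LINT x:{a<..<b}|lborel. W x * lg s x) / (2 * pi)"
proof -
  note av = curve_avoids[OF s]
  define g where "g x = of_real (V' x * x) * (I' x / (I x - s) - cnj (I' x) / (cnj (I x) - s))" for x
  have V'c: "continuous_on {a..b} V'" using V'_cont sub_pos continuous_on_subset by blast
  have gi: "set_integrable lborel {a<..<b} g"
  proof -
    have 1: "set_integrable lborel {a<..<b} (\<lambda>x. (of_real (V' x * x) / (I x - s)) * I' x)"
      by (rule continuous_times_I'_integrable) (use av in \<open>auto intro!: continuous_intros V'c I_cont\<close>)
    have "set_integrable lborel {a<..<b} (\<lambda>x. (of_real (V' x * x) / (I x - cnj s)) * I' x)"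
    proof (rule continuous_times_I'_integrable)
      have "I x \<noteq> cnj s" if "x \<in> {a..b}" for x using av(2)[OF that] by auto
      then show "continuous_on {a..b} (\<lambda>x. complex_of_real (V' x * x) / (I x - cnj s))"
        by (auto intro!: continuous_intros V'c I_cont)
    qed
    from set_integrable_cnj[OF this]
    have 2: "set_integrable lborel {a<..<b} (\<lambda>x. (of_real (V' x * x) / (cnj (I x) - s)) * cnj (I' x))" by simp
    have "g = (\<lambda>x. (of_real (V' x * x) / (I x - s)) * I' x - (of_real (V' x * x) / (cnj (I x) - s)) * cnj (I' x))"
      by (simp add: g_def fun_eq_iff right_diff_distrib)
    then show ?thesis using set_integral_diff(1)[OF 1 2] by simp
  qed
  have gRe: "set_integrable lborel {a<..<b} (\<lambda>x. Re (g x))" "(LINT x:{a<..<b}|lborel. Re (g x)) = Re (LINT x:{a<..<b}|lborel. g x)"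
    using integrable_Re[OF gi[unfolded set_integrable_def]] integral_Re[OF gi[unfolded set_integrable_def]]
    by (simp_all add: set_integrable_def set_lebesgue_integral_def)
  have lc: "continuous_on {a..b} (lg s)" by (rule lg_cont) (use av in auto)
  have Wi: "set_integrable lborel {a<..<b} (\<lambda>x. W x * lg s x)"
    by (rule set_integrable_subset[OF borel_integrable_atLeastAtMost']) (auto intro!: continuous_intros W_cont lc)
  define H where "H x = V' x * x * lg s x" for x
  have Hd: "(H has_vector_derivative W x * lg s x + Re (g x)) (at x)" if x: "x \<in> {a<..<b}" for x
  proof -
    have x0: "x > 0" and xx: "x \<in> {a..b}" using x a_pos by auto
    have "((\<lambda>x. V' x * x) has_real_derivative W x) (at x)"
      using DERIV_mult[OF V'_at[OF x0] DERIV_ident] by (simp add: W_def add.commute)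
    from DERIV_mult[OF this lg_deriv[OF x av[OF xx]]]
    have "(H has_real_derivative W x * lg s x + V' x * x * Re (I' x / (I x - s) - cnj (I' x) / (cnj (I x) - s))) (at x)"
      unfolding H_def[abs_def] by (simp only: mult.commute add.commute)
    moreover have "V' x * x * Re (I' x / (I x - s) - cnj (I' x) / (cnj (I x) - s)) = Re (g x)"
      unfolding g_def by (simp only: Re_complex_of_real Im_complex_of_real times_complex.sel mult_zero_left diff_0_right)
    ultimately show ?thesis by (simp only: has_real_derivative_iff_has_vector_derivative)
  qed
  have "continuous_on {a..b} H" unfolding H_def by (intro continuous_intros V'c lc)
  then have hi: "((\<lambda>x. W x * lg s x + Re (g x)) has_integral H b - H a) {a..b}"
    using Jab by (intro fundamental_theorem_of_calculus_interior Hd) auto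
  have Hz: "H b - H a = 0" by (simp add: H_def lg_ends)
  have si: "set_integrable lborel {a<..<b} (\<lambda>x. W x * lg s x + Re (g x))" by (rule set_integral_add(1)[OF Wi gRe(1)])
  have "(LINT x:{a<..<b}|lborel. W x * lg s x + Re (g x)) = 0"
    using set_borel_integral_eq_integral(2)[OF si] hi unfolding Hz
    by (simp add: has_integral_Icc_iff_Ioo integral_unique)
  then have key: "(LINT x:{a<..<b}|lborel. W x * lg s x) = - Re (LINT x:{a<..<b}|lborel. g x)"
    unfolding set_integral_add(2)[OF Wi gRe(1)] gRe(2) by linarith
  have "(LINT x:{a<..<b}|lborel. of_real (V' x) * (qf (I x) / (I x - s) - qf (cnj (I x)) / (cnj (I x) - s))) = (LINT x:{a<..<b}|lborel. g x)"
  proof (rule set_lebesgue_integral_cong, simp, intro allI impI)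
    fix x assume x: "x \<in> {a<..<b}"
    show "of_real (V' x) * (qf (I x) / (I x - s) - qf (cnj (I x)) / (cnj (I x) - s)) = g x"
      unfolding g_def qf_cnj curve_I'[OF x, symmetric] by (simp add: algebra_simps)
  qed
  then have "J s * G (J s) = 1 + (LINT x:{a<..<b}|lborel. g x) / (2 * of_real pi * \<i>)"
    unfolding resolvent_times_J[OF s] by simp
  moreover have "Im (X / (2 * of_real pi * \<i>)) = - Re X / (2 * pi)" for X
    by (simp add: Im_divide power2_eq_square field_simps)
  ultimately show ?thesis unfolding key by simp
qed

text \<open>Since J is open near I x0, the approaching points can be chosen with Re (J (s n)) = x0
  exactly, which produces the Poisson kernel at x0. The lower bound with kappa controls the
  logarithmic singularity of \<open>lg\<close> uniformly in n.\<close>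

lemma approach_interior:
  assumes x0: "x0 \<in> {a<..<b}"
  shows "\<exists>s \<epsilon> \<kappa>. \<kappa> > 0 \<and> s \<longlonglongrightarrow> I x0 \<and> \<epsilon> \<longlonglongrightarrow> 0 \<and> (\<forall>n. \<epsilon> n > 0 \<and> Im (s n) \<ge> Im (I x0) / 2 \<and> J (s n) = Complex x0 (\<epsilon> n)
    \<and> (\<forall>x\<in>{a<..<b}. \<kappa> * \<bar>x - x0\<bar> \<le> cmod (I x - s n)))"
proof -
  define t0 where "t0 = I x0"
  \<comment> \<open>Half the height, so that the closed ball around t0 stays in the upper
    half-plane.\<close>
  define r0 where "r0 = Im t0 / 2"
  have r0: "r0 > 0" using I_upper[OF x0] by (simp add: r0_def t0_def)
  have Jt0: "J t0 = of_real x0" using J_I[OF x0] by (simp add: t0_def)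
  have im: "r0 \<le> Im z" if "z \<in> cball t0 r0" for z
    using that abs_Im_le_cmod[of "t0 - z"] by (simp add: dist_norm r0_def abs_le_iff)
  have sub: "cball t0 r0 \<subseteq> slit"
  proof
    fix z assume "z \<in> cball t0 r0"
    from im[OF this] r0 show "z \<in> slit" by (simp add: slit_eq)
  qed
  have "continuous_on (cball t0 r0) (deriv J)"
    by (rule continuous_on_subset[OF holomorphic_on_imp_continuous_on[OF holomorphic_deriv[OF J_holomorphic open_slit]] sub])
  then have "bounded (deriv J ` cball t0 r0)" using compact_continuous_image compact_imp_bounded compact_cball by blast
  then obtain M0 where M0: "\<And>z. z \<in> cball t0 r0 \<Longrightarrow> norm (deriv J z) \<le> M0" unfolding bounded_iff by blast
  define M where "M = \<bar>M0\<bar> + 1"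
  have M: "M > 0" "\<And>z. z \<in> cball t0 r0 \<Longrightarrow> norm (deriv J z) \<le> M" using M0 by (force simp: M_def)+
  have lip: "norm (J z - J w) \<le> M * norm (z - w)" if "z \<in> cball t0 r0" "w \<in> cball t0 r0" for z w
  proof (rule field_differentiable_bound[OF convex_cball _ M(2) that])
    fix u assume "u \<in> cball t0 r0"
    then have "(J has_field_derivative deriv J u) (at u)" using sub J_holomorphic open_slit holomorphic_derivI by blast
    then show "(J has_field_derivative deriv J u) (at u within cball t0 r0)" by (rule has_field_derivative_at_within)
  qed
  have opn: "open (J ` ball t0 r)" if r: "0 < r" "r \<le> r0" for r
  proof (rule open_mapping_thm[where S = "ball t0 r"])
    have sb: "ball t0 r \<subseteq> slit" using sub r by auto
    show "J holomorphic_on ball t0 r" by (rule holomorphic_on_subset[OF J_holomorphic sb])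
    show "\<not> J constant_on ball t0 r"
    proof
      assume "J constant_on ball t0 r"
      then obtain k where k: "\<And>z. z \<in> ball t0 r \<Longrightarrow> J z = k" by (auto simp: constant_on_def)
      have "((\<lambda>_. k) has_field_derivative 0) (at t0)" by (rule DERIV_const)
      then have "(J has_field_derivative 0) (at t0)"
        by (rule has_field_derivative_transform_within_open[where S = "ball t0 r"]) (use k r in auto)
      moreover have nn: "t0 \<noteq> - of_real c" using I_ne[OF x0, of "-c"] by (simp add: t0_def)
      note D = deriv_J_qf[OF I_slit[OF x0] nn[unfolded t0_def] I_ne[OF x0] I_ne[OF x0], folded t0_def]
      ultimately have "J t0 / qf t0 = 0" using DERIV_unique D(1) by blast
      then show False using D(2,3) by simp
    qed
  qed (use r in auto)
  have "\<exists>s e. 0 < e \<and> e \<le> 1 / (real n + 1) \<and> s \<in> ball t0 (r0 / 2 * (1 / (real n + 1))) \<and> J s = Complex x0 e" for n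
  proof -
    define r where "r = r0 / 2 * (1 / (real n + 1))"
    have "1 / (real n + 1) \<le> 1" by simp
    then have "r \<le> r0 / 2 * 1" unfolding r_def using r0 by (intro mult_left_mono) auto
    then have "r \<le> r0" using r0 by linarith
    moreover have "0 < r" using r0 by (simp add: r_def)
    ultimately have r: "0 < r" "r \<le> r0" by auto
    have "of_real x0 \<in> J ` ball t0 r" using Jt0 r by (intro image_eqI[of _ _ t0]) auto
    then obtain d where d: "d > 0" "ball (of_real x0) d \<subseteq> J ` ball t0 r" using opn[OF r] open_contains_ball by blast
    define e where "e = min (d / 2) (1 / (real n + 1))"
    have e: "0 < e" "e \<le> 1 / (real n + 1)" "e < d" using d by (auto simp: e_def)
    have "of_real x0 - Complex x0 e = - (of_real e * \<i>)" by (simp add: complex_eq_iff)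
    then have "Complex x0 e \<in> ball (of_real x0) d" using e by (simp add: dist_norm norm_mult)
    then have "Complex x0 e \<in> J ` ball t0 r" using d(2) by blast
    then obtain s where "s \<in> ball t0 r" "Complex x0 e = J s" by (rule imageE)
    then show ?thesis using e unfolding r_def by (intro exI[of _ s] exI[of _ e]) auto
  qed
  then obtain s \<epsilon> where se: "\<And>n. 0 < \<epsilon> n" "\<And>n. \<epsilon> n \<le> 1 / (real n + 1)" "\<And>n. s n \<in> ball t0 (r0 / 2 * (1 / (real n + 1)))" "\<And>n. J (s n) = Complex x0 (\<epsilon> n)"
    by metis
  have inv: "(\<lambda>n. 1 / (real n + 1)) \<longlonglongrightarrow> 0" using LIMSEQ_inverse_real_of_nat by (simp add: divide_inverse add.commute)
  have e0: "\<epsilon> \<longlonglongrightarrow> 0"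
    by (rule tendsto_sandwich[OF _ _ tendsto_const inv]) (use se(1,2) in \<open>auto intro!: always_eventually less_imp_le\<close>)
  have sb: "cmod (s n - t0) \<le> r0 / 2 * (1 / (real n + 1))" for n
    using se(3)[of n] by (simp add: dist_norm norm_minus_commute)
  have "(\<lambda>n. s n - t0) \<longlonglongrightarrow> 0"
  proof (rule Lim_null_comparison)
    show "\<forall>\<^sub>F n in sequentially. norm (s n - t0) \<le> r0 / 2 * (1 / (real n + 1))" using sb by (intro always_eventually allI)
    show "(\<lambda>n. r0 / 2 * (1 / (real n + 1))) \<longlonglongrightarrow> 0" by (rule tendsto_mult_right_zero[OF inv])
  qed
  then have s0: "s \<longlonglongrightarrow> t0" by (simp add: LIM_zero_iff)
  have sb2: "cmod (s n - t0) \<le> r0 / 2" for n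
  proof -
    have "1 / (real n + 1) \<le> 1" by simp
    then have "r0 / 2 * (1 / (real n + 1)) \<le> r0 / 2 * 1" using r0 by (intro mult_left_mono) auto
    then show ?thesis using sb[of n] by linarith
  qed
  have sc: "s n \<in> cball t0 r0" for n using sb2[of n] r0 by (simp add: dist_norm norm_minus_commute)
  \<comment> \<open>Near I x0 the Lipschitz constant \<open>M\<close> of J bounds |x - x0| by M |I x
    - s n|; away from it |I x - s n| is at least r0/2 while |x - x0| is at most b - a.\<close>
  define \<kappa> where "\<kappa> = min (1 / M) (r0 / (2 * (b - a)))"
  have k: "\<kappa> > 0" "\<kappa> \<le> 1 / M" "\<kappa> \<le> r0 / (2 * (b - a))" using M r0 Jab by (auto simp: \<kappa>_def)
  have low: "\<kappa> * \<bar>x - x0\<bar> \<le> cmod (I x - s n)" if x: "x \<in> {a<..<b}" for x n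
  proof (cases "I x \<in> cball t0 r0")
    case True
    have "\<bar>x - x0\<bar> = \<bar>Re (J (I x) - J (s n))\<bar>" by (simp add: J_I[OF x] se(4))
    also have "\<dots> \<le> cmod (J (I x) - J (s n))" by (rule abs_Re_le_cmod)
    also have "\<dots> \<le> M * cmod (I x - s n)" by (rule lip[OF True sc])
    finally have "1 / M * \<bar>x - x0\<bar> \<le> cmod (I x - s n)" using M by (simp add: field_simps)
    moreover have "\<kappa> * \<bar>x - x0\<bar> \<le> 1 / M * \<bar>x - x0\<bar>" using k by (intro mult_right_mono) auto
    ultimately show ?thesis by linarith
  next
    case False
    then have "r0 < cmod (I x - t0)" by (simp add: dist_norm norm_minus_commute)
    moreover have "cmod (I x - t0) \<le> cmod (I x - s n) + cmod (s n - t0)"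
      using norm_triangle_ineq[of "I x - s n" "s n - t0"] by simp
    ultimately have "r0 / 2 \<le> cmod (I x - s n)" using sb2[of n] by linarith
    moreover have "\<kappa> * \<bar>x - x0\<bar> \<le> r0 / (2 * (b - a)) * (b - a)" using k r0 Jab x x0 by (intro mult_mono) auto
    moreover have "r0 / (2 * (b - a)) * (b - a) = r0 / 2" using Jab by (simp add: field_simps)
    ultimately show ?thesis by linarith
  qed
  have "Im (s n) \<ge> Im t0 / 2" for n using im[OF sc[of n]] by (simp add: r0_def)
  then show ?thesis using k(1) s0 e0 se low unfolding t0_def[symmetric] by blast
qed

text \<open>From z/(z - y) = 1 + y/(z - y): the imaginary part is - y times the Poisson
  kernel.\<close>

lemma Im_resolvent_kernel:
  assumes e: "e > 0"
  shows "Im (Complex x0 e * G (Complex x0 e)) = - (LINT y:{a<..<b}|lborel. (\<psi> y * y) * (e / ((x0 - y)^2 + e^2)))"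
proof -
  define z where "z = Complex x0 e"
  have z: "Im z > 0" using e by (simp add: z_def)
  note gi = set_integrable_mult_right[OF G_integrable[OF z], of z]
  have eq: "Im (z * (of_real (\<psi> y) / (z - of_real y))) = - ((\<psi> y * y) * (e / ((x0 - y)^2 + e^2)))" for y
  proof -
    have nz: "(x0 - y)^2 + e^2 \<noteq> 0" using e by (simp add: add_nonneg_eq_0_iff)
    have zy: "z - of_real y \<noteq> 0" using z by (auto simp: complex_eq_iff)
    have "z * (of_real (\<psi> y) / (z - of_real y)) = of_real (\<psi> y) * (1 + of_real y / (z - of_real y))"
      using zy by (simp add: field_simps)
    moreover have "Im (of_real y / (z - of_real y)) = - (y * (e / ((x0 - y)^2 + e^2)))"
      by (simp add: Im_divide z_def)
    ultimately show ?thesis by simp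
  qed
  have "z * G z = (LINT y:{a<..<b}|lborel. z * (of_real (\<psi> y) / (z - of_real y)))"
    unfolding G_def by (rule set_integral_mult_right[symmetric])
  then have "Im (z * G z) = (LINT y:{a<..<b}|lborel. Im (z * (of_real (\<psi> y) / (z - of_real y))))"
    using integral_Im[OF gi[unfolded set_integrable_def]] by (simp add: set_lebesgue_integral_def)
  then show ?thesis unfolding z_def[symmetric] eq by (simp add: set_lebesgue_integral_def)
qed

text \<open>Let s tend to I x0 in \<open>Im_resolvent\<close>: the left side is a Poisson integral
  with limit - pi x0 psi(x0), and the right side converges by domination. The point x0 is removed
  because \<open>lg (I x0)\<close> is singular there.\<close>

lemma density_formula:
  assumes x0: "x0 \<in> {a<..<b}"
  defines "S \<equiv> {a<..<b} - {x0}"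
  shows "set_integrable lborel S (\<lambda>x. W x * lg (I x0) x)"
    and "\<psi> x0 = - (LINT x:S|lborel. W x * lg (I x0) x) / (2 * pi^2 * x0)"
proof -
  define t0 where "t0 = I x0"
  have t0: "Im t0 > 0" using I_upper[OF x0] by (simp add: t0_def)
  obtain s \<epsilon> \<kappa> where k: "\<kappa> > 0" and s0: "s \<longlonglongrightarrow> t0" and e0: "\<epsilon> \<longlonglongrightarrow> 0" and e: "\<And>n. \<epsilon> n > 0"
    and ims: "\<And>n. Im (s n) \<ge> Im t0 / 2" and Js: "\<And>n. J (s n) = Complex x0 (\<epsilon> n)"
    and low: "\<And>n x. x \<in> {a<..<b} \<Longrightarrow> \<kappa> * \<bar>x - x0\<bar> \<le> cmod (I x - s n)"
    using approach_interior[OF x0] unfolding t0_def by blast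
  have sn: "Im (s n) > 0" "Im (J (s n)) > 0" for n using ims[of n] t0 e[of n] by (auto simp: Js)
  have lhs: "(\<lambda>n. Im (J (s n) * G (J (s n)))) \<longlonglongrightarrow> - (pi * (\<psi> x0 * x0))"
  proof -
    have "set_integrable lborel {a<..<b} (\<lambda>y. \<psi> y * y)" by (rule psi_mult_integrable) (intro continuous_intros)
    moreover have "continuous_on {a<..<b} (\<lambda>y. \<psi> y * y)" by (intro continuous_intros psi_cont)
    ultimately show ?thesis unfolding Js Im_resolvent_kernel[OF e]
      by (intro tendsto_minus poisson_kernel_limit x0 e e0)
  qed
  have "bounded (I ` {a..b})" using compact_continuous_image[OF I_cont] compact_imp_bounded by blast
  then obtain R1 where R1: "\<And>x. x \<in> {a..b} \<Longrightarrow> cmod (I x) \<le> R1" unfolding bounded_iff by blast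
  obtain R2 where R2: "\<And>n. cmod (s n) \<le> R2"
    using convergent_imp_Bseq[OF convergentI[OF s0]] by (auto simp: Bseq_def)
  have "bounded (W ` {a..b})" using compact_continuous_image[OF W_cont] compact_imp_bounded by blast
  then obtain K where K: "\<And>x. x \<in> {a..b} \<Longrightarrow> norm (W x) \<le> K" unfolding bounded_iff by blast
  have K0: "0 \<le> K" using K[of a] Jab by simp
  obtain C where C: "C > 0" "\<And>y x. y \<in> {a..b} \<Longrightarrow> x \<in> {a<..<b} \<Longrightarrow> (1 + \<bar>ln \<bar>x - y\<bar>\<bar>) * edge a b x \<le> C * dom a b y x"
    using ln_edge_le_dom[OF Jab] by blast
  \<comment> \<open>\<open>m\<close> bounds \<open>edge\<close> from below, which lets the majorant
    of the weighted logarithm serve for the logarithm itself.\<close>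
  define m where "m = (b - a) powr (-1/2)"
  have m: "m > 0" using Jab by (simp add: m_def)
  have em: "m \<le> edge a b x" if "x \<in> {a<..<b}" for x
  proof -
    have "(b - a) powr (-1/2) \<le> \<bar>x - a\<bar> powr (-1/2)" using that by (intro powr_mono2') auto
    then show ?thesis by (simp add: m_def edge_def add_increasing2)
  qed
  \<comment> \<open>Collects the constants of both logarithms: the singular modulus lies between
    kappa |x - x0| and R1 + R2, the regular one between Im t0 / 2 and R1 + R2.\<close>
  define A where "A = \<bar>ln \<kappa>\<bar> + 2 * \<bar>ln (R1 + R2)\<bar> + \<bar>ln (Im t0 / 2)\<bar>"
  define B where "B = K * ((A + 1) * (C / m))"
  have B0: "0 \<le> B" using K0 C(1) m by (simp add: B_def A_def)
  have bound: "\<bar>W x * lg (s n) x\<bar> \<le> B * dom a b x0 x" if x: "x \<in> S" for x n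
  proof -
    have xx: "x \<in> {a<..<b}" "x \<noteq> x0" using x by (auto simp: S_def)
    have d: "0 < \<bar>x - x0\<bar>" using xx by simp
    have u1: "cmod (I x - s n) \<le> R1 + R2" and u2: "cmod (cnj (I x) - s n) \<le> R1 + R2"
      using norm_triangle_ineq4[of "I x" "s n"] norm_triangle_ineq4[of "cnj (I x)" "s n"] R1[of x] R2[of n] xx by auto
    have "\<bar>ln (cmod (I x - s n))\<bar> \<le> \<bar>ln (\<kappa> * \<bar>x - x0\<bar>)\<bar> + \<bar>ln (R1 + R2)\<bar>"
      by (rule abs_ln_between[OF _ low[OF xx(1)] u1]) (use k d in simp)
    moreover have "ln (\<kappa> * \<bar>x - x0\<bar>) = ln \<kappa> + ln \<bar>x - x0\<bar>" using k d by (simp add: ln_mult)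
    moreover have "\<bar>ln (cmod (cnj (I x) - s n))\<bar> \<le> \<bar>ln (Im t0 / 2)\<bar> + \<bar>ln (R1 + R2)\<bar>"
    proof (rule abs_ln_between[OF _ _ u2])
      show "Im t0 / 2 \<le> cmod (cnj (I x) - s n)"
        using abs_Im_le_cmod[of "cnj (I x) - s n"] I_upper[OF xx(1)] ims[of n] by simp
    qed (use t0 in simp)
    ultimately have "\<bar>lg (s n) x\<bar> \<le> A + \<bar>ln \<bar>x - x0\<bar>\<bar>" unfolding lg_def A_def by linarith
    also have "\<dots> \<le> (A + 1) * (1 + \<bar>ln \<bar>x - x0\<bar>\<bar>)"
    proof -
      have "0 \<le> A * \<bar>ln \<bar>x - x0\<bar>\<bar>" by (simp add: A_def)
      then show ?thesis by (simp add: algebra_simps)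
    qed
    also have "\<dots> \<le> (A + 1) * (C / m * dom a b x0 x)"
    proof (rule mult_left_mono)
      have "(1 + \<bar>ln \<bar>x - x0\<bar>\<bar>) * m \<le> (1 + \<bar>ln \<bar>x - x0\<bar>\<bar>) * edge a b x" using em[OF xx(1)] by (intro mult_left_mono) auto
      also have "\<dots> \<le> C * dom a b x0 x" using C(2)[of x0 x] xx x0 by auto
      finally show "1 + \<bar>ln \<bar>x - x0\<bar>\<bar> \<le> C / m * dom a b x0 x" using m by (simp add: field_simps)
    qed (simp add: A_def)
    finally have "\<bar>lg (s n) x\<bar> \<le> (A + 1) * (C / m * dom a b x0 x)" .
    moreover have "\<bar>W x\<bar> \<le> K" using K[of x] xx by simp
    ultimately have "\<bar>W x\<bar> * \<bar>lg (s n) x\<bar> \<le> K * ((A + 1) * (C / m * dom a b x0 x))" using K0 by (intro mult_mono) auto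
    then show ?thesis by (simp add: B_def abs_mult mult_ac)
  qed
  have av: "I x \<noteq> t0" "cnj (I x) \<noteq> t0" if "x \<in> S" for x
  proof -
    have xx: "x \<in> {a<..<b}" "x \<noteq> x0" using that by (auto simp: S_def)
    show "I x \<noteq> t0" using J_I[OF xx(1)] J_I[OF x0] xx(2) unfolding t0_def by auto
    show "cnj (I x) \<noteq> t0" using I_upper[OF xx(1)] t0 by auto
  qed
  have Sm: "S \<in> sets borel" by (simp add: S_def)
  define f where "f x = indicator S x *\<^sub>R (W x * lg t0 x)" for x
  define h where "h n x = indicator {a<..<b} x *\<^sub>R (W x * lg (s n) x)" for n x
  define w where "w x = indicator {a<..<b} x *\<^sub>R (B * dom a b x0 x)" for x
  have fm: "f \<in> borel_measurable lborel"
  proof -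
    have "continuous_on S W" by (rule continuous_on_subset[OF W_cont]) (auto simp: S_def)
    moreover have "continuous_on S (lg t0)" by (rule lg_cont) (use av in \<open>auto simp: S_def\<close>)
    ultimately have "continuous_on S (\<lambda>x. W x * lg t0 x)" by (intro continuous_intros)
    from borel_measurable_continuous_on_indicator[OF Sm this] show ?thesis unfolding f_def[abs_def] by simp
  qed
  have hm: "h n \<in> borel_measurable lborel" for n
  proof -
    have "continuous_on {a<..<b} W" by (rule continuous_on_subset[OF W_cont]) auto
    moreover have "continuous_on {a<..<b} (lg (s n))" by (rule lg_cont) (use curve_avoids[OF sn] in auto)
    ultimately have "continuous_on {a<..<b} (\<lambda>x. W x * lg (s n) x)" by (intro continuous_intros)
    from borel_measurable_continuous_on_indicator[OF _ this] show ?thesis unfolding h_def[abs_def] by simp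
  qed
  have wi: "integrable lborel w"
    using set_integrable_mult_right[OF dom_integrable(1)[of a x0 b], of B] x0 unfolding w_def[abs_def] set_integrable_def by auto
  have ae: "AE x in lborel. x \<noteq> x0" by (rule AE_lborel_singleton)
  have lim: "AE x in lborel. (\<lambda>n. h n x) \<longlonglongrightarrow> f x"
    using ae
  proof eventually_elim
    case (elim x)
    show ?case
    proof (cases "x \<in> {a<..<b}")
      case True
      then have xS: "x \<in> S" using elim by (simp add: S_def)
      have "(\<lambda>n. W x * lg (s n) x) \<longlonglongrightarrow> W x * lg t0 x"
        unfolding lg_def using av[OF xS] by (intro tendsto_intros s0) auto
      then show ?thesis using True xS by (simp add: h_def f_def)
    next
      case False
      then have "x \<notin> S" by (auto simp: S_def)
      then show ?thesis using False by (simp add: h_def f_def)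
    qed
  qed
  have dominated: "AE x in lborel. norm (h n x) \<le> w x" for n
    using ae
  proof eventually_elim
    case (elim x)
    show ?case
    proof (cases "x \<in> {a<..<b}")
      case True
      then show ?thesis using bound[of x n] elim by (simp add: h_def w_def S_def)
    qed (simp add: h_def w_def)
  qed
  show "set_integrable lborel S (\<lambda>x. W x * lg (I x0) x)"
    using integrable_dominated_convergence[OF fm hm wi lim dominated] unfolding set_integrable_def f_def[abs_def] t0_def .
  have "(\<lambda>n. integral\<^sup>L lborel (h n)) \<longlonglongrightarrow> integral\<^sup>L lborel f"
    by (rule integral_dominated_convergence[OF fm hm wi lim dominated])
  then have "(\<lambda>n. integral\<^sup>L lborel (h n) / (2 * pi)) \<longlonglongrightarrow> integral\<^sup>L lborel f / (2 * pi)" by (intro tendsto_intros) auto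
  moreover have "integral\<^sup>L lborel (h n) / (2 * pi) = Im (J (s n) * G (J (s n)))" for n
    unfolding Im_resolvent[OF sn] h_def[abs_def] set_lebesgue_integral_def ..
  ultimately have "(\<lambda>n. Im (J (s n) * G (J (s n)))) \<longlonglongrightarrow> integral\<^sup>L lborel f / (2 * pi)" by simp
  from LIMSEQ_unique[OF this lhs] have "integral\<^sup>L lborel f / (2 * pi) = - (pi * (\<psi> x0 * x0))" .
  moreover have "x0 > 0" using x0 a_pos by auto
  ultimately have "\<psi> x0 = - integral\<^sup>L lborel f / (2 * pi^2 * x0)" by (simp add: field_simps power2_eq_square)
  then show "\<psi> x0 = - (LINT x:S|lborel. W x * lg (I x0) x) / (2 * pi^2 * x0)"
    unfolding f_def[abs_def] set_lebesgue_integral_def t0_def .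
qed

end

section \<open>The contour integrals\<close>

lemma (in jmap) J_cnj:
  assumes "Im s \<noteq> 0" shows "J (cnj s) = cnj (J s)"
proof -
  have "cnj (((s + 1) / s) powr of_real (1 / \<theta>)) = cnj ((s + 1) / s) powr cnj (of_real (1 / \<theta>))"
    using off_cut_upper[OF assms] by (intro cnj_powr) (auto simp: complex_nonpos_Reals_iff)
  then show ?thesis by (simp add: Jt_def)
qed

context equilibrium begin

text \<open>The first half of \<open>gamma\<close> is I run from b to a, the second its conjugate
  run from a to b, and J is real on both. So the two halves contribute - A and cnj A for one
  integral A. The values k = 0 and k = 1 are the two denominators of the system.\<close>

lemma contour_integral_gamma:
  fixes k :: real
  assumes k: "k = 0 \<or> k = 1"
  shows "contour_integral (gamma \<theta> c0 c1) (\<lambda>t. of_real (V' (Re (J t))) * J t / (t + of_real k))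
    = (LINT x:{a<..<b}|lborel. of_real (V' x * x) * (cnj (I' x) / (cnj (I x) + of_real k) - I' x / (I x + of_real k)))"
proof -
  define F where "F x = (of_real (V' x * x) / (I x + of_real k)) * I' x" for x
  have nz: "I x + of_real k \<noteq> 0" if x: "x \<in> {a..b}" for x
  proof (cases "x = a \<or> x = b")
    case True
    have "sa + k \<noteq> 0" "sb + k \<noteq> 0" using k sa_less sb_pos by auto
    then have "complex_of_real (sa + k) \<noteq> 0" "complex_of_real (sb + k) \<noteq> 0" unfolding of_real_eq_0_iff .
    then show ?thesis using True by (auto simp: I_a I_b)
  next
    case False
    then have "Im (I x) > 0" using x by (intro I_upper) auto
    then show ?thesis by (auto simp: complex_eq_iff)
  qed
  have "continuous_on {a..b} V'" using V'_cont sub_pos continuous_on_subset by blast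
  then have "continuous_on {a..b} (\<lambda>x. of_real (V' x * x) / (I x + of_real k))"
    using nz by (intro continuous_intros I_cont) blast+
  then have Fi: "set_integrable lborel {a<..<b} F" unfolding F_def by (rule continuous_times_I'_integrable)
  define A where "A = (LINT x:{a<..<b}|lborel. F x)"
  have FA: "(F has_integral A) {a..b}"
    unfolding has_integral_Icc_iff_Ioo A_def set_borel_integral_eq_integral(2)[OF Fi]
    by (rule integrable_integral[OF set_borel_integral_eq_integral(1)[OF Fi]])
  have cFA: "((\<lambda>x. cnj (F x)) has_integral cnj A) {a..b}" using FA has_integral_cnj[of F A "{a..b}"] by (simp add: o_def)
  \<comment> \<open>Each arc is run through in half of the parameter interval, hence at speed 2 (b -
    a) in x.\<close>
  define m where "m = 2 * (b - a)"
  have m: "m > 0" using Jab by (simp add: m_def)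
  let ?g = "gamma \<theta> c0 c1"
  let ?f = "\<lambda>t. of_real (V' (Re (J t))) * J t / (t + of_real k)"
  let ?h = "\<lambda>t. ?f (?g t) * vector_derivative ?g (at t)"
  have first: "(?h has_integral - A) {0..1/2}"
  proof -
    have eq: "(- b - - b) /\<^sub>R m = 0" "(- a - - b) /\<^sub>R m = 1 / 2" using m by (auto simp: m_def field_simps)
    have "((\<lambda>x. F (- x)) has_integral A) (cbox (- b) (- a))" using FA by (simp only: cbox_interval has_integral_reflect_real)
    from has_integral_mult_right[OF has_integral_affinity'[OF this m, of "- b"], of "- of_real m"]
    have "((\<lambda>t. - of_real m * F (- (m * t + - b))) has_integral - of_real m * (A /\<^sub>R m)) {0..1/2}"
      unfolding eq cbox_interval by simp
    moreover have "- of_real m * (A /\<^sub>R m) = - A" using m by (simp add: scaleR_conv_of_real)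
    moreover have "- (m * t + - b) = b - m * t" for t by simp
    ultimately have i: "((\<lambda>t. - of_real m * F (b - m * t)) has_integral - A) {0..1/2}" by (simp only:)
    show ?thesis
    proof (rule has_integral_spike_finite[OF _ _ i])
      \<comment> \<open>At 0 and 1/2 the arc is at a critical point, where J' = 0 and the velocity
        formula breaks down; two points do not affect the integral.\<close>
      fix t :: real assume "t \<in> {0..1/2} - {0, 1/2}"
      then have t: "0 < t" "t < 1/2" by auto
      define x where "x = b - m * t"
      have gt: "?g u = I (b - m * u)" if "u < 1/2" for u
      proof -
        have "a + (1 - 2 * u) * (b - a) = b - m * u" by (simp add: m_def algebra_simps)
        then show ?thesis using that by (simp add: gamma_def joinpaths_def reversepath_def gamma1_def)
      qed
      have "m * t < m * (1/2)" "0 < m * t" using m t by (auto intro: mult_strict_left_mono)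
      then have x: "x \<in> {a<..<b}" by (simp add: x_def m_def)
      have "((\<lambda>u. b - m * u) has_vector_derivative - m) (at t)"
        by (auto intro!: derivative_eq_intros simp: has_real_derivative_iff_has_vector_derivative[symmetric])
      from vector_diff_chain_at[OF this I_has_deriv[OF x, unfolded x_def]]
      have "((\<lambda>u. I (b - m * u)) has_vector_derivative - m *\<^sub>R I' x) (at t)" by (simp add: o_def x_def)
      then have "(?g has_vector_derivative - m *\<^sub>R I' x) (at t)"
        by (rule has_vector_derivative_transform_within_open[where S = "{..<1/2}"]) (use gt t in auto)
      then have "vector_derivative ?g (at t) = - m *\<^sub>R I' x" by (rule vector_derivative_at)
      then show "?h t = - of_real m * F (b - m * t)"
        unfolding gt[OF t(2)] x_def[symmetric] by (simp add: J_I[OF x] F_def scaleR_conv_of_real)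
    qed simp
  qed
  have second: "(?h has_integral cnj A) {1/2..1}"
  proof -
    have eq: "(a - (2 * a - b)) /\<^sub>R m = 1 / 2" "(b - (2 * a - b)) /\<^sub>R m = 1" using m by (auto simp: m_def field_simps)
    have "((\<lambda>x. cnj (F x)) has_integral cnj A) (cbox a b)" using cFA by (simp only: cbox_interval)
    from has_integral_mult_right[OF has_integral_affinity'[OF this m, of "2 * a - b"], of "of_real m"]
    have "((\<lambda>t. of_real m * cnj (F (m * t + (2 * a - b)))) has_integral of_real m * (cnj A /\<^sub>R m)) {1/2..1}"
      unfolding eq cbox_interval by simp
    moreover have "of_real m * (cnj A /\<^sub>R m) = cnj A" using m by (simp add: scaleR_conv_of_real)
    ultimately have i: "((\<lambda>t. of_real m * cnj (F (m * t + (2 * a - b)))) has_integral cnj A) {1/2..1}" by (simp only:)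
    show ?thesis
    proof (rule has_integral_spike_finite[OF _ _ i])
      fix t :: real assume "t \<in> {1/2..1} - {1/2, 1}"
      then have t: "1/2 < t" "t < 1" by auto
      define x where "x = m * t + (2 * a - b)"
      have gt: "?g u = cnj (I (m * u + (2 * a - b)))" if "u > 1/2" for u
      proof -
        have "a + (2 * u - 1) * (b - a) = m * u + (2 * a - b)" by (simp add: m_def algebra_simps)
        moreover have "?g u = cnj (I (a + (2 * u - 1) * (b - a)))" using that by (simp add: gamma_def joinpaths_def gamma1_def)
        ultimately show ?thesis by (simp only:)
      qed
      have "m * (1/2) < m * t" "m * t < m * 1" using m t by (auto intro: mult_strict_left_mono)
      then have x: "x \<in> {a<..<b}" by (simp add: x_def m_def)
      have "((\<lambda>u. m * u + (2 * a - b)) has_vector_derivative m) (at t)"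
        by (auto intro!: derivative_eq_intros simp: has_real_derivative_iff_has_vector_derivative[symmetric])
      from vector_diff_chain_at[OF this I_deriv_cnj[OF x, unfolded x_def]]
      have "((\<lambda>u. cnj (I (m * u + (2 * a - b)))) has_vector_derivative m *\<^sub>R cnj (I' x)) (at t)" by (simp add: o_def x_def)
      then have "(?g has_vector_derivative m *\<^sub>R cnj (I' x)) (at t)"
        by (rule has_vector_derivative_transform_within_open[where S = "{1/2<..}"]) (use gt t in auto)
      then have vd: "vector_derivative ?g (at t) = m *\<^sub>R cnj (I' x)" by (rule vector_derivative_at)
      have "J (cnj (I x)) = of_real x" using J_cnj[of "I x"] I_upper[OF x] J_I[OF x] by simp
      then show "?h t = of_real m * cnj (F (m * t + (2 * a - b)))"
        unfolding gt[OF t(1)] x_def[symmetric] vd by (simp add: F_def scaleR_conv_of_real)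
    qed simp
  qed
  have "(?h has_integral - A + cnj A) {0..1}"
    by (rule has_integral_combine[OF _ _ first second]) auto
  then have "contour_integral ?g ?f = cnj A - A" by (simp add: contour_integral_integral integral_unique)
  also have "\<dots> = (LINT x:{a<..<b}|lborel. cnj (F x) - F x)"
    unfolding set_integral_diff(2)[OF set_integrable_cnj[OF Fi] Fi] set_LINT_cnj A_def ..
  also have "\<dots> = (LINT x:{a<..<b}|lborel. of_real (V' x * x) * (cnj (I' x) / (cnj (I x) + of_real k) - I' x / (I x + of_real k)))"
    by (simp add: F_def right_diff_distrib)
  finally show ?thesis .
qed

lemma equilibrium_measure:
  shows "contour_integral (gamma \<theta> c0 c1) (\<lambda>t. of_real (V' (Re (J t))) * J t / t) / (2 * of_real pi * \<i>) = of_real (1 + \<theta>)"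
    and "contour_integral (gamma \<theta> c0 c1) (\<lambda>t. of_real (V' (Re (J t))) * J t / (t + 1)) / (2 * of_real pi * \<i>) = 1"
    and "x \<in> {a<..<b} \<Longrightarrow> \<psi> x = 1 / (2 * pi^2 * x) * integral {a..b} (\<lambda>y. (V'' y * y + V' y) *
          ln (cmod ((I y - Iminus \<theta> c0 c1 x) / (I y - I x))))"
proof -
  show "contour_integral (gamma \<theta> c0 c1) (\<lambda>t. of_real (V' (Re (J t))) * J t / t) / (2 * of_real pi * \<i>) = of_real (1 + \<theta>)"
    using contour_integral_gamma[of 0] contour_moments(1) by simp
  show "contour_integral (gamma \<theta> c0 c1) (\<lambda>t. of_real (V' (Re (J t))) * J t / (t + 1)) / (2 * of_real pi * \<i>) = 1"
    using contour_integral_gamma[of 1] contour_moments(2) by simp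
  assume x: "x \<in> {a<..<b}"
  define S where "S = {a<..<b} - {x}"
  define f where "f y = (V'' y * y + V' y) * ln (cmod ((I y - Iminus \<theta> c0 c1 x) / (I y - I x)))" for y
  have fS: "f y = - (W y * lg (I x) y)" if "y \<in> S" for y
  proof -
    have y: "y \<in> {a<..<b}" "y \<noteq> x" using that by (auto simp: S_def)
    have n1: "I y \<noteq> I x" using J_I[OF y(1)] J_I[OF x] y(2) by auto
    have "Im (cnj (I y)) < Im (I x)" using I_upper[OF y(1)] I_upper[OF x] by simp
    then have n2: "cnj (I y) \<noteq> I x" by fastforce
    have e: "cmod (I y - cnj (I x)) = cmod (cnj (I y) - I x)" by (metis complex_cnj_cnj complex_cnj_diff complex_mod_cnj)
    have "ln (cmod ((I y - Iminus \<theta> c0 c1 x) / (I y - I x))) = - lg (I x) y"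
      using n1 n2 by (simp add: Iminus_def norm_divide e lg_def ln_divide_pos)
    then show ?thesis by (simp add: f_def W_def)
  qed
  note D = density_formula[OF x, folded S_def]
  have "((\<lambda>y. W y * lg (I x) y) has_integral (LINT y:S|lborel. W y * lg (I x) y)) S"
    using set_borel_integral_eq_integral[OF D(1)] by (simp add: has_integral_iff)
  then have "(f has_integral - (LINT y:S|lborel. W y * lg (I x) y)) S"
    by (intro has_integral_eq[OF _ has_integral_neg]) (use fS in auto)
  \<comment> \<open>\<open>S\<close> omits only the points a, b and x of [a,b]; the value of the
    integrand there, in particular the division by zero at y = x, does not matter.\<close>
  then have "(f has_integral - (LINT y:S|lborel. W y * lg (I x) y)) {a..b}"
  proof (rule has_integral_spike_set_eq[THEN iffD1, rotated 2])
    show "negligible {y \<in> S - {a..b}. f y \<noteq> 0}" by (rule negligible_subset[of "{}"]) (auto simp: S_def)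
    show "negligible {y \<in> {a..b} - S. f y \<noteq> 0}" by (rule negligible_subset[of "{a, b, x}"]) (auto simp: S_def)
  qed
  then have "integral {a..b} f = - (LINT y:S|lborel. W y * lg (I x) y)" by (rule integral_unique)
  with D(2) show "\<psi> x = 1 / (2 * pi^2 * x) * integral {a..b} (\<lambda>y. (V'' y * y + V' y) * ln (cmod ((I y - Iminus \<theta> c0 c1 x) / (I y - I x))))"
    unfolding f_def[abs_def] by simp
qed

end

theorem theorem1p6:
  fixes \<theta> a b L :: real and V V' V'' \<psi> :: "real \<Rightarrow> real" and \<mu> :: "real measure"
  assumes theta: "\<theta> > 1"
    and V_deriv: "\<And>x. x \<ge> 0 \<Longrightarrow> (V has_real_derivative V' x) (at x within {0..})"
    and V'_deriv: "\<And>x. x \<ge> 0 \<Longrightarrow> (V' has_real_derivative V'' x) (at x within {0..})"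
    and V''_cont: "continuous_on {0..} V''"
    and V_growth: "filterlim (\<lambda>x. V x / ln x) at_top at_top"
    and a_pos: "a > 0"
    and mu_density: "\<mu> = density lborel (\<lambda>x. ennreal (indicator {a<..<b} x * \<psi> x))"
    and psi_nonneg: "\<And>x. x \<in> {a<..<b} \<Longrightarrow> \<psi> x \<ge> 0"
    and psi_cont: "continuous_on {a<..<b} \<psi>"
    and mu_prob: "prob_space \<mu>"
    and mu_supp: "measure_support \<mu> = {a..b}"
    and EL_eq: "\<And>x. x \<in> measure_support \<mu> \<Longrightarrow>
        integrable \<mu> (\<lambda>y. ln \<bar>x - y\<bar>) \<and> integrable \<mu> (\<lambda>y. ln \<bar>x powr \<theta> - y powr \<theta>\<bar>) \<and>
        (\<integral>y. ln \<bar>x - y\<bar> \<partial>\<mu>) + (\<integral>y. ln \<bar>x powr \<theta> - y powr \<theta>\<bar> \<partial>\<mu>) - V x = L"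
    and EL_le: "\<And>x. x \<ge> 0 \<Longrightarrow>
        integrable \<mu> (\<lambda>y. ln \<bar>x - y\<bar>) \<and> integrable \<mu> (\<lambda>y. ln \<bar>x powr \<theta> - y powr \<theta>\<bar>) \<longrightarrow>
        (\<integral>y. ln \<bar>x - y\<bar> \<partial>\<mu>) + (\<integral>y. ln \<bar>x powr \<theta> - y powr \<theta>\<bar> \<partial>\<mu>) - V x \<le> L"
  shows "\<exists>c0 c1. 0 < c1 \<and> c1 < c0 \<and>
     contour_integral (gamma \<theta> c0 c1)
       (\<lambda>t. of_real (V' (Re (Jt \<theta> c0 c1 t))) * Jt \<theta> c0 c1 t / t) / (2 * of_real pi * \<i>)
       = of_real (1 + \<theta>) \<and>
     contour_integral (gamma \<theta> c0 c1)
       (\<lambda>t. of_real (V' (Re (Jt \<theta> c0 c1 t))) * Jt \<theta> c0 c1 t / (t + 1)) / (2 * of_real pi * \<i>)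
       = 1 \<and>
     a = J_a \<theta> c0 c1 \<and> b = J_b \<theta> c0 c1 \<and>
     (\<forall>x \<in> {a<..<b}. \<psi> x = 1 / (2 * pi^2 * x) *
        integral {a..b} (\<lambda>y. (V'' y * y + V' y) *
          ln (cmod ((Iplus \<theta> c0 c1 y - Iminus \<theta> c0 c1 x) / (Iplus \<theta> c0 c1 y - Iplus \<theta> c0 c1 x)))))"
proof -
  define g where "g x = indicator {a<..<b} x * \<psi> x" for x
  have mu: "\<mu> = density lborel (\<lambda>x. ennreal (g x))" using mu_density by (simp add: g_def)
  have g0: "g x \<ge> 0" for x using psi_nonneg by (simp add: g_def indicator_def)
  have gm[measurable]: "g \<in> borel_measurable borel"
    using borel_measurable_continuous_on_indicator[OF _ psi_cont] by (simp add: g_def[abs_def])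
  have "emeasure \<mu> (space \<mu>) = 1" by (rule prob_space.emeasure_space_1[OF mu_prob])
  then have nn: "(\<integral>\<^sup>+ x. ennreal (g x) \<partial>lborel) = ennreal 1" unfolding mu by (simp add: emeasure_density)
  have gi: "integrable lborel g" and g1: "integral\<^sup>L lborel g = 1"
    using nn_integral_eq_integrable[THEN iffD1, OF _ _ _ nn] g0 by auto
  \<comment> \<open>An empty interval would make the density zero, against the total mass 1.\<close>
  have ab: "a < b"
  proof (rule ccontr)
    assume "\<not> a < b"
    then have "g = (\<lambda>_. 0)" by (simp add: g_def fun_eq_iff)
    then show False using g1 by simp
  qed
  have i: "integrable \<mu> f \<longleftrightarrow> set_integrable lborel {a<..<b} (\<lambda>y. \<psi> y * f y)"
    and l: "integral\<^sup>L \<mu> f = (LINT y:{a<..<b}|lborel. \<psi> y * f y)" if f: "f \<in> borel_measurable borel" for f :: "real \<Rightarrow> real"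
    using integrable_density[of f lborel g] integral_density[of f lborel g] f g0 unfolding mu
    by (simp_all add: set_integrable_def set_lebesgue_integral_def g_def mult.assoc)
  have m1: "(\<lambda>y. ln \<bar>x - y\<bar>) \<in> borel_measurable borel" and m2: "(\<lambda>y. ln \<bar>x powr \<theta> - y powr \<theta>\<bar>) \<in> borel_measurable borel" for x
    by measurable
  obtain c0 c1 where c: "0 < c1" "c1 < c0" and J: "J_a \<theta> c0 c1 = a" "J_b \<theta> c0 c1 = b"
    using exists_parameters[OF theta a_pos ab] by blast
  have eq: "equilibrium \<theta> c0 c1 V V' V'' \<psi> L"
  proof (unfold_locales, unfold J)
    show "1 < \<theta>" by (rule theta)
    show "0 < c1" "c1 < c0" by (fact c)+
    show "a < b" by (rule ab)
    show "set_integrable lborel {a<..<b} \<psi>" using gi by (simp add: set_integrable_def g_def[abs_def])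
    show "(LINT x:{a<..<b}|lborel. \<psi> x) = 1" using g1 by (simp add: set_lebesgue_integral_def g_def[abs_def])
    show "set_integrable lborel {a<..<b} (\<lambda>y. \<psi> y * ln \<bar>x - y\<bar>)" if "x \<in> {a..b}" for x
      using EL_eq[of x] that i[OF m1[of x]] mu_supp by simp
    show "set_integrable lborel {a<..<b} (\<lambda>y. \<psi> y * ln \<bar>x powr \<theta> - y powr \<theta>\<bar>)" if "x \<in> {a..b}" for x
      using EL_eq[of x] that i[OF m2[of x]] mu_supp by simp
    show "(LINT y:{a<..<b}|lborel. \<psi> y * ln \<bar>x - y\<bar>) + (LINT y:{a<..<b}|lborel. \<psi> y * ln \<bar>x powr \<theta> - y powr \<theta>\<bar>) = V x + L" if "x \<in> {a..b}" for x
    proof -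
      have "(\<integral>y. ln \<bar>x - y\<bar> \<partial>\<mu>) + (\<integral>y. ln \<bar>x powr \<theta> - y powr \<theta>\<bar> \<partial>\<mu>) - V x = L" using EL_eq[of x] that mu_supp by simp
      then show ?thesis unfolding l[OF m1[of x]] l[OF m2[of x]] by linarith
    qed
    show "(LINT y:{a<..<b}|lborel. \<psi> y * ln \<bar>x - y\<bar>) + (LINT y:{a<..<b}|lborel. \<psi> y * ln \<bar>x powr \<theta> - y powr \<theta>\<bar>) \<le> V x + L"
      if "x > 0" "set_integrable lborel {a<..<b} (\<lambda>y. \<psi> y * ln \<bar>x - y\<bar>)" "set_integrable lborel {a<..<b} (\<lambda>y. \<psi> y * ln \<bar>x powr \<theta> - y powr \<theta>\<bar>)" for x
    proof -
      have "(\<integral>y. ln \<bar>x - y\<bar> \<partial>\<mu>) + (\<integral>y. ln \<bar>x powr \<theta> - y powr \<theta>\<bar> \<partial>\<mu>) - V x \<le> L"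
        using EL_le[of x] that i[OF m1[of x]] i[OF m2[of x]] by simp
      then show ?thesis unfolding l[OF m1[of x]] l[OF m2[of x]] by linarith
    qed
  qed (fact V_deriv V'_deriv V''_cont psi_nonneg psi_cont)+
  show ?thesis
    using c equilibrium.equilibrium_measure[OF eq, unfolded J] by (intro exI[of _ c0] exI[of _ c1]) (auto simp: J)
qed

end
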